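(* Let $f\colon \mathscr{A}\to\Delta^*$ be any smooth family of principally polarized complex abelian varieties of dimension $g\ge 1$ over the punctured unit disc, with fibres $\mathscr{A}_t=f^{-1}(t)$ and associated polarized real torus $\Sigma_f$. Then $$I(\mathscr{A}_t)\sim -I(\Sigma_f)\log|t|-\frac{\dim \Sigma_f}{2}\log(-\log|t|).$$
   Context: Notation: $\Delta=\{z\in\mathbb{C}: |z|<1\}$, $\Delta^*=\Delta\setminus\{0\}$, $\mathbb{H}_g$ is the Siegel upper half-space of symmetric complex $g\times g$ matrices with positive-definite imaginary part. For continuous functions $f_1,f_2\colon\Delta^*\to\mathbb{R}$, write $f_1\sim f_2$ if $f_1-f_2$ extends to a continuous function on $\Delta$. The invariant $I$ of a principally polarized abelian variety. Let $(A,\Theta)$ be a principally polarized complex abelian variety of dimension $g$, $\Theta$ a symmetric effective divisor inducing the polarization with $\dim H^0(A,\mathcal{O}_A(\Theta))=1$. Choose $\tau\in\mathbb{H}_g$ with $A\cong\mathbb{C}^g/(\mathbb{Z}^g+\tau\mathbb{Z}^g)$ (as principally polarized abelian varieties), $\Theta$ being the zero divisor of $\theta(\tau,z)=\sum_{n\in\mathbb{Z}^g}\exp(\pi i\,{}^tn\tau n+2\pi i\,{}^tnz)$. Put $$\|\theta\|^2(z)=\det(\mathrm{Im}\,\tau)^{1/2}\exp\big(-2\pi\,{}^t(\mathrm{Im}\,z)(\mathrm{Im}\,\tau)^{-1}(\mathrm{Im}\,z)\big)|\theta(\tau,z)|^2,$$ a function on $A$, and $\nu=\frac{i}{2}\sum_{j,k}((\mathrm{Im}\,\tau)^{-1})_{jk}\,dz_j\wedge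 d\overline{z}_k$; then $\nu^g/g!$ is the Haar probability measure on $A$. Define $$I(A,\Theta)=\log\int_A\|\theta\|^2\frac{\nu^g}{g!}-\int_A\log\|\theta\|^2\,\frac{\nu^g}{g!},$$ which depends only on the principally polarized abelian variety; $I(\mathscr{A}_t)$ is this invariant of the fibre. Polarized real tori. A Euclidean lattice is a finitely generated free $\mathbb{Z}$-module $\Lambda$ with an inner product $[\cdot,\cdot]$ on $\Lambda_{\mathbb{R}}=\Lambda\otimes\mathbb{R}$; its polarized real torus is $\Sigma=\Lambda_{\mathbb{R}}/\Lambda$. The modified tropical Riemann theta function is $\|\Psi\|(\nu)=\min_{\lambda\in\Lambda}\frac12[\nu+\lambda,\nu+\lambda]$ on $\Sigma$, and the tropical moment is $I(\Sigma)=2\int_\Sigma\|\Psi\|\,\mu_H$, with $\mu_H$ the Haar measure of total mass $1$. For a symmetric positive-definite $B\in\mathbb{R}^{h\times h}$, $\Sigma_B=\mathbb{R}^h/B\mathbb{Z}^h$ is the polarized real torus of the lattice $B\mathbb{Z}^h$ with inner product $[x,y]_B={}^txB^{-1}y$. The torus $\Sigma_f$. A period map of $f$ is a multi-valued holomorphic map $T_f\colon\Delta^*\to\mathbb{H}_g$ (given by a flat multi-valued symplectic basis of $H_1(\mathscr{A}_t,\mathbb{Z})$) with $\mathscr{A}_t\cong\mathbb{C}^g/(\mathbb{Z}^g+T_f(t)\mathbb{Z}^g)$. It is known that one can choose $T_f$ such that for some integer $m\ge1$ $$T_f(t^m)=\begin{pmatrix}S_1(t)&S_3(t)\\ {}^tS_3(t)&\frac{m\log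 t}{2\pi i}B+S_2(t)\end{pmatrix},$$ where $g_1+g_2=g$, the maps $S_1\colon\Delta\to\mathbb{H}_{g_1}$, $S_3\colon\Delta\to\mathbb{C}^{g_1\times g_2}$, $S_2\colon\Delta\to\mathbb{C}^{g_2\times g_2}$ are single-valued and holomorphic on all of $\Delta$, and $B\in\mathbb{Q}^{g_2\times g_2}$ is symmetric positive-definite. Then $\Sigma_f:=\Sigma_B$ (well defined up to isomorphism), so $\dim\Sigma_f=g_2$. *)

theory Defs
  imports "HOL-Analysis.Analysis" "Jordan_Normal_Form.Gauss_Jordan_Elimination"
    "Jordan_Normal_Form.Determinant"
begin

text \<open>
  Dimensions are natural numbers occurring inside the statement, and the blocks of a degenerating
  period matrix may have size \<open>0\<close>. Vectors and matrices are therefore those of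
  Jordan-Normal-Form, and all analytic notions are understood entrywise.
\<close>

definition punctured_disc :: "complex set" where
  "punctured_disc = ball 0 1 - {0}"

text \<open>The universal cover of the punctured disc is the left half plane with projection \<open>exp\<close>; its
  coordinate \<open>s\<close> is the multi-valued function \<open>log t\<close>.\<close>
definition left_half_plane :: "complex set" where
  "left_half_plane = {s. Re s < 0}"

definition same_asymptotics :: "(complex \<Rightarrow> real) \<Rightarrow> (complex \<Rightarrow> real) \<Rightarrow> bool" where
  "same_asymptotics f1 f2 \<longleftrightarrow>
     (\<exists>h. continuous_on (ball 0 1) h \<and> (\<forall>t\<in>punctured_disc. h t = f1 t - f2 t))"


subsection \<open>Matrices\<close>

definition mat_inv :: "'a::field mat \<Rightarrow> 'a mat" where
  "mat_inv A = the (mat_inverse A)"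

definition int_vecs :: "nat \<Rightarrow> int Matrix.vec set" where
  "int_vecs n = carrier_vec n"

definition pos_def_mat :: "nat \<Rightarrow> real mat \<Rightarrow> bool" where
  "pos_def_mat n A \<longleftrightarrow> A \<in> carrier_mat n n \<and> transpose_mat A = A \<and>
     (\<forall>x\<in>carrier_vec n. x \<noteq> 0\<^sub>v n \<longrightarrow> scalar_prod x (A *\<^sub>v x) > 0)"

definition siegel :: "nat \<Rightarrow> complex mat set" where
  "siegel g = {\<tau> \<in> carrier_mat g g. transpose_mat \<tau> = \<tau> \<and> pos_def_mat g (map_mat Im \<tau>)}"

definition mat_holomorphic_on :: "nat \<Rightarrow> nat \<Rightarrow> (complex \<Rightarrow> complex mat) \<Rightarrow> complex set \<Rightarrow> bool" where
  "mat_holomorphic_on r c M S \<longleftrightarrow> (\<forall>t\<in>S. M t \<in> carrier_mat r c) \<and>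
     (\<forall>i<r. \<forall>j<c. (\<lambda>t. M t $$ (i, j)) holomorphic_on S)"

text \<open>Uniform distribution on \<open>[0,1]\<^sup>n\<close>. In the coordinates of a lattice basis it induces the
  normalised Haar measure of the quotient torus.\<close>
definition unit_cube :: "nat \<Rightarrow> (nat \<Rightarrow> real) measure" where
  "unit_cube n = PiM {..<n} (\<lambda>_. uniform_measure lborel {0..1})"


subsection \<open>Principally polarized abelian varieties\<close>

text \<open>\<open>P\<close> is the matrix whose columns form a \<open>\<int>\<close>-basis of the lattice \<open>\<Lambda>\<close> of rank \<open>2g\<close> in \<open>\<complex>\<^sup>g\<close>.\<close>
definition lattice_basis :: "nat \<Rightarrow> complex mat \<Rightarrow> complex Matrix.vec set \<Rightarrow> bool" where
  "lattice_basis g P \<Lambda> \<longleftrightarrow> P \<in> carrier_mat g (2 * g) \<and>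
     (\<forall>x\<in>carrier_vec (2 * g). P *\<^sub>v map_vec complex_of_real x = 0\<^sub>v g \<longrightarrow> x = 0\<^sub>v (2 * g)) \<and>
     \<Lambda> = {P *\<^sub>v map_vec of_int k | k. k \<in> int_vecs (2 * g)}"

text \<open>The complex torus \<open>\<complex>\<^sup>g/\<Lambda>\<close> with principal polarization \<open>E\<close>, that is \<open>E = Im H\<close> for the positive
  definite Hermitian form \<open>H(x,y) = E(ix,y) + i E(x,y)\<close>, and \<open>E\<close> is integral and unimodular
  on \<open>\<Lambda>\<close>.\<close>
definition ppav ::
  "nat \<Rightarrow> complex Matrix.vec set \<Rightarrow> (complex Matrix.vec \<Rightarrow> complex Matrix.vec \<Rightarrow> real) \<Rightarrow> bool" where
  "ppav g \<Lambda> E \<longleftrightarrow>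
     (\<exists>P. lattice_basis g P \<Lambda> \<and>
        Determinant.det (Matrix.mat (2 * g) (2 * g) (\<lambda>(i, j). E (col P i) (col P j))) = 1) \<and>
     (\<forall>x\<in>\<Lambda>. \<forall>y\<in>\<Lambda>. E x y \<in> \<int>) \<and>
     (\<forall>x\<in>carrier_vec g. \<forall>y\<in>carrier_vec g. \<forall>z\<in>carrier_vec g. \<forall>a b :: real.
        E (complex_of_real a \<cdot>\<^sub>v x + complex_of_real b \<cdot>\<^sub>v y) z = a * E x z + b * E y z) \<and>
     (\<forall>x\<in>carrier_vec g. \<forall>y\<in>carrier_vec g. E y x = - E x y) \<and>
     (\<forall>x\<in>carrier_vec g. \<forall>y\<in>carrier_vec g. E (\<i> \<cdot>\<^sub>v x) (\<i> \<cdot>\<^sub>v y) = E x y) \<and>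
     (\<forall>x\<in>carrier_vec g. x \<noteq> 0\<^sub>v g \<longrightarrow> E (\<i> \<cdot>\<^sub>v x) x > 0)"

text \<open>The analytic representation \<open>L\<close> of an isomorphism \<open>\<complex>\<^sup>g/\<Lambda> \<rightarrow> \<complex>\<^sup>g/\<Lambda>'\<close> of polarized tori.\<close>
definition ppav_iso ::
  "nat \<Rightarrow> complex mat \<Rightarrow>
   complex Matrix.vec set \<Rightarrow> (complex Matrix.vec \<Rightarrow> complex Matrix.vec \<Rightarrow> real) \<Rightarrow>
   complex Matrix.vec set \<Rightarrow> (complex Matrix.vec \<Rightarrow> complex Matrix.vec \<Rightarrow> real) \<Rightarrow> bool" where
  "ppav_iso g L \<Lambda> E \<Lambda>' E' \<longleftrightarrow> L \<in> carrier_mat g g \<and> invertible_mat L \<and>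
     (\<lambda>x. L *\<^sub>v x) ` \<Lambda> = \<Lambda>' \<and>
     (\<forall>x\<in>carrier_vec g. \<forall>y\<in>carrier_vec g. E' (L *\<^sub>v x) (L *\<^sub>v y) = E x y)"

definition std_lattice :: "nat \<Rightarrow> complex mat \<Rightarrow> complex Matrix.vec set" where
  "std_lattice g \<tau> =
     {map_vec of_int m + \<tau> *\<^sub>v map_vec of_int n | m n. m \<in> int_vecs g \<and> n \<in> int_vecs g}"

text \<open>The polarization of \<open>\<complex>\<^sup>g/(\<int>\<^sup>g + \<tau>\<int>\<^sup>g)\<close> given by the zero divisor of the theta function:
  \<open>H(x,y) = x\<^sup>T (Im \<tau>)\<^sup>-\<^sup>1 cnj y\<close>, so that \<open>E(m + \<tau>n, m' + \<tau>n') = n\<^sup>T m' - m\<^sup>T n'\<close>.\<close>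
definition std_form ::
  "complex mat \<Rightarrow> complex Matrix.vec \<Rightarrow> complex Matrix.vec \<Rightarrow> real" where
  "std_form \<tau> x y = Im (scalar_prod x
     (map_mat complex_of_real (mat_inv (map_mat Im \<tau>)) *\<^sub>v map_vec cnj y))"

definition period_matrix ::
  "nat \<Rightarrow> complex Matrix.vec set \<Rightarrow> (complex Matrix.vec \<Rightarrow> complex Matrix.vec \<Rightarrow> real) \<Rightarrow>
   complex mat \<Rightarrow> bool" where
  "period_matrix g \<Lambda> E \<tau> \<longleftrightarrow>
     \<tau> \<in> siegel g \<and> (\<exists>L. ppav_iso g L (std_lattice g \<tau>) (std_form \<tau>) \<Lambda> E)"


subsection \<open>The invariant of a principally polarized abelian variety\<close>

definition riemann_theta :: "nat \<Rightarrow> complex mat \<Rightarrow> complex Matrix.vec \<Rightarrow> complex" where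
  "riemann_theta g \<tau> z = (\<Sum>\<^sub>\<infinity>n\<in>int_vecs g.
     let n' = map_vec of_int n
     in exp (pi * \<i> * scalar_prod n' (\<tau> *\<^sub>v n') + 2 * pi * \<i> * scalar_prod n' z))"

definition norm_theta_sq :: "nat \<Rightarrow> complex mat \<Rightarrow> complex Matrix.vec \<Rightarrow> real" where
  "norm_theta_sq g \<tau> z = (let Y = map_mat Im \<tau>; y = map_vec Im z in
     sqrt (Determinant.det Y) * exp (- 2 * pi * scalar_prod y (mat_inv Y *\<^sub>v y)) *
     (cmod (riemann_theta g \<tau> z))\<^sup>2)"

text \<open>Integration over \<open>\<complex>\<^sup>g/(\<int>\<^sup>g + \<tau>\<int>\<^sup>g)\<close> against the Haar probability measure \<open>\<nu>\<^sup>g/g!\<close>, in the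
  coordinates \<open>z = x + \<tau> y\<close> with \<open>x, y \<in> [0,1]\<^sup>g\<close>.\<close>
definition torus_integral :: "nat \<Rightarrow> complex mat \<Rightarrow> (complex Matrix.vec \<Rightarrow> real) \<Rightarrow> real" where
  "torus_integral g \<tau> F = (\<integral>(x, y). F (Matrix.vec g (\<lambda>i. complex_of_real (x i)) +
     \<tau> *\<^sub>v Matrix.vec g (\<lambda>i. complex_of_real (y i))) \<partial>(unit_cube g \<Otimes>\<^sub>M unit_cube g))"

definition theta_invariant :: "nat \<Rightarrow> complex mat \<Rightarrow> real" where
  "theta_invariant g \<tau> =
     ln (torus_integral g \<tau> (norm_theta_sq g \<tau>)) -
     torus_integral g \<tau> (\<lambda>z. ln (norm_theta_sq g \<tau> z))"

definition ppav_invariant ::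
  "nat \<Rightarrow> complex Matrix.vec set \<Rightarrow> (complex Matrix.vec \<Rightarrow> complex Matrix.vec \<Rightarrow> real) \<Rightarrow> real" where
  "ppav_invariant g \<Lambda> E = theta_invariant g (SOME \<tau>. period_matrix g \<Lambda> E \<tau>)"


subsection \<open>Families over the punctured disc and their period maps\<close>

text \<open>A family is a holomorphic vector bundle (the relative Lie algebra) modulo a local system of
  lattices, with a locally constant polarization. The tangent space of the fibre over \<open>t\<close> is
  identified with \<open>\<complex>\<^sup>g\<close> by an arbitrary choice of coordinates, depending on \<open>t\<close> without any
  regularity; the complex structure of the bundle is given by the set of its local frames
  \<open>(U, \<phi>)\<close>, where \<open>\<phi> t\<close> maps \<open>\<complex>\<^sup>g\<close> isomorphically onto the tangent space for \<open>t \<in> U\<close>.\<close>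
record av_family =
  fibre_lattice :: "complex \<Rightarrow> complex Matrix.vec set"
  fibre_form :: "complex \<Rightarrow> complex Matrix.vec \<Rightarrow> complex Matrix.vec \<Rightarrow> real"
  frames :: "(complex set \<times> (complex \<Rightarrow> complex mat)) set"

definition ppav_family :: "nat \<Rightarrow> av_family \<Rightarrow> bool" where
  "ppav_family g f \<longleftrightarrow>
     (\<forall>t\<in>punctured_disc. ppav g (fibre_lattice f t) (fibre_form f t)) \<and>
     (\<Union>(U, \<phi>)\<in>frames f. U) = punctured_disc \<and>
     (\<forall>(U, \<phi>)\<in>frames f. open U \<and> (\<forall>t\<in>U. \<phi> t \<in> carrier_mat g g \<and> invertible_mat (\<phi> t))) \<and>
     (\<forall>(U, \<phi>)\<in>frames f. \<forall>(V, \<psi>)\<in>frames f.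
        mat_holomorphic_on g g (\<lambda>t. mat_inv (\<phi> t) * \<psi> t) (U \<inter> V)) \<and>
     (\<forall>(U, \<phi>)\<in>frames f. \<forall>t0\<in>U. \<exists>W P.
        open W \<and> t0 \<in> W \<and> W \<subseteq> U \<and> mat_holomorphic_on g (2 * g) P W \<and>
        (\<forall>t\<in>W. lattice_basis g (\<phi> t * P t) (fibre_lattice f t)) \<and>
        (\<forall>i<2 * g. \<forall>j<2 * g.
           (\<lambda>t. fibre_form f t (col (\<phi> t * P t) i) (col (\<phi> t * P t) j)) constant_on W))"

definition fibre_invariant :: "nat \<Rightarrow> av_family \<Rightarrow> complex \<Rightarrow> real" where
  "fibre_invariant g f t = ppav_invariant g (fibre_lattice f t) (fibre_form f t)"

text \<open>The multi-valued function \<open>t \<mapsto> T\<^sub>f(t)\<close> is \<open>s \<mapsto> T s\<close> with \<open>t = exp s\<close>. The columns of \<open>L s\<close> and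
  of \<open>L s * T s\<close> form the symplectic basis of the lattice of the fibre over \<open>exp s\<close>; a section of
  a bundle of lattices is flat if and only if it is continuous.\<close>
definition period_map :: "nat \<Rightarrow> av_family \<Rightarrow> (complex \<Rightarrow> complex mat) \<Rightarrow> bool" where
  "period_map g f T \<longleftrightarrow>
     (\<forall>s\<in>left_half_plane. T s \<in> siegel g) \<and> mat_holomorphic_on g g T left_half_plane \<and>
     (\<exists>L. (\<forall>s\<in>left_half_plane.
             ppav_iso g (L s) (std_lattice g (T s)) (std_form (T s))
               (fibre_lattice f (exp s)) (fibre_form f (exp s))) \<and>
          (\<forall>(U, \<phi>)\<in>frames f. \<forall>i<g. \<forall>j<g.
             continuous_on {s\<in>left_half_plane. exp s \<in> U}
               (\<lambda>s. (mat_inv (\<phi> (exp s)) * L s) $$ (i, j))))"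


subsection \<open>Polarized real tori\<close>

text \<open>The torus \<open>\<Sigma>\<^sub>B = \<real>\<^sup>h/B\<int>\<^sup>h\<close>, represented by the positive definite matrix \<open>B\<close>.\<close>
definition real_lattice :: "real mat \<Rightarrow> real Matrix.vec set" where
  "real_lattice B = {B *\<^sub>v map_vec of_int n | n. n \<in> int_vecs (dim_row B)}"

definition lattice_inner :: "real mat \<Rightarrow> real Matrix.vec \<Rightarrow> real Matrix.vec \<Rightarrow> real" where
  "lattice_inner B x y = scalar_prod x (mat_inv B *\<^sub>v y)"

text \<open>The infimum is attained, \<open>B\<int>\<^sup>h\<close> being discrete and closed.\<close>
definition tropical_theta :: "real mat \<Rightarrow> real Matrix.vec \<Rightarrow> real" where
  "tropical_theta B v = (INF l\<in>real_lattice B. 1/2 * lattice_inner B (v + l) (v + l))"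

definition tropical_moment :: "real mat \<Rightarrow> real" where
  "tropical_moment B =
     2 * (\<integral>x. tropical_theta B (B *\<^sub>v Matrix.vec (dim_row B) x) \<partial>unit_cube (dim_row B))"

definition torus_dim :: "real mat \<Rightarrow> nat" where
  "torus_dim B = dim_row B"

text \<open>\<open>\<Sigma>\<^sub>B\<close> is the torus \<open>\<Sigma>\<^sub>f\<close> of the family. With \<open>s = log t\<close>, the value \<open>T\<^sub>f(t\<^sup>m)\<close> is \<open>T (m s)\<close>.
  As \<open>\<Sigma>\<^sub>f\<close> is only well defined up to isomorphism, this is a relation between \<open>f\<close> and \<open>B\<close>.\<close>
definition associated_torus :: "nat \<Rightarrow> av_family \<Rightarrow> real mat \<Rightarrow> bool" where
  "associated_torus g f B \<longleftrightarrow>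
     (\<exists>T m g1 g2 S1 S2 S3.
        period_map g f T \<and> m \<ge> (1::nat) \<and> g1 + g2 = g \<and>
        (\<forall>t\<in>ball 0 1. S1 t \<in> siegel g1) \<and>
        mat_holomorphic_on g1 g1 S1 (ball 0 1) \<and>
        mat_holomorphic_on g1 g2 S3 (ball 0 1) \<and>
        mat_holomorphic_on g2 g2 S2 (ball 0 1) \<and>
        pos_def_mat g2 B \<and> (\<forall>i<g2. \<forall>j<g2. B $$ (i, j) \<in> \<rat>) \<and>
        (\<forall>s\<in>left_half_plane.
           T (of_nat m * s) =
             four_block_mat (S1 (exp s)) (S3 (exp s))
               (transpose_mat (S3 (exp s)))
               ((of_nat m * s / (2 * pi * \<i>)) \<cdot>\<^sub>m map_mat complex_of_real B + S2 (exp s))))"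

end

theory Submission
  imports Defs "HOL-Complex_Analysis.Complex_Analysis" "HOL-Probability.Probability" "HOL-Real_Asymp.Real_Asymp"
begin

text \<open>Translating the theta function by the lattice vector of a closest lattice point turns it into a
  Fourier series whose coefficients satisfy a uniform Gaussian bound and converge as \<open>t \<rightarrow> 0\<close>; for almost
  every point of the real torus only the frequencies in the first block survive. The translation
  contributes the tropical theta function to \<open>log \<parallel>\<theta>\<parallel>\<^sup>2\<close>, hence the tropical moment to the integral,
  while \<open>\<integral>\<parallel>\<theta>\<parallel>\<^sup>2 = 2\<^sup>-\<^sup>g\<^sup>/\<^sup>2\<close> is constant and \<open>log det Im \<tau>\<close> contributes the \<open>log(-log |t|)\<close> term. The
  remaining integrals of logarithms converge by Vitali's theorem, since Fourier series
  with constant coefficient \<open>1\<close> and a fixed Gaussian bound have a uniform bound on the measure of their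
  sublevel sets, and hence uniformly square integrable logarithms.

  Independence of the period matrix comes from the uniqueness of functions that are quasi-periodic
  like the theta function.\<close>

subsection \<open>Sublevel sets of entire functions\<close>

text \<open>The obstacle is that the normalised Fourier series have zeros which move with the
  parameter and with the point of the real torus, so their logarithms have no common integrable
  majorant. The sublevel estimate therefore has to see a series only through the two constants of
  its Gaussian bound: these are what can be kept fixed over all parameters and all points. Any
  positive power of the level suffices, so the crude exponent coming from iterated square roots is
  good enough. The limit is never computed. Two sequences of period matrices with the same pointwise
  limit data are shown to have the same limit of integrals; comparison with a constant sequence
  gives continuity away from the puncture, comparison with a fixed reference sequence gives the
  limit at it. The pointwise limit involves a choice of closest lattice points without any
  measurability, so the limit function is taken from the sequence itself. Holomorphy in several
  variables is used only on complex lines.\<close>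

text \<open>Induction on the order: in the step \<open>u j\<close> has slope at least 1, so it is
  smaller than sqrt \<epsilon> in modulus only on a short interval. On each of the two remaining
  sides the functions divided by sqrt \<epsilon>, up to sign, satisfy the hypothesis of order
  \<open>j\<close> at level sqrt \<epsilon>. The constant solves C' = 2 C + 4.\<close>

lemma emeasure_sublevel_deriv_ge_1:
  fixes u :: "nat \<Rightarrow> real \<Rightarrow> real"
  assumes "\<And>i s. i < j \<Longrightarrow> (u i has_real_derivative u (Suc i) s) (at s)"
    and "\<And>s. s \<in> {a..b} \<Longrightarrow> u j s \<ge> 1"
    and "0 < \<epsilon>" "\<epsilon> \<le> 1"
  shows "emeasure lborel {s\<in>{a..b}. \<bar>u 0 s\<bar> < \<epsilon>} \<le> ennreal (4 * (2 ^ j - 1) * \<epsilon> powr (1 / 2 ^ j))"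
  using assms
proof (induction j arbitrary: u a b \<epsilon>)
  case 0
  then have "{s\<in>{a..b}. \<bar>u 0 s\<bar> < \<epsilon>} = {}" by fastforce
  then show ?case by (simp only: emeasure_empty zero_le)
next
  case (Suc j)
  define \<eta> where "\<eta> = sqrt \<epsilon>"
  have \<eta>: "0 < \<eta>" "\<eta> \<le> 1" "\<epsilon> / \<eta> = \<eta>" "\<eta> * \<eta> = \<epsilon>"
    using Suc.prems(3,4) by (auto simp: \<eta>_def real_div_sqrt)
  have "isCont (u 0) s" for s using Suc.prems(1)[of 0 s] DERIV_isCont by blast
  then have cont0: "continuous_on UNIV (u 0)" by (simp add: continuous_on_eq_continuous_at)
  then have [measurable]: "u 0 \<in> borel_measurable borel" by (rule borel_measurable_continuous_onI)
  have "isCont (u j) s" for s using Suc.prems(1)[of j s] DERIV_isCont by blast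
  then have contj: "continuous_on S (u j)" for S by (simp add: continuous_at_imp_continuous_on)
  have mono: "t - s \<le> u j t - u j s" if "a \<le> s" "s \<le> t" "t \<le> b" for s t
  proof -
    have "\<exists>y\<ge>1. ((\<lambda>x. u j x - x) has_real_derivative y - 1) (at x)" if "s \<le> x" "x \<le> t" for x
      using Suc.prems(1)[of j x] Suc.prems(2)[of x] that \<open>a \<le> s\<close> \<open>t \<le> b\<close>
      by (intro exI[of _ "u (Suc j) x"]) (auto intro!: derivative_eq_intros)
    then have "u j s - s \<le> u j t - t"
      by (intro DERIV_nonneg_imp_nondecreasing[OF \<open>s \<le> t\<close>]) (metis diff_ge_0_iff_ge)
    then show ?thesis by simp
  qed
  define C where "C = 4 * (2 ^ j - 1) * \<eta> powr (1 / 2 ^ j)"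
  have C0: "C \<ge> 0" by (simp add: C_def)
  have piece: "emeasure lborel {s\<in>{c..d}. \<bar>u 0 s\<bar> < \<epsilon>} \<le> ennreal C"
    if sg: "\<sigma> \<in> {1, -1}" and *: "\<And>s. s \<in> {c..d} \<Longrightarrow> \<sigma> * u j s \<ge> \<eta>" for \<sigma> c d
  proof -
    have "{s\<in>{c..d}. \<bar>u 0 s\<bar> < \<epsilon>} = {s\<in>{c..d}. \<bar>\<sigma> * u 0 s / \<eta>\<bar> < \<epsilon> / \<eta>}"
      using sg \<eta>(1) by (auto simp: abs_mult divide_less_cancel)
    moreover have "emeasure lborel {s\<in>{c..d}. \<bar>(\<lambda>i s. \<sigma> * u i s / \<eta>) 0 s\<bar> < \<epsilon> / \<eta>} \<le> ennreal C"
      unfolding C_def \<eta>(3)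
      using Suc.prems(1) * \<eta>
      by (intro Suc.IH) (auto intro!: derivative_eq_intros)
    ultimately show ?thesis by simp
  qed
  define E1 where "E1 = {s\<in>{a..b}. \<bar>u 0 s\<bar> < \<epsilon> \<and> u j s \<le> -\<eta>}"
  define E2 where "E2 = {s\<in>{a..b}. \<bar>u 0 s\<bar> < \<epsilon> \<and> \<bar>u j s\<bar> < \<eta>}"
  define E3 where "E3 = {s\<in>{a..b}. \<bar>u 0 s\<bar> < \<epsilon> \<and> u j s \<ge> \<eta>}"
  have [measurable]: "u j \<in> borel_measurable borel" by (intro borel_measurable_continuous_onI contj)
  have [measurable]: "E1 \<in> sets borel" "E2 \<in> sets borel" "E3 \<in> sets borel"
    unfolding E1_def E2_def E3_def by measurable
  have 1: "emeasure lborel E1 \<le> ennreal C"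
  proof (cases "E1 = {}")
    case False
    \<comment> \<open>As \<open>u j\<close> is increasing, its values are at most -\<eta> on all of
      {a..p} for the largest point \<open>p\<close> of \<open>S\<close>; \<open>E3\<close> is
      treated alike with a smallest point.\<close>
    define S where "S = {s\<in>{a..b}. u j s \<le> -\<eta>}"
    have "closed ({a..b} \<inter> u j -` {..-\<eta>})"
      by (intro continuous_closed_preimage contj) auto
    also have "{a..b} \<inter> u j -` {..-\<eta>} = S" by (auto simp: S_def)
    finally have S: "closed S" "S \<noteq> {}" "bdd_above S"
      using False by (auto simp: S_def E1_def intro!: bdd_aboveI[of _ b])
    define p where "p = Sup S"
    have p: "p \<in> S" unfolding p_def using S by (rule closed_contains_Sup[rotated 2])
    have "E1 \<subseteq> {s\<in>{a..p}. \<bar>u 0 s\<bar> < \<epsilon>}"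
      using S(3) by (auto simp: E1_def p_def S_def intro!: cSup_upper)
    then have "emeasure lborel E1 \<le> emeasure lborel {s\<in>{a..p}. \<bar>u 0 s\<bar> < \<epsilon>}"
      by (intro emeasure_mono) auto
    also have "\<dots> \<le> ennreal C"
      using p by (intro piece[of "-1"]) (auto simp: S_def dest!: mono[of _ p])
    finally show ?thesis .
  qed (use C0 in auto)
  have 3: "emeasure lborel E3 \<le> ennreal C"
  proof (cases "E3 = {}")
    case False
    define S where "S = {s\<in>{a..b}. u j s \<ge> \<eta>}"
    have "closed ({a..b} \<inter> u j -` {\<eta>..})"
      by (intro continuous_closed_preimage contj) auto
    also have "{a..b} \<inter> u j -` {\<eta>..} = S" by (auto simp: S_def)
    finally have S: "closed S" "S \<noteq> {}" "bdd_below S"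
      using False by (auto simp: S_def E3_def intro!: bdd_belowI[of _ a])
    define p where "p = Inf S"
    have p: "p \<in> S" unfolding p_def using S by (rule closed_contains_Inf[rotated 2])
    have "E3 \<subseteq> {s\<in>{p..b}. \<bar>u 0 s\<bar> < \<epsilon>}"
      using S(3) by (auto simp: E3_def p_def S_def intro!: cInf_lower)
    then have "emeasure lborel E3 \<le> emeasure lborel {s\<in>{p..b}. \<bar>u 0 s\<bar> < \<epsilon>}"
      by (intro emeasure_mono) auto
    also have "\<dots> \<le> ennreal C"
      using p by (intro piece[of "1"]) (auto simp: S_def dest!: mono[of p])
    finally show ?thesis .
  qed (use C0 in auto)
  have 2: "emeasure lborel E2 \<le> ennreal (4 * \<eta>)"
  proof (cases "E2 = {}")
    case False
    then obtain s0 where s0: "s0 \<in> E2" by auto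
    have "E2 \<subseteq> {s0 - 2 * \<eta> .. s0 + 2 * \<eta>}"
    proof
      fix s assume s: "s \<in> E2"
      show "s \<in> {s0 - 2 * \<eta> .. s0 + 2 * \<eta>}"
        using s s0 mono[of s s0] mono[of s0 s] by (cases "s \<le> s0") (auto simp: E2_def)
    qed
    then have "emeasure lborel E2 \<le> emeasure lborel {s0 - 2 * \<eta> .. s0 + 2 * \<eta>}"
      by (intro emeasure_mono) auto
    then show ?thesis using \<eta>(1) by simp
  qed (use \<eta> in auto)
  have "{s\<in>{a..b}. \<bar>u 0 s\<bar> < \<epsilon>} \<subseteq> E1 \<union> (E2 \<union> E3)"
    by (auto simp: E1_def E2_def E3_def)
  then have "emeasure lborel {s\<in>{a..b}. \<bar>u 0 s\<bar> < \<epsilon>} \<le> emeasure lborel (E1 \<union> (E2 \<union> E3))"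
    by (rule emeasure_mono) simp
  also have "\<dots> \<le> emeasure lborel E1 + (emeasure lborel E2 + emeasure lborel E3)"
    by (intro order_trans[OF emeasure_subadditive] add_mono order_refl) auto
  also have "\<dots> \<le> ennreal C + (ennreal (4 * \<eta>) + ennreal C)"
    by (intro add_mono 1 2 3)
  also have "\<dots> = ennreal (2 * C + 4 * \<eta>)"
    using C0 \<eta>(1) by (simp flip: ennreal_plus)
  also have "\<dots> \<le> ennreal (4 * (2 ^ Suc j - 1) * \<epsilon> powr (1 / 2 ^ Suc j))"
  proof (rule ennreal_leI)
    have e: "\<epsilon> = \<eta> powr 2" using \<eta> by (simp add: powr_numeral power2_eq_square)
    have "\<epsilon> powr (1 / 2 ^ Suc j) = \<eta> powr (1 / 2 ^ j)"
      unfolding e powr_powr by simp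
    moreover have "\<eta> \<le> \<eta> powr (1 / 2 ^ j)"
      using powr_mono'[of "1 / 2 ^ j" 1 \<eta>] \<eta> by simp
    ultimately show "2 * C + 4 * \<eta> \<le> 4 * (2 ^ Suc j - 1) * \<epsilon> powr (1 / 2 ^ Suc j)"
      by (simp add: C_def algebra_simps)
  qed
  finally show ?case .
qed

text \<open>Taylor expansion at \<open>s1\<close>: if the first \<open>k\<close> derivatives were
  small, they would contribute at most e/12 < 1/4 to F(s0), and Cauchy estimates on the circle of
  radius 2 bound the remaining terms by 2 M / 2^k < 1/4. Circles of radius 2 around points of [0,1]
  stay in the disc of radius 3 on which \<open>M\<close> is a bound.\<close>

lemma higher_deriv_lower_bound:
  fixes F :: "complex \<Rightarrow> complex"
  assumes F: "F holomorphic_on UNIV" and M: "\<And>z. norm z \<le> 3 \<Longrightarrow> norm (F z) \<le> M"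
    and k: "2 * M / 2 ^ k < 1 / 4"
    and s0: "s0 \<in> {0..1}" "norm (F (of_real s0)) \<ge> 1 / 2" and s1: "s1 \<in> {0..1}"
  shows "\<exists>j<k. norm ((deriv ^^ j) F (of_real s1)) \<ge> 1 / 12"
proof (rule ccontr)
  assume "\<not> ?thesis"
  then have small: "norm ((deriv ^^ j) F (of_real s1)) < 1 / 12" if "j < k" for j
    using that by force
  define a where "a j = (deriv ^^ j) F (of_real s1) / fact j * (of_real s0 - of_real s1) ^ j" for j
  have sums: "a sums F (of_real s0)"
    unfolding a_def
  proof (rule holomorphic_power_series[of _ _ 2])
    show "F holomorphic_on ball (complex_of_real s1) 2" using F by (rule holomorphic_on_subset) simp
    show "complex_of_real s0 \<in> ball (complex_of_real s1) 2"
    proof -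
      have "\<bar>s1 - s0\<bar> < 2" using s0(1) s1 by auto
      then show ?thesis by (simp add: dist_norm flip: of_real_diff)
    qed
  qed
  have le1: "norm (of_real s0 - of_real s1 :: complex) ^ j \<le> 1" for j
  proof (rule power_le_one)
    have "\<bar>s0 - s1\<bar> \<le> 1" using s0(1) s1 by auto
    then show "norm (of_real s0 - of_real s1 :: complex) \<le> 1" by (simp flip: of_real_diff)
  qed simp
  have cauchy: "norm ((deriv ^^ j) F (of_real s1)) \<le> fact j * M / 2 ^ j" for j
  proof (rule Cauchy_inequality)
    show "cmod (F x) \<le> M" if "cmod (complex_of_real s1 - x) = 2" for x
    proof (rule M)
      have "norm x \<le> norm (complex_of_real s1) + norm (complex_of_real s1 - x)"
        by (metis norm_triangle_sub norm_minus_commute)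
      then show "norm x \<le> 3" using that s1 by auto
    qed
    show "F holomorphic_on ball (complex_of_real s1) 2" using F by (rule holomorphic_on_subset) simp
    show "continuous_on (cball (complex_of_real s1) 2) F"
      by (intro holomorphic_on_imp_continuous_on holomorphic_on_subset[OF F]) simp
  qed simp
  have a1: "norm (a j) \<le> M / 2 ^ j" for j
  proof -
    have "norm (a j) \<le> norm ((deriv ^^ j) F (of_real s1)) / fact j * 1"
      unfolding a_def norm_mult norm_divide norm_power
      using le1[of j] by (intro mult_mono) auto
    also have "\<dots> \<le> (fact j * M / 2 ^ j) / fact j" using cauchy[of j] by (simp add: divide_le_eq mult.commute)
    finally show ?thesis by simp
  qed
  have a2: "norm (a j) \<le> (1/12) * inverse (fact j)" if "j < k" for j
  proof -
    have "norm (a j) \<le> norm ((deriv ^^ j) F (of_real s1)) / fact j * 1"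
      unfolding a_def norm_mult norm_divide norm_power
      using le1[of j] by (intro mult_mono) auto
    also have "\<dots> \<le> (1/12) / fact j" using small[OF that] by (simp only: mult_1_right) (intro divide_right_mono, auto)
    finally show ?thesis by (simp add: field_simps)
  qed
  have geo: "(\<lambda>j. M / 2 ^ (j + k)) sums (2 * M / 2 ^ k)"
  proof -
    have "(\<lambda>j. (M / 2 ^ k) * (1/2) ^ j) sums ((M / 2 ^ k) * (1 / (1 - 1/2)))"
      by (intro sums_mult geometric_sums) simp
    then show ?thesis by (simp add: power_add power_divide field_simps)
  qed
  have summ: "summable (\<lambda>j. norm (a (j + k)))"
    by (rule summable_comparison_test_ev[OF _ sums_summable[OF geo]])
      (use a1 in \<open>auto intro!: always_eventually\<close>)
  have "F (of_real s0) = (\<Sum>j. a (j + k)) + (\<Sum>j<k. a j)"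
    using sums by (metis suminf_split_initial_segment sums_iff)
  then have "norm (F (of_real s0)) \<le> norm (\<Sum>j. a (j + k)) + norm (\<Sum>j<k. a j)"
    using norm_triangle_ineq by metis
  also have "norm (\<Sum>j. a (j + k)) \<le> (\<Sum>j. norm (a (j + k)))"
    by (rule summable_norm[OF summ])
  also have "\<dots> \<le> (\<Sum>j. M / 2 ^ (j + k))"
    by (intro suminf_le summ sums_summable[OF geo] a1)
  also have "\<dots> = 2 * M / 2 ^ k" using geo sums_unique by metis
  also have "norm (\<Sum>j<k. a j) \<le> (\<Sum>j<k. (1/12) * inverse (fact j))"
    by (rule sum_norm_le) (use a2 in auto)
  also have "\<dots> = (1/12) * (\<Sum>j<k. inverse (fact j))" by (simp add: sum_distrib_left)
  also have "\<dots> \<le> (1/12) * exp 1"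
  proof -
    have "(\<Sum>j<k. inverse (fact j)) \<le> (exp 1 :: real)"
      using sum_le_suminf[of "\<lambda>n. inverse (fact n) * (1::real) ^ n" "{..<k}"] summable_exp[of "1::real"]
      by (simp add: exp_def)
    then show ?thesis by simp
  qed
  also have "\<dots> \<le> (1/12) * 3" using e_less_272 by simp
  finally show False using s0(2) k by linarith
qed

text \<open>At every point of [0,1] some derivative of order below \<open>k\<close> is at least
  1/12, and a uniform bound for the next derivative keeps its direction on an interval of fixed
  length. On each such interval the real estimate applies to a rotated real part. The order may
  differ between intervals, so the exponent is the worst one.\<close>

lemma entire_sublevel_bound:
  fixes M :: real
  shows "\<exists>K \<alpha>. 0 \<le> K \<and> 0 < \<alpha> \<and> (\<forall>F. F holomorphic_on UNIV \<longrightarrow> (\<forall>z. norm z \<le> 3 \<longrightarrow> norm (F z) \<le> M) \<longrightarrow>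
           (\<exists>s\<in>{0..1}. norm (F (complex_of_real s)) \<ge> 1 / 2) \<longrightarrow>
           (\<forall>\<epsilon>. 0 < \<epsilon> \<longrightarrow> \<epsilon> \<le> 1 \<longrightarrow>
              emeasure lborel {s\<in>{0..1}. norm (F (complex_of_real s)) < \<epsilon>} \<le> ennreal (K * \<epsilon> powr \<alpha>)))"
proof -
  obtain k :: nat where k0: "8 * \<bar>M\<bar> < 2 ^ k"
    using real_arch_pow[of 2 "8 * \<bar>M\<bar>"] by auto
  have k: "2 * M / 2 ^ k < 1 / 4"
    using k0 by (simp add: divide_less_eq)
  \<comment> \<open>Bounds all derivatives up to order \<open>k\<close> on [0,1]. The choice of
    \<open>P\<close> then makes every derivative of order below \<open>k\<close> vary by at most
    1/24 on an interval of length 1/P.\<close>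
  define M' where "M' = fact k * \<bar>M\<bar> + 1"
  have M': "M' > 0" unfolding M'_def by (intro add_nonneg_pos) auto
  obtain P :: nat where P: "24 * M' < real P" using reals_Archimedean2 by blast
  have P0: "P > 0" using P M' by (cases P) auto
  define \<alpha> :: real where "\<alpha> = 1 / 2 ^ k"
  have \<alpha>: "0 < \<alpha>" "\<alpha> \<le> 1" by (auto simp: \<alpha>_def)
  define K where "K = real P * (4 * 2 ^ k * 24) + 24"
  have "emeasure lborel {s\<in>{0..1}. norm (F (complex_of_real s)) < \<epsilon>} \<le> ennreal (K * \<epsilon> powr \<alpha>)"
    if F: "F holomorphic_on UNIV" and M: "\<And>z. norm z \<le> 3 \<Longrightarrow> norm (F z) \<le> M"
      and s0: "\<exists>s\<in>{0..1}. norm (F (complex_of_real s)) \<ge> 1 / 2" and \<epsilon>: "0 < \<epsilon>" "\<epsilon> \<le> 1" for F \<epsilon>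
  \<comment> \<open>The functions below are scaled by 24, so the level 24 \<epsilon> must not exceed
    1; otherwise the summand 24 in \<open>K\<close> already makes the bound at least 1.\<close>
  proof (cases "24 * \<epsilon> \<le> 1")
    case False
    have [measurable]: "(\<lambda>s. F (complex_of_real s)) \<in> borel_measurable borel"
      using F by (intro borel_measurable_continuous_onI continuous_intros continuous_on_compose2[OF holomorphic_on_imp_continuous_on[OF F]]) auto
    have "emeasure lborel {s\<in>{0..1}. norm (F (complex_of_real s)) < \<epsilon>} \<le> emeasure lborel {0..1::real}"
      by (rule emeasure_mono) auto
    also have "\<dots> \<le> ennreal (K * \<epsilon> powr \<alpha>)"
    proof -
      have "1 \<le> 24 * \<epsilon> powr 1" using False \<epsilon> by simp
      also have "\<dots> \<le> K * \<epsilon> powr \<alpha>"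
        unfolding K_def using \<epsilon> \<alpha> by (intro mult_mono powr_mono') auto
      finally show ?thesis by simp
    qed
    finally show ?thesis .
  next
    case True
    define D where "D i = (deriv ^^ i) F" for i
    have D: "(D i has_field_derivative D (Suc i) z) (at z within S)" for i z S
      using holomorphic_derivI[OF holomorphic_higher_deriv[OF F, of i]] by (simp add: D_def has_field_derivative_at_within)
    have bound: "norm (D i (of_real s)) \<le> M'" if "i \<le> k" "s \<in> {0..1}" for i s
    proof -
      have "norm (D i (of_real s)) \<le> fact i * M / 2 ^ i" unfolding D_def
      proof (rule Cauchy_inequality)
        show "cmod (F x) \<le> M" if "cmod (complex_of_real s - x) = 2" for x
        proof (rule M)
          have "norm x \<le> norm (complex_of_real s) + norm (complex_of_real s - x)"
            by (metis norm_triangle_sub norm_minus_commute)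
          then show "norm x \<le> 3" using that \<open>s \<in> {0..1}\<close> by auto
        qed
        show "F holomorphic_on ball (complex_of_real s) 2" using F by (rule holomorphic_on_subset) simp
        show "continuous_on (cball (complex_of_real s) 2) F"
          by (intro holomorphic_on_imp_continuous_on holomorphic_on_subset[OF F]) simp
      qed simp
      also have "\<dots> \<le> fact i * \<bar>M\<bar> / 1" by (intro frac_le mult_left_mono) auto
      also have "\<dots> \<le> fact k * \<bar>M\<bar>" using fact_mono[OF \<open>i \<le> k\<close>] by (simp only: div_by_1) (intro mult_right_mono, auto)
      finally show ?thesis by (simp add: M'_def)
    qed
    have piece: "emeasure lborel {s\<in>{real i / P..real (Suc i) / P}. norm (F (complex_of_real s)) < \<epsilon>}
        \<le> ennreal (4 * 2 ^ k * 24 * \<epsilon> powr \<alpha>)" if i: "i < P" for i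
    proof -
      define s1 where "s1 = real i / P"
      have sub: "{real i / P..real (Suc i) / P} \<subseteq> {0..1}"
        using i P0 by (auto simp: field_simps intro: order_trans)
      have s1: "s1 \<in> {0..1}" using i by (auto simp: s1_def)
      obtain j where j: "j < k" "norm (D j (of_real s1)) \<ge> 1 / 12"
        using s0 higher_deriv_lower_bound[OF F M k _ _ s1] unfolding D_def by blast
      define w where "w = D j (of_real s1)"
      \<comment> \<open>Rotation by the phase of \<open>w\<close> makes the real part of the
        \<open>j\<close>-th derivative at \<open>s1\<close> equal to |w|, which is at least 1/12.
        The factor 24 turns this into 2, and the variation of at most 1/24 leaves at least 1 on the
        whole interval.\<close>
      define u where "u i s = 24 * Re (cnj (sgn w) * D i (of_real s))" for i s
      have w: "Re (cnj (sgn w) * w) = norm w"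
      proof -
        have "w \<noteq> 0" using j(2) by (auto simp: w_def)
        then have "cnj (sgn w) * w = of_real (norm w)"
          using complex_norm_square[of w] by (simp add: sgn_eq power2_eq_square field_simps)
        then show ?thesis by simp
      qed
      have n1: "norm (cnj (sgn w)) = 1" using j(2) by (auto simp: norm_sgn w_def)
      have "emeasure lborel {s\<in>{real i / P..real (Suc i) / P}. \<bar>u 0 s\<bar> < 24 * \<epsilon>}
          \<le> ennreal (4 * (2 ^ j - 1) * (24 * \<epsilon>) powr (1 / 2 ^ j))"
      proof (rule emeasure_sublevel_deriv_ge_1)
        show "(u i has_real_derivative u (Suc i) s) (at s)" for i s
        proof -
          have "((\<lambda>s. 24 * (cnj (sgn w) * D i (of_real s))) has_vector_derivative 24 * (cnj (sgn w) * D (Suc i) (of_real s))) (at s)"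
            by (rule has_vector_derivative_real_field) (auto intro!: derivative_eq_intros D)
          from bounded_linear.has_vector_derivative[OF bounded_linear_Re this]
          show ?thesis unfolding u_def has_real_derivative_iff_has_vector_derivative
            by (simp add: algebra_simps)
        qed
        show "1 \<le> u j s" if s: "s \<in> {real i / real P..real (Suc i) / real P}" for s
        proof -
          have s': "s \<in> {0..1}" using s sub by blast
          have "norm (D j (of_real s) - D j (of_real s1)) \<le> M' * norm (complex_of_real s - of_real s1)"
          proof (rule field_differentiable_bound[where S = "of_real ` {0..1}"])
            show "convex (complex_of_real ` {0..1})"
              by (intro convex_linear_image linear_of_real convex_real_interval)
            show "cmod (D (Suc j) z) \<le> M'" if "z \<in> complex_of_real ` {0..1}" for z
              using that bound[of "Suc j"] j(1) by auto
          qed (use D s' s1 in auto)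
          also have "norm (complex_of_real s - of_real s1) = \<bar>s - s1\<bar>" by (simp flip: of_real_diff)
          also have "\<dots> \<le> 1 / P" using s by (auto simp: s1_def add_divide_distrib)
          also have "M' * (1 / P) \<le> 1 / 24" using P P0 by (simp add: field_simps)
          finally have "norm (D j (of_real s) - w) \<le> 1 / 24" using M' by (simp add: w_def mult_left_mono)
          then have "\<bar>Re (cnj (sgn w) * (D j (of_real s) - w))\<bar> \<le> 1 / 24"
            using abs_Re_le_cmod[of "cnj (sgn w) * (D j (of_real s) - w)"] n1 by (simp add: norm_mult)
          moreover have "cnj (sgn w) * D j (of_real s) = cnj (sgn w) * w + cnj (sgn w) * (D j (of_real s) - w)"
            by (simp add: algebra_simps)
          ultimately have "Re (cnj (sgn w) * D j (of_real s)) \<ge> norm w - 1 / 24"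
            using w by (simp only: plus_complex.sel)
          then show ?thesis using j(2) by (simp add: u_def w_def)
        qed
      qed (use \<epsilon> True in auto)
      also have "\<dots> \<le> ennreal (4 * 2 ^ k * 24 * \<epsilon> powr \<alpha>)"
      proof (rule ennreal_leI)
        have "(24 * \<epsilon>) powr (1 / 2 ^ j) \<le> (24 * \<epsilon>) powr \<alpha>"
          using \<epsilon> True j by (intro powr_mono') (auto simp: \<alpha>_def frac_le)
        also have "\<dots> \<le> 24 powr 1 * \<epsilon> powr \<alpha>"
          unfolding powr_mult using \<alpha> by (intro mult_right_mono powr_mono) auto
        finally have "(24 * \<epsilon>) powr (1 / 2 ^ j) \<le> 24 * \<epsilon> powr \<alpha>" by simp
        moreover have "(2::real) ^ j - 1 \<le> 2 ^ k"
          using power_increasing[of j k "2::real"] j by linarith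
        ultimately have "((2::real) ^ j - 1) * (24 * \<epsilon>) powr (1 / 2 ^ j) \<le> 2 ^ k * (24 * \<epsilon> powr \<alpha>)"
          by (intro mult_mono) auto
        then show "4 * (2 ^ j - 1) * (24 * \<epsilon>) powr (1 / 2 ^ j) \<le> 4 * 2 ^ k * 24 * \<epsilon> powr \<alpha>"
          by linarith
      qed
      finally have *: "emeasure lborel {s\<in>{real i / P..real (Suc i) / P}. \<bar>u 0 s\<bar> < 24 * \<epsilon>}
          \<le> ennreal (4 * 2 ^ k * 24 * \<epsilon> powr \<alpha>)" .
      have "\<bar>u 0 s\<bar> \<le> 24 * norm (F (of_real s))" for s
        using abs_Re_le_cmod[of "cnj (sgn w) * F (of_real s)"] n1 by (simp add: u_def D_def norm_mult abs_mult)
      then have "\<bar>u 0 s\<bar> < 24 * \<epsilon>" if "norm (F (of_real s)) < \<epsilon>" for s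
        by (rule le_less_trans) (use that in simp)
      then have "{s\<in>{real i / P..real (Suc i) / P}. norm (F (complex_of_real s)) < \<epsilon>} \<subseteq>
          {s\<in>{real i / P..real (Suc i) / P}. \<bar>u 0 s\<bar> < 24 * \<epsilon>}"
        by auto
      moreover have "continuous_on UNIV (u 0)"
        unfolding u_def D_def funpow_0 by (intro continuous_intros continuous_on_compose2[OF holomorphic_on_imp_continuous_on[OF F]]) auto
      then have [measurable]: "u 0 \<in> borel_measurable borel" by (rule borel_measurable_continuous_onI)
      have "{s\<in>{real i / P..real (Suc i) / P}. \<bar>u 0 s\<bar> < 24 * \<epsilon>} \<in> sets lborel" by measurable
      ultimately show ?thesis using * emeasure_mono order_trans by blast
    qed
    have "{s\<in>{0..1}. norm (F (complex_of_real s)) < \<epsilon>} \<subseteq>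
        (\<Union>i<P. {s\<in>{real i / P..real (Suc i) / P}. norm (F (complex_of_real s)) < \<epsilon>})"
    proof
      fix s assume s: "s \<in> {s\<in>{0..1}. norm (F (complex_of_real s)) < \<epsilon>}"
      show "s \<in> (\<Union>i<P. {s\<in>{real i / P..real (Suc i) / P}. norm (F (complex_of_real s)) < \<epsilon>})"
      proof (cases "s = 1")
        case True
        then show ?thesis using s P0 by (auto intro!: bexI[of _ "P - 1"] simp: field_simps of_nat_diff)
      next
        case False
        define i where "i = nat \<lfloor>s * P\<rfloor>"
        have "0 \<le> s * P" "s * P < P" using s False P0 by auto
        then have "real i \<le> s * P" "s * P \<le> real i + 1" "i < P"
          by (auto simp: i_def nat_less_iff floor_less_iff)
        then show ?thesis using s P0 by (auto intro!: bexI[of _ i] simp: field_simps)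
      qed
    qed
    moreover have [measurable]: "(\<lambda>s. F (complex_of_real s)) \<in> borel_measurable borel"
      using F by (intro borel_measurable_continuous_onI continuous_intros continuous_on_compose2[OF holomorphic_on_imp_continuous_on[OF F]]) auto
    ultimately have "emeasure lborel {s\<in>{0..1}. norm (F (complex_of_real s)) < \<epsilon>} \<le>
        emeasure lborel (\<Union>i<P. {s\<in>{real i / P..real (Suc i) / P}. norm (F (complex_of_real s)) < \<epsilon>})"
      by (intro emeasure_mono) auto
    also have "\<dots> \<le> (\<Sum>i<P. emeasure lborel {s\<in>{real i / P..real (Suc i) / P}. norm (F (complex_of_real s)) < \<epsilon>})"
      by (rule emeasure_subadditive_finite) auto
    also have "\<dots> \<le> (\<Sum>i<P. ennreal (4 * 2 ^ k * 24 * \<epsilon> powr \<alpha>))"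
      by (intro sum_mono piece) simp
    also have "\<dots> = ennreal (real P * (4 * 2 ^ k * 24 * \<epsilon> powr \<alpha>))"
      by (simp add: ennreal_of_nat_eq_real_of_nat ennreal_mult del: ennreal_mult'')
    also have "\<dots> \<le> ennreal (K * \<epsilon> powr \<alpha>)"
      by (intro ennreal_leI) (simp add: K_def algebra_simps)
    finally show ?thesis .
  qed
  moreover have "0 \<le> K" by (simp add: K_def)
  ultimately show ?thesis using \<alpha>(1) by blast
qed

section \<open>Vitali convergence from square integrals, and square integrability of
  logarithms\<close>

context prob_space
begin

lemma integrable_of_nn_integral_square:
  fixes u :: "'a \<Rightarrow> real"
  assumes [measurable]: "u \<in> borel_measurable M" and K: "(\<integral>\<^sup>+x. ennreal ((u x)\<^sup>2) \<partial>M) \<le> ennreal K"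
  shows "integrable M u" "integrable M (\<lambda>x. (u x)\<^sup>2)" "0 \<le> K \<Longrightarrow> (\<integral>x. (u x)\<^sup>2 \<partial>M) \<le> K"
proof -
  show *: "integrable M (\<lambda>x. (u x)\<^sup>2)"
    using K by (intro integrableI_bounded) (auto intro: le_less_trans)
  have "\<bar>r\<bar> \<le> 1 + r\<^sup>2" for r :: real
    using self_le_power[of "\<bar>r\<bar>" 2] by (cases "\<bar>r\<bar> \<ge> 1") (auto simp: add_increasing2)
  then show "integrable M u"
    by (intro Bochner_Integration.integrable_bound[of M "\<lambda>x. 1 + (u x)\<^sup>2" u]) (use * in auto)
  show "(\<integral>x. (u x)\<^sup>2 \<partial>M) \<le> K" if "0 \<le> K"
    using K * that by (subst (asm) nn_integral_eq_integral) auto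
qed

text \<open>Vitali's theorem, with boundedness in L2 as the form of uniform integrability: cutting
  off at height T changes every integral by at most K/T, and the cut-off functions converge by
  dominated convergence. Fatou's lemma carries the bound to the limit.\<close>

lemma tendsto_integral_of_L2_bounded:
  fixes u :: "nat \<Rightarrow> 'a \<Rightarrow> real"
  assumes [measurable]: "\<And>k. u k \<in> borel_measurable M" "v \<in> borel_measurable M"
    and lim: "AE x in M. (\<lambda>k. u k x) \<longlonglongrightarrow> v x"
    and K: "\<And>k. (\<integral>\<^sup>+x. ennreal ((u k x)\<^sup>2) \<partial>M) \<le> ennreal K"
  shows "integrable M v" "(\<lambda>k. \<integral>x. u k x \<partial>M) \<longlonglongrightarrow> (\<integral>x. v x \<partial>M)"
proof -
  \<comment> \<open>\<open>ennreal\<close> sends a negative \<open>K\<close> to 0; the real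
    estimates below need a nonnegative constant.\<close>
  define K' where "K' = max K 0"
  have K': "K' \<ge> 0" "ennreal K = ennreal K'" by (auto simp: K'_def max_def ennreal_neg)
  have Kv: "(\<integral>\<^sup>+x. ennreal ((v x)\<^sup>2) \<partial>M) \<le> ennreal K"
  proof -
    have "(\<integral>\<^sup>+x. ennreal ((v x)\<^sup>2) \<partial>M) = (\<integral>\<^sup>+x. liminf (\<lambda>k. ennreal ((u k x)\<^sup>2)) \<partial>M)"
    proof (rule nn_integral_cong_AE, use lim in eventually_elim)
      fix x assume "(\<lambda>k. u k x) \<longlonglongrightarrow> v x"
      then have "(\<lambda>k. ennreal ((u k x)\<^sup>2)) \<longlonglongrightarrow> ennreal ((v x)\<^sup>2)"
        by (intro tendsto_intros)
      then show "ennreal ((v x)\<^sup>2) = liminf (\<lambda>k. ennreal ((u k x)\<^sup>2))"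
        by (metis lim_imp_Liminf trivial_limit_sequentially)
    qed
    also have "\<dots> \<le> liminf (\<lambda>k. \<integral>\<^sup>+x. ennreal ((u k x)\<^sup>2) \<partial>M)" by (rule nn_integral_liminf) simp
    also have "\<dots> \<le> liminf (\<lambda>k. ennreal K)" by (intro Liminf_mono always_eventually allI K)
    finally show ?thesis by (simp add: Liminf_const)
  qed
  show iv: "integrable M v" by (rule integrable_of_nn_integral_square[OF _ Kv]) simp
  have iu: "integrable M (u k)" for k by (rule integrable_of_nn_integral_square[OF _ K]) simp
  define c where "c T r = max (-T) (min T r)" for T r :: real
  have c_diff: "\<bar>r - c T r\<bar> \<le> r\<^sup>2 / T" if "T > 0" for T r
  proof (cases "\<bar>r\<bar> \<le> T")
    case False
    have "\<bar>r - c T r\<bar> \<le> \<bar>r\<bar>" using False that by (auto simp: c_def)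
    also have "\<dots> \<le> \<bar>r\<bar> * (\<bar>r\<bar> / T)" using False that mult_left_mono[of 1 "\<bar>r\<bar> / T" "\<bar>r\<bar>"] by simp
    also have "\<dots> = r\<^sup>2 / T" by (simp add: power2_eq_square)
    finally show ?thesis .
  qed (use that in \<open>auto simp: c_def\<close>)
  have ic: "integrable M (\<lambda>x. c T (w x))" if "T > 0" and [measurable]: "w \<in> borel_measurable M" for T and w :: "'a \<Rightarrow> real"
    using that by (intro integrable_const_bound[of _ T]) (auto simp: c_def)
  have trunc: "\<bar>(\<integral>x. w x \<partial>M) - (\<integral>x. c T (w x) \<partial>M)\<bar> \<le> K' / T"
    if T: "T > 0" and [measurable]: "w \<in> borel_measurable M" and Kw: "(\<integral>\<^sup>+x. ennreal ((w x)\<^sup>2) \<partial>M) \<le> ennreal K" for T w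
  proof -
    note w = integrable_of_nn_integral_square[OF that(2) Kw[unfolded K'(2)]]
    have "(\<integral>x. w x \<partial>M) - (\<integral>x. c T (w x) \<partial>M) = (\<integral>x. w x - c T (w x) \<partial>M)"
      using w ic[OF T] by simp
    also have "\<bar>\<dots>\<bar> \<le> (\<integral>x. (w x)\<^sup>2 / T \<partial>M)"
      by (rule order_trans[OF integral_abs_bound integral_mono]) (use w ic[OF T] c_diff[OF T] in auto)
    also have "\<dots> \<le> K' / T" using w K' T by (simp add: divide_right_mono)
    finally show ?thesis .
  qed
  have conv: "(\<lambda>k. \<integral>x. c T (u k x) \<partial>M) \<longlonglongrightarrow> (\<integral>x. c T (v x) \<partial>M)" if "T > 0" for T
  proof (rule integral_dominated_convergence[where w = "\<lambda>_. T"])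
    show "AE x in M. (\<lambda>k. c T (u k x)) \<longlonglongrightarrow> c T (v x)"
      using lim by eventually_elim (auto simp: c_def intro!: tendsto_intros)
  qed (use that in \<open>auto simp: c_def\<close>)
  show "(\<lambda>k. \<integral>x. u k x \<partial>M) \<longlonglongrightarrow> (\<integral>x. v x \<partial>M)"
  proof (rule LIMSEQ_I)
    fix r :: real assume r: "r > 0"
    define T where "T = 3 * (K' + 1) / r"
    have T: "T > 0" "K' / T < r / 3" using r K' by (auto simp: T_def field_simps)
    obtain N where N: "\<And>k. k \<ge> N \<Longrightarrow> \<bar>(\<integral>x. c T (u k x) \<partial>M) - (\<integral>x. c T (v x) \<partial>M)\<bar> < r / 3"
      using LIMSEQ_D[OF conv[OF T(1)], of "r / 3"] r by auto
    have "\<bar>(\<integral>x. u k x \<partial>M) - (\<integral>x. v x \<partial>M)\<bar> < r" if "k \<ge> N" for k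
      using N[OF that] trunc[OF T(1) assms(1) K, of k] trunc[OF T(1) assms(2) Kv] T(2) by linarith
    then show "\<exists>N. \<forall>k\<ge>N. norm ((\<integral>x. u k x \<partial>M) - (\<integral>x. v x \<partial>M)) < r" by auto
  qed
qed

text \<open>Summation over levels: where \<open>f\<close> lies between e^(-n-1) and e^(-n) the
  squared logarithm is at most (n+1)^2, and the power bound on the sublevel sets gives a geometric
  factor that beats this polynomial.\<close>

lemma nn_integral_ln_square_le:
  fixes f :: "'a \<Rightarrow> real"
  assumes [measurable]: "f \<in> borel_measurable M"
    and f: "\<And>x. x \<in> space M \<Longrightarrow> 0 \<le> f x \<and> f x \<le> C" and C: "C \<ge> 1" and K: "0 \<le> K" and \<alpha>: "0 < \<alpha>"
    and small: "\<And>\<epsilon>. 0 < \<epsilon> \<Longrightarrow> \<epsilon> \<le> 1 \<Longrightarrow> emeasure M {x\<in>space M. f x < \<epsilon>} \<le> ennreal (K * \<epsilon> powr \<alpha>)"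
  shows "(\<integral>\<^sup>+x. ennreal ((ln (f x))\<^sup>2) \<partial>M) \<le> ennreal ((ln C)\<^sup>2 + (\<Sum>n. (real n + 1)\<^sup>2 * (K * exp (- \<alpha> * real n))))"
proof -
  have summ: "summable (\<lambda>n. (real n + 1)\<^sup>2 * (K * exp (- \<alpha> * real n)))"
  proof (rule summable_comparison_test_bigo)
    show "summable (\<lambda>n. norm (1 / real n ^ 2))"
      using inverse_power_summable[of 2, where 'a = real] by (simp add: field_simps)
    show "(\<lambda>n. (real n + 1)\<^sup>2 * (K * exp (- \<alpha> * real n))) \<in> O(\<lambda>n. 1 / real n ^ 2)"
      using \<alpha> by real_asymp
  qed
  define I where "I n x = indicator {x\<in>space M. f x < exp (- real n)} x * ennreal ((real n + 1)\<^sup>2)" for n x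
  have [measurable]: "I n \<in> borel_measurable M" for n unfolding I_def by measurable
  have "ennreal ((ln (f x))\<^sup>2) \<le> ennreal ((ln C)\<^sup>2) + (\<Sum>n. I n x)" if x: "x \<in> space M" for x
  proof (cases "f x > 0 \<and> f x < 1")
    case True
    \<comment> \<open>The largest n with f x < exp(-n); the strict inequality in \<open>I n\<close>
      is the reason for the ceiling minus one.\<close>
    define n where "n = nat (\<lceil>- ln (f x)\<rceil> - 1)"
    have "ln (f x) < 0" using True by simp
    then have n: "real n < - ln (f x)" "- ln (f x) \<le> real n + 1"
      unfolding n_def by linarith+
    have "ln (f x) < - real n" using n by simp
    then have "f x < exp (- real n)" using True by (metis exp_less_cancel_iff exp_ln)
    moreover have "(ln (f x))\<^sup>2 \<le> (real n + 1)\<^sup>2"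
      using n by (simp add: abs_le_square_iff[symmetric])
    ultimately have "ennreal ((ln (f x))\<^sup>2) \<le> I n x"
      using x by (simp add: I_def ennreal_leI)
    also have "\<dots> \<le> (\<Sum>n. I n x)"
      using sum_le_suminf[of "\<lambda>n. I n x" "{n}"] by simp
    finally show ?thesis by (simp add: add_increasing)
  next
    case False
    have "(ln (f x))\<^sup>2 \<le> (ln C)\<^sup>2"
    \<comment> \<open>Zeros of \<open>f\<close> cause no trouble here, since
      \<open>ln 0 = 0\<close>.\<close>
    proof (cases "f x = 0")
      case False
      then have "1 \<le> f x" using f[OF x] \<open>\<not> (f x > 0 \<and> f x < 1)\<close> by auto
      then show ?thesis using f[OF x] by (intro power_mono) auto
    qed simp
    then show ?thesis by (simp add: add_increasing2 ennreal_leI)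
  qed
  then have "(\<integral>\<^sup>+x. ennreal ((ln (f x))\<^sup>2) \<partial>M) \<le> (\<integral>\<^sup>+x. ennreal ((ln C)\<^sup>2) + (\<Sum>n. I n x) \<partial>M)"
    by (rule nn_integral_mono)
  also have "\<dots> = ennreal ((ln C)\<^sup>2) + (\<Sum>n. \<integral>\<^sup>+x. I n x \<partial>M)"
    by (simp add: nn_integral_add nn_integral_suminf emeasure_space_1)
  also have "(\<Sum>n. \<integral>\<^sup>+x. I n x \<partial>M) \<le> (\<Sum>n. ennreal ((real n + 1)\<^sup>2 * (K * exp (- \<alpha> * real n))))"
  proof (rule suminf_le)
    fix n
    have "(\<integral>\<^sup>+x. I n x \<partial>M) = emeasure M {x\<in>space M. f x < exp (- real n)} * ennreal ((real n + 1)\<^sup>2)"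
      unfolding I_def by (subst nn_integral_multc) auto
    also have "\<dots> \<le> ennreal (K * exp (- real n) powr \<alpha>) * ennreal ((real n + 1)\<^sup>2)"
      by (intro mult_right_mono small) auto
    also have "\<dots> = ennreal ((real n + 1)\<^sup>2 * (K * exp (- \<alpha> * real n)))"
      using K by (simp add: powr_def mult_ac flip: ennreal_mult)
    finally show "(\<integral>\<^sup>+x. I n x \<partial>M) \<le> ennreal ((real n + 1)\<^sup>2 * (K * exp (- \<alpha> * real n)))" .
  qed auto
  also have "(\<Sum>n. ennreal ((real n + 1)\<^sup>2 * (K * exp (- \<alpha> * real n)))) = ennreal (\<Sum>n. (real n + 1)\<^sup>2 * (K * exp (- \<alpha> * real n)))"
    by (rule suminf_ennreal2) (use K summ in auto)
  finally show ?thesis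
    using K summ by (simp add: ennreal_plus suminf_nonneg)
qed

end

subsection \<open>Integrals over the unit cube\<close>

abbreviation U01 :: "real measure" where "U01 \<equiv> uniform_measure lborel {0..1}"

lemma prob_space_U01: "prob_space U01"
  by (rule prob_space_uniform_measure) auto

lemma sets_U01 [measurable_cong, simp]: "sets U01 = sets borel"
  by simp

lemma space_U01 [simp]: "space U01 = UNIV"
  by simp

interpretation U01: prob_space U01
  by (rule prob_space_U01)

interpretation cube_factors: product_prob_space "\<lambda>_::nat. U01" UNIV
  by standard

lemma prob_space_unit_cube: "prob_space (unit_cube g)"
  unfolding unit_cube_def by (rule prob_space_PiM) (rule prob_space_U01)

lemma sets_unit_cube [measurable_cong]: "sets (unit_cube g) = sets (PiM {..<g} (\<lambda>_. borel))"
  unfolding unit_cube_def by (intro sets_PiM_cong) auto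

lemma nn_integral_U01:
  assumes [measurable]: "f \<in> borel_measurable borel"
  shows "(\<integral>\<^sup>+x. f x \<partial>U01) = (\<integral>\<^sup>+x. f x * indicator {0..1} x \<partial>lborel)"
  by (subst nn_integral_uniform_measure) (auto simp: divide_ennreal_def)

lemma integral_U01:
  fixes f :: "real \<Rightarrow> 'a::{banach,second_countable_topology}"
  assumes [measurable]: "f \<in> borel_measurable borel"
  shows "(\<integral>x. f x \<partial>U01) = (\<integral>x. indicator {0..1} x *\<^sub>R f x \<partial>lborel)"
proof -
  have "uniform_measure lborel {0..1::real} = density lborel (\<lambda>x. ennreal (indicator {0..1} x))"
    unfolding uniform_measure_def by (intro density_cong) (auto split: split_indicator)
  then show ?thesis by (simp add: integral_density)
qed

lemma integral_U01_FTC: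
  fixes f :: "real \<Rightarrow> 'a::euclidean_space"
  assumes "\<And>x. (F has_vector_derivative f x) (at x)" and "continuous_on UNIV f"
  shows "(\<integral>x. f x \<partial>U01) = F 1 - F 0"
proof -
  have "f \<in> borel_measurable borel" using assms(2) by (rule borel_measurable_continuous_onI)
  then have "(\<integral>x. f x \<partial>U01) = (\<integral>x. indicator {0..1} x *\<^sub>R f x \<partial>lborel)" by (rule integral_U01)
  also have "\<dots> = F 1 - F 0"
    by (rule integral_FTC_Icc)
      (use assms in \<open>auto intro: has_vector_derivative_at_within continuous_on_subset\<close>)
  finally show ?thesis .
qed

lemma integral_U01_holomorphic:
  assumes h: "h holomorphic_on UNIV" and P: "\<And>z. (P has_field_derivative h z) (at z)"
  shows "(\<integral>x. h (complex_of_real x + w) \<partial>U01) = P (1 + w) - P w"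
proof -
  have "((\<lambda>x. P (complex_of_real x + w)) has_vector_derivative h (complex_of_real x + w)) (at x)" for x
    by (rule has_vector_derivative_real_field) (simp add: DERIV_shift[symmetric] P)
  moreover have "continuous_on UNIV (\<lambda>x. h (complex_of_real x + w))"
    by (intro continuous_on_compose2[OF holomorphic_on_imp_continuous_on[OF h]] continuous_intros) auto
  ultimately show ?thesis by (subst integral_U01_FTC[where F = "\<lambda>x. P (complex_of_real x + w)"]) auto
qed

text \<open>The integral is the increment P(1 + w) - P(w) of a primitive, and its derivative in w is
  h(1 + w) - h(w) = 0. This plays the role of a contour shift.\<close>

lemma integral_U01_shift_complex:
  assumes h: "h holomorphic_on UNIV" and per: "\<And>z. h (z + 1) = h z"
  shows "(\<integral>x. h (complex_of_real x + w) \<partial>U01) = (\<integral>x. h (complex_of_real x) \<partial>U01)"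
proof -
  obtain P where P: "\<And>z. (P has_field_derivative h z) (at z)"
    using holomorphic_convex_primitive'[OF _ _ h] by auto
  define q where "q w = P (1 + w) - P w" for w
  have "(q has_field_derivative 0) (at z)" for z
  proof -
    have "(q has_field_derivative h (1 + z) * 1 - h z) (at z)"
      unfolding q_def by (intro derivative_intros DERIV_chain2[OF P] P) (auto intro!: derivative_eq_intros)
    then show ?thesis using per[of z] by (simp add: add.commute)
  qed
  then obtain c where "\<And>z. q z = c"
    using has_field_derivative_zero_constant[of UNIV q] by auto
  then have "q w = q 0" by simp
  then show ?thesis
    using integral_U01_holomorphic[OF h P, of w] integral_U01_holomorphic[OF h P, of 0]
    by (simp add: q_def)
qed

lemma integral_U01_exp:
  "(\<integral>x. exp (2 * pi * \<i> * of_int m * complex_of_real x) \<partial>U01) = (if m = 0 then 1 else 0)"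
proof (cases "m = 0")
  case True
  then show ?thesis by (simp add: U01.prob_space[unfolded space_U01])
next
  case False
  define c where "c = 2 * pi * \<i> * of_int m"
  have c: "c \<noteq> 0" using False by (simp add: c_def)
  have "(\<integral>x. (\<lambda>z. exp (c * z)) (complex_of_real x + 0) \<partial>U01) = (\<lambda>z. exp (c * z) / c) (1 + 0) - (\<lambda>z. exp (c * z) / c) 0"
    by (rule integral_U01_holomorphic) (auto intro!: holomorphic_intros derivative_eq_intros simp: c)
  also have "exp c = 1"
    unfolding c_def using exp_integer_2pi[of "of_int m"] by (simp add: mult_ac)
  then have "(\<lambda>z. exp (c * z) / c) (1 + 0) - (\<lambda>z. exp (c * z) / c) 0 = 0" by simp
  finally show ?thesis using False by (simp add: c_def)
qed

lemma periodic_int_shift: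
  fixes h :: "real \<Rightarrow> 'b"
  assumes "\<And>x. h (x + 1) = h x"
  shows "h (x + of_int m) = h x"
proof (induction m rule: int_induct[of _ 0])
  case (step1 i)
  then show ?case using assms[of "x + of_int i"] by (simp add: add.assoc)
next
  case (step2 i)
  then show ?case using assms[of "x + of_int (i - 1)"] by (simp add: add.assoc)
qed simp

text \<open>Only the fractional part \<open>r\<close> of \<open>a\<close> matters; the interval is
  cut at 1 - r and the two pieces are glued in the other order, overlapping in a single
  point.\<close>

lemma nn_integral_U01_shift:
  fixes h :: "real \<Rightarrow> ennreal"
  assumes [measurable]: "h \<in> borel_measurable borel" and per: "\<And>x. h (x + 1) = h x"
  shows "(\<integral>\<^sup>+x. h (x + a) \<partial>U01) = (\<integral>\<^sup>+x. h x \<partial>U01)"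
proof -
  define r where "r = frac a"
  have r: "0 \<le> r" "r < 1" by (auto simp: r_def frac_lt_1)
  have "h (x + a) = h (x + r)" for x
    using periodic_int_shift[of h "x + r" "\<lfloor>a\<rfloor>", OF per] by (simp add: r_def frac_def algebra_simps)
  then have "(\<integral>\<^sup>+x. h (x + a) \<partial>U01) = (\<integral>\<^sup>+x. h (x + r) * indicator {0..1} x \<partial>lborel)"
    by (simp add: nn_integral_U01)
  also have "\<dots> = (\<integral>\<^sup>+x. (h (x + r) * indicator {0..1-r} x + h (x + r) * indicator {1-r..1} x) \<partial>lborel)"
    by (intro nn_integral_cong_AE eventually_mono[OF AE_lborel_singleton[of "1-r"]])
      (use r in \<open>auto split: split_indicator\<close>)
  also have "\<dots> = (\<integral>\<^sup>+x. h (x + r) * indicator {0..1-r} x \<partial>lborel) + (\<integral>\<^sup>+x. h (x + r) * indicator {1-r..1} x \<partial>lborel)"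
    by (rule nn_integral_add) auto
  also have "(\<integral>\<^sup>+x. h (x + r) * indicator {0..1-r} x \<partial>lborel) = (\<integral>\<^sup>+x. h x * indicator {r..1} x \<partial>lborel)"
    by (subst (2) nn_integral_real_affine[where c = 1 and t = r])
      (auto intro!: nn_integral_cong simp: add.commute split: split_indicator)
  also have "(\<integral>\<^sup>+x. h (x + r) * indicator {1-r..1} x \<partial>lborel) = (\<integral>\<^sup>+x. h x * indicator {0..r} x \<partial>lborel)"
  proof -
    have "h (x + (r - 1)) = h (x + r)" for x
      using per[of "x + (r - 1)"] by (simp add: algebra_simps)
    then show ?thesis
      by (subst (2) nn_integral_real_affine[where c = 1 and t = "r - 1"])
        (auto intro!: nn_integral_cong simp: add.commute split: split_indicator)
  qed
  also have "(\<integral>\<^sup>+x. h x * indicator {r..1} x \<partial>lborel) + (\<integral>\<^sup>+x. h x * indicator {0..r} x \<partial>lborel)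
     = (\<integral>\<^sup>+x. h x * indicator {r..1} x + h x * indicator {0..r} x \<partial>lborel)"
    by (rule nn_integral_add[symmetric]) auto
  also have "\<dots> = (\<integral>\<^sup>+x. h x * indicator {0..1} x \<partial>lborel)"
    by (intro nn_integral_cong_AE eventually_mono[OF AE_lborel_singleton[of "r"]])
      (use r in \<open>auto split: split_indicator\<close>)
  finally show ?thesis by (simp add: nn_integral_U01)
qed

text \<open>Translation invariance of the Haar measure of a real torus, one coordinate at a time.
  Translated points are restricted to \<open>I\<close> because the points of the product space are
  extensional functions.\<close>

lemma nn_integral_PiM_U01_shift:
  fixes h :: "(nat \<Rightarrow> real) \<Rightarrow> ennreal"
  assumes "finite I" "h \<in> borel_measurable (PiM I (\<lambda>_. borel))"
    and "\<And>x i. i \<in> I \<Longrightarrow> x \<in> extensional I \<Longrightarrow> h (x(i := x i + 1)) = h x"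
  shows "(\<integral>\<^sup>+x. h (\<lambda>i\<in>I. x i + a i) \<partial>(PiM I (\<lambda>_. U01))) = (\<integral>\<^sup>+x. h x \<partial>(PiM I (\<lambda>_. U01)))"
  using assms
proof (induction I arbitrary: h rule: finite_induct)
  case empty
  show ?case by (intro nn_integral_cong) (auto simp: space_PiM PiE_empty_domain restrict_def)
next
  case (insert i I)
  have [measurable_cong]: "sets (PiM J (\<lambda>_. U01)) = sets (PiM J (\<lambda>_. borel))" for J :: "nat set"
    by (intro sets_PiM_cong) auto
  note [measurable] = insert.prems(1)
  have upd: "(\<lambda>x. x(i := y)) \<in> PiM I (\<lambda>_. borel) \<rightarrow>\<^sub>M PiM (insert i I) (\<lambda>_. borel)" for y :: real
    by (rule measurable_fun_upd[where J = I]) auto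
  have upd2: "x \<in> space (PiM I (\<lambda>_. borel)) \<Longrightarrow> (\<lambda>y. x(i := y)) \<in> borel \<rightarrow>\<^sub>M PiM (insert i I) (\<lambda>_. borel)" for x :: "nat \<Rightarrow> real"
    by (rule measurable_component_update) (use insert in auto)
  have "(\<integral>\<^sup>+x. h (\<lambda>j\<in>insert i I. x j + a j) \<partial>(PiM (insert i I) (\<lambda>_. U01))) =
     (\<integral>\<^sup>+x. (\<integral>\<^sup>+y. h (\<lambda>j\<in>insert i I. (x(i := y)) j + a j) \<partial>U01) \<partial>(PiM I (\<lambda>_. U01)))"
    by (rule cube_factors.product_nn_integral_insert) (use insert in auto)
  also have "\<dots> = (\<integral>\<^sup>+x. (\<integral>\<^sup>+y. h ((\<lambda>j\<in>I. x j + a j)(i := y)) \<partial>U01) \<partial>(PiM I (\<lambda>_. U01)))"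
  proof (rule nn_integral_cong)
    fix x assume x: "x \<in> space (PiM I (\<lambda>_. U01))"
    have "(\<lambda>j\<in>insert i I. (x(i := y)) j + a j) = (\<lambda>j\<in>I. x j + a j)(i := y + a i)" for y
      using insert by (auto simp: fun_eq_iff restrict_def)
    moreover have "(\<integral>\<^sup>+y. h ((\<lambda>j\<in>I. x j + a j)(i := y + a i)) \<partial>U01) = (\<integral>\<^sup>+y. h ((\<lambda>j\<in>I. x j + a j)(i := y)) \<partial>U01)"
    proof (rule nn_integral_U01_shift)
      show "(\<lambda>y. h ((\<lambda>j\<in>I. x j + a j)(i := y))) \<in> borel_measurable borel"
        by (rule measurable_compose[OF upd2 insert.prems(1)]) (auto simp: space_PiM)
      show "h ((\<lambda>j\<in>I. x j + a j)(i := y + 1)) = h ((\<lambda>j\<in>I. x j + a j)(i := y))" for y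
      proof -
        have "(\<lambda>j\<in>I. x j + a j)(i := y) \<in> extensional (insert i I)" by (auto simp: extensional_def)
        from insert.prems(2)[OF insertI1 this] show ?thesis by (simp only: fun_upd_same fun_upd_upd)
      qed
    qed
    ultimately show "(\<integral>\<^sup>+y. h (\<lambda>j\<in>insert i I. (x(i := y)) j + a j) \<partial>U01) = (\<integral>\<^sup>+y. h ((\<lambda>j\<in>I. x j + a j)(i := y)) \<partial>U01)"
      by simp
  qed
  also have "\<dots> = (\<integral>\<^sup>+y. (\<integral>\<^sup>+x. h ((\<lambda>j\<in>I. x j + a j)(i := y)) \<partial>(PiM I (\<lambda>_. U01))) \<partial>U01)"
    by (rule pair_sigma_finite.Fubini'[symmetric])
      (auto intro!: pair_sigma_finite.intro prob_space_imp_sigma_finite prob_space_U01 prob_space_PiM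
        measurable_compose[OF _ insert.prems(1)] measurable_fun_upd[where J = I])
  also have "\<dots> = (\<integral>\<^sup>+y. (\<integral>\<^sup>+x. h (x(i := y)) \<partial>(PiM I (\<lambda>_. U01))) \<partial>U01)"
  proof (rule nn_integral_cong)
    fix y
    show "(\<integral>\<^sup>+x. h ((\<lambda>j\<in>I. x j + a j)(i := y)) \<partial>(PiM I (\<lambda>_. U01))) = (\<integral>\<^sup>+x. h (x(i := y)) \<partial>(PiM I (\<lambda>_. U01)))"
    proof (rule insert.IH)
      show "(\<lambda>x. h (x(i := y))) \<in> borel_measurable (PiM I (\<lambda>_. borel))"
        by (rule measurable_compose[OF upd insert.prems(1)])
      fix x :: "nat \<Rightarrow> real" and j assume j: "j \<in> I" and x: "x \<in> extensional I"
      from x have x': "x(i := y) \<in> extensional (insert i I)" by (auto simp: extensional_def)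
      show "h ((x(j := x j + 1))(i := y)) = h (x(i := y))"
        using insert.prems(2)[OF insertI2[OF j] x'] j insert.hyps fun_upd_twist[of i j x y "x j + 1"]
        by (metis fun_upd_other)
    qed
  qed
  also have "\<dots> = (\<integral>\<^sup>+x. h x \<partial>(PiM (insert i I) (\<lambda>_. U01)))"
    by (rule cube_factors.product_nn_integral_insert_rev[symmetric]) (use insert in auto)
  finally show ?case .
qed

subsection \<open>Quadratic forms and Gaussian integrals\<close>

text \<open>Vectors are functions whose values from \<open>g\<close> on are ignored, so translates,
  blocks and coordinate updates are plain lambda terms without dimension side conditions. Over the
  complex numbers the form is bilinear, without conjugation.\<close>

definition bform :: "nat \<Rightarrow> 'a::comm_ring_1 mat \<Rightarrow> (nat \<Rightarrow> 'a) \<Rightarrow> (nat \<Rightarrow> 'a) \<Rightarrow> 'a" where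
  "bform g A x y = (\<Sum>i<g. \<Sum>j<g. x i * A $$ (i, j) * y j)"

lemma scalar_prod_mult_mat_vec:
  assumes "A \<in> carrier_mat g g" "v \<in> carrier_vec g" "w \<in> carrier_vec g"
  shows "scalar_prod v (A *\<^sub>v w) = bform g A (vec_index v) (vec_index w)"
  using assms
  by (auto simp: scalar_prod_def bform_def sum_distrib_left atLeast0LessThan mult.assoc intro!: sum.cong)

lemma bform_cong:
  "(\<And>i. i < g \<Longrightarrow> x i = x' i) \<Longrightarrow> (\<And>i. i < g \<Longrightarrow> y i = y' i) \<Longrightarrow> bform g A x y = bform g A x' y'"
  by (simp add: bform_def)

lemma bform_add_left: "bform g A (\<lambda>i. x i + x' i) y = bform g A x y + bform g A x' y"
  by (simp add: bform_def distrib_right sum.distrib)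

lemma bform_add_right: "bform g A x (\<lambda>i. y i + y' i) = bform g A x y + bform g A x y'"
  by (simp add: bform_def distrib_left sum.distrib)

lemma bform_sym:
  assumes "A \<in> carrier_mat g g" "transpose_mat A = A"
  shows "bform g A x y = bform g A y x"
proof -
  have "A $$ (i, j) = A $$ (j, i)" if "i < g" "j < g" for i j
    using assms that by (metis carrier_matD index_transpose_mat(1))
  then have "(\<Sum>i<g. \<Sum>j<g. x i * A $$ (i, j) * y j) = (\<Sum>i<g. \<Sum>j<g. y j * A $$ (j, i) * x i)"
    by (intro sum.cong refl) (simp add: mult_ac)
  then show ?thesis unfolding bform_def by (subst (asm) sum.swap) simp
qed

lemma sym_matD: "A \<in> carrier_mat g g \<Longrightarrow> transpose_mat A = A \<Longrightarrow> i < g \<Longrightarrow> j < g \<Longrightarrow> A $$ (i, j) = A $$ (j, i)"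
  by (metis carrier_matD index_transpose_mat(1))

lemma pos_def_mat_bform:
  assumes "pos_def_mat g A" "\<exists>i<g. x i \<noteq> 0"
  shows "bform g A x x > 0"
proof -
  have "Matrix.vec g x \<noteq> 0\<^sub>v g" using assms(2) by (metis index_vec index_zero_vec(1))
  then have "scalar_prod (Matrix.vec g x) (A *\<^sub>v Matrix.vec g x) > 0"
    using assms(1) by (auto simp: pos_def_mat_def)
  moreover have "bform g A (vec_index (Matrix.vec g x)) (vec_index (Matrix.vec g x)) = bform g A x x"
    by (rule bform_cong) auto
  ultimately show ?thesis
    using assms(1) scalar_prod_mult_mat_vec[of A g "Matrix.vec g x" "Matrix.vec g x"] by (simp add: pos_def_mat_def)
qed

lemma pos_def_matI_bform:
  assumes "A \<in> carrier_mat g g" "transpose_mat A = A" "\<And>x. \<exists>i<g. x i \<noteq> 0 \<Longrightarrow> bform g A x x > 0"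
  shows "pos_def_mat g A"
  unfolding pos_def_mat_def
proof (intro conjI ballI impI)
  fix x :: "real Matrix.vec" assume x: "x \<in> carrier_vec g" "x \<noteq> 0\<^sub>v g"
  then have "\<exists>i<g. vec_index x i \<noteq> 0" by (intro ccontr[of "\<exists>i<g. vec_index x i \<noteq> 0"]) (auto intro!: eq_vecI)
  then show "0 < scalar_prod x (A *\<^sub>v x)"
    using assms scalar_prod_mult_mat_vec[OF assms(1) x(1) x(1)] by simp
qed (use assms in auto)

text \<open>Completing the square in the last coordinate: \<open>a\<close> is the last diagonal
  entry and \<open>S\<close> its Schur complement, so that the quadratic form and the determinant
  split together. This drives positivity of the determinant, coercivity and the Gaussian
  integral.\<close>

lemma pos_def_mat_induct [consumes 1, case_names 0 Suc]:
  assumes "pos_def_mat g Y"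
    and "\<And>Y. pos_def_mat 0 Y \<Longrightarrow> Determinant.det Y = 1 \<Longrightarrow> P 0 Y"
    and "\<And>g Y a l S. pos_def_mat (Suc g) Y \<Longrightarrow> a > 0 \<Longrightarrow> pos_def_mat g S \<Longrightarrow> P g S \<Longrightarrow> Determinant.det Y = a * Determinant.det S \<Longrightarrow>
       (\<And>x. bform (Suc g) Y x x = a * (x g + (\<Sum>i<g. l i * x i))\<^sup>2 + bform g S x x) \<Longrightarrow> P (Suc g) Y"
  shows "P g Y"
  using assms(1)
proof (induction g arbitrary: Y)
  case 0
  then have "Determinant.det Y = 1" by (intro det_dim_zero) (simp add: pos_def_mat_def)
  with 0 show ?case by (rule assms(2))
next
  case (Suc g)
  have Y: "Y \<in> carrier_mat (Suc g) (Suc g)" "transpose_mat Y = Y" using Suc.prems by (auto simp: pos_def_mat_def)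
  note sym = sym_matD[OF Y]
  define a where "a = Y $$ (g, g)"
  define r where "r i = Y $$ (i, g)" for i
  define l where "l i = r i / a" for i
  define S where "S = Matrix.mat g g (\<lambda>(i, j). Y $$ (i, j) - r i * r j / a)"
  have a: "a > 0"
  proof -
    have "bform (Suc g) Y (\<lambda>i. if i = g then 1 else 0) (\<lambda>i. if i = g then 1 else 0) > 0"
      by (rule pos_def_mat_bform[OF Suc.prems]) auto
    also have "bform (Suc g) Y (\<lambda>i. if i = g then 1 else 0) (\<lambda>i. if i = g then 1 else 0) = a"
    proof -
      have "bform (Suc g) Y (\<lambda>i. if i = g then 1 else 0) (\<lambda>i. if i = g then 1 else 0) =
          (\<Sum>i<Suc g. \<Sum>j<Suc g. if j = g then (if i = g then a else 0) else 0)"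
        unfolding bform_def a_def by (intro sum.cong refl) auto
      then show ?thesis by (simp del: sum.lessThan_Suc)
    qed
    finally show ?thesis .
  qed
  have ident: "bform (Suc g) Y x x = a * (x g + (\<Sum>i<g. l i * x i))\<^sup>2 + bform g S x x" for x
  proof -
    define L where "L = (\<Sum>i<g. r i * x i)"
    have "bform (Suc g) Y x x = (\<Sum>i<g. \<Sum>j<g. x i * Y $$ (i, j) * x j) + L * x g + (\<Sum>j<g. x g * Y $$ (g, j) * x j) + x g * a * x g"
      by (simp add: bform_def sum.distrib L_def r_def a_def sum_distrib_right sum_distrib_left mult_ac)
    also have "(\<Sum>j<g. x g * Y $$ (g, j) * x j) = L * x g"
      using sym unfolding L_def r_def sum_distrib_right by (intro sum.cong) (auto simp: mult_ac)
    also have "(\<Sum>i<g. \<Sum>j<g. x i * Y $$ (i, j) * x j) = bform g S x x + L * L / a"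
    proof -
      have "L * L / a = (\<Sum>i<g. \<Sum>j<g. x i * (r i * r j / a) * x j)"
        unfolding L_def sum_product sum_divide_distrib by (simp add: mult_ac)
      then show ?thesis
        unfolding bform_def S_def sum.distrib[symmetric]
        by (simp add: sum.distrib[symmetric] left_diff_distrib right_diff_distrib)
    qed
    also have "bform g S x x + L * L / a + L * x g + L * x g + x g * a * x g = a * (x g + L / a)\<^sup>2 + bform g S x x"
      using a by (simp add: power2_eq_square field_simps)
    also have "L / a = (\<Sum>i<g. l i * x i)" by (simp add: l_def L_def sum_divide_distrib)
    finally show ?thesis .
  qed
  have pS: "pos_def_mat g S"
  proof (rule pos_def_matI_bform)
    show "transpose_mat S = S" using sym by (intro eq_matI) (auto simp: S_def)
    fix x :: "nat \<Rightarrow> real" assume x: "\<exists>i<g. x i \<noteq> 0"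
    \<comment> \<open>The last coordinate is chosen to make the completed square vanish.\<close>
    define x' where "x' = x(g := - (\<Sum>i<g. l i * x i))"
    have "bform (Suc g) Y x' x' > 0"
      by (rule pos_def_mat_bform[OF Suc.prems]) (use x in \<open>auto simp: x'_def\<close>)
    also have "bform (Suc g) Y x' x' = bform g S x x"
      unfolding ident by (simp add: x'_def) (rule bform_cong; simp)
    finally show "bform g S x x > 0" .
  qed (simp add: S_def)
  have "Determinant.det Y = a * Determinant.det S"
  proof -
    define D0 where "D0 = Matrix.mat g g (\<lambda>(i, j). Y $$ (i, j))"
    define R where "R = Matrix.mat g 1 (\<lambda>(i, j). r i)"
    define R' where "R' = Matrix.mat 1 g (\<lambda>(i, j). r j)"
    define A where "A = Matrix.mat 1 1 (\<lambda>(i, j). a)"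
    define V where "V = Matrix.mat 1 g (\<lambda>(i, j). - l j)"
    have carr: "D0 \<in> carrier_mat g g" "R \<in> carrier_mat g 1" "R' \<in> carrier_mat 1 g" "A \<in> carrier_mat 1 1" "V \<in> carrier_mat 1 g"
      "S \<in> carrier_mat g g"
      by (auto simp: D0_def R_def R'_def A_def V_def S_def)
    have YY: "Y = four_block_mat D0 R R' A"
      using Y(1) sym by (intro eq_matI) (auto simp: D0_def R_def R'_def A_def r_def a_def less_Suc_eq)
    \<comment> \<open>A unipotent column operation that clears the last row: \<open>Y * U\<close> is
      block triangular with diagonal blocks \<open>S\<close> and \<open>A\<close>.\<close>
    define U where "U = four_block_mat (1\<^sub>m g) (0\<^sub>m g 1) V (1\<^sub>m 1)"
    have U: "U \<in> carrier_mat (g + 1) (g + 1)" unfolding U_def by (rule four_block_carrier_mat) auto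
    have dU: "Determinant.det U = 1"
      unfolding U_def by (subst det_four_block_mat_upper_right_zero[OF _ refl]) (use carr in auto)
    have "Y * U = four_block_mat (D0 * 1\<^sub>m g + R * V) (D0 * 0\<^sub>m g 1 + R * 1\<^sub>m 1) (R' * 1\<^sub>m g + A * V) (R' * 0\<^sub>m g 1 + A * 1\<^sub>m 1)"
      unfolding YY U_def by (rule mult_four_block_mat) (use carr in auto)
    also have "D0 * 1\<^sub>m g + R * V = S"
      using carr by (intro eq_matI) (auto simp: D0_def R_def V_def S_def l_def scalar_prod_def)
    also have "D0 * 0\<^sub>m g 1 + R * 1\<^sub>m 1 = R" using carr by auto
    also have "R' * 1\<^sub>m g + A * V = 0\<^sub>m 1 g"
      using carr a by (intro eq_matI) (auto simp: R'_def A_def V_def l_def scalar_prod_def)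
    also have "R' * 0\<^sub>m g 1 + A * 1\<^sub>m 1 = A" using carr by auto
    finally have "Determinant.det (Y * U) = Determinant.det S * Determinant.det A"
      by (simp only: det_four_block_mat_lower_left_zero[OF carr(6) carr(2) refl carr(4)])
    moreover have "Determinant.det A = a" by (simp add: A_def det_single)
    moreover have "Determinant.det (Y * U) = Determinant.det Y * Determinant.det U"
      by (rule Determinant.det_mult) (use Y U in auto)
    ultimately show ?thesis using dU by simp
  qed
  then show ?case by (rule assms(3)[OF Suc.prems a pS Suc.IH[OF pS] _ ident])
qed

lemma pos_def_mat_det_pos: "pos_def_mat g Y \<Longrightarrow> Determinant.det Y > 0"
  by (induction rule: pos_def_mat_induct) auto

text \<open>Induction over the completed squares produces a constant directly. The last coordinate
  is recovered from x g + L, with the linear form L controlled by Cauchy-Schwarz.\<close>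

lemma pos_def_mat_coercive:
  "pos_def_mat g Y \<Longrightarrow> \<exists>c>0. \<forall>x. c * (\<Sum>i<g. (x i)\<^sup>2) \<le> bform g Y x x"
proof (induction rule: pos_def_mat_induct)
  case (0 Y)
  show ?case by (intro exI[of _ 1]) (simp add: bform_def)
next
  case (Suc g Y a l S)
  obtain c where c: "c > 0" "\<And>x. c * (\<Sum>i<g. (x i)\<^sup>2) \<le> bform g S x x" using Suc.IH by blast
  define R where "R = (\<Sum>i<g. (l i)\<^sup>2) + 1"
  have R: "R \<ge> 1" by (simp add: R_def sum_nonneg)
  \<comment> \<open>The first entry pays for 2 R + 1 copies of the earlier squares, the second for
    the factor 2 in (x g)^2 <= 2 (x g + L)^2 + 2 L^2.\<close>
  define c' where "c' = min (c / (2 * R + 1)) (a / 2)"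
  have c': "c' > 0" "c' * 2 \<le> a" using c Suc(2) R by (auto simp: c'_def min_def)
  have "c' \<le> c / (2 * R + 1)" by (simp add: c'_def)
  then have c'3: "c' * (2 * R + 1) \<le> c" using R by (simp add: pos_le_divide_eq)
  show ?case
  proof (intro exI conjI allI)
    fix x :: "nat \<Rightarrow> real"
    define N where "N = (\<Sum>i<g. (x i)\<^sup>2)"
    define L where "L = (\<Sum>i<g. l i * x i)"
    have N: "N \<ge> 0" by (simp add: N_def sum_nonneg)
    have "L\<^sup>2 \<le> (\<Sum>i<g. (l i)\<^sup>2) * N" unfolding L_def N_def by (rule Cauchy_Schwarz_ineq_sum)
    also have "\<dots> \<le> R * N" using N by (intro mult_right_mono) (auto simp: R_def)
    finally have L: "L\<^sup>2 \<le> R * N" .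
    have "(x g)\<^sup>2 \<le> 2 * (x g + L)\<^sup>2 + 2 * L\<^sup>2"
      using zero_le_power2[of "x g + 2 * L"] by (simp add: power2_eq_square algebra_simps)
    then have "c' * ((x g)\<^sup>2 + N) \<le> c' * (2 * (x g + L)\<^sup>2 + 2 * (R * N) + N)"
      using c' L by (intro mult_left_mono) auto
    also have "\<dots> = (c' * 2) * (x g + L)\<^sup>2 + (c' * (2 * R + 1)) * N" by (simp add: algebra_simps)
    also have "\<dots> \<le> a * (x g + L)\<^sup>2 + c * N"
      using c' c'3 N by (intro add_mono mult_right_mono) auto
    also have "\<dots> \<le> bform (Suc g) Y x x"
      unfolding Suc(5) using c(2)[of x] by (simp add: N_def L_def)
    finally show "c' * (\<Sum>i<Suc g. (x i)\<^sup>2) \<le> bform (Suc g) Y x x"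
      by (simp add: N_def add.commute)
  qed (rule c'(1))
qed

interpretation lborel_factors: product_sigma_finite "\<lambda>_::nat. lborel :: real measure"
  by standard

lemma nn_integral_gauss:
  assumes a: "a > 0"
  shows "(\<integral>\<^sup>+t. ennreal (exp (- 2 * pi * (a * (t + l)\<^sup>2))) \<partial>lborel) = ennreal (1 / sqrt (2 * a))"
proof -
  \<comment> \<open>Standard deviation of the normal density proportional to this Gaussian.\<close>
  define s where "s = sqrt (1 / (4 * pi * a))"
  have s: "s > 0" "s\<^sup>2 = 1 / (4 * pi * a)" using a by (auto simp: s_def)
  have "exp (- 2 * pi * (a * (t + l)\<^sup>2)) = sqrt (1 / (2 * a)) * normal_density (- l) s t" for t
  proof -
    have "normal_density (- l) s t = 1 / sqrt (1 / (2 * a)) * exp (- 2 * pi * (a * (t + l)\<^sup>2))"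
      unfolding normal_density_def s(2) using a by (simp add: field_simps)
    then show ?thesis using a by simp
  qed
  then have "(\<integral>\<^sup>+t. ennreal (exp (- 2 * pi * (a * (t + l)\<^sup>2))) \<partial>lborel) = (\<integral>\<^sup>+t. ennreal (sqrt (1 / (2 * a)) * normal_density (- l) s t) \<partial>lborel)"
    by simp
  also have "\<dots> = ennreal (\<integral>t. sqrt (1 / (2 * a)) * normal_density (- l) s t \<partial>lborel)"
    using a s by (intro nn_integral_eq_integral integrable_mult_right integrable_normal_density AE_I2) auto
  also have "\<dots> = ennreal (1 / sqrt (2 * a))"
    using integral_normal_density[OF s(1)] by (simp add: real_sqrt_divide)
  finally show ?thesis .
qed

lemma bform_measurable [measurable]:
  fixes A :: "real mat"
  assumes [measurable]: "\<And>i. i < g \<Longrightarrow> (\<lambda>w. x w i) \<in> borel_measurable M" "\<And>i. i < g \<Longrightarrow> (\<lambda>w. y w i) \<in> borel_measurable M"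
  shows "(\<lambda>w. bform g A (x w) (y w)) \<in> borel_measurable M"
  unfolding bform_def by measurable

text \<open>Integrating the last coordinate gives the factor (2 a)^(-1/2) whatever the others are,
  because the linear form only shifts the Gaussian; the determinant splits off the same
  \<open>a\<close>.\<close>

lemma nn_integral_gauss_bform:
  "pos_def_mat g Y \<Longrightarrow> (\<integral>\<^sup>+x. ennreal (exp (- 2 * pi * bform g Y x x)) \<partial>PiM {..<g} (\<lambda>_. lborel)) = ennreal (1 / sqrt (2 ^ g * Determinant.det Y))"
proof (induction rule: pos_def_mat_induct)
  case (0 Y)
  then show ?case by (simp add: PiM_empty nn_integral_count_space_finite bform_def)
next
  case (Suc g Y a l S)
  have ins: "{..<Suc g} = insert g {..<g}" by auto
  have comp [measurable]: "(\<lambda>x. x i) \<in> borel_measurable (PiM J (\<lambda>_. lborel :: real measure))" if "i \<in> J" for i :: nat and J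
    using measurable_component_singleton[OF that, of "\<lambda>_. lborel :: real measure"] by simp
  have m: "(\<lambda>x. ennreal (exp (- 2 * pi * bform h A x x))) \<in> borel_measurable (PiM J (\<lambda>_. lborel))" if "{..<h} \<subseteq> J" for h A and J
    using that by (intro measurable_compose[OF _ measurable_ennreal] borel_measurable_exp[THEN measurable_compose[rotated]] borel_measurable_times
        bform_measurable borel_measurable_const comp) auto
  have "(\<integral>\<^sup>+x. ennreal (exp (- 2 * pi * bform (Suc g) Y x x)) \<partial>PiM {..<Suc g} (\<lambda>_. lborel)) =
    (\<integral>\<^sup>+x. (\<integral>\<^sup>+t. ennreal (exp (- 2 * pi * bform (Suc g) Y (x(g := t)) (x(g := t)))) \<partial>lborel) \<partial>PiM {..<g} (\<lambda>_. lborel))"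
    unfolding ins by (rule lborel_factors.product_nn_integral_insert[OF _ _ m]) auto
  also have "\<dots> = (\<integral>\<^sup>+x. ennreal (exp (- 2 * pi * bform g S x x)) * ennreal (1 / sqrt (2 * a)) \<partial>PiM {..<g} (\<lambda>_. lborel))"
  proof (rule nn_integral_cong)
    fix x :: "nat \<Rightarrow> real"
    define L where "L = (\<Sum>i<g. l i * x i)"
    have "ennreal (exp (- 2 * pi * bform (Suc g) Y (x(g := t)) (x(g := t)))) =
        ennreal (exp (- 2 * pi * bform g S x x)) * ennreal (exp (- 2 * pi * (a * (t + L)\<^sup>2)))" for t
    proof -
      have "bform g S (x(g := t)) (x(g := t)) = bform g S x x" by (rule bform_cong) auto
      then have "bform (Suc g) Y (x(g := t)) (x(g := t)) = a * (t + L)\<^sup>2 + bform g S x x"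
        unfolding Suc(5) by (simp add: L_def)
      then show ?thesis by (simp add: ennreal_mult[symmetric] exp_add[symmetric] algebra_simps)
    qed
    then show "(\<integral>\<^sup>+t. ennreal (exp (- 2 * pi * bform (Suc g) Y (x(g := t)) (x(g := t)))) \<partial>lborel) =
        ennreal (exp (- 2 * pi * bform g S x x)) * ennreal (1 / sqrt (2 * a))"
      using nn_integral_gauss[OF Suc(2), of L] by (simp add: nn_integral_cmult)
  qed
  also have "\<dots> = ennreal (1 / sqrt (2 ^ g * Determinant.det S)) * ennreal (1 / sqrt (2 * a))"
    unfolding Suc.IH[symmetric] by (rule nn_integral_multc) (rule m, simp)
  also have "\<dots> = ennreal (1 / sqrt (2 ^ Suc g * Determinant.det Y))"
    using Suc(2) pos_def_mat_det_pos[OF Suc(3)] by (simp add: Suc(4) real_sqrt_mult mult_ac flip: ennreal_mult)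
  finally show ?case .
qed

text \<open>The integer translates of the unit interval tile the line up to endpoints. Sums are
  integrals over counting measure, so that exchanging them with integrals is Tonelli's
  theorem.\<close>

lemma nn_integral_U01_int_sum:
  fixes h :: "real \<Rightarrow> ennreal"
  assumes [measurable]: "h \<in> borel_measurable borel"
  shows "(\<integral>\<^sup>+m. (\<integral>\<^sup>+y. h (y + of_int m) \<partial>U01) \<partial>count_space UNIV) = (\<integral>\<^sup>+t. h t \<partial>lborel)"
proof -
  interpret C: sigma_finite_measure "count_space (UNIV :: int set)"
    by (rule sigma_finite_measure_count_space)
  have "(\<integral>\<^sup>+y. h (y + of_int m) \<partial>U01) = (\<integral>\<^sup>+t. h t * indicator {real_of_int m..<of_int m + 1} t \<partial>lborel)" for m :: int
  proof -
    have "(\<integral>\<^sup>+y. h (y + of_int m) \<partial>U01) = (\<integral>\<^sup>+y. h (y + of_int m) * indicator {0..1} y \<partial>lborel)"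
      by (rule nn_integral_U01) measurable
    also have "\<dots> = (\<integral>\<^sup>+t. h t * indicator {real_of_int m..of_int m + 1} t \<partial>lborel)"
      by (subst (2) nn_integral_real_affine[where c = 1 and t = "of_int m"])
        (auto intro!: nn_integral_cong simp: add.commute split: split_indicator)
    also have "\<dots> = (\<integral>\<^sup>+t. h t * indicator {real_of_int m..<of_int m + 1} t \<partial>lborel)"
      by (intro nn_integral_cong_AE eventually_mono[OF AE_lborel_singleton[of "of_int m + 1"]])
        (auto split: split_indicator)
    finally show ?thesis .
  qed
  then have "(\<integral>\<^sup>+m. (\<integral>\<^sup>+y. h (y + of_int m) \<partial>U01) \<partial>count_space UNIV) =
      (\<integral>\<^sup>+m. (\<integral>\<^sup>+t. h t * indicator {real_of_int m..<of_int m + 1} t \<partial>lborel) \<partial>count_space UNIV)" by simp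
  also have "\<dots> = (\<integral>\<^sup>+t. (\<integral>\<^sup>+m. h t * indicator {real_of_int m..<of_int m + 1} t \<partial>count_space UNIV) \<partial>lborel)"
  proof (rule pair_sigma_finite.Fubini')
    show "pair_sigma_finite lborel (count_space (UNIV :: int set))" ..
    show "(\<lambda>(t, m). h t * indicator {real_of_int m..<of_int m + 1} t) \<in> borel_measurable (lborel \<Otimes>\<^sub>M count_space UNIV)"
    proof (subst measurable_pair_swap_iff, rule measurable_pair_measure_countable1)
      fix m :: int
      have "(\<lambda>t. h t * indicator {real_of_int m..<of_int m + 1} t) \<in> borel_measurable lborel" by measurable
      then show "(\<lambda>y. (\<lambda>(x, y). (\<lambda>(t, m). h t * indicator {real_of_int m..<of_int m + 1} t) (y, x)) (m, y)) \<in> borel_measurable lborel" by simp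
    qed simp
  qed
  also have "\<dots> = (\<integral>\<^sup>+t. h t \<partial>lborel)"
  proof (rule nn_integral_cong)
    fix t :: real
    have "indicator {real_of_int m..<of_int m + 1} t = (indicator {\<lfloor>t\<rfloor>} m :: ennreal)" for m
    proof -
      have "t \<in> {real_of_int m..<of_int m + 1} \<longleftrightarrow> m \<in> {\<lfloor>t\<rfloor>}" by (auto simp: floor_eq_iff[symmetric])
      then show ?thesis by (simp only: indicator_def)
    qed
    then show "(\<integral>\<^sup>+m. h t * indicator {real_of_int m..<of_int m + 1} t \<partial>count_space UNIV) = h t"
      by (simp add: nn_integral_cmult_indicator)
  qed
  finally show ?thesis .
qed

text \<open>Unfolding in several variables. The induction splits off one coordinate, and the
  exchanges of order bring the sum over its integer part next to the integral over its unit
  interval.\<close>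

lemma nn_integral_PiM_int_sum:
  fixes h :: "(nat \<Rightarrow> real) \<Rightarrow> ennreal"
  assumes "finite I" "h \<in> borel_measurable (PiM I (\<lambda>_. borel))"
  shows "(\<integral>\<^sup>+f. (\<integral>\<^sup>+x. h (\<lambda>i\<in>I. x i + of_int (f i)) \<partial>PiM I (\<lambda>_. U01)) \<partial>count_space (PiE I (\<lambda>_. UNIV :: int set)))
    = (\<integral>\<^sup>+x. h x \<partial>PiM I (\<lambda>_. lborel))"
  using assms
proof (induction I arbitrary: h rule: finite_induct)
  case empty
  show ?case by (simp add: PiM_empty nn_integral_count_space_finite restrict_def)
next
  case (insert i I)
  interpret C: product_sigma_finite "\<lambda>_::nat. count_space (UNIV :: int set)"
    by (rule product_sigma_finite.intro) (rule sigma_finite_measure_count_space)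
  have cnt: "count_space (PiE J (\<lambda>_. UNIV :: int set)) = PiM J (\<lambda>_. count_space UNIV)" if "finite J" for J :: "nat set"
    using that by (intro count_space_PiM_finite[symmetric]) auto
  have ctb: "countable (PiE J (\<lambda>_. UNIV :: int set))" if "finite J" for J :: "nat set"
    using that by (intro countable_PiE) auto
  have sU: "sets (PiM J (\<lambda>_. U01)) = sets (PiM J (\<lambda>_. borel))" for J :: "nat set"
    by (intro sets_PiM_cong) auto
  have sL: "sets (PiM J (\<lambda>_. lborel)) = sets (PiM J (\<lambda>_. borel :: real measure))" for J :: "nat set"
    by (intro sets_PiM_cong) auto
  note hm = insert.prems
  have upd: "(\<lambda>x. x(i := y)) \<in> PiM I (\<lambda>_. borel) \<rightarrow>\<^sub>M PiM (insert i I) (\<lambda>_. borel)" for y :: real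
    by (rule measurable_fun_upd[where J = I]) auto
  have upd2: "(\<lambda>y. (restrict x I)(i := y)) \<in> borel \<rightarrow>\<^sub>M PiM (insert i I) (\<lambda>_. borel)" for x :: "nat \<Rightarrow> real"
    by (rule measurable_component_update) (use insert in \<open>auto simp: space_PiM\<close>)
  have fI [simp]: "finite (insert i I)" "finite I" using insert by auto
  have addm: "(\<lambda>x. \<lambda>j\<in>J. x j + of_int (f j)) \<in> PiM J (\<lambda>_. borel) \<rightarrow>\<^sub>M PiM J (\<lambda>_. borel :: real measure)" for J :: "nat set" and f :: "nat \<Rightarrow> int"
    by (rule measurable_restrict) measurable
  let ?s = "\<lambda>f x. \<lambda>j\<in>I. x j + real_of_int (f j)"
  have "(\<integral>\<^sup>+f. (\<integral>\<^sup>+x. h (\<lambda>j\<in>insert i I. x j + of_int (f j)) \<partial>PiM (insert i I) (\<lambda>_. U01)) \<partial>count_space (PiE (insert i I) (\<lambda>_. UNIV :: int set)))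
    = (\<integral>\<^sup>+f. (\<integral>\<^sup>+m. (\<integral>\<^sup>+x. h (\<lambda>j\<in>insert i I. x j + of_int ((f(i := m)) j)) \<partial>PiM (insert i I) (\<lambda>_. U01)) \<partial>count_space UNIV) \<partial>count_space (PiE I (\<lambda>_. UNIV)))"
    unfolding cnt[OF fI(1)] cnt[OF fI(2)]
    by (rule C.product_nn_integral_insert) (use insert in \<open>auto simp: cnt[OF fI(1), symmetric]\<close>)
  also have "\<dots> = (\<integral>\<^sup>+f. (\<integral>\<^sup>+m. (\<integral>\<^sup>+x. (\<integral>\<^sup>+y. h ((?s f x)(i := y + of_int m)) \<partial>U01) \<partial>PiM I (\<lambda>_. U01)) \<partial>count_space UNIV) \<partial>count_space (PiE I (\<lambda>_. UNIV)))"
  proof (intro nn_integral_cong)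
    fix f :: "nat \<Rightarrow> int" and m :: int
    have "(\<lambda>j\<in>insert i I. (x(i := y)) j + of_int ((f(i := m)) j)) = (?s f x)(i := y + of_int m)" for x :: "nat \<Rightarrow> real" and y
      using insert by (auto simp: fun_eq_iff restrict_def)
    then show "(\<integral>\<^sup>+x. h (\<lambda>j\<in>insert i I. x j + of_int ((f(i := m)) j)) \<partial>PiM (insert i I) (\<lambda>_. U01)) =
        (\<integral>\<^sup>+x. (\<integral>\<^sup>+y. h ((?s f x)(i := y + of_int m)) \<partial>U01) \<partial>PiM I (\<lambda>_. U01))"
      by (subst cube_factors.product_nn_integral_insert)
        (use insert in \<open>auto simp: measurable_cong_sets[OF sU refl] intro!: measurable_compose[OF addm hm]\<close>)
  qed
  also have "\<dots> = (\<integral>\<^sup>+f. (\<integral>\<^sup>+x. (\<integral>\<^sup>+m. (\<integral>\<^sup>+y. h ((?s f x)(i := y + of_int m)) \<partial>U01) \<partial>count_space UNIV) \<partial>PiM I (\<lambda>_. U01)) \<partial>count_space (PiE I (\<lambda>_. UNIV)))"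
  proof (intro nn_integral_cong pair_sigma_finite.Fubini')
    fix f :: "nat \<Rightarrow> int"
    show "pair_sigma_finite (PiM I (\<lambda>_. U01)) (count_space (UNIV :: int set))"
      by (intro pair_sigma_finite.intro prob_space_imp_sigma_finite prob_space_PiM prob_space_U01 sigma_finite_measure_count_space)
    show "(\<lambda>(x, m). \<integral>\<^sup>+y. h ((?s f x)(i := y + of_int m)) \<partial>U01) \<in> borel_measurable (PiM I (\<lambda>_. U01) \<Otimes>\<^sub>M count_space UNIV)"
    proof (subst measurable_pair_swap_iff, rule measurable_pair_measure_countable1)
      fix m :: int
      have "(\<lambda>(x, y). (\<lambda>j\<in>I. x j + of_int (f j))(i := y + of_int m)) \<in> PiM I (\<lambda>_. borel) \<Otimes>\<^sub>M borel \<rightarrow>\<^sub>M PiM (insert i I) (\<lambda>_. borel :: real measure)"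
        unfolding case_prod_beta
        by (rule measurable_fun_upd[where J = I]) (auto intro!: measurable_compose[OF measurable_fst addm])
      from measurable_compose[OF this hm]
      have "(\<lambda>(x, y). h ((?s f x)(i := y + of_int m))) \<in> borel_measurable (PiM I (\<lambda>_. U01) \<Otimes>\<^sub>M U01)"
        unfolding measurable_cong_sets[OF sets_pair_measure_cong[OF sU sets_U01] refl] by (simp only: case_prod_unfold)
      from U01.borel_measurable_nn_integral[OF this]
      show "(\<lambda>y. (\<lambda>(x, y). (\<lambda>(x, m). \<integral>\<^sup>+y. h ((?s f x)(i := y + of_int m)) \<partial>U01) (y, x)) (m, y)) \<in> borel_measurable (PiM I (\<lambda>_. U01))"
        by simp
    qed simp
  qed
  also have "\<dots> = (\<integral>\<^sup>+f. (\<integral>\<^sup>+x. (\<integral>\<^sup>+t. h ((?s f x)(i := t)) \<partial>lborel) \<partial>PiM I (\<lambda>_. U01)) \<partial>count_space (PiE I (\<lambda>_. UNIV)))"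
    by (intro nn_integral_cong nn_integral_U01_int_sum measurable_compose[OF upd2 hm])
  also have "\<dots> = (\<integral>\<^sup>+f. (\<integral>\<^sup>+t. (\<integral>\<^sup>+x. h ((?s f x)(i := t)) \<partial>PiM I (\<lambda>_. U01)) \<partial>lborel) \<partial>count_space (PiE I (\<lambda>_. UNIV)))"
  proof (intro nn_integral_cong pair_sigma_finite.Fubini'[symmetric])
    fix f :: "nat \<Rightarrow> int"
    show "pair_sigma_finite (PiM I (\<lambda>_. U01)) lborel"
      by (intro pair_sigma_finite.intro prob_space_imp_sigma_finite prob_space_PiM prob_space_U01 sigma_finite_lborel)
    have "(\<lambda>(x, y). (\<lambda>j\<in>I. x j + of_int (f j))(i := y)) \<in> PiM I (\<lambda>_. borel) \<Otimes>\<^sub>M borel \<rightarrow>\<^sub>M PiM (insert i I) (\<lambda>_. borel :: real measure)"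
      unfolding case_prod_beta
      by (rule measurable_fun_upd[where J = I]) (auto intro!: measurable_compose[OF measurable_fst addm])
    from measurable_compose[OF this hm]
    show "(\<lambda>(x, t). h ((?s f x)(i := t))) \<in> borel_measurable (PiM I (\<lambda>_. U01) \<Otimes>\<^sub>M lborel)"
      unfolding measurable_cong_sets[OF sets_pair_measure_cong[OF sU sets_lborel] refl] by (simp only: case_prod_unfold)
  qed
  also have "\<dots> = (\<integral>\<^sup>+t. (\<integral>\<^sup>+f. (\<integral>\<^sup>+x. h ((?s f x)(i := t)) \<partial>PiM I (\<lambda>_. U01)) \<partial>count_space (PiE I (\<lambda>_. UNIV))) \<partial>lborel)"
  proof (rule pair_sigma_finite.Fubini')
    show "pair_sigma_finite lborel (count_space (PiE I (\<lambda>_. UNIV :: int set)))"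
      by (intro pair_sigma_finite.intro sigma_finite_lborel sigma_finite_measure_count_space_countable ctb fI)
    show "(\<lambda>(t, f). \<integral>\<^sup>+x. h ((?s f x)(i := t)) \<partial>PiM I (\<lambda>_. U01)) \<in> borel_measurable (lborel \<Otimes>\<^sub>M count_space (PiE I (\<lambda>_. UNIV)))"
    proof (subst measurable_pair_swap_iff, rule measurable_pair_measure_countable1[OF ctb[OF fI(2)]])
      fix f :: "nat \<Rightarrow> int"
      interpret PU: prob_space "PiM I (\<lambda>_. U01)" by (rule prob_space_PiM) (rule prob_space_U01)
      have "(\<lambda>(y, x). (\<lambda>j\<in>I. x j + of_int (f j))(i := y)) \<in> borel \<Otimes>\<^sub>M PiM I (\<lambda>_. borel) \<rightarrow>\<^sub>M PiM (insert i I) (\<lambda>_. borel :: real measure)"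
        unfolding case_prod_beta
        by (rule measurable_fun_upd[where J = I]) (auto intro!: measurable_compose[OF measurable_snd addm])
      from measurable_compose[OF this hm]
      have "(\<lambda>(t, x). h ((?s f x)(i := t))) \<in> borel_measurable (lborel \<Otimes>\<^sub>M PiM I (\<lambda>_. U01))"
        unfolding measurable_cong_sets[OF sets_pair_measure_cong[OF sets_lborel sU] refl] by (simp only: case_prod_unfold)
      from PU.borel_measurable_nn_integral[OF this]
      show "(\<lambda>y. (\<lambda>(x, y). (\<lambda>(t, f). \<integral>\<^sup>+x. h ((?s f x)(i := t)) \<partial>PiM I (\<lambda>_. U01)) (y, x)) (f, y)) \<in> borel_measurable lborel"
        by simp
    qed
  qed
  also have "\<dots> = (\<integral>\<^sup>+t. (\<integral>\<^sup>+x. h (x(i := t)) \<partial>PiM I (\<lambda>_. lborel)) \<partial>lborel)"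
    by (intro nn_integral_cong insert.IH measurable_compose[OF upd hm])
  also have "\<dots> = (\<integral>\<^sup>+x. h x \<partial>PiM (insert i I) (\<lambda>_. lborel))"
    by (rule lborel_factors.product_nn_integral_insert_rev[symmetric])
      (use insert hm in \<open>auto simp: measurable_cong_sets[OF sL refl]\<close>)
  finally show ?case .
qed

subsection \<open>Fourier series with Gaussian coefficients\<close>

abbreviation nsq :: "nat \<Rightarrow> int Matrix.vec \<Rightarrow> real" where
  "nsq g n \<equiv> (\<Sum>i<g. (real_of_int (vec_index n i))\<^sup>2)"

text \<open>Both constants are parameters because all later estimates must be uniform over the
  series that share them.\<close>

definition gauss_bounded :: "nat \<Rightarrow> real \<Rightarrow> real \<Rightarrow> (int Matrix.vec \<Rightarrow> complex) \<Rightarrow> bool" where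
  "gauss_bounded g C c b \<longleftrightarrow> (\<forall>n\<in>int_vecs g. norm (b n) \<le> C * exp (- c * nsq g n))"

definition fourier_char :: "nat \<Rightarrow> int Matrix.vec \<Rightarrow> (nat \<Rightarrow> complex) \<Rightarrow> complex" where
  "fourier_char g n z = exp (2 * pi * \<i> * (\<Sum>i<g. of_int (vec_index n i) * z i))"

text \<open>A Bochner integral over counting measure, so that dominated convergence, Fubini and the
  measurability of parameter integrals apply to it; \<open>infsum_eq_fourier_series\<close> links it
  to the unordered sum.\<close>

definition fourier_series :: "nat \<Rightarrow> (int Matrix.vec \<Rightarrow> complex) \<Rightarrow> (nat \<Rightarrow> complex) \<Rightarrow> complex" where
  "fourier_series g b z = (\<integral>n. b n * fourier_char g n z \<partial>count_space (int_vecs g))"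

abbreviation cpx :: "(nat \<Rightarrow> real) \<Rightarrow> nat \<Rightarrow> complex" where
  "cpx x \<equiv> \<lambda>i. complex_of_real (x i)"

lemma bij_betw_int_vecs:
  "bij_betw (\<lambda>f. Matrix.vec g f) (PiE {..<g} (\<lambda>_. UNIV)) (int_vecs g)"
proof (rule bij_betwI[where g = "\<lambda>v. \<lambda>i\<in>{..<g}. vec_index v i"])
  show "(\<lambda>i\<in>{..<g}. vec_index (Matrix.vec g f) i) = f" if "f \<in> PiE {..<g} (\<lambda>_. UNIV)" for f :: "nat \<Rightarrow> int"
    using that by (auto simp: fun_eq_iff PiE_def extensional_def)
  show "Matrix.vec g (restrict (vec_index v) {..<g}) = v" if "v \<in> int_vecs g" for v
    using that by (auto simp: int_vecs_def)
qed (auto simp: int_vecs_def)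

lemma countable_int_vecs [simp]: "countable (int_vecs g)"
proof -
  have "countable (PiE {..<g} (\<lambda>_. UNIV :: int set))" by (rule countable_PiE) auto
  then have "countable ((\<lambda>f. Matrix.vec g f) ` PiE {..<g} (\<lambda>_. UNIV :: int set))" by (rule countable_image)
  then show ?thesis using bij_betw_imp_surj_on[OF bij_betw_int_vecs[of g]] by simp
qed

interpretation int_vecs: sigma_finite_measure "count_space (int_vecs g)" for g
  by (rule sigma_finite_measure_count_space_countable) simp

interpretation cube: prob_space "unit_cube g" for g
  by (rule prob_space_unit_cube)

lemma int_vecs_eqI:
  "m \<in> int_vecs g \<Longrightarrow> n \<in> int_vecs g \<Longrightarrow> (\<And>i. i < g \<Longrightarrow> vec_index m i = vec_index n i) \<Longrightarrow> m = n"
  unfolding int_vecs_def by (intro eq_vecI) auto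

lemma zero_int_vecs [simp]: "0\<^sub>v g \<in> int_vecs g"
  by (simp add: int_vecs_def)

text \<open>The weight is a product over the coordinates, so summability reduces to one series over
  the integers and, by symmetry, to one over the naturals.\<close>

lemma integrable_gauss_weight:
  assumes c: "c > 0"
  shows "integrable (count_space (int_vecs g)) (\<lambda>n. exp (- c * nsq g n))"
proof -
  define h where "h m = exp (- c * (real_of_int m)\<^sup>2)" for m :: int
  have nat: "Infinite_Set_Sum.abs_summable_on (\<lambda>n::nat. exp (- c * (real n)\<^sup>2)) UNIV"
  proof -
    have "summable (\<lambda>n. exp (- c * (real n)\<^sup>2))"
    proof (rule summable_comparison_test_bigo)
      show "summable (\<lambda>n. norm (1 / real n ^ 2))"
        using inverse_power_summable[of 2, where 'a = real] by (simp add: field_simps)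
      show "(\<lambda>n. exp (- c * (real n)\<^sup>2)) \<in> O(\<lambda>n. 1 / real n ^ 2)"
        using c by real_asymp
    qed
    then show ?thesis by (simp add: abs_summable_on_nat_iff')
  qed
  have "Infinite_Set_Sum.abs_summable_on h (range int)" "Infinite_Set_Sum.abs_summable_on h (range (\<lambda>n. - int n))"
    using nat by (intro abs_summable_on_reindex; simp add: h_def)+
  then have "Infinite_Set_Sum.abs_summable_on h (range int \<union> range (\<lambda>n. - int n))" by (rule abs_summable_on_union)
  also have "range int \<union> range (\<lambda>n. - int n) = (UNIV :: int set)"
  proof (intro UNIV_eq_I[symmetric])
    fix m :: int
    show "m \<in> range int \<union> range (\<lambda>n. - int n)" by (cases m rule: int_cases2) auto
  qed
  finally have "Infinite_Set_Sum.abs_summable_on (\<lambda>f. \<Prod>i<g. h (f i)) (PiE {..<g} (\<lambda>_. UNIV))"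
    by (intro abs_summable_on_prod_PiE) auto
  also have "?this \<longleftrightarrow> Infinite_Set_Sum.abs_summable_on (\<lambda>f. exp (- c * nsq g (Matrix.vec g f))) (PiE {..<g} (\<lambda>_. UNIV))"
    by (intro abs_summable_on_cong) (auto simp: h_def exp_sum sum_distrib_left)
  also have "\<dots> \<longleftrightarrow> Infinite_Set_Sum.abs_summable_on (\<lambda>n. exp (- c * nsq g n)) (int_vecs g)"
    by (rule abs_summable_on_reindex_bij_betw[OF bij_betw_int_vecs])
  finally show ?thesis by (simp add: abs_summable_on_def)
qed

definition gauss_mass :: "nat \<Rightarrow> real \<Rightarrow> real" where
  "gauss_mass g c = (\<integral>n. exp (- c * nsq g n) \<partial>count_space (int_vecs g))"

lemma norm_fourier_char:
  "norm (fourier_char g n z) = exp (- 2 * pi * (\<Sum>i<g. of_int (vec_index n i) * Im (z i)))"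
  by (simp add: fourier_char_def)

lemma norm_fourier_char_cpx [simp]: "norm (fourier_char g n (cpx x)) = 1"
  by (simp add: norm_fourier_char)

text \<open>Half of the Gaussian weight absorbs the linear exponent, by completing the square in
  each coordinate.\<close>

lemma exp_linear_le_gauss:
  fixes c K :: real
  assumes c: "c > 0" and K: "\<And>i. i < g \<Longrightarrow> \<bar>t i\<bar> \<le> K"
  shows "exp (- c * nsq g n + (\<Sum>i<g. of_int (vec_index n i) * t i))
    \<le> exp (real g * (K\<^sup>2 / (2 * c))) * exp (- (c / 2) * nsq g n)"
proof -
  have "real_of_int (vec_index n i) * t i \<le> K\<^sup>2 / (2 * c) + (c / 2) * (real_of_int (vec_index n i))\<^sup>2" if "i < g" for i
  proof -
    define x where "x = real_of_int (vec_index n i)"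
    have "x * t i \<le> \<bar>x\<bar> * K" 
      by (rule order_trans[OF abs_ge_self]) (use K[OF that] in \<open>auto simp: abs_mult intro!: mult_left_mono\<close>)
    moreover have "0 \<le> (c * \<bar>x\<bar> - K)\<^sup>2" by simp
    then have "2 * c * (\<bar>x\<bar> * K) \<le> c\<^sup>2 * x\<^sup>2 + K\<^sup>2"
      by (simp add: power2_diff power_mult_distrib mult_ac)
    then have "\<bar>x\<bar> * K \<le> K\<^sup>2 / (2 * c) + (c / 2) * x\<^sup>2"
      using c by (simp add: field_simps power2_eq_square)
    ultimately show ?thesis by (simp add: x_def)
  qed
  then have "(\<Sum>i<g. real_of_int (vec_index n i) * t i) \<le> (\<Sum>i<g. K\<^sup>2 / (2 * c) + (c / 2) * (real_of_int (vec_index n i))\<^sup>2)"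
    by (intro sum_mono) auto
  also have "\<dots> = real g * (K\<^sup>2 / (2 * c)) + (c / 2) * nsq g n"
    by (simp add: sum.distrib sum_distrib_left)
  finally show ?thesis
    by (simp add: algebra_simps flip: exp_add)
qed

lemma gauss_boundedD: "gauss_bounded g C c b \<Longrightarrow> n \<in> int_vecs g \<Longrightarrow> norm (b n) \<le> C * exp (- c * nsq g n)"
  by (simp add: gauss_bounded_def)

lemma gauss_bounded_nonneg: "gauss_bounded g C c b \<Longrightarrow> 0 \<le> C"
  using order_trans[OF norm_ge_zero gauss_boundedD[of g C c b "0\<^sub>v g"]] by (simp add: zero_le_mult_iff)

lemma fourier_term_le:
  assumes b: "gauss_bounded g C c b" and c: "c > 0" and n: "n \<in> int_vecs g"
    and K: "\<And>i. i < g \<Longrightarrow> \<bar>Im (z i)\<bar> \<le> K"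
  shows "norm (b n * fourier_char g n z) \<le> C * exp (real g * ((2 * pi * K)\<^sup>2 / (2 * c))) * exp (- (c / 2) * nsq g n)"
proof -
  have "norm (b n * fourier_char g n z) \<le> C * exp (- c * nsq g n) * norm (fourier_char g n z)"
    unfolding norm_mult by (intro mult_right_mono gauss_boundedD[OF b n]) auto
  also have "\<dots> = C * exp (- c * nsq g n + (\<Sum>i<g. of_int (vec_index n i) * (- 2 * pi * Im (z i))))"
    by (simp add: norm_fourier_char sum_negf sum_distrib_left mult_ac flip: exp_add)
  also have "\<dots> \<le> C * (exp (real g * ((2 * pi * K)\<^sup>2 / (2 * c))) * exp (- (c / 2) * nsq g n))"
    by (intro mult_left_mono exp_linear_le_gauss c gauss_bounded_nonneg[OF b]) (use K in \<open>auto simp: abs_mult\<close>)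
  finally show ?thesis by (simp add: mult_ac)
qed

lemma ex_Im_bound: "\<exists>K\<ge>0. \<forall>i<g. \<bar>Im (z i)\<bar> \<le> K" for z :: "nat \<Rightarrow> complex"
proof (intro exI conjI allI impI)
  show "\<bar>Im (z i)\<bar> \<le> (\<Sum>i<g. \<bar>Im (z i)\<bar>)" if "i < g" for i
    by (rule member_le_sum) (use that in auto)
qed (auto intro: sum_nonneg)

lemma integrable_fourier_terms:
  assumes b: "gauss_bounded g C c b" and c: "c > 0"
  shows "integrable (count_space (int_vecs g)) (\<lambda>n. b n * fourier_char g n z)"
proof -
  obtain K where "K \<ge> 0" and K: "\<And>i. i < g \<Longrightarrow> \<bar>Im (z i)\<bar> \<le> K" using ex_Im_bound by blast
  define D where "D = C * exp (real g * ((2 * pi * K)\<^sup>2 / (2 * c)))"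
  show ?thesis
  proof (rule Bochner_Integration.integrable_bound)
    show "integrable (count_space (int_vecs g)) (\<lambda>n. D * exp (- (c / 2) * nsq g n))"
      using integrable_gauss_weight[of "c/2" g] c by (intro integrable_mult_right) auto
    show "AE n in count_space (int_vecs g). norm (b n * fourier_char g n z) \<le> norm (D * exp (- (c / 2) * nsq g n))"
      unfolding AE_count_space D_def
      using order_trans[OF fourier_term_le[OF b c _ K] abs_ge_self] by auto
  qed simp
qed

lemma infsum_eq_fourier_series:
  assumes "gauss_bounded g C c b" "c > 0"
  shows "(\<Sum>\<^sub>\<infinity>n\<in>int_vecs g. b n * fourier_char g n z) = fourier_series g b z"
  using infsetsum_infsum[of "\<lambda>n. b n * fourier_char g n z" "int_vecs g"] integrable_fourier_terms[OF assms, of z]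
  by (simp add: abs_summable_on_def infsetsum_def fourier_series_def)

lemma norm_fourier_series_le:
  assumes b: "gauss_bounded g C c b" and c: "c > 0"
    and K: "\<And>i. i < g \<Longrightarrow> \<bar>Im (z i)\<bar> \<le> K"
  shows "norm (fourier_series g b z) \<le> C * exp (real g * ((2 * pi * K)\<^sup>2 / (2 * c))) * gauss_mass g (c / 2)"
proof -
  have "norm (fourier_series g b z) \<le> (\<integral>n. norm (b n * fourier_char g n z) \<partial>count_space (int_vecs g))"
    unfolding fourier_series_def by (rule integral_norm_bound)
  also have "\<dots> \<le> (\<integral>n. C * exp (real g * ((2 * pi * K)\<^sup>2 / (2 * c))) * exp (- (c / 2) * nsq g n) \<partial>count_space (int_vecs g))"
    using integrable_gauss_weight[of "c/2" g] integrable_fourier_terms[OF b c, of z] c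
    by (intro integral_mono fourier_term_le[OF b c _ K] integrable_norm integrable_mult_right) auto
  finally show ?thesis by (simp add: gauss_mass_def)
qed

lemma fourier_series_measurable [measurable]:
  assumes [measurable]: "\<And>i. i < g \<Longrightarrow> (\<lambda>w. z w i) \<in> borel_measurable M"
  shows "(\<lambda>w. fourier_series g b (z w)) \<in> borel_measurable M"
proof -
  have "(\<lambda>(w, n). b n * fourier_char g n (z w)) \<in> borel_measurable (M \<Otimes>\<^sub>M count_space (int_vecs g))"
  proof (subst measurable_pair_swap_iff, rule measurable_pair_measure_countable1)
    fix n
    have "(\<lambda>w. b n * exp (2 * pi * \<i> * (\<Sum>i<g. of_int (vec_index n i) * z w i))) \<in> borel_measurable M"
      by (auto intro!: borel_measurable_times borel_measurable_exp borel_measurable_sum)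
    then show "(\<lambda>y. (\<lambda>(x, y). (\<lambda>(w, n). b n * fourier_char g n (z w)) (y, x)) (n, y)) \<in> borel_measurable M"
      unfolding fourier_char_def by simp
  qed simp
  from int_vecs.borel_measurable_lebesgue_integral[OF this] show ?thesis
    unfolding fourier_series_def by simp
qed

lemma fourier_series_tendsto:
  assumes b: "\<And>k. gauss_bounded g C c (b k)" and c: "c > 0"
    and K: "\<And>k i. i < g \<Longrightarrow> \<bar>Im (z k i)\<bar> \<le> K"
    and lim_b: "\<And>n. n \<in> int_vecs g \<Longrightarrow> (\<lambda>k. b k n) \<longlonglongrightarrow> b' n"
    and lim_z: "\<And>i. i < g \<Longrightarrow> (\<lambda>k. z k i) \<longlonglongrightarrow> z' i"
  shows "(\<lambda>k. fourier_series g (b k) (z k)) \<longlonglongrightarrow> fourier_series g b' z'"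
  unfolding fourier_series_def
proof (rule integral_dominated_convergence)
  show "integrable (count_space (int_vecs g)) (\<lambda>n. C * exp (real g * ((2 * pi * K)\<^sup>2 / (2 * c))) * exp (- (c / 2) * nsq g n))"
    using integrable_gauss_weight[of "c/2" g] c by auto
  show "AE n in count_space (int_vecs g). (\<lambda>k. b k n * fourier_char g n (z k)) \<longlonglongrightarrow> b' n * fourier_char g n z'"
    unfolding fourier_char_def by (auto simp: AE_count_space intro!: tendsto_intros lim_b lim_z)
  show "AE n in count_space (int_vecs g). norm (b k n * fourier_char g n (z k)) \<le>
      C * exp (real g * ((2 * pi * K)\<^sup>2 / (2 * c))) * exp (- (c / 2) * nsq g n)" for k
    using fourier_term_le[OF b c _ K] by (auto simp: AE_count_space)
qed auto

lemma gauss_bounded_limit: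
  assumes b: "\<And>k. gauss_bounded g C c (b k)" and lim: "\<And>n. n \<in> int_vecs g \<Longrightarrow> (\<lambda>k. b k n) \<longlonglongrightarrow> b' n"
  shows "gauss_bounded g C c b'"
  unfolding gauss_bounded_def
proof
  fix n assume n: "n \<in> int_vecs g"
  show "norm (b' n) \<le> C * exp (- c * nsq g n)"
    by (rule LIMSEQ_le_const2[OF tendsto_norm[OF lim[OF n]]]) (use gauss_boundedD[OF b n] in auto)
qed

text \<open>On a disc of the line the imaginary parts are bounded, so the majorant of
  \<open>fourier_term_le\<close> is uniform there and the M-test makes the sum a uniform limit of
  entire functions.\<close>

lemma fourier_series_line_holomorphic:
  assumes b: "gauss_bounded g C c b" and c: "c > 0"
  shows "(\<lambda>\<zeta>. fourier_series g b (\<lambda>i. p i + \<zeta> * d i)) holomorphic_on UNIV"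
proof -
  have "(\<lambda>\<zeta>. fourier_series g b (\<lambda>i. p i + \<zeta> * d i)) holomorphic_on ball 0 r" if r: "r > 0" for r
  proof -
    define K1 K2 where "K1 = (\<Sum>i<g. norm (p i))" and "K2 = (\<Sum>i<g. norm (d i))"
    have K: "norm (p i) \<le> K1" "norm (d i) \<le> K2" if "i < g" for i
      unfolding K1_def K2_def using that by (auto intro!: member_le_sum)
    define K where "K = K1 + r * K2"
    have Im: "\<bar>Im (p i + \<zeta> * d i)\<bar> \<le> K" if "i < g" "\<zeta> \<in> cball 0 r" for i \<zeta>
    proof -
      have "\<bar>Im (p i + \<zeta> * d i)\<bar> \<le> norm (p i) + norm \<zeta> * norm (d i)"
        by (metis abs_Im_le_cmod norm_mult norm_triangle_ineq order_trans)
      also have "\<dots> \<le> K" unfolding K_def using K[OF that(1)] that(2) r by (intro add_mono mult_mono) auto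
      finally show ?thesis .
    qed
    define t where "t n \<zeta> = b n * fourier_char g n (\<lambda>i. p i + \<zeta> * d i)" for n \<zeta>
    have "uniform_limit (cball 0 r) (\<lambda>X \<zeta>. \<Sum>n\<in>X. t n \<zeta>) (\<lambda>\<zeta>. \<Sum>\<^sub>\<infinity>n\<in>int_vecs g. t n \<zeta>) (finite_subsets_at_top (int_vecs g))"
    proof (rule Weierstrass_m_test_general)
      show "norm (t n \<zeta>) \<le> C * exp (real g * ((2 * pi * K)\<^sup>2 / (2 * c))) * exp (- (c / 2) * nsq g n)"
        if "n \<in> int_vecs g" "\<zeta> \<in> cball 0 r" for n \<zeta>
        unfolding t_def using fourier_term_le[OF b c that(1) Im[OF _ that(2)]] .
      have "Infinite_Set_Sum.abs_summable_on (\<lambda>n. C * exp (real g * ((2 * pi * K)\<^sup>2 / (2 * c))) * exp (- (c / 2) * nsq g n)) (int_vecs g)"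
        using integrable_gauss_weight[of "c/2" g] c by (auto simp: abs_summable_on_def)
      then show "(\<lambda>n. C * exp (real g * ((2 * pi * K)\<^sup>2 / (2 * c))) * exp (- (c / 2) * nsq g n)) summable_on int_vecs g"
        by (metis abs_summable_equivalent abs_summable_summable)
    qed
    then have "(\<lambda>\<zeta>. \<Sum>\<^sub>\<infinity>n\<in>int_vecs g. t n \<zeta>) holomorphic_on ball 0 r"
      by (rule holomorphic_uniform_limit[rotated])
        (auto simp: t_def fourier_char_def intro!: always_eventually continuous_intros holomorphic_intros)
    also have "(\<lambda>\<zeta>. \<Sum>\<^sub>\<infinity>n\<in>int_vecs g. t n \<zeta>) = (\<lambda>\<zeta>. fourier_series g b (\<lambda>i. p i + \<zeta> * d i))"
      unfolding t_def by (intro ext infsum_eq_fourier_series[OF b c])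
    finally show ?thesis .
  qed
  then have "(\<lambda>\<zeta>. fourier_series g b (\<lambda>i. p i + \<zeta> * d i)) field_differentiable at z" for z
    by (rule holomorphic_on_imp_differentiable_at[of _ "ball 0 (norm z + 1)"])
      (auto intro: le_less_trans[OF _ less_add_one] add_nonneg_pos)
  then show ?thesis by (auto simp: holomorphic_on_def field_differentiable_at_within)
qed

section \<open>Fourier coefficients and Parseval's identity\<close>

lemma integral_series_swap:
  fixes a :: "'i \<Rightarrow> complex" and u :: "'i \<Rightarrow> 'a \<Rightarrow> complex"
  assumes A: "countable A" and M: "prob_space M"
    and a: "integrable (count_space A) a"
    and u: "\<And>n. n \<in> A \<Longrightarrow> u n \<in> borel_measurable M" and B: "\<And>n x. n \<in> A \<Longrightarrow> x \<in> space M \<Longrightarrow> norm (u n x) \<le> B"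
  shows "(\<integral>x. (\<integral>n. a n * u n x \<partial>count_space A) \<partial>M) = (\<integral>n. a n * (\<integral>x. u n x \<partial>M) \<partial>count_space A)"
proof -
  interpret prob_space M by fact
  interpret A: sigma_finite_measure "count_space A" by (rule sigma_finite_measure_count_space_countable[OF A])
  interpret pair_sigma_finite "count_space A" M ..
  have iu: "integrable M (u n)" if "n \<in> A" for n
    by (rule integrable_const_bound[of _ B]) (use u B that in auto)
  have "integrable (count_space A \<Otimes>\<^sub>M M) (\<lambda>(n, x). a n * u n x)"
  proof (rule Fubini_integrable)
    show "(\<lambda>(n, x). a n * u n x) \<in> borel_measurable (count_space A \<Otimes>\<^sub>M M)"
      by (rule measurable_pair_measure_countable1[OF A]) (use u in auto)
    show "AE n in count_space A. integrable M (\<lambda>x. case (n, x) of (n, x) \<Rightarrow> a n * u n x)"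
      using iu by (auto simp: AE_count_space)
    show "integrable (count_space A) (\<lambda>n. \<integral>x. norm (case (n, x) of (n, x) \<Rightarrow> a n * u n x) \<partial>M)"
    proof (rule Bochner_Integration.integrable_bound)
      show "integrable (count_space A) (\<lambda>n. norm (a n) * B)" using a by auto
      show "AE n in count_space A. norm (\<integral>x. norm (case (n, x) of (n, x) \<Rightarrow> a n * u n x) \<partial>M) \<le> norm (norm (a n) * B)"
      proof (rule AE_I2)
        fix n assume n: "n \<in> space (count_space A)"
        have "(\<integral>x. norm (u n x) \<partial>M) \<le> (\<integral>x. B \<partial>M)"
          by (rule integral_mono) (use iu n B in auto)
        also have "\<dots> \<le> \<bar>B\<bar>" by (simp add: prob_space)
        finally show "norm (\<integral>x. norm (case (n, x) of (n, x) \<Rightarrow> a n * u n x) \<partial>M) \<le> norm (norm (a n) * B)"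
          by (simp add: norm_mult abs_mult mult_left_mono)
      qed
    qed simp
  qed
  from Fubini_integral[OF this] show ?thesis by simp
qed

lemma fourier_char_add: "fourier_char g n (\<lambda>i. z i + w i) = fourier_char g n z * fourier_char g n w"
  by (simp add: fourier_char_def distrib_left sum.distrib flip: exp_add)

lemma fourier_char_diff:
  "n \<in> int_vecs g \<Longrightarrow> k \<in> int_vecs g \<Longrightarrow> fourier_char g (n - k) z = fourier_char g n z / fourier_char g k z"
  by (auto simp: fourier_char_def int_vecs_def left_diff_distrib right_diff_distrib sum_subtractf exp_diff)

lemma fourier_char_nonzero [simp]: "fourier_char g n z \<noteq> 0"
  by (simp add: fourier_char_def)

lemma fourier_char_0 [simp]: "fourier_char g (0\<^sub>v g) z = 1"
  by (simp add: fourier_char_def)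

lemma fourier_char_measurable [measurable]:
  assumes [measurable]: "\<And>i. i < g \<Longrightarrow> (\<lambda>w. z w i) \<in> borel_measurable M"
  shows "(\<lambda>w. fourier_char g n (z w)) \<in> borel_measurable M"
  unfolding fourier_char_def by measurable

lemma component_measurable_unit_cube [measurable]:
  "i < g \<Longrightarrow> (\<lambda>x. x i) \<in> borel_measurable (unit_cube g)"
  unfolding measurable_cong_sets[OF sets_unit_cube refl] by measurable

lemma integral_fourier_char:
  assumes n: "n \<in> int_vecs g"
  shows "(\<integral>x. fourier_char g n (cpx x) \<partial>unit_cube g) = (if n = 0\<^sub>v g then 1 else 0)"
proof -
  have "(\<integral>x. fourier_char g n (cpx x) \<partial>unit_cube g) =
      (\<integral>x. (\<Prod>i<g. exp (2 * pi * \<i> * of_int (vec_index n i) * complex_of_real (x i))) \<partial>PiM {..<g} (\<lambda>_. U01))"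
    by (simp add: fourier_char_def unit_cube_def exp_sum sum_distrib_left mult_ac)
  also have "\<dots> = (\<Prod>i<g. \<integral>x. exp (2 * pi * \<i> * of_int (vec_index n i) * complex_of_real x) \<partial>U01)"
  proof (rule cube_factors.product_integral_prod)
    show "integrable U01 (\<lambda>x. exp (2 * pi * \<i> * of_int (vec_index n i) * complex_of_real x))" for i
      by (rule U01.integrable_const_bound[of _ 1])
        (auto simp: measurable_cong_sets[OF sets_U01 refl])
  qed simp
  also have "\<dots> = (\<Prod>i<g. if vec_index n i = 0 then 1 else 0)"
    by (intro prod.cong refl integral_U01_exp)
  also have "\<dots> = (if n = 0\<^sub>v g then 1 else 0)"
  proof (cases "n = 0\<^sub>v g")
    case False
    then obtain i where "i < g" "vec_index n i \<noteq> 0" using int_vecs_eqI[OF n zero_int_vecs] by auto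
    then have "(\<Prod>i<g. if vec_index n i = 0 then 1 else 0 :: complex) = 0"
      by (intro prod_zero) auto
    then show ?thesis using False by simp
  qed simp
  finally show ?thesis .
qed

lemma integral_count_space_delta:
  fixes a :: "'i \<Rightarrow> complex"
  assumes "k \<in> A"
  shows "(\<integral>n. a n * (if n = k then 1 else 0) \<partial>count_space A) = a k"
proof -
  have "(\<integral>n. a n * (if n = k then 1 else 0) \<partial>count_space A) = (\<Sum>n | n \<in> A \<and> a n * (if n = k then 1 else 0) \<noteq> 0. a n * (if n = k then 1 else 0))"
    by (rule lebesgue_integral_count_space_finite_support) (auto intro: finite_subset[of _ "{k}"])
  also have "{n. n \<in> A \<and> a n * (if n = k then 1 else 0) \<noteq> 0} = (if a k = 0 then {} else {k})"
    using assms by auto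
  finally show ?thesis by auto
qed

text \<open>The integration runs over a complex translate of the real torus. Characters are
  multiplicative, so the translation only rescales each term by a character value at
  \<open>w\<close>, and this factor cancels in the term n = k.\<close>

lemma integral_fourier_series_coeff:
  assumes b: "gauss_bounded g C c b" and c: "c > 0" and k: "k \<in> int_vecs g"
  shows "(\<integral>x. fourier_series g b (\<lambda>i. cpx x i + w i) / fourier_char g k (\<lambda>i. cpx x i + w i) \<partial>unit_cube g) = b k"
proof -
  define a where "a n = b n * fourier_char g n w / fourier_char g k w" for n
  have a: "integrable (count_space (int_vecs g)) a"
    unfolding a_def by (intro integrable_divide integrable_fourier_terms[OF b c])
  have diff: "n - k = 0\<^sub>v g \<longleftrightarrow> n = k" if "n \<in> int_vecs g" for n
    using that k by (auto simp: int_vecs_def intro!: eq_vecI dest: arg_cong[where f = "\<lambda>v. vec_index v i" for i])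
       (metis carrier_vecD eq_iff_diff_eq_0 index_minus_vec(1) index_zero_vec(1))
  have "fourier_series g b (\<lambda>i. cpx x i + w i) / fourier_char g k (\<lambda>i. cpx x i + w i) =
      (\<integral>n. a n * fourier_char g (n - k) (cpx x) \<partial>count_space (int_vecs g))" for x
    unfolding fourier_series_def integral_divide_zero[symmetric]
    by (rule Bochner_Integration.integral_cong) (auto simp: a_def fourier_char_diff k fourier_char_add mult_ac)
  then have "(\<integral>x. fourier_series g b (\<lambda>i. cpx x i + w i) / fourier_char g k (\<lambda>i. cpx x i + w i) \<partial>unit_cube g) =
      (\<integral>n. a n * (\<integral>x. fourier_char g (n - k) (cpx x) \<partial>unit_cube g) \<partial>count_space (int_vecs g))"
    by (simp only:) (rule integral_series_swap[where B = 1], auto intro: a prob_space_unit_cube)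
  also have "\<dots> = (\<integral>n. a n * (if n = k then 1 else 0) \<partial>count_space (int_vecs g))"
    by (rule Bochner_Integration.integral_cong)
      (use k diff in \<open>auto simp: integral_fourier_char int_vecs_def\<close>)
  also have "\<dots> = a k" by (rule integral_count_space_delta[OF k])
  finally show ?thesis by (simp add: a_def)
qed

lemma norm_fourier_series_cpx_le:
  assumes b: "gauss_bounded g C c b" and c: "c > 0"
  shows "norm (fourier_series g b (cpx x)) \<le> C * gauss_mass g (c / 2)"
  using norm_fourier_series_le[OF b c, of "cpx x" 0] by simp

text \<open>Only one of the two factors is expanded; what remains under the sum is an integral that
  equals the conjugate of a coefficient already computed.\<close>

lemma fourier_series_parseval:
  assumes b: "gauss_bounded g C c b" and c: "c > 0"
  shows "(\<integral>x. (norm (fourier_series g b (cpx x)))\<^sup>2 \<partial>unit_cube g) = (\<integral>n. (norm (b n))\<^sup>2 \<partial>count_space (int_vecs g))"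
proof -
  let ?f = "\<lambda>x. fourier_series g b (cpx x)"
  have "complex_of_real (\<integral>x. (norm (?f x))\<^sup>2 \<partial>unit_cube g) = (\<integral>x. ?f x * cnj (?f x) \<partial>unit_cube g)"
    unfolding integral_complex_of_real[symmetric] complex_norm_square ..
  also have "\<dots> = (\<integral>x. (\<integral>n. b n * (fourier_char g n (cpx x) * cnj (?f x)) \<partial>count_space (int_vecs g)) \<partial>unit_cube g)"
    unfolding mult.assoc[symmetric] integral_mult_left_zero by (simp add: fourier_series_def)
  also have "\<dots> = (\<integral>n. b n * (\<integral>x. fourier_char g n (cpx x) * cnj (?f x) \<partial>unit_cube g) \<partial>count_space (int_vecs g))"
  proof (rule integral_series_swap)
    show "integrable (count_space (int_vecs g)) b"
      using integrable_fourier_terms[OF b c, of "\<lambda>_. 0"] by (simp add: fourier_char_def)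
    show "norm (fourier_char g n (cpx x) * cnj (?f x)) \<le> C * gauss_mass g (c / 2)" for n x
      using norm_fourier_series_cpx_le[OF b c] by (simp add: norm_mult)
    show "(\<lambda>x. fourier_char g n (cpx x) * cnj (?f x)) \<in> borel_measurable (unit_cube g)" for n
      by (intro borel_measurable_times fourier_char_measurable measurable_compose[OF _ borel_measurable_continuous_onI[OF continuous_on_cnj[OF continuous_on_id]]] fourier_series_measurable) auto
  qed (auto intro: prob_space_unit_cube)
  also have "\<dots> = (\<integral>n. complex_of_real ((norm (b n))\<^sup>2) \<partial>count_space (int_vecs g))"
  proof (rule Bochner_Integration.integral_cong)
    fix n assume "n \<in> space (count_space (int_vecs g))"
    then have n: "n \<in> int_vecs g" by simp
    have fc: "fourier_char g n (cpx x) = 1 / cnj (fourier_char g n (cpx x))" for x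
      by (simp add: fourier_char_def exp_cnj exp_minus[symmetric] inverse_eq_divide[symmetric] sum_negf[symmetric])
    have "fourier_char g n (cpx x) * cnj (?f x) = cnj (?f x / fourier_char g n (cpx x))" for x
      using fc[of x] by (metis complex_cnj_divide mult.commute mult_1_right times_divide_eq_right)
    then have "(\<integral>x. fourier_char g n (cpx x) * cnj (?f x) \<partial>unit_cube g) = cnj (\<integral>x. ?f x / fourier_char g n (cpx x) \<partial>unit_cube g)"
      by (simp only: Bochner_Integration.integral_cnj)
    also have "\<dots> = cnj (b n)"
      using integral_fourier_series_coeff[OF b c n, of "\<lambda>_. 0"] by simp
    finally show "b n * (\<integral>x. fourier_char g n (cpx x) * cnj (?f x) \<partial>unit_cube g) = complex_of_real ((norm (b n))\<^sup>2)"
      by (simp only: complex_norm_square)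
  qed simp
  also have "\<dots> = complex_of_real (\<integral>n. (norm (b n))\<^sup>2 \<partial>count_space (int_vecs g))"
    by (rule integral_complex_of_real)
  finally show ?thesis by (simp only: of_real_eq_iff)
qed

section \<open>Uniform sublevel bound for Fourier series\<close>

text \<open>Modulo \<open>N\<close> only the lowest digit is left, and it is smaller than
  \<open>N\<close> in modulus, so it vanishes; division by \<open>N\<close> continues with the
  others. Consequently a nonzero frequency with all entries below \<open>N\<close> still oscillates
  along the direction (1, N, N^2, ...).\<close>

lemma base_expansion_zero:
  fixes n :: "nat \<Rightarrow> int"
  assumes "\<And>i. i < g \<Longrightarrow> \<bar>n i\<bar> < int N" and "(\<Sum>i<g. n i * int N ^ i) = 0" and "i < g"
  shows "n i = 0"
  using assms
proof (induction g arbitrary: n i)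
  case (Suc g)
  have "(\<Sum>i<Suc g. n i * int N ^ i) = n 0 + int N * (\<Sum>i<g. n (Suc i) * int N ^ i)"
    by (simp add: sum.lessThan_Suc_shift sum_distrib_left mult_ac del: sum.lessThan_Suc)
  then have *: "n 0 + int N * (\<Sum>i<g. n (Suc i) * int N ^ i) = 0" using Suc.prems(2) by simp
  then have "int N dvd n 0" by (metis dvd_add_left_iff dvd_0_right dvd_triv_left)
  then have n0: "n 0 = 0" using Suc.prems(1)[of 0] dvd_imp_le_int[of "n 0" "int N"] by auto
  show ?case
  proof (cases i)
    case (Suc j)
    have "int N > 0" using Suc.prems(1)[of 0] by simp
    then have "(\<Sum>i<g. n (Suc i) * int N ^ i) = 0" using * n0 by simp
    then show ?thesis using Suc.IH[of "\<lambda>i. n (Suc i)" j] Suc.prems Suc by auto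
  qed (use n0 in simp)
qed simp

lemma fourier_series_line:
  "fourier_series g b (\<lambda>i. p i + \<zeta> * d i) =
     (\<integral>n. b n * fourier_char g n p * exp (2 * pi * \<i> * (\<Sum>i<g. of_int (vec_index n i) * d i) * \<zeta>) \<partial>count_space (int_vecs g))"
  unfolding fourier_series_def fourier_char_add[of g _ p]
  by (intro Bochner_Integration.integral_cong refl) (simp add: fourier_char_def sum_distrib_left sum_distrib_right mult_ac)

text \<open>Every fixed frequency leaves the tail as soon as N exceeds its entries, so dominated
  convergence applies.\<close>

lemma gauss_tail_small:
  assumes c: "c > 0" and \<delta>: "\<delta> > 0"
  shows "\<exists>N::nat. N \<ge> 1 \<and> (\<integral>n. C * exp (- c * nsq g n) * (if \<exists>i<g. \<bar>vec_index n i\<bar> \<ge> int N then 1 else 0) \<partial>count_space (int_vecs g)) < \<delta>"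
proof -
  have "(\<lambda>N::nat. \<integral>n. C * exp (- c * nsq g n) * (if \<exists>i<g. \<bar>vec_index n i\<bar> \<ge> int N then 1 else 0) \<partial>count_space (int_vecs g)) \<longlonglongrightarrow>
     (\<integral>n. 0 \<partial>count_space (int_vecs g))"
  proof (rule integral_dominated_convergence)
    show "integrable (count_space (int_vecs g)) (\<lambda>n. \<bar>C\<bar> * exp (- c * nsq g n))"
      using integrable_gauss_weight[OF c] by (rule integrable_mult_right)
    show "AE n in count_space (int_vecs g). (\<lambda>N. C * exp (- c * nsq g n) * (if \<exists>i<g. \<bar>vec_index n i\<bar> \<ge> int N then 1 else 0)) \<longlonglongrightarrow> 0"
    proof (rule AE_I2)
      fix n :: "int Matrix.vec"
      define N0 where "N0 = nat (\<Sum>i<g. \<bar>vec_index n i\<bar>) + 1"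
      have "\<not> (\<exists>i<g. \<bar>vec_index n i\<bar> \<ge> int N)" if "N \<ge> N0" for N
      proof -
        have "\<bar>vec_index n i\<bar> \<le> (\<Sum>i<g. \<bar>vec_index n i\<bar>)" if "i < g" for i
          by (rule member_le_sum) (use that in auto)
        then show ?thesis using that unfolding N0_def by force
      qed
      then have "eventually (\<lambda>N. C * exp (- c * nsq g n) * (if \<exists>i<g. \<bar>vec_index n i\<bar> \<ge> int N then 1 else 0) = 0) sequentially"
        by (intro eventually_sequentiallyI[of N0]) auto
      then show "(\<lambda>N. C * exp (- c * nsq g n) * (if \<exists>i<g. \<bar>vec_index n i\<bar> \<ge> int N then 1 else 0)) \<longlonglongrightarrow> 0"
        by (rule tendsto_eventually)
    qed
  qed (auto simp: abs_mult)
  then have "eventually (\<lambda>N::nat. (\<integral>n. C * exp (- c * nsq g n) * (if \<exists>i<g. \<bar>vec_index n i\<bar> \<ge> int N then 1 else 0) \<partial>count_space (int_vecs g)) < \<delta>) sequentially"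
    using \<delta> by (simp add: order_tendstoD(2))
  from eventually_happens[OF eventually_conj[OF this eventually_ge_at_top[of 1]]]
  show ?thesis by auto
qed

text \<open>Restricting the series to a line \<open>s \<mapsto> x + s(1, N, N\<^sup>2, \<dots>)\<close> with \<open>N\<close> large separates the
  frequencies; this is what makes the bound uniform in the coefficients.\<close>
lemma fourier_series_sublevel:
  fixes C c :: real
  assumes c: "c > 0"
  shows "\<exists>K \<alpha>. 0 \<le> K \<and> 0 < \<alpha> \<and> (\<forall>b. gauss_bounded g C c b \<longrightarrow> b (0\<^sub>v g) = 1 \<longrightarrow>
           (\<forall>\<epsilon>. 0 < \<epsilon> \<longrightarrow> \<epsilon> \<le> 1 \<longrightarrow>
              emeasure (unit_cube g) {x\<in>space (unit_cube g). norm (fourier_series g b (cpx x)) < \<epsilon>} \<le> ennreal (K * \<epsilon> powr \<alpha>)))"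
proof -
  \<comment> \<open>Frequencies with an entry of size at least \<open>N\<close> have total weight
    below 1/4; the smaller ones are separated on the line.\<close>
  obtain N :: nat where N: "N \<ge> 1" "(\<integral>n. C * exp (- c * nsq g n) * (if \<exists>i<g. \<bar>vec_index n i\<bar> \<ge> int N then 1 else 0) \<partial>count_space (int_vecs g)) < 1 / 4"
    using gauss_tail_small[OF c, of "1/4"] by auto
  define d where "d i = complex_of_real (real N ^ i)" for i
  \<comment> \<open>Bound for the series along the complexified line over the disc of radius 3,
    where the imaginary parts are at most 3 N^g.\<close>
  define M where "M = C * exp (real g * ((2 * pi * (3 * real N ^ g))\<^sup>2 / (2 * c))) * gauss_mass g (c / 2)"
  obtain K \<alpha> where K: "0 \<le> K" "0 < \<alpha>" and bound': "\<forall>F. F holomorphic_on UNIV \<longrightarrow> (\<forall>z. norm z \<le> 3 \<longrightarrow> norm (F z) \<le> M) \<longrightarrow>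
           (\<exists>s\<in>{0..1}. norm (F (complex_of_real s)) \<ge> 1 / 2) \<longrightarrow>
           (\<forall>\<epsilon>. 0 < \<epsilon> \<longrightarrow> \<epsilon> \<le> 1 \<longrightarrow>
              emeasure lborel {s\<in>{0..1}. norm (F (complex_of_real s)) < \<epsilon>} \<le> ennreal (K * \<epsilon> powr \<alpha>))"
    using entire_sublevel_bound[of M] by (elim exE conjE) (rule that)
  have bound: "emeasure lborel {s\<in>{0..1}. norm (F (complex_of_real s)) < \<epsilon>} \<le> ennreal (K * \<epsilon> powr \<alpha>)"
    if "F holomorphic_on UNIV" "\<And>z. norm z \<le> 3 \<Longrightarrow> norm (F z) \<le> M"
      "\<exists>s\<in>{0..1}. norm (F (complex_of_real s)) \<ge> 1 / 2" "0 < \<epsilon>" "\<epsilon> \<le> 1" for F \<epsilon>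
    using bound'[rule_format, OF that(1,2,3,4,5)] .
  have "emeasure (unit_cube g) {x\<in>space (unit_cube g). norm (fourier_series g b (cpx x)) < \<epsilon>} \<le> ennreal (K * \<epsilon> powr \<alpha>)"
    if b: "gauss_bounded g C c b" and b0: "b (0\<^sub>v g) = 1" and \<epsilon>: "0 < \<epsilon>" "\<epsilon> \<le> 1" for b \<epsilon>
  proof -
    have fm [measurable]: "(\<lambda>x. fourier_series g b (cpx x)) \<in> borel_measurable (unit_cube g)"
      by (rule fourier_series_measurable) measurable
    define F where "F x \<zeta> = fourier_series g b (\<lambda>i. cpx x i + \<zeta> * d i)" for x \<zeta>
    have line: "emeasure U01 {s. norm (F x (of_real s)) < \<epsilon>} \<le> ennreal (K * \<epsilon> powr \<alpha>)" for x
    proof -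
      have hol: "F x holomorphic_on UNIV"
        unfolding F_def by (rule fourier_series_line_holomorphic[OF b c])
      have le: "norm (F x z) \<le> M" if "norm z \<le> 3" for z
        unfolding F_def M_def
      proof (rule norm_fourier_series_le[OF b c])
        fix i assume "i < g"
        have "\<bar>Im (cpx x i + z * d i)\<bar> = \<bar>Im z\<bar> * real N ^ i"
          by (simp add: d_def abs_mult del: of_real_power)
        also have "\<dots> \<le> 3 * real N ^ g"
          using that N \<open>i < g\<close> abs_Im_le_cmod[of z] by (intro mult_mono power_increasing) auto
        finally show "\<bar>Im (cpx x i + z * d i)\<bar> \<le> 3 * real N ^ g" .
      qed
      \<comment> \<open>The mean over the line differs from the constant coefficient 1 by less than
        1/4, so the restriction cannot be at most 1/2 in modulus throughout.\<close>
      have ge: "\<exists>s\<in>{0..1}. norm (F x (complex_of_real s)) \<ge> 1 / 2"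
      proof (rule ccontr)
        assume "\<not> ?thesis"
        then have less: "norm (F x (complex_of_real s)) \<le> 1 / 2" if "s \<in> {0..1}" for s
          using that by force
        define e where "e n = (\<Sum>i<g. vec_index n i * int N ^ i)" for n
        define a where "a n = b n * fourier_char g n (cpx x)" for n
        have ia: "integrable (count_space (int_vecs g)) a"
          unfolding a_def by (rule integrable_fourier_terms[OF b c])
        have "(\<integral>s. F x (complex_of_real s) \<partial>U01) =
            (\<integral>s. (\<integral>n. a n * exp (2 * pi * \<i> * of_int (e n) * of_real s) \<partial>count_space (int_vecs g)) \<partial>U01)"
          unfolding F_def fourier_series_line a_def by (simp add: e_def d_def)
        also have "\<dots> = (\<integral>n. a n * (\<integral>s. exp (2 * pi * \<i> * of_int (e n) * of_real s) \<partial>U01) \<partial>count_space (int_vecs g))"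
          by (rule integral_series_swap[where B = 1])
            (auto intro: ia prob_space_U01 simp: measurable_cong_sets[OF sets_U01 refl])
        also have "\<dots> = (\<integral>n. a n * (if e n = 0 then 1 else 0) \<partial>count_space (int_vecs g))"
          unfolding integral_U01_exp ..
        finally have int_F: "(\<integral>s. F x (complex_of_real s) \<partial>U01) = (\<integral>n. a n * (if e n = 0 then 1 else 0) \<partial>count_space (int_vecs g))" .
        have i1: "integrable (count_space (int_vecs g)) (\<lambda>n. a n * (if e n = 0 then 1 else 0))"
          by (rule Bochner_Integration.integrable_bound[OF ia]) auto
        have i2: "integrable (count_space (int_vecs g)) (\<lambda>n. a n * (if n = 0\<^sub>v g then 1 else 0))"
          by (rule Bochner_Integration.integrable_bound[OF ia]) auto
        have i3: "integrable (count_space (int_vecs g)) (\<lambda>n. C * exp (- c * nsq g n) * (if \<exists>i<g. \<bar>vec_index n i\<bar> \<ge> int N then 1 else 0))"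
        proof (rule Bochner_Integration.integrable_bound)
          show "integrable (count_space (int_vecs g)) (\<lambda>n. C * exp (- c * nsq g n))"
            using integrable_gauss_weight[OF c] by (rule integrable_mult_right)
        qed auto
        have "(\<integral>s. F x (complex_of_real s) \<partial>U01) - 1 =
            (\<integral>n. a n * (if e n = 0 then 1 else 0) \<partial>count_space (int_vecs g)) - (\<integral>n. a n * (if n = 0\<^sub>v g then 1 else 0) \<partial>count_space (int_vecs g))"
          unfolding int_F integral_count_space_delta[OF zero_int_vecs] by (simp add: a_def b0)
        also have "\<dots> = (\<integral>n. a n * (if e n = 0 then 1 else 0) - a n * (if n = 0\<^sub>v g then 1 else 0) \<partial>count_space (int_vecs g))"
          using i1 i2 by (rule Bochner_Integration.integral_diff[symmetric])
        also have "norm \<dots> \<le> (\<integral>n. C * exp (- c * nsq g n) * (if \<exists>i<g. \<bar>vec_index n i\<bar> \<ge> int N then 1 else 0) \<partial>count_space (int_vecs g))"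
        proof (rule order_trans[OF integral_norm_bound integral_mono])
          fix n assume "n \<in> space (count_space (int_vecs g))"
          then have n: "n \<in> int_vecs g" by simp
          have e0: "e (0\<^sub>v g) = 0" by (simp add: e_def)
          have an: "norm (a n) \<le> C * exp (- c * nsq g n)"
            unfolding a_def norm_mult using gauss_boundedD[OF b n] by simp
          consider "n = 0\<^sub>v g" | "e n \<noteq> 0" | "n \<noteq> 0\<^sub>v g" "e n = 0" by blast
          then show "norm (a n * (if e n = 0 then 1 else 0) - a n * (if n = 0\<^sub>v g then 1 else 0)) \<le>
              C * exp (- c * nsq g n) * (if \<exists>i<g. \<bar>vec_index n i\<bar> \<ge> int N then 1 else 0)"
          proof cases
            case 3
            have "\<exists>i<g. \<bar>vec_index n i\<bar> \<ge> int N"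
            proof (rule ccontr)
              assume "\<not> ?thesis"
              then have "vec_index n i = 0" if "i < g" for i
                using base_expansion_zero[of g "vec_index n" N i] 3(2) that by (auto simp: e_def not_le)
              then have "n = 0\<^sub>v g" by (intro int_vecs_eqI[OF n zero_int_vecs]) auto
              with 3 show False by simp
            qed
            then show ?thesis using 3 an by simp
          qed (use e0 gauss_bounded_nonneg[OF b] in auto)
        qed (use i1 i2 i3 in auto)
        finally have "norm ((\<integral>s. F x (complex_of_real s) \<partial>U01) - 1) < 1 / 4" using N(2) by linarith
        moreover have "norm (\<integral>s. F x (complex_of_real s) \<partial>U01) \<le> 1 / 2"
        proof -
          have cont: "continuous_on UNIV (\<lambda>s. F x (complex_of_real s))"
            by (intro continuous_on_compose2[OF holomorphic_on_imp_continuous_on[OF hol]] continuous_intros) auto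
          have m: "(\<lambda>s. F x (complex_of_real s)) \<in> borel_measurable borel"
            by (rule borel_measurable_continuous_onI[OF cont])
          have ae: "AE s in U01. norm (F x (complex_of_real s)) \<le> 1 / 2"
            by (rule AE_uniform_measureI) (use less in auto)
          have "integrable U01 (\<lambda>s. F x (complex_of_real s))"
            by (rule U01.integrable_const_bound[OF ae]) (simp add: measurable_cong_sets[OF sets_U01 refl] m)
          from this ae have "norm (\<integral>s. F x (complex_of_real s) \<partial>U01) \<le> (\<integral>s. 1 / 2 \<partial>U01)"
            by (intro order_trans[OF integral_norm_bound] integral_mono_AE ae) auto
          then show ?thesis by (simp add: U01.prob_space[unfolded space_U01])
        qed
        ultimately show False
          using norm_triangle_ineq2[of 1 "1 - (\<integral>s. F x (complex_of_real s) \<partial>U01)"] by (simp add: norm_minus_commute)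
      qed
      have cont: "continuous_on UNIV (\<lambda>s. F x (complex_of_real s))"
        by (intro continuous_on_compose2[OF holomorphic_on_imp_continuous_on[OF hol]] continuous_intros) auto
      have [measurable]: "(\<lambda>s. F x (complex_of_real s)) \<in> borel_measurable borel"
        by (rule borel_measurable_continuous_onI[OF cont])
      have "{s. norm (F x (complex_of_real s)) < \<epsilon>} \<in> sets borel" by measurable
      then have "emeasure U01 {s. norm (F x (of_real s)) < \<epsilon>} = emeasure lborel {s\<in>{0..1}. norm (F x (complex_of_real s)) < \<epsilon>}"
        by (subst emeasure_uniform_measure) (auto simp: divide_ennreal_def Int_def conj_commute)
      also have "\<dots> \<le> ennreal (K * \<epsilon> powr \<alpha>)"
        by (rule bound[OF hol le ge \<epsilon>])
      finally show ?thesis .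
    qed
    \<comment> \<open>Indicator of the sublevel set. Averaging its translates along the line does
      not change its integral over the cube, and after exchanging the integrals the one-dimensional
      bound applies through every base point.\<close>
    define h where "h x = (if norm (fourier_series g b (cpx x)) < \<epsilon> then 1 else 0 :: ennreal)" for x
    have hm: "h \<in> borel_measurable (PiM {..<g} (\<lambda>_. borel))"
      using fm unfolding h_def measurable_cong_sets[OF sets_unit_cube refl] by measurable
    have hm' [measurable]: "h \<in> borel_measurable (unit_cube g)"
      using hm unfolding measurable_cong_sets[OF sets_unit_cube refl] .
    have h_cong: "h x = h y" if "\<And>i. i < g \<Longrightarrow> x i = y i" for x y
      using that by (simp add: h_def fourier_series_def fourier_char_def)
    have hF: "h (\<lambda>i\<in>{..<g}. x i + s * real N ^ i) = indicator {s. norm (F x (of_real s)) < \<epsilon>} s" for x s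
    proof -
      have "fourier_series g b (cpx (\<lambda>i\<in>{..<g}. x i + s * real N ^ i)) = F x (of_real s)"
        by (simp add: F_def fourier_series_def fourier_char_def d_def)
      then show ?thesis by (simp add: h_def)
    qed
    have "emeasure (unit_cube g) {x\<in>space (unit_cube g). norm (fourier_series g b (cpx x)) < \<epsilon>} = (\<integral>\<^sup>+x. h x \<partial>unit_cube g)"
    proof -
      have "(\<integral>\<^sup>+x. h x \<partial>unit_cube g) = (\<integral>\<^sup>+x. indicator {x\<in>space (unit_cube g). norm (fourier_series g b (cpx x)) < \<epsilon>} x \<partial>unit_cube g)"
        by (rule nn_integral_cong) (simp add: h_def)
      then show ?thesis by simp
    qed
    also have "\<dots> = (\<integral>\<^sup>+s. (\<integral>\<^sup>+x. h x \<partial>unit_cube g) \<partial>U01)"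
      using U01.emeasure_space_1 by simp
    also have "\<dots> = (\<integral>\<^sup>+s. (\<integral>\<^sup>+x. h (\<lambda>i\<in>{..<g}. x i + s * real N ^ i) \<partial>unit_cube g) \<partial>U01)"
    proof (rule nn_integral_cong)
      fix s
      have "(\<integral>\<^sup>+x. h (\<lambda>i\<in>{..<g}. x i + s * real N ^ i) \<partial>unit_cube g) = (\<integral>\<^sup>+x. h x \<partial>unit_cube g)"
        unfolding unit_cube_def
      proof (rule nn_integral_PiM_U01_shift[OF _ hm])
        fix x i assume i: "i \<in> {..<g}"
        have "fourier_char g n (cpx (x(i := x i + 1))) = fourier_char g n (cpx x)" for n
        proof -
          have "(\<Sum>j<g. of_int (vec_index n j) * cpx (x(i := x i + 1)) j) = (\<Sum>j<g. of_int (vec_index n j) * cpx x j + (if j = i then of_int (vec_index n i) else 0))"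
            by (intro sum.cong) (auto simp: algebra_simps)
          also have "\<dots> = (\<Sum>j<g. of_int (vec_index n j) * cpx x j) + of_int (vec_index n i)"
            using i by (simp add: sum.distrib)
          finally show ?thesis
            using exp_integer_2pi[of "of_int (vec_index n i)"] by (simp add: fourier_char_def distrib_left exp_add mult_ac)
        qed
        then show "h (x(i := x i + 1)) = h x"
          by (simp add: h_def fourier_series_def del: fun_upd_apply)
      qed simp
      then show "(\<integral>\<^sup>+x. h x \<partial>unit_cube g) = (\<integral>\<^sup>+x. h (\<lambda>i\<in>{..<g}. x i + s * real N ^ i) \<partial>unit_cube g)" by simp
    qed
    also have "\<dots> = (\<integral>\<^sup>+x. (\<integral>\<^sup>+s. h (\<lambda>i\<in>{..<g}. x i + s * real N ^ i) \<partial>U01) \<partial>unit_cube g)"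
    proof (rule pair_sigma_finite.Fubini')
      show "pair_sigma_finite (unit_cube g) U01" ..
      have "(\<lambda>(x, s). \<lambda>i\<in>{..<g}. x i + s * real N ^ i) \<in> (PiM {..<g} (\<lambda>_. borel)) \<Otimes>\<^sub>M borel \<rightarrow>\<^sub>M PiM {..<g} (\<lambda>_. borel)"
        unfolding case_prod_beta by (rule measurable_restrict) measurable
      from measurable_compose[OF this hm]
      show "(\<lambda>(x, s). h (\<lambda>i\<in>{..<g}. x i + s * real N ^ i)) \<in> borel_measurable (unit_cube g \<Otimes>\<^sub>M U01)"
        unfolding measurable_cong_sets[OF sets_pair_measure_cong[OF sets_unit_cube sets_U01] refl] case_prod_beta .
    qed
    also have "\<dots> \<le> (\<integral>\<^sup>+x. ennreal (K * \<epsilon> powr \<alpha>) \<partial>unit_cube g)"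
    proof (rule nn_integral_mono)
      fix x
      have "{s. norm (F x (of_real s)) < \<epsilon>} \<in> sets borel"
      proof -
        have "(\<lambda>s. F x (of_real s)) \<in> borel_measurable borel"
          unfolding F_def by (rule fourier_series_measurable) measurable
        then show ?thesis by measurable
      qed
      then show "(\<integral>\<^sup>+s. h (\<lambda>i\<in>{..<g}. x i + s * real N ^ i) \<partial>U01) \<le> ennreal (K * \<epsilon> powr \<alpha>)"
        unfolding hF using line[of x] by (simp add: measurable_cong_sets[OF sets_U01 refl])
    qed
    also have "\<dots> = ennreal (K * \<epsilon> powr \<alpha>)" using cube.emeasure_space_1 by simp
    finally show ?thesis .
  qed
  then show ?thesis using K by blast
qed

section \<open>Uniqueness of Fourier coefficients and of quasi-periodic functions\<close>

lemma integrable_U01_continuous: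
  fixes f :: "real \<Rightarrow> 'a::{banach,second_countable_topology}"
  assumes f: "continuous_on UNIV f"
  shows "integrable U01 f"
proof -
  have "compact (f ` {0..1})" by (intro compact_continuous_image continuous_on_subset[OF f]) auto
  then obtain B where B: "\<And>x. x \<in> {0..1} \<Longrightarrow> norm (f x) \<le> B"
    by (meson compact_imp_bounded bounded_iff imageI)
  show ?thesis
  proof (rule U01.integrable_const_bound)
    show "AE x in U01. norm (f x) \<le> B" by (rule AE_uniform_measureI) (use B in auto)
    show "f \<in> borel_measurable U01"
      using borel_measurable_continuous_onI[OF f] by (simp add: measurable_cong_sets[OF sets_U01 refl])
  qed
qed

text \<open>The powers of cos^2(pi (x - x0)) are trigonometric polynomials, so they are orthogonal
  to \<open>h\<close>, and they concentrate at \<open>x0\<close>. If h x0 were nonzero, a mass of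
  order q^N near \<open>x0\<close> would have to be balanced by one of order r^N elsewhere, with r <
  q.\<close>

lemma fourier_uniqueness_1_interior:
  fixes h :: "real \<Rightarrow> complex"
  assumes h: "continuous_on UNIV h" and coef: "\<And>m. (\<integral>s. h s / exp (2 * pi * \<i> * of_int m * complex_of_real s) \<partial>U01) = 0"
    and x0: "0 < x0" "x0 < 1"
  shows "h x0 = 0"
proof (rule ccontr)
  assume nz: "h x0 \<noteq> 0"
  define a where "a = norm (h x0)"
  have a: "a > 0" using nz by (simp add: a_def)
  define k where "k x = (cos (pi * (x - x0)))\<^sup>2" for x
  have k01: "0 \<le> k x" "k x \<le> 1" for x
    by (auto simp: k_def abs_square_le_1)
  define E where "E m s = exp (2 * pi * \<i> * of_int m * complex_of_real s)" for m s
  have Ecoef: "(\<integral>s. h s * E m s \<partial>U01) = 0" for m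
    using coef[of "- m"] by (simp add: E_def divide_inverse exp_minus[symmetric])
  have ksum: "complex_of_real (k s) = 1/2 + exp (- 2 * pi * \<i> * x0) / 4 * E 1 s + exp (2 * pi * \<i> * x0) / 4 * E (-1) s" for s
  proof -
    define u where "u = pi * (s - x0)"
    have "complex_of_real (k s) = (complex_of_real (cos u))\<^sup>2" by (simp add: k_def u_def)
    also have "complex_of_real (cos u) = (exp (\<i> * u) + exp (- \<i> * u)) / 2"
      by (simp add: cos_of_real[symmetric] cos_exp_eq)
    also have "((exp (\<i> * u) + exp (- \<i> * u)) / 2)\<^sup>2 = 1/2 + (exp (2 * (\<i> * u)) + exp (- (2 * (\<i> * u)))) / 4"
      by (simp add: power2_eq_square field_simps flip: exp_add)
    also have "exp (2 * (\<i> * u)) = exp (- 2 * pi * \<i> * x0) * E 1 s"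
      by (simp add: E_def u_def algebra_simps flip: exp_add)
    also have "exp (- (2 * (\<i> * u))) = exp (2 * pi * \<i> * x0) * E (-1) s"
      by (simp add: E_def u_def algebra_simps flip: exp_add)
    finally show ?thesis by (simp add: add_divide_distrib)
  qed
  have Eadd: "E m s * E l s = E (m + l) s" for m l s
    by (simp add: E_def algebra_simps flip: exp_add)
  have int: "integrable U01 (\<lambda>s. h s * complex_of_real (k s ^ N) * E m s)" for N m
    unfolding k_def E_def by (intro integrable_U01_continuous continuous_intros h)
  \<comment> \<open>Multiplication by the kernel moves a frequency by at most 1, so vanishing passes
    to the next power; this is why \<open>m\<close> is arbitrary in the induction.\<close>
  have zero: "(\<integral>s. h s * complex_of_real (k s ^ N) * E m s \<partial>U01) = 0" for N m
  proof (induction N arbitrary: m)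
    case (Suc N)
    have "h s * complex_of_real (k s ^ Suc N) * E m s =
        (h s * complex_of_real (k s ^ N) * E m s) / 2
        + exp (- 2 * pi * \<i> * x0) / 4 * (h s * complex_of_real (k s ^ N) * E (m + 1) s)
        + exp (2 * pi * \<i> * x0) / 4 * (h s * complex_of_real (k s ^ N) * E (m + - 1) s)" for s
      unfolding Eadd[symmetric] power_Suc of_real_mult ksum by (simp add: algebra_simps)
    then show ?case using int[of N] Suc.IH by simp
  qed (simp add: Ecoef)
  obtain \<delta>0 where \<delta>0: "\<delta>0 > 0" "\<And>x. \<bar>x - x0\<bar> < \<delta>0 \<Longrightarrow> norm (h x - h x0) < a / 2"
    using h a unfolding continuous_on_iff by (metis UNIV_I dist_norm half_gt_zero real_norm_def)
  \<comment> \<open>The window of radius 2 \<delta> stays inside [0,1], so no point of [0,1] comes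
    close to the neighbouring peaks x0 - 1 and x0 + 1 of the kernel; the bound 1/8 keeps the cosine
    of 2 pi \<delta> positive.\<close>
  define \<delta> where "\<delta> = min (\<delta>0 / 2) (min (x0 / 2) (min ((1 - x0) / 2) (1 / 8)))"
  have \<delta>: "\<delta> > 0" "2 * \<delta> \<le> \<delta>0" "2 * \<delta> \<le> x0" "2 * \<delta> \<le> 1 - x0" "\<delta> \<le> 1 / 8"
    using \<delta>0 x0 by (auto simp: \<delta>_def min_def)
  define r q where "r = (cos (2 * pi * \<delta>))\<^sup>2" and "q = (cos (pi * \<delta>))\<^sup>2"
  have pd: "2 * pi * \<delta> \<le> pi / 2" "0 \<le> pi * \<delta>" using \<delta> pi_gt_zero by (auto simp: field_simps)
  have cospos: "0 \<le> cos (2 * pi * \<delta>)" using pd by (intro cos_ge_zero) linarith+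
  have coslt: "cos (2 * pi * \<delta>) < cos (pi * \<delta>)"
    using pd \<delta> pi_gt_zero by (intro cos_monotone_0_pi) (auto simp: field_simps)
  have rq: "0 \<le> r" "r < q" using cospos coslt by (auto simp: r_def q_def intro!: power_strict_mono)
  have near: "q \<le> k x" if "\<bar>x - x0\<bar> \<le> \<delta>" for x
  proof -
    have "cos (pi * \<delta>) \<le> cos (pi * \<bar>x - x0\<bar>)"
      using that pd \<delta> by (intro cos_monotone_0_pi_le) (auto simp: mult_left_mono)
    also have "cos (pi * \<bar>x - x0\<bar>) = cos (pi * (x - x0))"
      by (metis abs_mult abs_of_pos cos_abs_real pi_gt_zero)
    finally show ?thesis unfolding k_def q_def using cospos coslt by (intro power_mono) auto
  qed
  have far: "k x \<le> r" if "\<bar>x - x0\<bar> \<ge> 2 * \<delta>" "x \<in> {0..1}" for x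
  proof -
    have le: "\<bar>x - x0\<bar> \<le> 1 - 2 * \<delta>" using that \<delta> by auto
    have eq: "cos (pi * (x - x0)) = cos (pi * \<bar>x - x0\<bar>)"
      by (metis abs_mult abs_of_pos cos_abs_real pi_gt_zero)
    have "cos (pi * \<bar>x - x0\<bar>) \<le> cos (pi * (2 * \<delta>))"
      using that(1) le \<delta> by (intro cos_monotone_0_pi_le) (auto simp: mult_left_mono mult_left_le)
    moreover have "cos (pi * (1 - 2 * \<delta>)) \<le> cos (pi * \<bar>x - x0\<bar>)"
      using that(1) le \<delta> by (intro cos_monotone_0_pi_le) (auto simp: mult_left_mono)
    moreover have "cos (pi * (1 - 2 * \<delta>)) = - cos (2 * pi * \<delta>)"
      using cos_minus_pi[of "2 * pi * \<delta>"] by (simp add: algebra_simps cos_diff)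
    ultimately have "\<bar>cos (pi * (x - x0))\<bar> \<le> \<bar>cos (2 * pi * \<delta>)\<bar>"
      unfolding eq using cospos by (simp add: abs_le_iff mult_ac)
    then show ?thesis unfolding k_def r_def by (rule power2_le_iff_abs_le[THEN iffD2, rotated] | simp add: abs_le_square_iff)+
  qed
  have "compact (h ` {0..1})" by (intro compact_continuous_image continuous_on_subset[OF h]) auto
  then obtain B where B: "\<And>x. x \<in> {0..1} \<Longrightarrow> norm (h x) \<le> B"
    by (meson compact_imp_bounded bounded_iff imageI)
  have B0: "B \<ge> 0" using order_trans[OF norm_ge_zero B[of 0]] by simp
  have ik: "integrable U01 (\<lambda>s. k s ^ N)" for N
    unfolding k_def by (intro integrable_U01_continuous continuous_intros)
  have key: "a * \<delta> * q ^ N \<le> (B + a) * r ^ N" for N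
  proof -
    define I where "I = (\<integral>s. k s ^ N \<partial>U01)"
    have i2: "integrable U01 (\<lambda>s. (h s - h x0) * complex_of_real (k s ^ N))"
      unfolding k_def by (intro integrable_U01_continuous continuous_intros h)
    have "(\<integral>s. (h s - h x0) * complex_of_real (k s ^ N) \<partial>U01) =
       (\<integral>s. h s * complex_of_real (k s ^ N) * E 0 s \<partial>U01) - h x0 * (\<integral>s. complex_of_real (k s ^ N) \<partial>U01)"
      using int[of N 0] ik[of N] by (simp add: E_def left_diff_distrib del: of_real_power)
    also have "\<dots> = - (h x0 * complex_of_real I)"
      unfolding zero I_def integral_complex_of_real by simp
    finally have "a * \<bar>I\<bar> = norm (\<integral>s. (h s - h x0) * complex_of_real (k s ^ N) \<partial>U01)"
      by (simp add: norm_mult a_def)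
    also have "\<dots> \<le> (\<integral>s. a / 2 * k s ^ N + (B + a) * r ^ N \<partial>U01)"
    proof (rule order_trans[OF integral_norm_bound integral_mono_AE])
      show "AE s in U01. norm ((h s - h x0) * complex_of_real (k s ^ N)) \<le> a / 2 * k s ^ N + (B + a) * r ^ N"
      proof (rule AE_uniform_measureI, simp, rule AE_I2, rule impI)
        fix s :: real assume s: "s \<in> {0..1}"
        have n: "norm ((h s - h x0) * complex_of_real (k s ^ N)) = norm (h s - h x0) * k s ^ N"
          using k01 by (simp add: norm_mult norm_power)
        show "norm ((h s - h x0) * complex_of_real (k s ^ N)) \<le> a / 2 * k s ^ N + (B + a) * r ^ N"
        proof (cases "\<bar>s - x0\<bar> < 2 * \<delta>")
          case True
          then have "norm (h s - h x0) \<le> a / 2" using \<delta>0(2)[of s] \<delta>(2) by auto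
          then have "norm (h s - h x0) * k s ^ N \<le> a / 2 * k s ^ N" using k01 by (intro mult_right_mono) auto
          then show ?thesis unfolding n using B0 a rq by (simp add: add_increasing2)
        next
          case False
          then have "k s ^ N \<le> r ^ N" using far s k01 by (intro power_mono) auto
          moreover have "norm (h s - h x0) \<le> B + a"
            unfolding a_def by (rule order_trans[OF norm_triangle_ineq4]) (use B[OF s] in simp)
          ultimately have "norm (h s - h x0) * k s ^ N \<le> (B + a) * r ^ N"
            using k01 B0 a by (intro mult_mono) auto
          then show ?thesis unfolding n using a k01 by (simp add: add_increasing)
        qed
      qed
    qed (use i2 ik[of N] in \<open>auto intro: integrable_norm\<close>)
    also have "\<dots> = a / 2 * I + (B + a) * r ^ N"
      using ik[of N] by (simp add: I_def U01.prob_space[unfolded space_U01])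
    finally have 1: "a * I \<le> a / 2 * I + (B + a) * r ^ N"
      using a abs_ge_self[of I] by (meson mult_left_mono less_imp_le order_trans)
    have "(\<integral>s. indicator {x0 - \<delta>..x0 + \<delta>} s * q ^ N \<partial>U01) \<le> I"
      unfolding I_def
    proof (rule integral_mono)
      show "integrable U01 (\<lambda>s. indicator {x0 - \<delta>..x0 + \<delta>} s * q ^ N)"
        by (intro U01.integrable_const_bound[of _ "\<bar>q\<bar> ^ N"]) (auto simp: indicator_def measurable_cong_sets[OF sets_U01 refl] power_abs)
      show "indicator {x0 - \<delta>..x0 + \<delta>} s * q ^ N \<le> k s ^ N" for s
        using near[of s] k01 rq by (auto simp: indicator_def intro!: power_mono)
    qed (rule ik)
    also have "(\<integral>s. indicator {x0 - \<delta>..x0 + \<delta>} s * q ^ N \<partial>U01) = 2 * \<delta> * q ^ N"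
    proof -
      have "(\<integral>s. indicator {x0 - \<delta>..x0 + \<delta>} s * q ^ N \<partial>U01) = (\<integral>s. indicator {0..1} s *\<^sub>R (indicator {x0 - \<delta>..x0 + \<delta>} s * q ^ N) \<partial>lborel)"
        by (rule integral_U01) measurable
      also have "\<dots> = (\<integral>s. indicator {x0 - \<delta>..x0 + \<delta>} s * q ^ N \<partial>lborel)"
        by (rule Bochner_Integration.integral_cong) (use \<delta> in \<open>auto simp: indicator_def\<close>)
      finally show ?thesis using \<delta> by simp
    qed
    finally have "2 * \<delta> * q ^ N \<le> I" .
    then have "a * (2 * \<delta> * q ^ N) \<le> a * I" using a by (intro mult_left_mono) auto
    moreover have "a * I \<le> 2 * ((B + a) * r ^ N)" using 1 by simp
    ultimately show ?thesis by simp
  qed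
  have "(\<lambda>N. (B + a) * (r / q) ^ N) \<longlonglongrightarrow> (B + a) * 0"
    using rq by (intro tendsto_mult tendsto_const LIMSEQ_power_zero) auto
  moreover have "a * \<delta> \<le> (B + a) * (r / q) ^ N" for N
    using key[of N] rq by (simp add: power_divide pos_le_divide_eq zero_less_power)
  ultimately have "a * \<delta> \<le> 0" by (intro LIMSEQ_le_const) auto
  then show False using a \<delta> by (simp add: mult_le_0_iff)
qed

lemma fourier_uniqueness_1:
  fixes h :: "real \<Rightarrow> complex"
  assumes h: "continuous_on UNIV h" and per: "\<And>x. h (x + 1) = h x"
    and coef: "\<And>m. (\<integral>s. h s / exp (2 * pi * \<i> * of_int m * complex_of_real s) \<partial>U01) = 0"
  shows "h x = 0"
proof -
  have *: "h y = 0" if "y \<in> {0..1}" for y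
  proof (rule continuous_constant_on_closure[of "{0<..<1}" h 0])
    show "continuous_on (closure {0<..<1}) h" by (rule continuous_on_subset[OF h]) auto
  qed (use fourier_uniqueness_1_interior[OF h coef] that in auto)
  have "h (frac x + of_int \<lfloor>x\<rfloor>) = h (frac x)" by (rule periodic_int_shift[of h, OF per])
  then show ?thesis using *[of "frac x"] frac_lt_1[of x] by (simp add: frac_def)
qed

text \<open>Induction on the dimension: the coefficients in the last variable are functions of the
  others all of whose coefficients vanish, hence zero, and then the one-dimensional case applies on
  each line. Continuity along coordinatewise sequences also encodes that \<open>D\<close> depends on
  the first \<open>g\<close> coordinates only.\<close>

lemma fourier_uniqueness:
  fixes D :: "(nat \<Rightarrow> real) \<Rightarrow> complex"
  assumes "\<And>X x. (\<And>i. i < g \<Longrightarrow> (\<lambda>k. X k i) \<longlonglongrightarrow> x i) \<Longrightarrow> (\<lambda>k. D (X k)) \<longlonglongrightarrow> D x"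
    and "D \<in> borel_measurable (PiM {..<g} (\<lambda>_. borel))"
    and "\<And>x. norm (D x) \<le> B"
    and "\<And>x i. i < g \<Longrightarrow> D (x(i := x i + 1)) = D x"
    and "\<And>n. n \<in> int_vecs g \<Longrightarrow> (\<integral>x. D x / fourier_char g n (cpx x) \<partial>unit_cube g) = 0"
  shows "D x = 0"
  using assms
proof (induction g arbitrary: D x)
  case 0
  \<comment> \<open>For g = 0 the convergence hypothesis is vacuous, so a constant sequence shows
    that \<open>D\<close> is constant.\<close>
  have "D x = D (\<lambda>_. undefined)"
    using 0(1)[of "\<lambda>_. \<lambda>_. undefined" x] by (simp add: LIMSEQ_const_iff)
  moreover have "(\<integral>x. D x / fourier_char 0 (0\<^sub>v 0) (cpx x) \<partial>unit_cube 0) = D (\<lambda>_. undefined)"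
    by (simp add: unit_cube_def PiM_empty lebesgue_integral_count_space_finite fourier_char_def)
  ultimately show ?case using 0(5)[OF zero_int_vecs] by metis
next
  case (Suc g)
  note cont = Suc.prems(1) and meas = Suc.prems(2) and bdd = Suc.prems(3) and per = Suc.prems(4) and coef = Suc.prems(5)
  have Bnn: "B \<ge> 0" using order_trans[OF norm_ge_zero bdd] by simp
  have ins: "{..<Suc g} = insert g {..<g}" by auto
  define E where "E m s = exp (2 * pi * \<i> * of_int m * complex_of_real s)" for m s
  have nE [simp]: "norm (E m s) = 1" for m s by (simp add: E_def)
  have contE: "continuous_on UNIV (E m)" for m unfolding E_def by (intro continuous_intros)
  then have mE [measurable]: "E m \<in> borel_measurable borel" for m by (rule borel_measurable_continuous_onI)
  have slice: "continuous_on UNIV (\<lambda>s. D (x(g := s)))" for x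
    unfolding continuous_on_sequentially
  proof (intro ballI allI impI)
    fix X :: "nat \<Rightarrow> real" and a assume "(\<forall>n. X n \<in> UNIV) \<and> X \<longlonglongrightarrow> a"
    then show "((\<lambda>s. D (x(g := s))) \<circ> X) \<longlonglongrightarrow> D (x(g := a))"
      unfolding o_def by (intro cont) auto
  qed
  then have mslice [measurable]: "(\<lambda>s. D (x(g := s))) \<in> borel_measurable borel" for x
    by (rule borel_measurable_continuous_onI)
  define H where "H m x = (\<integral>s. D (x(g := s)) / E m s \<partial>U01)" for m x
  have H0: "H m x = 0" for m x
  proof (rule Suc.IH)
    fix X :: "nat \<Rightarrow> nat \<Rightarrow> real" and x assume X: "\<And>i. i < g \<Longrightarrow> (\<lambda>k. X k i) \<longlonglongrightarrow> x i"
    show "(\<lambda>k. H m (X k)) \<longlonglongrightarrow> H m x"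
      unfolding H_def
    proof (rule integral_dominated_convergence[where w = "\<lambda>_. B"])
      show "AE s in U01. (\<lambda>k. D ((X k)(g := s)) / E m s) \<longlonglongrightarrow> D (x(g := s)) / E m s"
      proof (intro AE_I2 tendsto_divide tendsto_const cont)
        fix s i assume "i < Suc g"
        then show "(\<lambda>k. ((X k)(g := s)) i) \<longlonglongrightarrow> (x(g := s)) i" using X[of i] by (cases "i = g") auto
      qed (simp add: E_def)
    qed (use bdd in \<open>auto simp: norm_divide measurable_cong_sets[OF sets_U01 refl]\<close>)
  next
    have "(\<lambda>(x, s). D (x(g := s)) / E m s) \<in> borel_measurable (PiM {..<g} (\<lambda>_. borel) \<Otimes>\<^sub>M borel)"
    proof -
      have "(\<lambda>(x, s). x(g := s)) \<in> PiM {..<g} (\<lambda>_. borel) \<Otimes>\<^sub>M borel \<rightarrow>\<^sub>M PiM (insert g {..<g}) (\<lambda>_. borel :: real measure)"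
        by (rule measurable_add_dim)
      from measurable_compose[OF this meas[unfolded ins]] have "(\<lambda>p. D ((fst p)(g := snd p))) \<in> borel_measurable (PiM {..<g} (\<lambda>_. borel) \<Otimes>\<^sub>M borel)"
        by (simp only: case_prod_beta)
      then show ?thesis unfolding case_prod_beta
        by (intro borel_measurable_divide) (auto intro: measurable_compose[OF measurable_snd mE])
    qed
    then have "(\<lambda>(x, s). D (x(g := s)) / E m s) \<in> borel_measurable (PiM {..<g} (\<lambda>_. borel) \<Otimes>\<^sub>M U01)"
      unfolding measurable_cong_sets[OF sets_pair_measure_cong[OF refl sets_U01] refl] .
    then show "H m \<in> borel_measurable (PiM {..<g} (\<lambda>_. borel))"
      unfolding H_def by (rule U01.borel_measurable_lebesgue_integral)
  next
    show "norm (H m x) \<le> B" for x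
    proof -
      have "norm (H m x) \<le> (\<integral>s. norm (D (x(g := s)) / E m s) \<partial>U01)" unfolding H_def by (rule integral_norm_bound)
      also have "\<dots> \<le> (\<integral>s. B \<partial>U01)"
      proof (rule integral_mono)
        show "integrable U01 (\<lambda>s. norm (D (x(g := s)) / E m s))"
          by (rule U01.integrable_const_bound[of _ B]) (use bdd in \<open>auto simp: norm_divide measurable_cong_sets[OF sets_U01 refl]\<close>)
      qed (use bdd in \<open>auto simp: norm_divide\<close>)
      finally show ?thesis by (simp add: U01.prob_space[unfolded space_U01])
    qed
    show "H m (x(i := x i + 1)) = H m x" if "i < g" for x i
    proof -
      have "D ((x(i := x i + 1))(g := s)) = D (x(g := s))" for s
        using per[of i "x(g := s)"] that fun_upd_twist[of i g x "x i + 1" s]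
        by (metis fun_upd_other less_Suc_eq nat_neq_iff)
      then show ?thesis by (simp add: H_def del: fun_upd_apply)
    qed
    fix n assume n: "n \<in> int_vecs g"
    define n' where "n' = Matrix.vec (Suc g) (\<lambda>i. if i < g then vec_index n i else m)"
    have n': "n' \<in> int_vecs (Suc g)" by (simp add: n'_def int_vecs_def)
    have fc: "fourier_char (Suc g) n' (cpx (x(g := s))) = fourier_char g n (cpx x) * E m s" for x s
    proof -
      have "(\<Sum>i<g. of_int (vec_index n' i) * cpx (x(g := s)) i) = (\<Sum>i<g. of_int (vec_index n i) * cpx x i)"
        by (rule sum.cong) (auto simp: n'_def)
      then show ?thesis by (simp add: fourier_char_def E_def n'_def distrib_left exp_add mult_ac)
    qed
    have "0 = (\<integral>x. D x / fourier_char (Suc g) n' (cpx x) \<partial>unit_cube (Suc g))"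
      using coef[OF n'] by simp
    also have "\<dots> = (\<integral>x. (\<integral>s. D (x(g := s)) / fourier_char (Suc g) n' (cpx (x(g := s))) \<partial>U01) \<partial>unit_cube g)"
      unfolding unit_cube_def ins
    proof (rule cube_factors.product_integral_insert)
      interpret P: prob_space "PiM (insert g {..<g}) (\<lambda>_. U01)" by (rule prob_space_PiM) (rule prob_space_U01)
      have s: "sets (PiM (insert g {..<g}) (\<lambda>_. U01)) = sets (PiM {..<Suc g} (\<lambda>_. borel))"
        unfolding ins by (intro sets_PiM_cong) auto
      show "integrable (PiM (insert g {..<g}) (\<lambda>_. U01)) (\<lambda>x. D x / fourier_char (Suc g) n' (cpx x))"
      proof (rule P.integrable_const_bound[of _ B])
        show "(\<lambda>x. D x / fourier_char (Suc g) n' (cpx x)) \<in> borel_measurable (PiM (insert g {..<g}) (\<lambda>_. U01))"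
          unfolding measurable_cong_sets[OF s refl]
          by (intro borel_measurable_divide meas fourier_char_measurable) measurable
      qed (use bdd in \<open>simp add: norm_divide\<close>)
    qed auto
    also have "\<dots> = (\<integral>x. H m x / fourier_char g n (cpx x) \<partial>unit_cube g)"
      unfolding fc H_def by (simp add: mult.commute[of "fourier_char g n _"] flip: divide_divide_eq_left)
    finally show "(\<integral>x. H m x / fourier_char g n (cpx x) \<partial>unit_cube g) = 0" by simp
  qed
  have "D (x(g := x g)) = 0"
  proof (rule fourier_uniqueness_1[of "\<lambda>s. D (x(g := s))"])
    show "D (x(g := s + 1)) = D (x(g := s))" for s
      using per[of g "x(g := s)"] by (simp only: fun_upd_same fun_upd_upd lessI)
  qed (use slice H0 in \<open>auto simp: H_def E_def simp del: fun_upd_apply\<close>)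
  then show ?case by simp
qed

text \<open>The factors of the cube are measures on the whole line, so lying in [0,1] is a property
  of almost every point only.\<close>

lemma AE_unit_cube: "AE x in unit_cube g. \<forall>i<g. x i \<in> {0..1}"
proof -
  have "AE x in unit_cube g. \<forall>i\<in>{..<g}. x i \<in> {0..1}"
    unfolding unit_cube_def
  proof (rule AE_finite_allI)
    fix i assume i: "i \<in> {..<g}"
    have "AE s in U01. s \<in> {0..1}" by (rule AE_uniform_measureI) auto
    then show "AE x in PiM {..<g} (\<lambda>_. U01). x i \<in> {0..1}"
      using i by (intro AE_PiM_component[where P = "\<lambda>s. s \<in> {0..1}"] prob_space_U01) auto
  qed simp
  then show ?thesis by (auto elim: eventually_mono)
qed

text \<open>The domain of integration is moved back to the real torus in one coordinate after the
  other, each time by the one-dimensional contour shift.\<close>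

lemma integral_cube_shift_complex:
  fixes F :: "(nat \<Rightarrow> complex) \<Rightarrow> complex"
  assumes hol: "\<And>p d. (\<lambda>\<zeta>. F (\<lambda>i. p i + \<zeta> * d i)) holomorphic_on UNIV"
    and per: "\<And>z i. i < g \<Longrightarrow> F (z(i := z i + 1)) = F z"
    and int: "\<And>w. integrable (unit_cube g) (\<lambda>x. F (\<lambda>i. cpx x i + w i))"
    and dep: "\<And>z z'. (\<And>i. i < g \<Longrightarrow> z i = z' i) \<Longrightarrow> F z = F z'"
  shows "(\<integral>x. F (\<lambda>i. cpx x i + w i) \<partial>unit_cube g) = (\<integral>x. F (cpx x) \<partial>unit_cube g)"
proof -
  have one: "(\<integral>x. F (\<lambda>i. cpx x i + w i) \<partial>unit_cube g) = (\<integral>x. F (\<lambda>i. cpx x i + (w(j := 0)) i) \<partial>unit_cube g)"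
    if j: "j < g" for w j
  proof -
    have ins: "{..<g} = insert j ({..<g} - {j})" using j by auto
    let ?P = "PiM ({..<g} - {j}) (\<lambda>_. U01)"
    have split: "(\<integral>x. F (\<lambda>i. cpx x i + w i) \<partial>unit_cube g) = (\<integral>x. (\<integral>y. F (\<lambda>i. cpx (x(j := y)) i + w i) \<partial>U01) \<partial>?P)" for w
      unfolding unit_cube_def
      by (subst ins, rule cube_factors.product_integral_insert) (use int[of w] ins in \<open>auto simp: unit_cube_def\<close>)
    have "(\<integral>y. F (\<lambda>i. cpx (x(j := y)) i + w i) \<partial>U01) = (\<integral>y. F (\<lambda>i. cpx (x(j := y)) i + (w(j := 0)) i) \<partial>U01)" for x
    proof -
      define h where "h \<zeta> = F (\<lambda>i. ((\<lambda>i. cpx x i + w i)(j := 0)) i + \<zeta> * (if i = j then 1 else 0))" for \<zeta>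
      have h: "h \<zeta> = F ((\<lambda>i. cpx x i + w i)(j := \<zeta>))" for \<zeta>
        unfolding h_def by (rule arg_cong[where f = F]) auto
      have "(\<integral>y. h (complex_of_real y + w j) \<partial>U01) = (\<integral>y. h (complex_of_real y) \<partial>U01)"
      proof (rule integral_U01_shift_complex)
        show "h holomorphic_on UNIV" unfolding h_def by (rule hol)
        show "h (z + 1) = h z" for z
          using per[OF j, of "(\<lambda>i. cpx x i + w i)(j := z)"] by (simp add: h del: fun_upd_apply) (simp add: fun_upd_def)
      qed
      moreover have "F (\<lambda>i. cpx (x(j := y)) i + w i) = h (complex_of_real y + w j)" for y
        unfolding h by (rule arg_cong[where f = F]) auto
      moreover have "F (\<lambda>i. cpx (x(j := y)) i + (w(j := 0)) i) = h (complex_of_real y)" for y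
        unfolding h by (rule arg_cong[where f = F]) auto
      ultimately show ?thesis by simp
    qed
    then show ?thesis unfolding split by simp
  qed
  have "(\<integral>x. F (\<lambda>i. cpx x i + w i) \<partial>unit_cube g) = (\<integral>x. F (\<lambda>i. cpx x i + (if i < k then 0 else w i)) \<partial>unit_cube g)"
    if "k \<le> g" for k
    using that
  proof (induction k)
    case (Suc k)
    have "(\<lambda>i. if i < k then 0 else w i)(k := 0) = (\<lambda>i. if i < Suc k then 0 else w i)" by auto
    then show ?case using Suc one[of k "\<lambda>i. if i < k then 0 else w i"] by simp
  qed simp
  from this[of g] have "(\<integral>x. F (\<lambda>i. cpx x i + w i) \<partial>unit_cube g) = (\<integral>x. F (\<lambda>i. cpx x i + (if i < g then 0 else w i)) \<partial>unit_cube g)" by simp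
  also have "\<dots> = (\<integral>x. F (cpx x) \<partial>unit_cube g)"
    by (intro Bochner_Integration.integral_cong refl dep) auto
  finally show ?thesis .
qed

lemma fourier_char_periodic:
  assumes i: "i < g"
  shows "fourier_char g n (z(i := z i + 1)) = fourier_char g n z"
proof -
  have "(\<Sum>j<g. of_int (vec_index n j) * (z(i := z i + 1)) j) = (\<Sum>j<g. of_int (vec_index n j) * z j + (if j = i then of_int (vec_index n i) else 0))"
    by (intro sum.cong) (auto simp: algebra_simps)
  also have "\<dots> = (\<Sum>j<g. of_int (vec_index n j) * z j) + of_int (vec_index n i)"
    using i by (simp add: sum.distrib)
  finally show ?thesis
    using exp_integer_2pi[of "of_int (vec_index n i)"] by (simp add: fourier_char_def distrib_left exp_add mult_ac)
qed

lemma fourier_series_periodic: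
  "i < g \<Longrightarrow> fourier_series g b (z(i := z i + 1)) = fourier_series g b z"
  unfolding fourier_series_def by (simp only: fourier_char_periodic)

lemma fourier_char_cong:
  "(\<And>i. i < g \<Longrightarrow> z i = z' i) \<Longrightarrow> fourier_char g n z = fourier_char g n z'"
  by (simp add: fourier_char_def)

lemma fourier_series_cong:
  "(\<And>i. i < g \<Longrightarrow> z i = z' i) \<Longrightarrow> fourier_series g b z = fourier_series g b z'"
  by (simp add: fourier_series_def fourier_char_def)

text \<open>Carries bounds for periodic functions from the unit cube to all real points.\<close>

lemma periodic_frac:
  fixes D :: "(nat \<Rightarrow> real) \<Rightarrow> 'b"
  assumes per: "\<And>x i. i < g \<Longrightarrow> D (x(i := x i + 1)) = D x"
  shows "D x = D (\<lambda>i. if i < g then frac (x i) else x i)"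
proof -
  have "D x = D (\<lambda>i. if i < k then frac (x i) else x i)" if "k \<le> g" for k
    using that
  proof (induction k)
    case (Suc k)
    define y where "y = (\<lambda>i. if i < k then frac (x i) else x i)"
    have per': "D (y(k := s + 1)) = D (y(k := s))" for s
      using per[of k "y(k := s)"] Suc.prems by (simp only: fun_upd_same fun_upd_upd Suc_le_lessD)
    have "D (y(k := frac (x k) + of_int \<lfloor>x k\<rfloor>)) = D (y(k := frac (x k)))"
      by (rule periodic_int_shift[of "\<lambda>s. D (y(k := s))", OF per'])
    moreover have "y(k := frac (x k) + of_int \<lfloor>x k\<rfloor>) = y" by (auto simp: y_def frac_def)
    moreover have "y(k := frac (x k)) = (\<lambda>i. if i < Suc k then frac (x i) else x i)" by (auto simp: y_def)
    ultimately show ?case using Suc by (simp add: y_def)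
  qed simp
  from this[of g] show ?thesis by simp
qed

text \<open>Means over complex translates of the real torus agree. Translating by \<open>T\<close>
  applied to \<open>n\<close> and using quasi-periodicity turns the zeroth coefficient of
  \<open>f\<close> into the \<open>n\<close>-th one divided by \<open>b n\<close>, so all
  coefficients are determined by the zeroth.\<close>

lemma theta_uniqueness:
  fixes f :: "(nat \<Rightarrow> complex) \<Rightarrow> complex" and T :: "nat \<Rightarrow> nat \<Rightarrow> complex"
  assumes b: "gauss_bounded g C c b" and c: "c > 0"
    and bnz: "\<And>n. n \<in> int_vecs g \<Longrightarrow> b n \<noteq> 0"
    and hol: "\<And>p d. (\<lambda>\<zeta>. f (\<lambda>i. p i + \<zeta> * d i)) holomorphic_on UNIV"
    and cont: "\<And>X x. (\<And>i. i < g \<Longrightarrow> (\<lambda>k. X k i) \<longlonglongrightarrow> x i) \<Longrightarrow> (\<lambda>k. f (X k)) \<longlonglongrightarrow> f x"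
    and bd: "\<And>K. \<exists>B. \<forall>z. (\<forall>i<g. norm (z i) \<le> K) \<longrightarrow> norm (f z) \<le> B"
    and meas: "\<And>w. (\<lambda>x. f (\<lambda>i. cpx x i + w i)) \<in> borel_measurable (unit_cube g)"
    and per: "\<And>z i. i < g \<Longrightarrow> f (z(i := z i + 1)) = f z"
    and quasi: "\<And>z n. n \<in> int_vecs g \<Longrightarrow> f (\<lambda>i. z i + (\<Sum>j<g. T i j * of_int (vec_index n j))) = f z / (b n * fourier_char g n z)"
  shows "\<exists>c0. \<forall>z. f z = c0 * fourier_series g b z"
proof -
  have dep: "f z = f z'" if "\<And>i. i < g \<Longrightarrow> z i = z' i" for z z'
    using cont[of "\<lambda>_. z" z'] that by (simp add: LIMSEQ_const_iff)
  define F where "F k z = f z / fourier_char g k z" for k z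
  have Fm: "(\<lambda>x. F k (\<lambda>i. cpx x i + w i)) \<in> borel_measurable (unit_cube g)" for k w
    unfolding F_def by (intro borel_measurable_divide meas fourier_char_measurable) measurable
  have Fint: "integrable (unit_cube g) (\<lambda>x. F k (\<lambda>i. cpx x i + w i))" for k w
  proof -
    define K where "K = 1 + (\<Sum>i<g. norm (w i))"
    obtain B where B: "\<And>z. (\<And>i. i < g \<Longrightarrow> norm (z i) \<le> K) \<Longrightarrow> norm (f z) \<le> B" using bd[of K] by blast
    show ?thesis
    proof (rule cube.integrable_const_bound)
      show "AE x in unit_cube g. norm (F k (\<lambda>i. cpx x i + w i)) \<le> B / norm (fourier_char g k w)"
        using AE_unit_cube
      proof eventually_elim
        fix x :: "nat \<Rightarrow> real" assume x: "\<forall>i<g. x i \<in> {0..1}"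
        have "norm (f (\<lambda>i. cpx x i + w i)) \<le> B"
        proof (rule B)
          fix i assume i: "i < g"
          have "norm (w i) \<le> (\<Sum>i<g. norm (w i))" by (rule member_le_sum) (use i in auto)
          moreover have "norm (cpx x i + w i) \<le> norm (cpx x i) + norm (w i)" by (rule norm_triangle_ineq)
          ultimately show "norm (cpx x i + w i) \<le> K" using x i by (auto simp: K_def)
        qed
        then show "norm (F k (\<lambda>i. cpx x i + w i)) \<le> B / norm (fourier_char g k w)"
          by (simp add: F_def norm_divide fourier_char_add norm_mult divide_right_mono)
      qed
    qed (rule Fm)
  qed
  define cc where "cc k = (\<integral>x. F k (cpx x) \<partial>unit_cube g)" for k
  have shift: "(\<integral>x. F k (\<lambda>i. cpx x i + w i) \<partial>unit_cube g) = cc k" for k w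
    unfolding cc_def
  proof (rule integral_cube_shift_complex)
    show "(\<lambda>\<zeta>. F k (\<lambda>i. p i + \<zeta> * d i)) holomorphic_on UNIV" for p d
    proof -
      have "(\<lambda>\<zeta>. fourier_char g k (\<lambda>i. p i + \<zeta> * d i)) holomorphic_on UNIV"
        unfolding fourier_char_def by (intro holomorphic_intros)
      then show ?thesis unfolding F_def by (intro holomorphic_on_divide hol) auto
    qed
    show "F k (z(i := z i + 1)) = F k z" if "i < g" for z i
      using that by (simp only: F_def per fourier_char_periodic)
    show "F k z = F k z'" if "\<And>i. i < g \<Longrightarrow> z i = z' i" for z z'
      unfolding F_def using dep[OF that] fourier_char_cong[OF that] by simp
  qed (rule Fint)
  have cc: "cc n = b n * cc (0\<^sub>v g)" if n: "n \<in> int_vecs g" for n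
  proof -
    have "cc (0\<^sub>v g) = (\<integral>x. F (0\<^sub>v g) (\<lambda>i. cpx x i + (\<Sum>j<g. T i j * of_int (vec_index n j))) \<partial>unit_cube g)"
      using shift[of "0\<^sub>v g" "\<lambda>i. \<Sum>j<g. T i j * of_int (vec_index n j)"] by simp
    also have "\<dots> = (\<integral>x. F n (cpx x) / b n \<partial>unit_cube g)"
      unfolding F_def fourier_char_0 quasi[OF n] by (simp add: mult.commute)
    finally show ?thesis using bnz[OF n] by (simp add: cc_def)
  qed
  have "f z = cc (0\<^sub>v g) * fourier_series g b z" for z
  proof -
    \<comment> \<open>The difference is studied on the real torus through \<open>z\<close>; its
      value at the origin is the claim at \<open>z\<close>.\<close>
    define D where "D x = f (\<lambda>i. cpx x i + z i) - cc (0\<^sub>v g) * fourier_series g b (\<lambda>i. cpx x i + z i)" for x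
    have Dper: "D (x(i := x i + 1)) = D x" if "i < g" for x i
    proof -
      have "(\<lambda>j. cpx (x(i := x i + 1)) j + z j) = (\<lambda>j. cpx x j + z j)(i := (\<lambda>j. cpx x j + z j) i + 1)" by auto
      then show ?thesis
        unfolding D_def using per[OF that, of "\<lambda>j. cpx x j + z j"] fourier_series_periodic[OF that, of b "\<lambda>j. cpx x j + z j"]
        by (simp only:)
    qed
    define K where "K = 1 + (\<Sum>i<g. norm (z i))"
    obtain B1 where B1: "\<And>z. (\<And>i. i < g \<Longrightarrow> norm (z i) \<le> K) \<Longrightarrow> norm (f z) \<le> B1" using bd[of K] by blast
    define B2 where "B2 = C * exp (real g * ((2 * pi * K)\<^sup>2 / (2 * c))) * gauss_mass g (c / 2)"
    have Dbd: "norm (D x) \<le> B1 + norm (cc (0\<^sub>v g)) * B2" for x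
    proof -
      define y where "y i = (if i < g then frac (x i) else x i)" for i
      have zK: "norm (z i) \<le> K - 1" if "i < g" for i
        unfolding K_def using that by (auto intro!: member_le_sum)
      have y: "norm (cpx y i + z i) \<le> K" if "i < g" for i
      proof -
        have "norm (cpx y i + z i) \<le> norm (cpx y i) + norm (z i)" by (rule norm_triangle_ineq)
        moreover have "norm (cpx y i) \<le> 1" using that frac_lt_1[of "x i"] by (simp add: y_def)
        ultimately show ?thesis using zK[OF that] by linarith
      qed
      have "D x = D y" using periodic_frac[of g D x, OF Dper] by (simp add: y_def[abs_def])
      also have "norm (D y) \<le> norm (f (\<lambda>i. cpx y i + z i)) + norm (cc (0\<^sub>v g)) * norm (fourier_series g b (\<lambda>i. cpx y i + z i))"
        unfolding D_def norm_mult[symmetric] by (rule norm_triangle_ineq4)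
      also have "\<dots> \<le> B1 + norm (cc (0\<^sub>v g)) * B2"
      proof (intro add_mono mult_left_mono B1 y)
        show "norm (fourier_series g b (\<lambda>i. cpx y i + z i)) \<le> B2"
          unfolding B2_def by (rule norm_fourier_series_le[OF b c]) (rule order_trans[OF abs_Im_le_cmod y])
      qed auto
      finally show ?thesis .
    qed
    have "D (\<lambda>_. 0) = 0"
    proof (rule fourier_uniqueness[of g D "B1 + norm (cc (0\<^sub>v g)) * B2"])
      fix X :: "nat \<Rightarrow> nat \<Rightarrow> real" and x assume X: "\<And>i. i < g \<Longrightarrow> (\<lambda>k. X k i) \<longlonglongrightarrow> x i"
      show "(\<lambda>k. D (X k)) \<longlonglongrightarrow> D x"
        unfolding D_def
      proof (intro tendsto_diff tendsto_mult tendsto_const cont tendsto_add tendsto_of_real X)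
        show "(\<lambda>k. fourier_series g b (\<lambda>i. cpx (X k) i + z i)) \<longlonglongrightarrow> fourier_series g b (\<lambda>i. cpx x i + z i)"
        proof (rule fourier_series_tendsto[OF b c, where K = K])
          show "\<bar>Im (cpx (X k) i + z i)\<bar> \<le> K" if "i < g" for k i
          proof -
            have "norm (z i) \<le> (\<Sum>i<g. norm (z i))" by (rule member_le_sum) (use that in auto)
            then show ?thesis using abs_Im_le_cmod[of "z i"] by (simp add: K_def)
          qed
        qed (auto intro!: tendsto_intros X)
      qed
    next
      show "D \<in> borel_measurable (PiM {..<g} (\<lambda>_. borel))"
        unfolding measurable_cong_sets[OF sets_unit_cube[symmetric] refl] D_def
        by (intro borel_measurable_diff borel_measurable_times meas borel_measurable_const fourier_series_measurable) measurable
    next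
      fix n assume n: "n \<in> int_vecs g"
      have i2: "integrable (unit_cube g) (\<lambda>x. fourier_series g b (\<lambda>i. cpx x i + z i) / fourier_char g n (\<lambda>i. cpx x i + z i))"
      proof (rule cube.integrable_const_bound[of _ "B2 / norm (fourier_char g n z)"])
        have "norm (fourier_series g b (\<lambda>i. cpx x i + z i)) \<le> B2" for x
          unfolding B2_def
        proof (rule norm_fourier_series_le[OF b c])
          fix i assume "i < g"
          then have "norm (z i) \<le> (\<Sum>i<g. norm (z i))" by (intro member_le_sum) auto
          then show "\<bar>Im (cpx x i + z i)\<bar> \<le> K" using abs_Im_le_cmod[of "z i"] by (simp add: K_def)
        qed
        then show "AE x in unit_cube g. norm (fourier_series g b (\<lambda>i. cpx x i + z i) / fourier_char g n (\<lambda>i. cpx x i + z i)) \<le> B2 / norm (fourier_char g n z)"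
          by (simp add: norm_divide fourier_char_add norm_mult divide_right_mono)
      qed (intro borel_measurable_divide fourier_series_measurable fourier_char_measurable; measurable)
      have "D x / fourier_char g n (cpx x) = fourier_char g n z * (F n (\<lambda>i. cpx x i + z i) -
          cc (0\<^sub>v g) * (fourier_series g b (\<lambda>i. cpx x i + z i) / fourier_char g n (\<lambda>i. cpx x i + z i)))" for x
        by (simp add: D_def F_def fourier_char_add diff_divide_distrib right_diff_distrib)
      then have "(\<integral>x. D x / fourier_char g n (cpx x) \<partial>unit_cube g) = fourier_char g n z * (cc n - cc (0\<^sub>v g) * b n)"
        by (simp only: integral_mult_right_zero Bochner_Integration.integral_diff[OF Fint integrable_mult_right[OF i2]]
            shift integral_fourier_series_coeff[OF b c n])
      then show "(\<integral>x. D x / fourier_char g n (cpx x) \<partial>unit_cube g) = 0"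
        using cc[OF n] by simp
    qed (use Dbd Dper in auto)
    then show ?thesis by (simp add: D_def)
  qed
  then show ?thesis by blast
qed

subsection \<open>Theta functions in real coordinates\<close>

abbreviation zr :: "int Matrix.vec \<Rightarrow> nat \<Rightarrow> real" where
  "zr n \<equiv> \<lambda>i. real_of_int (vec_index n i)"

abbreviation zc :: "int Matrix.vec \<Rightarrow> nat \<Rightarrow> complex" where
  "zc n \<equiv> \<lambda>i. of_int (vec_index n i)"

text \<open>Coefficients of the theta function with real characteristic \<open>v\<close>; for v = 0
  those of the Riemann theta function.\<close>

definition section_coeff :: "nat \<Rightarrow> complex mat \<Rightarrow> (nat \<Rightarrow> real) \<Rightarrow> int Matrix.vec \<Rightarrow> complex" where
  "section_coeff g \<tau> v n = exp (pi * \<i> * bform g \<tau> (\<lambda>i. zc n i + cpx v i) (\<lambda>i. zc n i + cpx v i))"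

text \<open>The theta function as a section over the torus in the real coordinates \<open>z = x + \<tau>v\<close>: the
  factor \<open>exp(\<pi>i v\<^sup>T\<tau>v)\<close> absorbs the metric, so that \<open>\<parallel>\<theta>\<parallel>\<^sup>2\<close> is the squared modulus up to \<open>(det Im \<tau>)\<^sup>1\<^sup>/\<^sup>2\<close>.\<close>
definition theta_section :: "nat \<Rightarrow> complex mat \<Rightarrow> (nat \<Rightarrow> real) \<Rightarrow> (nat \<Rightarrow> real) \<Rightarrow> complex" where
  "theta_section g \<tau> v x = fourier_series g (section_coeff g \<tau> v) (cpx x)"

abbreviation torus_point :: "nat \<Rightarrow> complex mat \<Rightarrow> (nat \<Rightarrow> real) \<Rightarrow> (nat \<Rightarrow> real) \<Rightarrow> complex Matrix.vec" where
  "torus_point g \<tau> x y \<equiv> Matrix.vec g (\<lambda>i. complex_of_real (x i)) + \<tau> *\<^sub>v Matrix.vec g (\<lambda>i. complex_of_real (y i))"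

lemma siegelD:
  assumes "\<tau> \<in> siegel g"
  shows "\<tau> \<in> carrier_mat g g" "transpose_mat \<tau> = \<tau>" "pos_def_mat g (map_mat Im \<tau>)"
    "map_mat Im \<tau> \<in> carrier_mat g g" "transpose_mat (map_mat Im \<tau>) = map_mat Im \<tau>"
  using assms by (auto simp: siegel_def pos_def_mat_def)

lemma Im_bform_cpx:
  assumes "\<tau> \<in> carrier_mat g g"
  shows "Im (bform g \<tau> (cpx x) (cpx y)) = bform g (map_mat Im \<tau>) x y"
  using assms by (simp add: bform_def mult_ac)

lemma norm_section_coeff:
  assumes "\<tau> \<in> carrier_mat g g"
  shows "norm (section_coeff g \<tau> v n) = exp (- pi * bform g (map_mat Im \<tau>) (\<lambda>i. zr n i + v i) (\<lambda>i. zr n i + v i))"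
  using Im_bform_cpx[OF assms, of "\<lambda>i. zr n i + v i" "\<lambda>i. zr n i + v i"]
  by (simp add: section_coeff_def)

lemma section_coeff_gauss_bounded:
  assumes t: "\<tau> \<in> siegel g"
  shows "\<exists>C c. c > 0 \<and> gauss_bounded g C c (section_coeff g \<tau> v)"
proof -
  obtain c where c: "c > 0" "\<And>x. c * (\<Sum>i<g. (x i)\<^sup>2) \<le> bform g (map_mat Im \<tau>) x x"
    using pos_def_mat_coercive[OF siegelD(3)[OF t]] by blast
  have "norm (section_coeff g \<tau> v n) \<le> exp (pi * c * (\<Sum>i<g. (v i)\<^sup>2)) * exp (- (pi * c / 2) * nsq g n)" for n
  proof -
    have "(\<Sum>i<g. (zr n i)\<^sup>2 / 2 - (v i)\<^sup>2) \<le> (\<Sum>i<g. (zr n i + v i)\<^sup>2)"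
    proof (rule sum_mono)
      fix i
      have "0 \<le> (zr n i + 2 * v i)\<^sup>2" by simp
      then show "(zr n i)\<^sup>2 / 2 - (v i)\<^sup>2 \<le> (zr n i + v i)\<^sup>2" by (simp add: power2_eq_square algebra_simps)
    qed
    then have "c * (nsq g n / 2 - (\<Sum>i<g. (v i)\<^sup>2)) \<le> c * (\<Sum>i<g. (zr n i + v i)\<^sup>2)"
      using c(1) by (intro mult_left_mono) (auto simp: sum_subtractf sum_divide_distrib)
    also have "\<dots> \<le> bform g (map_mat Im \<tau>) (\<lambda>i. zr n i + v i) (\<lambda>i. zr n i + v i)" by (rule c(2))
    finally have "pi * (c * (nsq g n / 2 - (\<Sum>i<g. (v i)\<^sup>2))) \<le> pi * bform g (map_mat Im \<tau>) (\<lambda>i. zr n i + v i) (\<lambda>i. zr n i + v i)"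
      by (intro mult_left_mono) auto
    then show ?thesis
      unfolding norm_section_coeff[OF siegelD(1)[OF t]] by (simp add: algebra_simps flip: exp_add)
  qed
  then show ?thesis unfolding gauss_bounded_def using c(1)
    by (intro exI[of _ "exp (pi * c * (\<Sum>i<g. (v i)\<^sup>2))"] exI[of _ "pi * c / 2"]) auto
qed

lemma integral_int_vecs_shift:
  fixes F :: "int Matrix.vec \<Rightarrow> complex"
  assumes k: "k \<in> int_vecs g"
  shows "(\<integral>n. F (n + k) \<partial>count_space (int_vecs g)) = (\<integral>n. F n \<partial>count_space (int_vecs g))"
proof (rule integral_bij_count_space)
  show "bij_betw (\<lambda>n. n + k) (int_vecs g) (int_vecs g)"
    by (rule bij_betwI[where g = "\<lambda>n. n - k"]) (use k in \<open>auto simp: int_vecs_def\<close>)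
qed

text \<open>Shifting the summation index moves an integer vector from the frequency to the
  characteristic and leaves a character of modulus 1. Any representative of \<open>v\<close> modulo
  integers may therefore be used, in particular a closest one.\<close>

lemma theta_section_shift:
  assumes k: "k \<in> int_vecs g"
  shows "norm (theta_section g \<tau> (\<lambda>i. v i + zr k i) x) = norm (theta_section g \<tau> v x)"
proof -
  have "theta_section g \<tau> v x = (\<integral>n. section_coeff g \<tau> v (n + k) * fourier_char g (n + k) (cpx x) \<partial>count_space (int_vecs g))"
    unfolding theta_section_def fourier_series_def by (rule integral_int_vecs_shift[OF k, symmetric])
  also have "\<dots> = (\<integral>n. fourier_char g k (cpx x) * (section_coeff g \<tau> (\<lambda>i. v i + zr k i) n * fourier_char g n (cpx x)) \<partial>count_space (int_vecs g))"
  proof (rule Bochner_Integration.integral_cong)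
    fix n assume "n \<in> space (count_space (int_vecs g))"
    then have n: "n \<in> int_vecs g" by simp
    have "section_coeff g \<tau> v (n + k) = section_coeff g \<tau> (\<lambda>i. v i + zr k i) n"
      unfolding section_coeff_def using n k
      by (intro arg_cong[where f = exp] arg_cong2[where f = "(*)"] refl bform_cong) (auto simp: int_vecs_def)
    moreover have "fourier_char g (n + k) (cpx x) = fourier_char g n (cpx x) * fourier_char g k (cpx x)"
      using n k by (auto simp: fourier_char_def int_vecs_def distrib_right distrib_left sum.distrib exp_add)
    ultimately show "section_coeff g \<tau> v (n + k) * fourier_char g (n + k) (cpx x) =
        fourier_char g k (cpx x) * (section_coeff g \<tau> (\<lambda>i. v i + zr k i) n * fourier_char g n (cpx x))" by simp
  qed simp
  also have "\<dots> = fourier_char g k (cpx x) * theta_section g \<tau> (\<lambda>i. v i + zr k i) x"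
    unfolding theta_section_def fourier_series_def by (rule integral_mult_right_zero)
  finally show ?thesis by (simp add: norm_mult)
qed

lemma riemann_theta_eq:
  assumes t: "\<tau> \<in> siegel g" and z: "z \<in> carrier_vec g"
  shows "riemann_theta g \<tau> z = fourier_series g (section_coeff g \<tau> (\<lambda>_. 0)) (vec_index z)"
proof -
  obtain C c where c: "c > 0" "gauss_bounded g C c (section_coeff g \<tau> (\<lambda>_. 0))"
    using section_coeff_gauss_bounded[OF t] by blast
  have "riemann_theta g \<tau> z = (\<Sum>\<^sub>\<infinity>n\<in>int_vecs g. section_coeff g \<tau> (\<lambda>_. 0) n * fourier_char g n (vec_index z))"
    unfolding riemann_theta_def Let_def
  proof (rule infsum_cong)
    fix n assume n: "n \<in> int_vecs g"
    then have n': "map_vec of_int n \<in> (carrier_vec g :: complex Matrix.vec set)" by (simp add: int_vecs_def)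
    have "scalar_prod (map_vec of_int n) (\<tau> *\<^sub>v map_vec of_int n) = bform g \<tau> (zc n) (zc n)"
      unfolding scalar_prod_mult_mat_vec[OF siegelD(1)[OF t] n' n']
      using n by (intro bform_cong) (auto simp: int_vecs_def)
    moreover have "scalar_prod (map_vec of_int n) z = (\<Sum>i<g. zc n i * vec_index z i)"
      using n z by (auto simp: scalar_prod_def int_vecs_def atLeast0LessThan intro!: sum.cong)
    ultimately show "exp (pi * \<i> * scalar_prod (map_vec of_int n) (\<tau> *\<^sub>v map_vec of_int n) + 2 * pi * \<i> * scalar_prod (map_vec of_int n) z)
        = section_coeff g \<tau> (\<lambda>_. 0) n * fourier_char g n (vec_index z)"
      by (simp add: section_coeff_def fourier_char_def exp_add)
  qed
  also have "\<dots> = fourier_series g (section_coeff g \<tau> (\<lambda>_. 0)) (vec_index z)"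
    by (rule infsum_eq_fourier_series[OF c(2,1)])
  finally show ?thesis .
qed

text \<open>Ensures that \<open>the\<close> in the definition of \<open>mat_inv\<close> meets a
  genuine inverse.\<close>

lemma mat_inv_pos_def:
  assumes "pos_def_mat g A"
  shows "mat_inv A \<in> carrier_mat g g" "mat_inv A * A = 1\<^sub>m g" "A * mat_inv A = 1\<^sub>m g"
proof -
  have A: "A \<in> carrier_mat g g" using assms by (simp add: pos_def_mat_def)
  have "A \<in> Units (ring_mat TYPE(real) g ())"
    using pos_def_mat_det_pos[OF assms] by (intro det_non_zero_imp_unit[OF A]) auto
  then obtain B where B: "mat_inverse A = Some B"
    using mat_inverse(1)[OF A, of "()"] by (cases "mat_inverse A") auto
  from mat_inverse(2)[OF A B] show "mat_inv A \<in> carrier_mat g g" "mat_inv A * A = 1\<^sub>m g" "A * mat_inv A = 1\<^sub>m g"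
    by (simp_all add: mat_inv_def B)
qed

lemma index_torus_point:
  assumes "\<tau> \<in> carrier_mat g g" "i < g"
  shows "vec_index (torus_point g \<tau> x y) i = complex_of_real (x i) + (\<Sum>j<g. \<tau> $$ (i, j) * complex_of_real (y j))"
  using assms by (auto simp: scalar_prod_def atLeast0LessThan intro!: sum.cong)

lemma fourier_char_tau:
  "fourier_char g n (\<lambda>i. \<Sum>j<g. \<tau> $$ (i, j) * w j) = exp (2 * pi * \<i> * bform g \<tau> (zc n) w)"
  by (simp add: fourier_char_def bform_def sum_distrib_left mult.assoc)

lemma section_coeff_expand:
  assumes "\<tau> \<in> carrier_mat g g" "transpose_mat \<tau> = \<tau>"
  shows "section_coeff g \<tau> v n = exp (pi * \<i> * bform g \<tau> (cpx v) (cpx v)) *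
      (section_coeff g \<tau> (\<lambda>_. 0) n * exp (2 * pi * \<i> * bform g \<tau> (zc n) (cpx v)))"
proof -
  have "bform g \<tau> (\<lambda>i. zc n i + cpx v i) (\<lambda>i. zc n i + cpx v i) =
      bform g \<tau> (cpx v) (cpx v) + (bform g \<tau> (zc n) (zc n) + 2 * bform g \<tau> (zc n) (cpx v))"
    using bform_sym[OF assms, of "cpx v" "zc n"] by (simp add: bform_add_left bform_add_right)
  then show ?thesis by (simp add: section_coeff_def algebra_simps flip: exp_add)
qed

lemma theta_section_eq_riemann_theta:
  assumes t: "\<tau> \<in> siegel g"
  shows "theta_section g \<tau> y x = exp (pi * \<i> * bform g \<tau> (cpx y) (cpx y)) * riemann_theta g \<tau> (torus_point g \<tau> x y)"
proof -
  have p: "torus_point g \<tau> x y \<in> carrier_vec g" using siegelD(1)[OF t] by auto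
  have "section_coeff g \<tau> (\<lambda>_. 0) n * fourier_char g n (vec_index (torus_point g \<tau> x y)) =
      section_coeff g \<tau> (\<lambda>_. 0) n * exp (2 * pi * \<i> * bform g \<tau> (zc n) (cpx y)) * fourier_char g n (cpx x)" for n
  proof -
    have "fourier_char g n (vec_index (torus_point g \<tau> x y)) = fourier_char g n (\<lambda>i. cpx x i + (\<Sum>j<g. \<tau> $$ (i, j) * cpx y j))"
      by (rule fourier_char_cong) (rule index_torus_point[OF siegelD(1)[OF t]])
    then show ?thesis by (simp add: fourier_char_add fourier_char_tau)
  qed
  then show ?thesis
    unfolding riemann_theta_eq[OF t p] theta_section_def fourier_series_def section_coeff_expand[OF siegelD(1,2)[OF t], of y]
    by (simp only: mult.assoc integral_mult_right_zero)
qed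

text \<open>For z = x + \<tau> y the imaginary part of z is (Im \<tau>) y, so the metric exponent
  becomes the form of Im \<tau> at y. Its exponential is the squared modulus of the factor built
  into \<open>theta_section\<close>.\<close>

lemma norm_theta_sq_torus_point:
  assumes t: "\<tau> \<in> siegel g"
  shows "norm_theta_sq g \<tau> (torus_point g \<tau> x y) = sqrt (Determinant.det (map_mat Im \<tau>)) * (norm (theta_section g \<tau> y x))\<^sup>2"
proof -
  note c = siegelD[OF t]
  note inv = mat_inv_pos_def[OF c(3)]
  define yv where "yv = Matrix.vec g y"
  have yv: "yv \<in> carrier_vec g" by (simp add: yv_def)
  have Im: "map_vec Im (torus_point g \<tau> x y) = map_mat Im \<tau> *\<^sub>v yv"
    using c(1) by (intro eq_vecI) (auto simp: scalar_prod_def yv_def intro!: sum.cong)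
  have "scalar_prod (map_mat Im \<tau> *\<^sub>v yv) (mat_inv (map_mat Im \<tau>) *\<^sub>v (map_mat Im \<tau> *\<^sub>v yv)) = scalar_prod (map_mat Im \<tau> *\<^sub>v yv) yv"
    using inv c(4) yv by (simp add: assoc_mult_mat_vec[symmetric])
  also have "\<dots> = scalar_prod yv (map_mat Im \<tau> *\<^sub>v yv)"
    using c(4) yv by (intro comm_scalar_prod[of _ g]) auto
  also have "\<dots> = bform g (map_mat Im \<tau>) y y"
    unfolding scalar_prod_mult_mat_vec[OF c(4) yv yv] by (rule bform_cong) (auto simp: yv_def)
  finally have "norm_theta_sq g \<tau> (torus_point g \<tau> x y) = sqrt (Determinant.det (map_mat Im \<tau>)) *
      (exp (- 2 * pi * bform g (map_mat Im \<tau>) y y) * (cmod (riemann_theta g \<tau> (torus_point g \<tau> x y)))\<^sup>2)"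
    by (simp add: norm_theta_sq_def Let_def Im)
  also have "exp (- 2 * pi * bform g (map_mat Im \<tau>) y y) * (cmod (riemann_theta g \<tau> (torus_point g \<tau> x y)))\<^sup>2 = (norm (theta_section g \<tau> y x))\<^sup>2"
  proof -
    have "norm (exp (pi * \<i> * bform g \<tau> (cpx y) (cpx y))) ^ 2 = exp (- 2 * pi * bform g (map_mat Im \<tau>) y y)"
      using Im_bform_cpx[OF c(1), of y y] by (simp add: exp_double[symmetric] power2_eq_square flip: exp_add)
    then show ?thesis
      unfolding theta_section_eq_riemann_theta[OF t] norm_mult power_mult_distrib by simp
  qed
  finally show ?thesis .
qed

section \<open>The mean of the squared norm of theta\<close>

lemma theta_section_measurable:
  "(\<lambda>p. theta_section g \<tau> (snd p) (fst p)) \<in> borel_measurable (unit_cube g \<Otimes>\<^sub>M unit_cube g)"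
proof -
  have f: "(\<lambda>p. fst p i) \<in> borel_measurable (unit_cube g \<Otimes>\<^sub>M unit_cube g)"
    and s: "(\<lambda>p. snd p i) \<in> borel_measurable (unit_cube g \<Otimes>\<^sub>M unit_cube g)" if "i < g" for i
    using that by (auto intro: measurable_compose[OF measurable_fst component_measurable_unit_cube] measurable_compose[OF measurable_snd component_measurable_unit_cube])
  have "(\<lambda>(p, n). section_coeff g \<tau> (snd p) n * fourier_char g n (cpx (fst p))) \<in> borel_measurable ((unit_cube g \<Otimes>\<^sub>M unit_cube g) \<Otimes>\<^sub>M count_space (int_vecs g))"
  proof (subst measurable_pair_swap_iff, rule measurable_pair_measure_countable1)
    fix n
    have "(\<lambda>p. section_coeff g \<tau> (snd p) n * fourier_char g n (cpx (fst p))) \<in> borel_measurable (unit_cube g \<Otimes>\<^sub>M unit_cube g)"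
      unfolding section_coeff_def bform_def fourier_char_def
      by (intro borel_measurable_times borel_measurable_exp[THEN measurable_compose[rotated]] borel_measurable_sum borel_measurable_add borel_measurable_const
          borel_measurable_of_real[THEN measurable_compose[rotated]] f s measurable_compose[OF _ borel_measurable_of_real]) auto
    then show "(\<lambda>y. (\<lambda>(x, y). (\<lambda>(p, n). section_coeff g \<tau> (snd p) n * fourier_char g n (cpx (fst p))) (y, x)) (n, y)) \<in> borel_measurable (unit_cube g \<Otimes>\<^sub>M unit_cube g)"
      by simp
  qed simp
  from int_vecs.borel_measurable_lebesgue_integral[OF this] show ?thesis
    unfolding theta_section_def fourier_series_def by simp
qed

interpretation cube2: pair_prob_space "unit_cube g" "unit_cube g" for g
  by (intro pair_prob_space.intro pair_sigma_finite.intro prob_space_imp_sigma_finite prob_space_unit_cube)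

lemma theta_section_measurable_x:
  "(\<lambda>x. theta_section g \<tau> v x) \<in> borel_measurable (unit_cube g)"
  unfolding theta_section_def by (rule fourier_series_measurable) measurable

lemma theta_section_parseval:
  assumes t: "\<tau> \<in> siegel g"
  shows "(\<integral>\<^sup>+x. ennreal ((norm (theta_section g \<tau> v x))\<^sup>2) \<partial>unit_cube g) =
    (\<integral>\<^sup>+n. ennreal (exp (- 2 * pi * bform g (map_mat Im \<tau>) (\<lambda>i. v i + zr n i) (\<lambda>i. v i + zr n i))) \<partial>count_space (int_vecs g))"
proof -
  obtain C c where c: "c > 0" "gauss_bounded g C c (section_coeff g \<tau> v)"
    using section_coeff_gauss_bounded[OF t] by blast
  have n2: "(norm (section_coeff g \<tau> v n))\<^sup>2 = exp (- 2 * pi * bform g (map_mat Im \<tau>) (\<lambda>i. v i + zr n i) (\<lambda>i. v i + zr n i))" for n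
    unfolding norm_section_coeff[OF siegelD(1)[OF t]] by (simp add: add.commute power2_eq_square flip: exp_add)
  have "integrable (unit_cube g) (\<lambda>x. (norm (theta_section g \<tau> v x))\<^sup>2)"
  proof (rule cube.integrable_const_bound)
    show "AE x in unit_cube g. norm ((norm (theta_section g \<tau> v x))\<^sup>2) \<le> (C * gauss_mass g (c / 2))\<^sup>2"
      unfolding theta_section_def using norm_fourier_series_cpx_le[OF c(2,1)] by (auto intro!: power_mono)
  qed (intro borel_measurable_power measurable_compose[OF theta_section_measurable_x borel_measurable_norm])
  then have "(\<integral>\<^sup>+x. ennreal ((norm (theta_section g \<tau> v x))\<^sup>2) \<partial>unit_cube g) = ennreal (\<integral>x. (norm (theta_section g \<tau> v x))\<^sup>2 \<partial>unit_cube g)"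
    by (rule nn_integral_eq_integral) simp
  also have "(\<integral>x. (norm (theta_section g \<tau> v x))\<^sup>2 \<partial>unit_cube g) = (\<integral>n. (norm (section_coeff g \<tau> v n))\<^sup>2 \<partial>count_space (int_vecs g))"
    unfolding theta_section_def by (rule fourier_series_parseval[OF c(2,1)])
  also have "ennreal \<dots> = (\<integral>\<^sup>+n. ennreal ((norm (section_coeff g \<tau> v n))\<^sup>2) \<partial>count_space (int_vecs g))"
  proof (rule nn_integral_eq_integral[symmetric])
    show "integrable (count_space (int_vecs g)) (\<lambda>n. (norm (section_coeff g \<tau> v n))\<^sup>2)"
    proof (rule Bochner_Integration.integrable_bound)
      show "integrable (count_space (int_vecs g)) (\<lambda>n. C\<^sup>2 * exp (- (2 * c) * nsq g n))"
        using c by (intro integrable_mult_right integrable_gauss_weight) auto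
      show "AE n in count_space (int_vecs g). norm ((norm (section_coeff g \<tau> v n))\<^sup>2) \<le> norm (C\<^sup>2 * exp (- (2 * c) * nsq g n))"
      proof (rule AE_I2)
        fix n assume "n \<in> space (count_space (int_vecs g))"
        then have "(norm (section_coeff g \<tau> v n))\<^sup>2 \<le> (C * exp (- c * nsq g n))\<^sup>2"
          by (intro power_mono gauss_boundedD[OF c(2)]) auto
        also have "\<dots> = C\<^sup>2 * exp (- (2 * c) * nsq g n)"
          by (simp add: power_mult_distrib power2_eq_square flip: exp_add)
        finally show "norm ((norm (section_coeff g \<tau> v n))\<^sup>2) \<le> norm (C\<^sup>2 * exp (- (2 * c) * nsq g n))" by simp
      qed
    qed simp
  qed simp
  finally show ?thesis unfolding n2 .
qed

text \<open>Parseval in x leaves a lattice sum of Gaussians in y, which unfolds to a Gaussian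
  integral over the whole space. Its determinant is the one that cancels against the metric
  factor.\<close>

lemma nn_integral_norm_theta_sq:
  assumes t: "\<tau> \<in> siegel g"
  shows "(\<integral>\<^sup>+p. ennreal ((norm (theta_section g \<tau> (snd p) (fst p)))\<^sup>2) \<partial>(unit_cube g \<Otimes>\<^sub>M unit_cube g)) =
    ennreal (1 / sqrt (2 ^ g * Determinant.det (map_mat Im \<tau>)))"
proof -
  let ?Y = "map_mat Im \<tau>"
  define h where "h x = ennreal (exp (- 2 * pi * bform g ?Y x x))" for x
  have hm: "h \<in> borel_measurable (PiM {..<g} (\<lambda>_. borel))"
    unfolding h_def by (intro measurable_compose[OF _ measurable_ennreal] borel_measurable_exp[THEN measurable_compose[rotated]] borel_measurable_times
        bform_measurable borel_measurable_const measurable_component_singleton) auto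
  have h_cong: "h x = h y" if "\<And>i. i < g \<Longrightarrow> x i = y i" for x y
    unfolding h_def using bform_cong[of g x y x y] that by simp
  have "(\<integral>\<^sup>+p. ennreal ((norm (theta_section g \<tau> (snd p) (fst p)))\<^sup>2) \<partial>(unit_cube g \<Otimes>\<^sub>M unit_cube g)) =
     (\<integral>\<^sup>+y. (\<integral>\<^sup>+x. ennreal ((norm (theta_section g \<tau> y x))\<^sup>2) \<partial>unit_cube g) \<partial>unit_cube g)"
    by (subst cube2.nn_integral_snd[symmetric])
      (auto intro!: measurable_compose[OF _ measurable_ennreal] borel_measurable_power measurable_compose[OF theta_section_measurable borel_measurable_norm])
  also have "\<dots> = (\<integral>\<^sup>+y. (\<integral>\<^sup>+n. h (\<lambda>i\<in>{..<g}. y i + zr n i) \<partial>count_space (int_vecs g)) \<partial>unit_cube g)"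
    unfolding theta_section_parseval[OF t] by (intro nn_integral_cong) (auto simp: h_def intro!: arg_cong[where f = exp] bform_cong)
  also have "\<dots> = (\<integral>\<^sup>+n. (\<integral>\<^sup>+y. h (\<lambda>i\<in>{..<g}. y i + zr n i) \<partial>unit_cube g) \<partial>count_space (int_vecs g))"
  proof (rule pair_sigma_finite.Fubini'[symmetric])
    show "pair_sigma_finite (unit_cube g) (count_space (int_vecs g))" ..
    show "(\<lambda>(y, n). h (\<lambda>i\<in>{..<g}. y i + zr n i)) \<in> borel_measurable (unit_cube g \<Otimes>\<^sub>M count_space (int_vecs g))"
    proof (subst measurable_pair_swap_iff, rule measurable_pair_measure_countable1)
      fix n
      have "(\<lambda>y. \<lambda>i\<in>{..<g}. y i + zr n i) \<in> PiM {..<g} (\<lambda>_. borel) \<rightarrow>\<^sub>M PiM {..<g} (\<lambda>_. borel :: real measure)"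
        by (rule measurable_restrict) measurable
      from measurable_compose[OF this hm]
      show "(\<lambda>y. (\<lambda>(x, y). (\<lambda>(y, n). h (\<lambda>i\<in>{..<g}. y i + zr n i)) (y, x)) (n, y)) \<in> borel_measurable (unit_cube g)"
        unfolding measurable_cong_sets[OF sets_unit_cube refl] by simp
    qed simp
  qed
  also have "\<dots> = (\<integral>\<^sup>+f. (\<integral>\<^sup>+y. h (\<lambda>i\<in>{..<g}. y i + zr (Matrix.vec g f) i) \<partial>unit_cube g) \<partial>count_space (PiE {..<g} (\<lambda>_. UNIV)))"
    by (rule nn_integral_bij_count_space[OF bij_betw_int_vecs, symmetric])
  also have "\<dots> = (\<integral>\<^sup>+f. (\<integral>\<^sup>+y. h (\<lambda>i\<in>{..<g}. y i + of_int (f i)) \<partial>PiM {..<g} (\<lambda>_. U01)) \<partial>count_space (PiE {..<g} (\<lambda>_. UNIV)))"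
    unfolding unit_cube_def by (intro nn_integral_cong h_cong) auto
  also have "\<dots> = (\<integral>\<^sup>+x. h x \<partial>PiM {..<g} (\<lambda>_. lborel))"
    by (rule nn_integral_PiM_int_sum[OF _ hm]) simp
  also have "\<dots> = ennreal (1 / sqrt (2 ^ g * Determinant.det ?Y))"
    unfolding h_def by (rule nn_integral_gauss_bform[OF siegelD(3)[OF t]])
  finally show ?thesis .
qed

lemma torus_integral_eq:
  "torus_integral g \<tau> F = (\<integral>p. F (torus_point g \<tau> (fst p) (snd p)) \<partial>(unit_cube g \<Otimes>\<^sub>M unit_cube g))"
  unfolding torus_integral_def by (simp add: case_prod_unfold)

lemma torus_integral_norm_theta_sq:
  assumes t: "\<tau> \<in> siegel g"
  shows "torus_integral g \<tau> (norm_theta_sq g \<tau>) = 1 / sqrt (2 ^ g)"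
proof -
  let ?d = "Determinant.det (map_mat Im \<tau>)"
  have d: "?d > 0" by (rule pos_def_mat_det_pos[OF siegelD(3)[OF t]])
  have "(\<integral>p. (norm (theta_section g \<tau> (snd p) (fst p)))\<^sup>2 \<partial>(unit_cube g \<Otimes>\<^sub>M unit_cube g)) =
      enn2real (\<integral>\<^sup>+p. ennreal ((norm (theta_section g \<tau> (snd p) (fst p)))\<^sup>2) \<partial>(unit_cube g \<Otimes>\<^sub>M unit_cube g))"
    by (intro integral_eq_nn_integral borel_measurable_power measurable_compose[OF theta_section_measurable borel_measurable_norm]) auto
  also have "\<dots> = 1 / sqrt (2 ^ g * ?d)"
    unfolding nn_integral_norm_theta_sq[OF t] using d by simp
  finally show ?thesis
    unfolding torus_integral_eq norm_theta_sq_torus_point[OF t] using d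
    by (simp add: real_sqrt_mult)
qed

lemma theta_invariant_eq:
  assumes t: "\<tau> \<in> siegel g"
  shows "theta_invariant g \<tau> = - (real g / 2) * ln 2 -
     (\<integral>p. ln (norm_theta_sq g \<tau> (torus_point g \<tau> (fst p) (snd p))) \<partial>(unit_cube g \<Otimes>\<^sub>M unit_cube g))"
  unfolding theta_invariant_def torus_integral_norm_theta_sq[OF t] torus_integral_eq[of g \<tau> "\<lambda>z. ln (norm_theta_sq g \<tau> z)"]
  by (simp add: ln_div ln_sqrt ln_realpow)

section \<open>Uniform bounds and limits for the logarithms\<close>

lemma fourier_series_ln_L2:
  fixes C c :: real
  assumes c: "c > 0"
  shows "\<exists>K\<ge>0. \<forall>b. gauss_bounded g C c b \<longrightarrow> b (0\<^sub>v g) = 1 \<longrightarrow>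
     (\<integral>\<^sup>+x. ennreal ((ln (norm (fourier_series g b (cpx x))))\<^sup>2) \<partial>unit_cube g) \<le> ennreal K"
proof -
  obtain K \<alpha> where K: "0 \<le> K" "0 < \<alpha>" and sub: "\<forall>b. gauss_bounded g C c b \<longrightarrow> b (0\<^sub>v g) = 1 \<longrightarrow>
           (\<forall>\<epsilon>. 0 < \<epsilon> \<longrightarrow> \<epsilon> \<le> 1 \<longrightarrow>
              emeasure (unit_cube g) {x\<in>space (unit_cube g). norm (fourier_series g b (cpx x)) < \<epsilon>} \<le> ennreal (K * \<epsilon> powr \<alpha>))"
    using fourier_series_sublevel[OF c, of g C] by (elim exE conjE) (rule that)
  define B where "B = max 1 (C * gauss_mass g (c / 2))"
  define K' where "K' = (ln B)\<^sup>2 + (\<Sum>n. (real n + 1)\<^sup>2 * (K * exp (- \<alpha> * real n)))"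
  have "(\<integral>\<^sup>+x. ennreal ((ln (norm (fourier_series g b (cpx x))))\<^sup>2) \<partial>unit_cube g) \<le> ennreal K'"
    if b: "gauss_bounded g C c b" "b (0\<^sub>v g) = 1" for b
    unfolding K'_def
  proof (rule cube.nn_integral_ln_square_le[OF _ _ _ K])
    show "(\<lambda>x. norm (fourier_series g b (cpx x))) \<in> borel_measurable (unit_cube g)"
      by (intro measurable_compose[OF _ borel_measurable_norm] fourier_series_measurable) measurable
    show "0 \<le> norm (fourier_series g b (cpx x)) \<and> norm (fourier_series g b (cpx x)) \<le> B" for x
      using norm_fourier_series_cpx_le[OF b(1) c, of x] by (simp add: B_def)
  qed (use sub b in \<open>auto simp: B_def\<close>)
  then have "\<forall>b. gauss_bounded g C c b \<longrightarrow> b (0\<^sub>v g) = 1 \<longrightarrow>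
     (\<integral>\<^sup>+x. ennreal ((ln (norm (fourier_series g b (cpx x))))\<^sup>2) \<partial>unit_cube g) \<le> ennreal (max 0 K')"
    by (auto intro: order_trans ennreal_leI)
  then show ?thesis by (intro exI[of _ "max 0 K'"]) simp
qed

text \<open>The zero set is contained in all sublevel sets, whose measures tend to 0.\<close>

lemma fourier_series_AE_nonzero:
  assumes c: "c > 0" and b: "gauss_bounded g C c b" "b (0\<^sub>v g) = 1"
  shows "AE x in unit_cube g. fourier_series g b (cpx x) \<noteq> 0"
proof -
  obtain K \<alpha> where K: "0 \<le> K" "0 < \<alpha>" and sub: "\<forall>b. gauss_bounded g C c b \<longrightarrow> b (0\<^sub>v g) = 1 \<longrightarrow>
           (\<forall>\<epsilon>. 0 < \<epsilon> \<longrightarrow> \<epsilon> \<le> 1 \<longrightarrow>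
              emeasure (unit_cube g) {x\<in>space (unit_cube g). norm (fourier_series g b (cpx x)) < \<epsilon>} \<le> ennreal (K * \<epsilon> powr \<alpha>))"
    using fourier_series_sublevel[OF c, of g C] by (elim exE conjE) (rule that)
  have m: "(\<lambda>x. fourier_series g b (cpx x)) \<in> borel_measurable (unit_cube g)"
    by (rule fourier_series_measurable) measurable
  let ?Z = "{x\<in>space (unit_cube g). fourier_series g b (cpx x) = 0}"
  have Zm: "?Z \<in> sets (unit_cube g)" using m by measurable
  have "emeasure (unit_cube g) ?Z \<le> ennreal (K * (1 / real (Suc n)) powr \<alpha>)" for n
  proof -
    have "{x\<in>space (unit_cube g). norm (fourier_series g b (cpx x)) < 1 / real (Suc n)} \<in> sets (unit_cube g)"
      using m by measurable
    then have "emeasure (unit_cube g) ?Z \<le> emeasure (unit_cube g) {x\<in>space (unit_cube g). norm (fourier_series g b (cpx x)) < 1 / real (Suc n)}"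
      by (intro emeasure_mono) auto
    also have "\<dots> \<le> ennreal (K * (1 / real (Suc n)) powr \<alpha>)"
      using sub[rule_format, OF b, of "1 / real (Suc n)"] by simp
    finally show ?thesis .
  qed
  moreover have "(\<lambda>n. ennreal (K * (1 / real (Suc n)) powr \<alpha>)) \<longlonglongrightarrow> ennreal 0"
    using K by (intro tendsto_ennrealI) real_asymp
  ultimately have "emeasure (unit_cube g) ?Z \<le> ennreal 0"
    by (intro LIMSEQ_le_const) auto
  then have "?Z \<in> null_sets (unit_cube g)" using Zm by auto
  then show ?thesis by (rule AE_I') auto
qed

text \<open>Section coefficients divided by the one at frequency 0. This makes the constant
  coefficient 1, as the sublevel bound demands, and the factor divided out carries the quadratic
  growth.\<close>

definition normalized_coeff :: "nat \<Rightarrow> complex mat \<Rightarrow> (nat \<Rightarrow> real) \<Rightarrow> int Matrix.vec \<Rightarrow> complex" where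
  "normalized_coeff g \<tau> v n = exp (pi * \<i> * (bform g \<tau> (zc n) (zc n) + 2 * bform g \<tau> (zc n) (cpx v)))"

lemma normalized_coeff_0 [simp]: "normalized_coeff g \<tau> v (0\<^sub>v g) = 1"
  by (simp add: normalized_coeff_def bform_def)

lemma norm_normalized_coeff:
  assumes "\<tau> \<in> carrier_mat g g"
  shows "norm (normalized_coeff g \<tau> v n) =
    exp (- pi * (bform g (map_mat Im \<tau>) (zr n) (zr n) + 2 * bform g (map_mat Im \<tau>) (zr n) v))"
  using Im_bform_cpx[OF assms, of "zr n" "zr n"] Im_bform_cpx[OF assms, of "zr n" v]
  by (simp add: normalized_coeff_def)

lemma section_coeff_normalized:
  assumes "\<tau> \<in> carrier_mat g g" "transpose_mat \<tau> = \<tau>"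
  shows "section_coeff g \<tau> v n = exp (pi * \<i> * bform g \<tau> (cpx v) (cpx v)) * normalized_coeff g \<tau> v n"
  unfolding section_coeff_expand[OF assms, of v]
  by (simp add: section_coeff_def normalized_coeff_def algebra_simps flip: exp_add)

lemma norm_theta_section_normalized:
  assumes t: "\<tau> \<in> siegel g"
  shows "norm (theta_section g \<tau> v x) = exp (- pi * bform g (map_mat Im \<tau>) v v) * norm (fourier_series g (normalized_coeff g \<tau> v) (cpx x))"
proof -
  have "theta_section g \<tau> v x = exp (pi * \<i> * bform g \<tau> (cpx v) (cpx v)) * fourier_series g (normalized_coeff g \<tau> v) (cpx x)"
    unfolding theta_section_def fourier_series_def section_coeff_normalized[OF siegelD(1,2)[OF t]]
    by (simp only: mult.assoc integral_mult_right_zero)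
  then show ?thesis
    using Im_bform_cpx[OF siegelD(1)[OF t], of v v] by (simp add: norm_mult)
qed

lemma ln_norm_theta_sq:
  assumes t: "\<tau> \<in> siegel g" and k: "k \<in> int_vecs g"
    and nz: "fourier_series g (normalized_coeff g \<tau> (\<lambda>i. y i + zr k i)) (cpx x) \<noteq> 0"
  shows "ln (norm_theta_sq g \<tau> (torus_point g \<tau> x y)) = ln (Determinant.det (map_mat Im \<tau>)) / 2
     - 2 * pi * bform g (map_mat Im \<tau>) (\<lambda>i. y i + zr k i) (\<lambda>i. y i + zr k i)
     + 2 * ln (norm (fourier_series g (normalized_coeff g \<tau> (\<lambda>i. y i + zr k i)) (cpx x)))"
proof -
  let ?v = "\<lambda>i. y i + zr k i"
  have d: "Determinant.det (map_mat Im \<tau>) > 0" by (rule pos_def_mat_det_pos[OF siegelD(3)[OF t]])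
  have "norm_theta_sq g \<tau> (torus_point g \<tau> x y) = sqrt (Determinant.det (map_mat Im \<tau>)) *
      (exp (- pi * bform g (map_mat Im \<tau>) ?v ?v) * norm (fourier_series g (normalized_coeff g \<tau> ?v) (cpx x)))\<^sup>2"
    unfolding norm_theta_sq_torus_point[OF t]
    using theta_section_shift[OF k, of \<tau> y x] norm_theta_section_normalized[OF t, of ?v x] by simp
  then show ?thesis
    using d nz by (simp add: ln_mult ln_realpow ln_sqrt)
qed

text \<open>The function \<open>m\<close> is the expected growth of the quadratic form at the chosen
  representative: Im \<sigma> times the lattice minimum for a degeneration, and 0 for a sequence
  converging in the Siegel space.\<close>

definition renormalized_log :: "nat \<Rightarrow> complex mat \<Rightarrow> ((nat \<Rightarrow> real) \<Rightarrow> real) \<Rightarrow> (nat \<Rightarrow> real) \<times> (nat \<Rightarrow> real) \<Rightarrow> real" where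
  "renormalized_log g \<tau> m p = ln (norm_theta_sq g \<tau> (torus_point g \<tau> (fst p) (snd p)))
     - ln (Determinant.det (map_mat Im \<tau>)) / 2 + 2 * pi * m (snd p)"

lemma renormalized_log_eq:
  assumes t: "\<tau> \<in> siegel g" and k: "k \<in> int_vecs g"
    and nz: "fourier_series g (normalized_coeff g \<tau> (\<lambda>i. y i + zr k i)) (cpx x) \<noteq> 0"
  shows "renormalized_log g \<tau> m (x, y) =
     - 2 * pi * (bform g (map_mat Im \<tau>) (\<lambda>i. y i + zr k i) (\<lambda>i. y i + zr k i) - m y)
     + 2 * ln (norm (fourier_series g (normalized_coeff g \<tau> (\<lambda>i. y i + zr k i)) (cpx x)))"
  unfolding renormalized_log_def fst_conv snd_conv ln_norm_theta_sq[OF assms] by (simp add: algebra_simps)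

lemma renormalized_log_measurable:
  assumes t: "\<tau> \<in> siegel g" and m: "m \<in> borel_measurable (unit_cube g)"
  shows "renormalized_log g \<tau> m \<in> borel_measurable (unit_cube g \<Otimes>\<^sub>M unit_cube g)"
  unfolding renormalized_log_def norm_theta_sq_torus_point[OF t]
  by (intro borel_measurable_add borel_measurable_diff borel_measurable_times borel_measurable_const
      measurable_compose[OF measurable_snd m] measurable_compose[OF _ borel_measurable_ln[OF measurable_ident]]
      borel_measurable_ln borel_measurable_power measurable_compose[OF theta_section_measurable borel_measurable_norm])

text \<open>The inner integral over \<open>x\<close> is bounded for each \<open>y\<close>
  separately, using the lattice vector of that \<open>y\<close>; the vectors can thus be chosen
  without regard to measurability. The resulting constant sees only \<open>C\<close>,
  \<open>c\<close> and \<open>R\<close>.\<close>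

lemma renormalized_log_L2:
  fixes C c R :: real
  assumes c: "c > 0"
  shows "\<exists>K\<ge>0. \<forall>\<tau> m. \<tau> \<in> siegel g \<longrightarrow> m \<in> borel_measurable (unit_cube g) \<longrightarrow>
     (AE y in unit_cube g. \<exists>k\<in>int_vecs g. gauss_bounded g C c (normalized_coeff g \<tau> (\<lambda>i. y i + zr k i)) \<and>
        \<bar>bform g (map_mat Im \<tau>) (\<lambda>i. y i + zr k i) (\<lambda>i. y i + zr k i) - m y\<bar> \<le> R) \<longrightarrow>
     (\<integral>\<^sup>+p. ennreal ((renormalized_log g \<tau> m p)\<^sup>2) \<partial>(unit_cube g \<Otimes>\<^sub>M unit_cube g)) \<le> ennreal K"
proof -
  obtain K where K: "K \<ge> 0" and L2: "\<And>b. gauss_bounded g C c b \<Longrightarrow> b (0\<^sub>v g) = 1 \<Longrightarrow>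
     (\<integral>\<^sup>+x. ennreal ((ln (norm (fourier_series g b (cpx x))))\<^sup>2) \<partial>unit_cube g) \<le> ennreal K"
    using fourier_series_ln_L2[OF c, of g C] by (elim exE conjE) (rule that, auto)
  \<comment> \<open>From (-2 pi r + 2 l)^2 <= 8 pi^2 r^2 + 8 l^2.\<close>
  define K' where "K' = 8 * pi\<^sup>2 * R\<^sup>2 + 8 * K"
  have "(\<integral>\<^sup>+p. ennreal ((renormalized_log g \<tau> m p)\<^sup>2) \<partial>(unit_cube g \<Otimes>\<^sub>M unit_cube g)) \<le> ennreal K'"
    if t: "\<tau> \<in> siegel g" and m: "m \<in> borel_measurable (unit_cube g)"
      and ae: "AE y in unit_cube g. \<exists>k\<in>int_vecs g. gauss_bounded g C c (normalized_coeff g \<tau> (\<lambda>i. y i + zr k i)) \<and>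
        \<bar>bform g (map_mat Im \<tau>) (\<lambda>i. y i + zr k i) (\<lambda>i. y i + zr k i) - m y\<bar> \<le> R" for \<tau> m
  proof -
    have "(\<integral>\<^sup>+p. ennreal ((renormalized_log g \<tau> m p)\<^sup>2) \<partial>(unit_cube g \<Otimes>\<^sub>M unit_cube g)) =
      (\<integral>\<^sup>+y. (\<integral>\<^sup>+x. ennreal ((renormalized_log g \<tau> m (x, y))\<^sup>2) \<partial>unit_cube g) \<partial>unit_cube g)"
      by (rule cube2.nn_integral_snd[symmetric])
        (intro measurable_compose[OF _ measurable_ennreal] borel_measurable_power renormalized_log_measurable[OF t m])
    also have "\<dots> \<le> (\<integral>\<^sup>+y. ennreal K' \<partial>unit_cube g)"
    proof (rule nn_integral_mono_AE, use ae in eventually_elim)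
      fix y :: "nat \<Rightarrow> real"
      assume "\<exists>k\<in>int_vecs g. gauss_bounded g C c (normalized_coeff g \<tau> (\<lambda>i. y i + zr k i)) \<and>
        \<bar>bform g (map_mat Im \<tau>) (\<lambda>i. y i + zr k i) (\<lambda>i. y i + zr k i) - m y\<bar> \<le> R"
      then obtain k where k: "k \<in> int_vecs g" and gb: "gauss_bounded g C c (normalized_coeff g \<tau> (\<lambda>i. y i + zr k i))"
        and R: "\<bar>bform g (map_mat Im \<tau>) (\<lambda>i. y i + zr k i) (\<lambda>i. y i + zr k i) - m y\<bar> \<le> R" by blast
      define r where "r = bform g (map_mat Im \<tau>) (\<lambda>i. y i + zr k i) (\<lambda>i. y i + zr k i) - m y"
      define l where "l x = ln (norm (fourier_series g (normalized_coeff g \<tau> (\<lambda>i. y i + zr k i)) (cpx x)))" for x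
      have lm: "l \<in> borel_measurable (unit_cube g)"
        unfolding l_def by (intro borel_measurable_ln measurable_compose[OF _ borel_measurable_norm] fourier_series_measurable) measurable
      have "(\<integral>\<^sup>+x. ennreal ((renormalized_log g \<tau> m (x, y))\<^sup>2) \<partial>unit_cube g) \<le> (\<integral>\<^sup>+x. ennreal (8 * pi\<^sup>2 * R\<^sup>2) + ennreal 8 * ennreal ((l x)\<^sup>2) \<partial>unit_cube g)"
      proof (rule nn_integral_mono_AE, use fourier_series_AE_nonzero[OF c gb normalized_coeff_0] in eventually_elim)
        fix x assume nz: "fourier_series g (normalized_coeff g \<tau> (\<lambda>i. y i + zr k i)) (cpx x) \<noteq> 0"
        have "(renormalized_log g \<tau> m (x, y))\<^sup>2 = (- 2 * pi * r + 2 * l x)\<^sup>2"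
          unfolding renormalized_log_eq[OF t k nz] r_def l_def ..
        also have "\<dots> \<le> 8 * pi\<^sup>2 * r\<^sup>2 + 8 * (l x)\<^sup>2"
          using zero_le_power2[of "2 * pi * r + 2 * l x"] by (simp add: power2_eq_square algebra_simps)
        also have "r\<^sup>2 \<le> R\<^sup>2" using R power_mono[of "\<bar>r\<bar>" R 2] by (simp add: r_def)
        finally have "(renormalized_log g \<tau> m (x, y))\<^sup>2 \<le> 8 * pi\<^sup>2 * R\<^sup>2 + 8 * (l x)\<^sup>2" by (simp add: mult_left_mono)
        then show "ennreal ((renormalized_log g \<tau> m (x, y))\<^sup>2) \<le> ennreal (8 * pi\<^sup>2 * R\<^sup>2) + ennreal 8 * ennreal ((l x)\<^sup>2)"
          using ennreal_leI[of "(renormalized_log g \<tau> m (x, y))\<^sup>2" "8 * pi\<^sup>2 * R\<^sup>2 + 8 * (l x)\<^sup>2"]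
          by (simp add: ennreal_mult)
      qed
      also have "\<dots> = ennreal (8 * pi\<^sup>2 * R\<^sup>2) + ennreal 8 * (\<integral>\<^sup>+x. ennreal ((l x)\<^sup>2) \<partial>unit_cube g)"
      proof (subst nn_integral_add)
        show "(\<lambda>x. ennreal 8 * ennreal ((l x)\<^sup>2)) \<in> borel_measurable (unit_cube g)" using lm by measurable
        show "(\<integral>\<^sup>+x. ennreal (8 * pi\<^sup>2 * R\<^sup>2) \<partial>unit_cube g) + (\<integral>\<^sup>+x. ennreal 8 * ennreal ((l x)\<^sup>2) \<partial>unit_cube g) =
            ennreal (8 * pi\<^sup>2 * R\<^sup>2) + ennreal 8 * (\<integral>\<^sup>+x. ennreal ((l x)\<^sup>2) \<partial>unit_cube g)"
          using lm by (subst nn_integral_cmult) (auto simp: cube.emeasure_space_1)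
      qed simp
      also have "\<dots> \<le> ennreal (8 * pi\<^sup>2 * R\<^sup>2) + ennreal 8 * ennreal K"
        unfolding l_def by (intro add_mono mult_left_mono L2[OF gb]) auto
      also have "\<dots> = ennreal K'"
        using K by (simp add: K'_def ennreal_mult)
      finally show "(\<integral>\<^sup>+x. ennreal ((renormalized_log g \<tau> m (x, y))\<^sup>2) \<partial>unit_cube g) \<le> ennreal K'" .
    qed
    also have "\<dots> = ennreal K'" by (simp add: cube.emeasure_space_1)
    finally show ?thesis .
  qed
  moreover have "K' \<ge> 0" using K by (simp add: K'_def)
  ultimately show ?thesis by blast
qed

text \<open>At a point where the limit series is nonzero, the approximating series are eventually
  nonzero too, and the closed formula for the logarithm is available. Almost every point is of this
  kind, since the limit series inherits the bound and the constant coefficient 1.\<close>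

lemma renormalized_log_tendsto:
  assumes c: "c > 0" and t: "\<And>j. \<tau> j \<in> siegel g"
    and k: "k \<in> int_vecs g"
    and gb: "\<And>j. gauss_bounded g C c (normalized_coeff g (\<tau> j) (\<lambda>i. y i + zr k i))"
    and lb: "\<And>n. n \<in> int_vecs g \<Longrightarrow> (\<lambda>j. normalized_coeff g (\<tau> j) (\<lambda>i. y i + zr k i) n) \<longlonglongrightarrow> \<beta> n"
    and lr: "(\<lambda>j. bform g (map_mat Im (\<tau> j)) (\<lambda>i. y i + zr k i) (\<lambda>i. y i + zr k i) - m j y) \<longlonglongrightarrow> \<rho>"
  shows "AE x in unit_cube g. (\<lambda>j. renormalized_log g (\<tau> j) (m j) (x, y)) \<longlonglongrightarrow> - 2 * pi * \<rho> + 2 * ln (norm (fourier_series g \<beta> (cpx x)))"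
proof -
  let ?b = "\<lambda>j. normalized_coeff g (\<tau> j) (\<lambda>i. y i + zr k i)"
  have b0: "\<beta> (0\<^sub>v g) = 1"
    using lb[OF zero_int_vecs] by (simp add: LIMSEQ_const_iff)
  have gb': "gauss_bounded g C c \<beta>" by (rule gauss_bounded_limit[OF gb lb])
  show ?thesis using fourier_series_AE_nonzero[OF c gb' b0]
  proof eventually_elim
    fix x assume nz: "fourier_series g \<beta> (cpx x) \<noteq> 0"
    have lim: "(\<lambda>j. fourier_series g (?b j) (cpx x)) \<longlonglongrightarrow> fourier_series g \<beta> (cpx x)"
      by (rule fourier_series_tendsto[OF gb c, where K = 0]) (auto intro: lb)
    have ev: "eventually (\<lambda>j. fourier_series g (?b j) (cpx x) \<noteq> 0) sequentially"
      by (rule tendsto_imp_eventually_ne[OF lim nz])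
    have "(\<lambda>j. - 2 * pi * (bform g (map_mat Im (\<tau> j)) (\<lambda>i. y i + zr k i) (\<lambda>i. y i + zr k i) - m j y)
       + 2 * ln (norm (fourier_series g (?b j) (cpx x)))) \<longlonglongrightarrow> - 2 * pi * \<rho> + 2 * ln (norm (fourier_series g \<beta> (cpx x)))"
      using nz by (intro tendsto_intros lr lim) auto
    then show "(\<lambda>j. renormalized_log g (\<tau> j) (m j) (x, y)) \<longlonglongrightarrow> - 2 * pi * \<rho> + 2 * ln (norm (fourier_series g \<beta> (cpx x)))"
      by (rule Lim_transform_eventually) (use ev in \<open>auto elim!: eventually_mono simp: renormalized_log_eq[OF t k]\<close>)
  qed
qed

text \<open>A description of convergence by countably many conditions, which makes the set of points
  of convergence measurable.\<close>

lemma LIMSEQ_iff_inverse_Suc: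
  fixes X :: "nat \<Rightarrow> real"
  shows "X \<longlonglongrightarrow> l \<longleftrightarrow> (\<forall>i. \<exists>N. \<forall>k\<ge>N. \<bar>X k - l\<bar> < 1 / real (Suc i))"
proof
  assume "X \<longlonglongrightarrow> l"
  then show "\<forall>i. \<exists>N. \<forall>k\<ge>N. \<bar>X k - l\<bar> < 1 / real (Suc i)"
    unfolding LIMSEQ_iff by simp
next
  assume *: "\<forall>i. \<exists>N. \<forall>k\<ge>N. \<bar>X k - l\<bar> < 1 / real (Suc i)"
  show "X \<longlonglongrightarrow> l"
  proof (rule LIMSEQ_I)
    fix r :: real assume "r > 0"
    then obtain i where "1 / real (Suc i) < r" using nat_approx_posE by blast
    with * show "\<exists>N. \<forall>k\<ge>N. norm (X k - l) < r" by (force intro: less_trans)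
  qed
qed

text \<open>What determines the limit of the integrals. The bounds and the limits \<beta> and \<rho>
  are not tied to the sequence, so that two sequences can share them; the lattice vector varies with
  \<open>y\<close> but not with \<open>j\<close>.\<close>

definition degeneration_data ::
  "nat \<Rightarrow> real \<Rightarrow> real \<Rightarrow> real \<Rightarrow> ((nat \<Rightarrow> real) \<Rightarrow> int Matrix.vec \<Rightarrow> complex) \<Rightarrow> ((nat \<Rightarrow> real) \<Rightarrow> real) \<Rightarrow>
   (nat \<Rightarrow> complex mat) \<Rightarrow> (nat \<Rightarrow> (nat \<Rightarrow> real) \<Rightarrow> real) \<Rightarrow> bool" where
  "degeneration_data g C c R \<beta> \<rho> \<tau> m \<longleftrightarrow> (\<forall>j. \<tau> j \<in> siegel g \<and> m j \<in> borel_measurable (unit_cube g)) \<and>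
     (AE y in unit_cube g. \<exists>k\<in>int_vecs g.
        (\<forall>j. gauss_bounded g C c (normalized_coeff g (\<tau> j) (\<lambda>i. y i + zr k i)) \<and>
          \<bar>bform g (map_mat Im (\<tau> j)) (\<lambda>i. y i + zr k i) (\<lambda>i. y i + zr k i) - m j y\<bar> \<le> R) \<and>
        (\<forall>n\<in>int_vecs g. (\<lambda>j. normalized_coeff g (\<tau> j) (\<lambda>i. y i + zr k i) n) \<longlonglongrightarrow> \<beta> y n) \<and>
        (\<lambda>j. bform g (map_mat Im (\<tau> j)) (\<lambda>i. y i + zr k i) (\<lambda>i. y i + zr k i) - m j y) \<longlonglongrightarrow> \<rho> y)"

text \<open>Both sequences converge almost everywhere to the expression in \<beta> and \<rho>. No
  measurability is known for that expression, so the pointwise limit \<open>W\<close> of the first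
  sequence represents it in the integral.\<close>

lemma degeneration_data_same_limit:
  assumes c: "c > 0" and d1: "degeneration_data g C c R \<beta> \<rho> \<tau> m" and d2: "degeneration_data g C c R \<beta> \<rho> \<tau>' m'"
  shows "\<exists>l. (\<lambda>j. \<integral>p. renormalized_log g (\<tau> j) (m j) p \<partial>(unit_cube g \<Otimes>\<^sub>M unit_cube g)) \<longlonglongrightarrow> l \<and>
    (\<lambda>j. \<integral>p. renormalized_log g (\<tau>' j) (m' j) p \<partial>(unit_cube g \<Otimes>\<^sub>M unit_cube g)) \<longlonglongrightarrow> l"
proof -
  let ?M = "unit_cube g \<Otimes>\<^sub>M unit_cube g"
  define U where "U j = renormalized_log g (\<tau> j) (m j)" for j
  have Um: "U j \<in> borel_measurable ?M" for j
    using d1 unfolding degeneration_data_def U_def by (auto intro: renormalized_log_measurable)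
  define W where "W p = lim (\<lambda>j. U j p)" for p
  have Wm: "W \<in> borel_measurable ?M"
    unfolding W_def by (rule borel_measurable_lim_metric[OF Um])
  have lims: "AE y in unit_cube g. AE x in unit_cube g. (\<lambda>j. renormalized_log g (\<tau> j) (m j) (x, y)) \<longlonglongrightarrow> - 2 * pi * \<rho> y + 2 * ln (norm (fourier_series g (\<beta> y) (cpx x)))"
    if "degeneration_data g C c R \<beta> \<rho> \<tau> m" for \<tau> m
  proof -
    have t: "\<tau> j \<in> siegel g" for j using that by (simp add: degeneration_data_def)
    from that have "AE y in unit_cube g. \<exists>k\<in>int_vecs g.
        (\<forall>j. gauss_bounded g C c (normalized_coeff g (\<tau> j) (\<lambda>i. y i + zr k i)) \<and>
          \<bar>bform g (map_mat Im (\<tau> j)) (\<lambda>i. y i + zr k i) (\<lambda>i. y i + zr k i) - m j y\<bar> \<le> R) \<and>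
        (\<forall>n\<in>int_vecs g. (\<lambda>j. normalized_coeff g (\<tau> j) (\<lambda>i. y i + zr k i) n) \<longlonglongrightarrow> \<beta> y n) \<and>
        (\<lambda>j. bform g (map_mat Im (\<tau> j)) (\<lambda>i. y i + zr k i) (\<lambda>i. y i + zr k i) - m j y) \<longlonglongrightarrow> \<rho> y"
      by (simp add: degeneration_data_def)
    then show ?thesis
    proof eventually_elim
      case (elim y)
      then obtain k where k: "k \<in> int_vecs g" and gb: "\<And>j. gauss_bounded g C c (normalized_coeff g (\<tau> j) (\<lambda>i. y i + zr k i))"
        and lb: "\<And>n. n \<in> int_vecs g \<Longrightarrow> (\<lambda>j. normalized_coeff g (\<tau> j) (\<lambda>i. y i + zr k i) n) \<longlonglongrightarrow> \<beta> y n"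
        and lr: "(\<lambda>j. bform g (map_mat Im (\<tau> j)) (\<lambda>i. y i + zr k i) (\<lambda>i. y i + zr k i) - m j y) \<longlonglongrightarrow> \<rho> y"
        by auto
      show ?case
        by (rule renormalized_log_tendsto[where \<tau> = \<tau> and m = m and \<beta> = "\<beta> y" and \<rho> = "\<rho> y", OF c t k gb])
          (rule lb, assumption, rule lr)
    qed
  qed
  have main: "(\<lambda>j. \<integral>p. renormalized_log g (\<tau> j) (m j) p \<partial>?M) \<longlonglongrightarrow> (\<integral>p. W p \<partial>?M)"
    if d: "degeneration_data g C c R \<beta> \<rho> \<tau> m" for \<tau> m
  proof -
    have mm: "renormalized_log g (\<tau> j) (m j) \<in> borel_measurable ?M" for j
      using d unfolding degeneration_data_def by (auto intro: renormalized_log_measurable)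
    obtain K where K: "\<forall>\<tau> m. \<tau> \<in> siegel g \<longrightarrow> m \<in> borel_measurable (unit_cube g) \<longrightarrow>
     (AE y in unit_cube g. \<exists>k\<in>int_vecs g. gauss_bounded g C c (normalized_coeff g \<tau> (\<lambda>i. y i + zr k i)) \<and>
        \<bar>bform g (map_mat Im \<tau>) (\<lambda>i. y i + zr k i) (\<lambda>i. y i + zr k i) - m y\<bar> \<le> R) \<longrightarrow>
     (\<integral>\<^sup>+p. ennreal ((renormalized_log g \<tau> m p)\<^sup>2) \<partial>?M) \<le> ennreal K"
      using renormalized_log_L2[OF c, of g C R] by (elim exE conjE) (rule that)
    have L2: "(\<integral>\<^sup>+p. ennreal ((renormalized_log g (\<tau> j) (m j) p)\<^sup>2) \<partial>?M) \<le> ennreal K" for j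
    proof (rule K[rule_format])
      show "AE y in unit_cube g. \<exists>k\<in>int_vecs g. gauss_bounded g C c (normalized_coeff g (\<tau> j) (\<lambda>i. y i + zr k i)) \<and>
        \<bar>bform g (map_mat Im (\<tau> j)) (\<lambda>i. y i + zr k i) (\<lambda>i. y i + zr k i) - m j y\<bar> \<le> R"
        using d unfolding degeneration_data_def by (auto elim!: eventually_mono)
    qed (use d in \<open>auto simp: degeneration_data_def\<close>)
    \<comment> \<open>A measurable set of good points is needed to pass from almost every x for
      almost every y to almost every pair.\<close>
    define P where "P p \<longleftrightarrow> (\<forall>i. \<exists>N. \<forall>j\<ge>N. \<bar>renormalized_log g (\<tau> j) (m j) p - W p\<bar> < 1 / real (Suc i))" for p
    have P_iff: "P p \<longleftrightarrow> (\<lambda>j. renormalized_log g (\<tau> j) (m j) p) \<longlonglongrightarrow> W p" for p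
      unfolding P_def LIMSEQ_iff_inverse_Suc ..
    have Pm: "{p \<in> space ?M. P p} \<in> sets ?M"
    proof -
      have [measurable]: "(\<lambda>p. renormalized_log g (\<tau> j) (m j) p) \<in> borel_measurable ?M" "W \<in> borel_measurable ?M" for j
        using mm Wm by auto
      show ?thesis unfolding P_def by measurable
    qed
    have "AE y in unit_cube g. AE x in unit_cube g. P (x, y)"
      using lims[OF d1] lims[OF d]
    proof eventually_elim
      case (elim y)
      from elim show ?case
      proof eventually_elim
        case (elim x)
        have "W (x, y) = - 2 * pi * \<rho> y + 2 * ln (norm (fourier_series g (\<beta> y) (cpx x)))"
          unfolding W_def U_def by (rule limI[OF elim(1)])
        then show ?case using elim(2) by (simp add: P_iff)
      qed
    qed
    then have "AE x in unit_cube g. AE y in unit_cube g. P (x, y)"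
      by (subst cube2.AE_commute) (use Pm in \<open>auto simp: case_prod_beta\<close>)
    then have "AE p in ?M. P p"
      by (rule cube2.AE_pair_measure[OF Pm])
    then have ae: "AE p in ?M. (\<lambda>j. renormalized_log g (\<tau> j) (m j) p) \<longlonglongrightarrow> W p"
      by (simp add: P_iff)
    show ?thesis
      by (rule cube2.tendsto_integral_of_L2_bounded(2)[OF mm Wm ae L2])
  qed
  show ?thesis using main[OF d1] main[OF d2] by blast
qed

text \<open>The matrix \<open>Z\<close> stands in for Im \<tau>. Under degeneration the entries of
  Im \<tau> are unbounded and would spoil the linear term, whereas \<open>Z\<close> can be kept
  bounded and coercive while still estimating the increments of the form from below.\<close>

lemma normalized_coeff_gauss_bounded:
  fixes Z :: "real mat"
  assumes t: "\<tau> \<in> siegel g" and c: "c > 0" and coer: "\<And>x. c * (\<Sum>i<g. (x i)\<^sup>2) \<le> bform g Z x x"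
    and A: "\<And>i j. i < g \<Longrightarrow> j < g \<Longrightarrow> \<bar>Z $$ (i, j)\<bar> \<le> A" and D: "\<And>i. i < g \<Longrightarrow> \<bar>v i\<bar> \<le> D"
    and le: "\<And>n. n \<in> int_vecs g \<Longrightarrow> bform g Z (zr n) (zr n) + 2 * bform g Z (zr n) v \<le>
        bform g (map_mat Im \<tau>) (zr n) (zr n) + 2 * bform g (map_mat Im \<tau>) (zr n) v"
  shows "gauss_bounded g (exp (real g * ((2 * pi * (real g * (A * D)))\<^sup>2 / (2 * (pi * c))))) (pi * c / 2) (normalized_coeff g \<tau> v)"
  unfolding gauss_bounded_def
proof
  fix n assume n: "n \<in> int_vecs g"
  define s where "s i = - 2 * pi * (\<Sum>j<g. Z $$ (i, j) * v j)" for i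
  have s: "\<bar>s i\<bar> \<le> 2 * pi * (real g * (A * D))" if "i < g" for i
  proof -
    have "\<bar>\<Sum>j<g. Z $$ (i, j) * v j\<bar> \<le> (\<Sum>j<g. \<bar>Z $$ (i, j) * v j\<bar>)" by (rule sum_abs)
    also have "\<dots> \<le> (\<Sum>j<g. A * D)"
      unfolding abs_mult using A[OF that] D order_trans[OF abs_ge_zero A[OF that that]] by (intro sum_mono mult_mono) auto
    finally show ?thesis by (simp add: s_def abs_mult)
  qed
  have "norm (normalized_coeff g \<tau> v n) \<le> exp (- pi * (bform g Z (zr n) (zr n) + 2 * bform g Z (zr n) v))"
    unfolding norm_normalized_coeff[OF siegelD(1)[OF t]] using le[OF n] by simp
  also have "\<dots> \<le> exp (- (pi * c) * nsq g n + (\<Sum>i<g. of_int (vec_index n i) * s i))"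
  proof -
    have "(\<Sum>i<g. of_int (vec_index n i) * s i) = - 2 * pi * bform g Z (zr n) v"
      by (simp add: s_def bform_def sum_distrib_left mult_ac sum_negf)
    moreover have "pi * (c * nsq g n) \<le> pi * bform g Z (zr n) (zr n)"
      using coer[of "zr n"] by (intro mult_left_mono) auto
    ultimately show ?thesis by (simp add: algebra_simps)
  qed
  also have "\<dots> \<le> exp (real g * ((2 * pi * (real g * (A * D)))\<^sup>2 / (2 * (pi * c)))) * exp (- (pi * c / 2) * nsq g n)"
    by (rule exp_linear_le_gauss) (use c s in auto)
  finally show "norm (normalized_coeff g \<tau> v n) \<le> exp (real g * ((2 * pi * (real g * (A * D)))\<^sup>2 / (2 * (pi * c)))) * exp (- (pi * c / 2) * nsq g n)" .
qed

subsection \<open>Independence of the period matrix\<close>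

definition lin_map :: "nat \<Rightarrow> complex mat \<Rightarrow> (nat \<Rightarrow> complex) \<Rightarrow> nat \<Rightarrow> complex" where
  "lin_map g L z i = (\<Sum>j<g. L $$ (i, j) * z j)"

definition tpoint :: "nat \<Rightarrow> complex mat \<Rightarrow> (nat \<Rightarrow> real) \<Rightarrow> (nat \<Rightarrow> real) \<Rightarrow> nat \<Rightarrow> complex" where
  "tpoint g \<tau> x y i = complex_of_real (x i) + lin_map g \<tau> (cpx y) i"

text \<open>Together with \<open>xcoord\<close> this inverts \<open>tpoint\<close>: the two are the
  real coordinates in z = x + \<tau> y.\<close>

definition ycoord :: "nat \<Rightarrow> complex mat \<Rightarrow> (nat \<Rightarrow> complex) \<Rightarrow> nat \<Rightarrow> real" where
  "ycoord g \<tau> z i = (\<Sum>j<g. mat_inv (map_mat Im \<tau>) $$ (i, j) * Im (z j))"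

definition xcoord :: "nat \<Rightarrow> complex mat \<Rightarrow> (nat \<Rightarrow> complex) \<Rightarrow> nat \<Rightarrow> real" where
  "xcoord g \<tau> z i = Re (z i) - Re (lin_map g \<tau> (cpx (ycoord g \<tau> z)) i)"

text \<open>Real linear in the first argument and complex linear in the second, with skew part the
  polarization. An isomorphism preserves the skew part, so it changes this form by a symmetric
  and hence complex bilinear form; this produces the quadratic exponential factor in the
  transformation formula of theta functions.\<close>
definition yform :: "nat \<Rightarrow> complex mat \<Rightarrow> (nat \<Rightarrow> complex) \<Rightarrow> (nat \<Rightarrow> complex) \<Rightarrow> complex" where
  "yform g \<tau> z w = (\<Sum>i<g. complex_of_real (ycoord g \<tau> z i) * w i)"

abbreviation theta_fun :: "nat \<Rightarrow> complex mat \<Rightarrow> (nat \<Rightarrow> complex) \<Rightarrow> complex" where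
  "theta_fun g \<tau> \<equiv> fourier_series g (section_coeff g \<tau> (\<lambda>_. 0))"

lemma mat_inv_Im_sym:
  assumes t: "\<tau> \<in> siegel g" and "i < g" "j < g"
  shows "mat_inv (map_mat Im \<tau>) $$ (i, j) = mat_inv (map_mat Im \<tau>) $$ (j, i)"
proof -
  let ?Y = "map_mat Im \<tau>" and ?I = "mat_inv (map_mat Im \<tau>)"
  note inv = mat_inv_pos_def[OF siegelD(3)[OF t]] and Y = siegelD(4,5)[OF t]
  have "transpose_mat ?I * ?Y = transpose_mat (?Y * ?I)"
    using inv(1) Y by (simp add: transpose_mult[of ?Y g g ?I g])
  also have "\<dots> = 1\<^sub>m g" unfolding inv(3) by simp
  finally have 1: "transpose_mat ?I * ?Y = 1\<^sub>m g" .
  have "transpose_mat ?I = transpose_mat ?I * (?Y * ?I)" using inv by simp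
  also have "\<dots> = (transpose_mat ?I * ?Y) * ?I"
    using inv(1) Y by (intro assoc_mult_mat[symmetric, of _ g g _ g _ g]) auto
  also have "\<dots> = ?I" unfolding 1 using inv(1) by simp
  finally have "transpose_mat ?I = ?I" .
  then show ?thesis using sym_matD[OF inv(1)] assms by blast
qed

lemma lin_map_add: "lin_map g L (\<lambda>i. z i + w i) = (\<lambda>i. lin_map g L z i + lin_map g L w i)"
  by (simp add: lin_map_def fun_eq_iff distrib_left sum.distrib)

lemma lin_map_cong: "(\<And>i. i < g \<Longrightarrow> z i = w i) \<Longrightarrow> lin_map g L z = lin_map g L w"
  by (simp add: lin_map_def fun_eq_iff)

lemma ycoord_cong: "(\<And>i. i < g \<Longrightarrow> z i = w i) \<Longrightarrow> ycoord g \<tau> z = ycoord g \<tau> w"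
  by (simp add: ycoord_def fun_eq_iff)

lemma ycoord_add: "ycoord g \<tau> (\<lambda>i. z i + w i) = (\<lambda>i. ycoord g \<tau> z i + ycoord g \<tau> w i)"
  by (simp add: ycoord_def fun_eq_iff distrib_left sum.distrib)

lemma yform_cong: "(\<And>i. i < g \<Longrightarrow> z i = z' i) \<Longrightarrow> (\<And>i. i < g \<Longrightarrow> w i = w' i) \<Longrightarrow> yform g \<tau> z w = yform g \<tau> z' w'"
  using ycoord_cong[of g z z' \<tau>] by (simp add: yform_def)

lemma yform_add_left: "yform g \<tau> (\<lambda>i. z i + z' i) w = yform g \<tau> z w + yform g \<tau> z' w"
  by (simp add: yform_def ycoord_add distrib_right sum.distrib)

lemma yform_add_right: "yform g \<tau> z (\<lambda>i. w i + w' i) = yform g \<tau> z w + yform g \<tau> z w'"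
  by (simp add: yform_def distrib_left sum.distrib)

lemma yform_expand_right: "yform g \<tau> z w = (\<Sum>j<g. w j * yform g \<tau> z (\<lambda>i. if i = j then 1 else 0))"
  by (simp add: yform_def if_distrib mult.commute cong: if_cong)

lemma std_form_eq_yform:
  assumes t: "\<tau> \<in> siegel g"
  shows "complex_of_real (std_form \<tau> (Matrix.vec g z) (Matrix.vec g w)) = yform g \<tau> z w - yform g \<tau> w z"
proof -
  let ?I = "mat_inv (map_mat Im \<tau>)"
  have I: "?I \<in> carrier_mat g g" by (rule mat_inv_pos_def(1)[OF siegelD(3)[OF t]])
  have "std_form \<tau> (Matrix.vec g z) (Matrix.vec g w) = Im (\<Sum>i<g. \<Sum>j<g. z i * (complex_of_real (?I $$ (i, j)) * cnj (w j)))"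
    unfolding std_form_def using I
    by (auto simp: scalar_prod_def atLeast0LessThan sum_distrib_left intro!: arg_cong[where f = Im] sum.cong)
  also have "\<dots> = (\<Sum>i<g. \<Sum>j<g. ?I $$ (i, j) * (Im (z i) * Re (w j) - Re (z i) * Im (w j)))"
    by (simp add: algebra_simps)
  finally have E: "std_form \<tau> (Matrix.vec g z) (Matrix.vec g w) = (\<Sum>i<g. \<Sum>j<g. ?I $$ (i, j) * (Im (z i) * Re (w j) - Re (z i) * Im (w j)))" .
  have "yform g \<tau> z w = (\<Sum>i<g. \<Sum>j<g. complex_of_real (?I $$ (i, j) * Im (z j)) * w i)"
    by (simp add: yform_def ycoord_def sum_distrib_right)
  also have "\<dots> = (\<Sum>j<g. \<Sum>i<g. complex_of_real (?I $$ (i, j) * Im (z j)) * w i)" by (rule sum.swap)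
  also have "\<dots> = (\<Sum>i<g. \<Sum>j<g. complex_of_real (?I $$ (i, j) * Im (z i)) * w j)"
    using mat_inv_Im_sym[OF t] by (intro sum.cong) auto
  finally have 1: "yform g \<tau> z w = (\<Sum>i<g. \<Sum>j<g. complex_of_real (?I $$ (i, j) * Im (z i)) * w j)" .
  have 2: "yform g \<tau> w z = (\<Sum>i<g. \<Sum>j<g. complex_of_real (?I $$ (i, j) * Im (w j)) * z i)"
    by (simp add: yform_def ycoord_def sum_distrib_right)
  show ?thesis
    unfolding E 1 2 sum_subtractf[symmetric] of_real_sum
    by (intro sum.cong refl) (simp add: complex_eq_iff algebra_simps)
qed

lemma Im_lin_map_cpx: "\<tau> \<in> carrier_mat g g \<Longrightarrow> i < g \<Longrightarrow> Im (lin_map g \<tau> (cpx y) i) = (\<Sum>j<g. map_mat Im \<tau> $$ (i, j) * y j)"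
  by (simp add: lin_map_def)

lemma mat_mult_entry:
  assumes "A \<in> carrier_mat g g" "B \<in> carrier_mat g g" "i < g" "j < g"
  shows "(\<Sum>k<g. A $$ (i, k) * B $$ (k, j)) = (A * B) $$ (i, j)"
  using assms by (simp add: scalar_prod_def atLeast0LessThan)

lemma ycoord_tpoint:
  assumes t: "\<tau> \<in> siegel g" and i: "i < g"
  shows "ycoord g \<tau> (tpoint g \<tau> x y) i = y i"
proof -
  let ?Y = "map_mat Im \<tau>" and ?I = "mat_inv (map_mat Im \<tau>)"
  note inv = mat_inv_pos_def[OF siegelD(3)[OF t]] and Y = siegelD(4)[OF t]
  have "ycoord g \<tau> (tpoint g \<tau> x y) i = (\<Sum>j<g. \<Sum>k<g. ?I $$ (i, j) * (?Y $$ (j, k) * y k))"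
    unfolding ycoord_def tpoint_def using siegelD(1)[OF t]
    by (intro sum.cong) (simp_all add: Im_lin_map_cpx sum_distrib_left)
  also have "\<dots> = (\<Sum>k<g. \<Sum>j<g. ?I $$ (i, j) * (?Y $$ (j, k) * y k))" by (rule sum.swap)
  also have "\<dots> = (\<Sum>k<g. (?I * ?Y) $$ (i, k) * y k)"
    using i by (intro sum.cong refl) (simp add: mat_mult_entry[OF inv(1) Y, symmetric] sum_distrib_right mult.assoc)
  also have "\<dots> = (\<Sum>k<g. if k = i then y k else 0)"
    unfolding inv(2) using i by (intro sum.cong) auto
  finally show ?thesis using i by simp
qed

lemma tpoint_coords:
  assumes t: "\<tau> \<in> siegel g" and i: "i < g"
  shows "tpoint g \<tau> (xcoord g \<tau> z) (ycoord g \<tau> z) i = z i"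
proof (rule complex_eqI)
  let ?Y = "map_mat Im \<tau>" and ?I = "mat_inv (map_mat Im \<tau>)"
  note inv = mat_inv_pos_def[OF siegelD(3)[OF t]] and Y = siegelD(4)[OF t]
  show "Re (tpoint g \<tau> (xcoord g \<tau> z) (ycoord g \<tau> z) i) = Re (z i)"
    by (simp add: tpoint_def xcoord_def)
  have "Im (tpoint g \<tau> (xcoord g \<tau> z) (ycoord g \<tau> z) i) = (\<Sum>j<g. ?Y $$ (i, j) * ycoord g \<tau> z j)"
    unfolding tpoint_def plus_complex.sel Im_lin_map_cpx[OF siegelD(1)[OF t] i] by simp
  also have "\<dots> = (\<Sum>j<g. \<Sum>k<g. ?Y $$ (i, j) * (?I $$ (j, k) * Im (z k)))"
    unfolding ycoord_def by (simp only: sum_distrib_left)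
  also have "\<dots> = (\<Sum>k<g. \<Sum>j<g. ?Y $$ (i, j) * (?I $$ (j, k) * Im (z k)))" by (rule sum.swap)
  also have "\<dots> = (\<Sum>k<g. (?Y * ?I) $$ (i, k) * Im (z k))"
    using i by (intro sum.cong refl) (simp add: mat_mult_entry[OF Y inv(1), symmetric] sum_distrib_right mult.assoc)
  also have "\<dots> = (\<Sum>k<g. if k = i then Im (z k) else 0)"
    unfolding inv(3) using i by (intro sum.cong) auto
  finally show "Im (tpoint g \<tau> (xcoord g \<tau> z) (ycoord g \<tau> z) i) = Im (z i)" using i by simp
qed

lemma yform_tpoint:
  assumes t: "\<tau> \<in> siegel g"
  shows "yform g \<tau> (tpoint g \<tau> x y) w = (\<Sum>i<g. complex_of_real (y i) * w i)"
  unfolding yform_def using ycoord_tpoint[OF t] by (intro sum.cong) auto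

lemma tpoint_add: "(\<lambda>i. tpoint g \<tau> x y i + tpoint g \<tau> x' y' i) = tpoint g \<tau> (\<lambda>i. x i + x' i) (\<lambda>i. y i + y' i)"
  using lin_map_add[of g \<tau> "cpx y" "cpx y'"] by (simp add: fun_eq_iff tpoint_def)

lemma exp_2pi_int: "exp (2 * pi * \<i> * of_int k) = (1 :: complex)"
  using exp_integer_2pi[of "of_int k"] by (simp add: mult_ac)

lemma fourier_char_int: "fourier_char g n (zc p) = 1"
proof -
  have "(\<Sum>i<g. of_int (vec_index n i) * zc p i) = of_int (\<Sum>i<g. vec_index n i * vec_index p i)" by simp
  then show ?thesis unfolding fourier_char_def by (simp only: exp_2pi_int)
qed

lemma theta_fun_quasi_periodic:
  assumes t: "\<tau> \<in> siegel g" and p: "p \<in> int_vecs g" and q: "q \<in> int_vecs g"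
  shows "theta_fun g \<tau> (\<lambda>i. w i + tpoint g \<tau> (zr p) (zr q) i) =
    theta_fun g \<tau> w / (section_coeff g \<tau> (\<lambda>_. 0) q * fourier_char g q w)"
proof -
  let ?s = "section_coeff g \<tau> (\<lambda>_. 0)"
  have "theta_fun g \<tau> w = (\<integral>n. ?s (n + q) * fourier_char g (n + q) w \<partial>count_space (int_vecs g))"
    unfolding fourier_series_def by (rule integral_int_vecs_shift[OF q, symmetric])
  also have "\<dots> = (\<integral>n. (?s q * fourier_char g q w) * (?s n * fourier_char g n (\<lambda>i. w i + tpoint g \<tau> (zr p) (zr q) i)) \<partial>count_space (int_vecs g))"
  proof (rule Bochner_Integration.integral_cong)
    fix n assume "n \<in> space (count_space (int_vecs g))"
    then have n: "n \<in> int_vecs g" by simp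
    have 1: "?s (n + q) = ?s n * ?s q * exp (2 * pi * \<i> * bform g \<tau> (zc n) (zc q))"
    proof -
      have "bform g \<tau> (zc (n + q)) (zc (n + q)) = bform g \<tau> (\<lambda>i. zc n i + zc q i) (\<lambda>i. zc n i + zc q i)"
        using n q by (intro bform_cong) (auto simp: int_vecs_def)
      also have "\<dots> = bform g \<tau> (zc n) (zc n) + bform g \<tau> (zc q) (zc q) + 2 * bform g \<tau> (zc n) (zc q)"
        using bform_sym[OF siegelD(1,2)[OF t], of "zc q" "zc n"] by (simp add: bform_add_left bform_add_right)
      finally show ?thesis by (simp add: section_coeff_def algebra_simps flip: exp_add)
    qed
    have 2: "fourier_char g (n + q) w = fourier_char g n w * fourier_char g q w"
      using n q by (auto simp: fourier_char_def int_vecs_def distrib_right distrib_left sum.distrib exp_add)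
    have "fourier_char g n (\<lambda>i. w i + tpoint g \<tau> (zr p) (zr q) i) = fourier_char g n (\<lambda>i. w i + (zc p i + (\<Sum>j<g. \<tau> $$ (i, j) * zc q j)))"
      by (rule fourier_char_cong) (simp add: tpoint_def lin_map_def)
    also have "\<dots> = fourier_char g n w * exp (2 * pi * \<i> * bform g \<tau> (zc n) (zc q))"
      by (simp only: fourier_char_add fourier_char_int fourier_char_tau) simp
    finally show "?s (n + q) * fourier_char g (n + q) w = (?s q * fourier_char g q w) * (?s n * fourier_char g n (\<lambda>i. w i + tpoint g \<tau> (zr p) (zr q) i))"
      unfolding 1 2 by simp
  qed simp
  also have "\<dots> = (?s q * fourier_char g q w) * theta_fun g \<tau> (\<lambda>i. w i + tpoint g \<tau> (zr p) (zr q) i)"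
    unfolding fourier_series_def by (rule integral_mult_right_zero)
  finally show ?thesis by (simp add: section_coeff_def)
qed

text \<open>Written with \<open>yform\<close>, the automorphy factor depends on the lattice vector
  alone, except for the sign exp(pi i p.q), which remembers the symplectic basis. Only this sign is
  an obstacle when bases are changed.\<close>

lemma theta_fun_translate:
  assumes t: "\<tau> \<in> siegel g" and p: "p \<in> int_vecs g" and q: "q \<in> int_vecs g"
  shows "theta_fun g \<tau> (\<lambda>i. w i + tpoint g \<tau> (zr p) (zr q) i) =
    exp (pi * \<i> * (\<Sum>i<g. zc p i * zc q i)) *
    exp (- pi * \<i> * (yform g \<tau> (tpoint g \<tau> (zr p) (zr q)) (tpoint g \<tau> (zr p) (zr q)) + 2 * yform g \<tau> (tpoint g \<tau> (zr p) (zr q)) w)) * theta_fun g \<tau> w"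
proof -
  have "yform g \<tau> (tpoint g \<tau> (zr p) (zr q)) (tpoint g \<tau> (zr p) (zr q)) = (\<Sum>i<g. zc p i * zc q i) + bform g \<tau> (zc q) (zc q)"
    unfolding yform_tpoint[OF t] by (simp add: tpoint_def lin_map_def bform_def distrib_left sum.distrib sum_distrib_left mult_ac)
  moreover have "section_coeff g \<tau> (\<lambda>_. 0) q * fourier_char g q w = exp (pi * \<i> * (bform g \<tau> (zc q) (zc q) + 2 * yform g \<tau> (tpoint g \<tau> (zr p) (zr q)) w))"
    unfolding yform_tpoint[OF t] by (simp add: section_coeff_def fourier_char_def algebra_simps flip: exp_add)
  ultimately show ?thesis
    unfolding theta_fun_quasi_periodic[OF t p q]
    by (simp add: divide_inverse exp_minus[symmetric] algebra_simps flip: exp_add)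
qed

text \<open>Off-diagonal terms come in equal pairs and n^2 has the parity of n, so modulo 2 a
  symmetric quadratic form is linear.\<close>

lemma parity_quadratic_form:
  fixes n :: "nat \<Rightarrow> int"
  assumes "\<And>i j. i < g \<Longrightarrow> j < g \<Longrightarrow> A i j = A j i"
  shows "even ((\<Sum>i<g. \<Sum>j<g. n i * n j * A i j) - (\<Sum>i<g. n i * A i i))"
  using assms
proof (induction g)
  case (Suc g)
  have "(\<Sum>j<g. n g * n j * A g j) = (\<Sum>i<g. n i * n g * A i g)"
    using Suc.prems by (intro sum.cong) auto
  then have *: "(\<Sum>i<Suc g. \<Sum>j<Suc g. n i * n j * A i j) - (\<Sum>i<Suc g. n i * A i i) =
      ((\<Sum>i<g. \<Sum>j<g. n i * n j * A i j) - (\<Sum>i<g. n i * A i i)) + 2 * (\<Sum>i<g. n i * n g * A i g) + n g * (n g - 1) * A g g"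
    by (simp add: sum.distrib algebra_simps)
  have "even ((\<Sum>i<g. \<Sum>j<g. n i * n j * A i j) - (\<Sum>i<g. n i * A i i))"
    using Suc.prems by (intro Suc.IH) auto
  moreover have "even (n g * (n g - 1) * A g g)" by (rule dvd_mult2) simp
  ultimately show ?case unfolding * by (intro dvd_add dvd_triv_left)
qed simp

section \<open>Transformation of theta under an isomorphism of polarized tori\<close>

locale torus_iso =
  fixes g :: nat and L \<tau> \<tau>' :: "complex mat"
  assumes t: "\<tau> \<in> siegel g" and t': "\<tau>' \<in> siegel g"
    and iso: "ppav_iso g L (std_lattice g \<tau>) (std_form \<tau>) (std_lattice g \<tau>') (std_form \<tau>')"
begin

lemma L_carrier: "L \<in> carrier_mat g g"
  using iso by (simp add: ppav_iso_def)

lemma lin_map_vec: "L *\<^sub>v Matrix.vec g z = Matrix.vec g (lin_map g L z)"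
  using L_carrier by (intro eq_vecI) (auto simp: lin_map_def scalar_prod_def atLeast0LessThan intro!: sum.cong)

lemma std_lattice_tpoint:
  assumes p: "p \<in> int_vecs g" and q: "q \<in> int_vecs g" and s: "\<sigma> \<in> carrier_mat g g"
  shows "map_vec of_int p + \<sigma> *\<^sub>v map_vec of_int q = Matrix.vec g (tpoint g \<sigma> (zr p) (zr q))"
  using assms by (intro eq_vecI) (auto simp: int_vecs_def tpoint_def lin_map_def scalar_prod_def atLeast0LessThan intro!: sum.cong)

lemma lattice_image:
  assumes p: "p \<in> int_vecs g" and q: "q \<in> int_vecs g"
  shows "\<exists>p'\<in>int_vecs g. \<exists>q'\<in>int_vecs g. \<forall>i<g. lin_map g L (tpoint g \<tau> (zr p) (zr q)) i = tpoint g \<tau>' (zr p') (zr q') i"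
proof -
  have "Matrix.vec g (tpoint g \<tau> (zr p) (zr q)) \<in> std_lattice g \<tau>"
    unfolding std_lattice_def std_lattice_tpoint[OF p q siegelD(1)[OF t], symmetric] using p q by blast
  then have "Matrix.vec g (lin_map g L (tpoint g \<tau> (zr p) (zr q))) \<in> std_lattice g \<tau>'"
    unfolding lin_map_vec[symmetric] using iso by (auto simp: ppav_iso_def)
  then obtain p' q' where pq: "p' \<in> int_vecs g" "q' \<in> int_vecs g"
    "Matrix.vec g (lin_map g L (tpoint g \<tau> (zr p) (zr q))) = map_vec of_int p' + \<tau>' *\<^sub>v map_vec of_int q'"
    unfolding std_lattice_def by blast
  then have eq: "Matrix.vec g (lin_map g L (tpoint g \<tau> (zr p) (zr q))) = Matrix.vec g (tpoint g \<tau>' (zr p') (zr q'))"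
    using std_lattice_tpoint[OF pq(1,2) siegelD(1)[OF t']] by simp
  have "lin_map g L (tpoint g \<tau> (zr p) (zr q)) i = tpoint g \<tau>' (zr p') (zr q') i" if "i < g" for i
    using arg_cong[OF eq, of "\<lambda>v. vec_index v i"] that by simp
  then show ?thesis using pq by blast
qed

lemma form_preserved:
  "yform g \<tau>' (lin_map g L z) (lin_map g L w) - yform g \<tau>' (lin_map g L w) (lin_map g L z) = yform g \<tau> z w - yform g \<tau> w z"
proof -
  have "std_form \<tau>' (L *\<^sub>v Matrix.vec g z) (L *\<^sub>v Matrix.vec g w) = std_form \<tau> (Matrix.vec g z) (Matrix.vec g w)"
    using iso by (auto simp: ppav_iso_def)
  then show ?thesis
    unfolding lin_map_vec std_form_eq_yform[OF t, symmetric] std_form_eq_yform[OF t', symmetric] by simp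
qed

definition qform :: "(nat \<Rightarrow> complex) \<Rightarrow> (nat \<Rightarrow> complex) \<Rightarrow> complex" where
  "qform z w = yform g \<tau>' (lin_map g L z) (lin_map g L w) - yform g \<tau> z w"

lemma qform_sym: "qform z w = qform w z"
  using form_preserved[of z w] unfolding qform_def by (simp add: algebra_simps)

lemma qform_add_left: "qform (\<lambda>i. z i + z' i) w = qform z w + qform z' w"
  by (simp add: qform_def lin_map_add yform_add_left)

lemma qform_add_right: "qform z (\<lambda>i. w i + w' i) = qform z w + qform z w'"
  by (simp add: qform_def lin_map_add yform_add_right)

abbreviation unit_fun :: "nat \<Rightarrow> nat \<Rightarrow> complex" where
  "unit_fun j \<equiv> \<lambda>i. if i = j then 1 else 0"

lemma qform_expand_right: "qform z w = (\<Sum>j<g. w j * qform z (unit_fun j))"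
proof -
  have lin: "lin_map g L w = (\<lambda>i. \<Sum>j<g. w j * lin_map g L (unit_fun j) i)" for w
    by (simp add: lin_map_def fun_eq_iff if_distrib mult.commute cong: if_cong)
  have "yform g \<tau>' (lin_map g L z) (lin_map g L w) = (\<Sum>i<g. \<Sum>j<g. complex_of_real (ycoord g \<tau>' (lin_map g L z) i) * (w j * lin_map g L (unit_fun j) i))"
    unfolding yform_def by (subst lin) (simp add: sum_distrib_left)
  also have "\<dots> = (\<Sum>j<g. \<Sum>i<g. complex_of_real (ycoord g \<tau>' (lin_map g L z) i) * (w j * lin_map g L (unit_fun j) i))"
    by (rule sum.swap)
  also have "\<dots> = (\<Sum>j<g. w j * yform g \<tau>' (lin_map g L z) (lin_map g L (unit_fun j)))"
    unfolding yform_def sum_distrib_left by (intro sum.cong refl) (simp add: mult_ac)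
  finally show ?thesis
    unfolding qform_def yform_expand_right[of g \<tau> z w] by (simp add: sum_subtractf right_diff_distrib)
qed

text \<open>Symmetry transfers complex linearity from the right argument to the left. The result is
  a polynomial in the coordinates, from which holomorphy, continuity and bounds of the correction
  factor are read off.\<close>

lemma qform_expand: "qform z w = (\<Sum>j<g. \<Sum>i<g. w j * (z i * qform (unit_fun j) (unit_fun i)))"
  by (subst qform_expand_right) (simp only: qform_sym[of z] qform_expand_right[of _ z] sum_distrib_left)

text \<open>The sign in \<open>theta_fun_translate\<close>, a semicharacter of the lattice.\<close>

definition chi :: "int Matrix.vec \<Rightarrow> int Matrix.vec \<Rightarrow> complex" where
  "chi p q = exp (pi * \<i> * (\<Sum>i<g. zc p i * zc q i))"

text \<open>On the isotropic sublattices Z^g and \<tau> Z^g the sign for \<tau> is trivial, but the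
  one pulled back from \<tau>' need not be. It is a homomorphism to {1, -1} on each of them, hence l
  -> exp(2 pi i E(l, c)) for a half period \<open>c\<close> with E the polarization, and the two
  sublattices fix the two real coordinates of \<open>c\<close>.\<close>

lemma ex_half_period:
  "\<exists>c. \<forall>p q. p \<in> int_vecs g \<longrightarrow> q \<in> int_vecs g \<longrightarrow> (p = 0\<^sub>v g \<or> q = 0\<^sub>v g) \<longrightarrow>
     (\<exists>p'\<in>int_vecs g. \<exists>q'\<in>int_vecs g. (\<forall>i<g. lin_map g L (tpoint g \<tau> (zr p) (zr q)) i = tpoint g \<tau>' (zr p') (zr q') i) \<and>
       chi p' q' * exp (- 2 * pi * \<i> * (yform g \<tau> (tpoint g \<tau> (zr p) (zr q)) c - yform g \<tau> c (tpoint g \<tau> (zr p) (zr q)))) = 1)"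
proof -
  define u where "u j = Matrix.vec g (\<lambda>i. if i = j then 1 else 0 :: int)" for j
  have u: "u j \<in> int_vecs g" for j by (simp add: u_def int_vecs_def)
  have zu: "zr (u j) i = (if i = j then 1 else 0)" if "i < g" for i j using that by (simp add: u_def)
  \<comment> \<open>For an isotropic family \<open>e\<close>, the sign of an integer combination is
    given by a linear form, namely the diagonal of the matrix \<open>A\<close> below.\<close>
  have gen: "\<exists>x0 y0. \<forall>n\<in>int_vecs g. \<exists>p'\<in>int_vecs g. \<exists>q'\<in>int_vecs g.
      (\<forall>i<g. lin_map g L (\<lambda>i. \<Sum>j<g. zc n j * e j i) i = tpoint g \<tau>' (zr p') (zr q') i) \<and>
      chi p' q' = exp (pi * \<i> * of_int (\<Sum>i<g. vec_index n i * (\<Sum>k<g. vec_index (x0 i) k * vec_index (y0 i) k)))"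
    if e: "\<And>j. \<exists>p'\<in>int_vecs g. \<exists>q'\<in>int_vecs g. \<forall>i<g. lin_map g L (e j) i = tpoint g \<tau>' (zr p') (zr q') i"
      and iso: "\<And>j k. yform g \<tau> (e j) (e k) = yform g \<tau> (e k) (e j)" for e :: "nat \<Rightarrow> nat \<Rightarrow> complex"
  proof -
    from e obtain P Q where PQ: "\<And>j. P j \<in> int_vecs g" "\<And>j. Q j \<in> int_vecs g"
      "\<And>i j. i < g \<Longrightarrow> lin_map g L (e j) i = tpoint g \<tau>' (zr (P j)) (zr (Q j)) i" by metis
    define A where "A i j = (\<Sum>k<g. vec_index (P i) k * vec_index (Q j) k)" for i j
    \<comment> \<open>Symmetry of \<open>A\<close> says that the images of the \<open>e j\<close>
      are isotropic for the polarization of \<tau>'; the parity argument rests on it.\<close>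
    have A: "A i j = A j i" for i j
    proof -
      have y: "yform g \<tau>' (lin_map g L (e j)) (lin_map g L (e k)) = of_int (A k j) + bform g \<tau>' (zc (Q j)) (zc (Q k))" for j k
      proof -
        have "yform g \<tau>' (lin_map g L (e j)) (lin_map g L (e k)) = yform g \<tau>' (tpoint g \<tau>' (zr (P j)) (zr (Q j))) (tpoint g \<tau>' (zr (P k)) (zr (Q k)))"
          by (rule yform_cong) (use PQ(3) in auto)
        also have "\<dots> = of_int (A k j) + bform g \<tau>' (zc (Q j)) (zc (Q k))"
          unfolding yform_tpoint[OF t'] by (simp add: tpoint_def lin_map_def bform_def A_def distrib_left sum.distrib sum_distrib_left mult_ac)
        finally show ?thesis .
      qed
      have "complex_of_int (A j i) = of_int (A i j)"
        using form_preserved[of "e i" "e j"] iso[of i j] bform_sym[OF siegelD(1,2)[OF t'], of "zc (Q i)" "zc (Q j)"]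
        unfolding y by simp
      then show ?thesis by simp
    qed
    have "\<exists>p'\<in>int_vecs g. \<exists>q'\<in>int_vecs g.
      (\<forall>i<g. lin_map g L (\<lambda>i. \<Sum>j<g. zc n j * e j i) i = tpoint g \<tau>' (zr p') (zr q') i) \<and>
      chi p' q' = exp (pi * \<i> * of_int (\<Sum>i<g. vec_index n i * A i i))" if n: "n \<in> int_vecs g" for n
    proof -
      define p' where "p' = Matrix.vec g (\<lambda>k. \<Sum>j<g. vec_index n j * vec_index (P j) k)"
      define q' where "q' = Matrix.vec g (\<lambda>k. \<Sum>j<g. vec_index n j * vec_index (Q j) k)"
      have 1: "lin_map g L (\<lambda>i. \<Sum>j<g. zc n j * e j i) i = tpoint g \<tau>' (zr p') (zr q') i" if i: "i < g" for i
      proof -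
        have "lin_map g L (\<lambda>i. \<Sum>j<g. zc n j * e j i) i = (\<Sum>k<g. \<Sum>j<g. L $$ (i, k) * (zc n j * e j k))"
          by (simp add: lin_map_def sum_distrib_left)
        also have "\<dots> = (\<Sum>j<g. \<Sum>k<g. L $$ (i, k) * (zc n j * e j k))" by (rule sum.swap)
        also have "\<dots> = (\<Sum>j<g. zc n j * lin_map g L (e j) i)"
          by (simp add: lin_map_def sum_distrib_left mult_ac)
        also have "\<dots> = (\<Sum>j<g. zc n j * zc (P j) i) + (\<Sum>j<g. \<Sum>k<g. zc n j * (\<tau>' $$ (i, k) * zc (Q j) k))"
          using PQ(3)[OF i] by (simp add: tpoint_def lin_map_def distrib_left sum.distrib sum_distrib_left)
        also have "(\<Sum>j<g. \<Sum>k<g. zc n j * (\<tau>' $$ (i, k) * zc (Q j) k)) = (\<Sum>k<g. \<Sum>j<g. zc n j * (\<tau>' $$ (i, k) * zc (Q j) k))"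
          by (rule sum.swap)
        also have "(\<Sum>j<g. zc n j * zc (P j) i) + \<dots> = tpoint g \<tau>' (zr p') (zr q') i"
          using i by (simp add: tpoint_def lin_map_def p'_def q'_def sum_distrib_left mult_ac)
        finally show ?thesis .
      qed
      have "(\<Sum>k<g. vec_index p' k * vec_index q' k) = (\<Sum>k<g. \<Sum>i<g. \<Sum>j<g. vec_index n i * vec_index n j * (vec_index (P i) k * vec_index (Q j) k))"
        by (simp add: p'_def q'_def sum_product mult_ac)
      also have "\<dots> = (\<Sum>i<g. \<Sum>k<g. \<Sum>j<g. vec_index n i * vec_index n j * (vec_index (P i) k * vec_index (Q j) k))"
        by (rule sum.swap)
      also have "\<dots> = (\<Sum>i<g. \<Sum>j<g. \<Sum>k<g. vec_index n i * vec_index n j * (vec_index (P i) k * vec_index (Q j) k))"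
        by (intro sum.cong refl sum.swap)
      also have "\<dots> = (\<Sum>i<g. \<Sum>j<g. vec_index n i * vec_index n j * A i j)"
        by (simp add: A_def sum_distrib_left)
      finally have s: "(\<Sum>k<g. vec_index p' k * vec_index q' k) = (\<Sum>i<g. \<Sum>j<g. vec_index n i * vec_index n j * A i j)" .
      have "even ((\<Sum>k<g. vec_index p' k * vec_index q' k) - (\<Sum>i<g. vec_index n i * A i i))"
        unfolding s by (rule parity_quadratic_form) (rule A)
      then obtain r where "(\<Sum>k<g. vec_index p' k * vec_index q' k) - (\<Sum>i<g. vec_index n i * A i i) = 2 * r"
        by (rule evenE)
      then have r: "(\<Sum>k<g. vec_index p' k * vec_index q' k) = (\<Sum>i<g. vec_index n i * A i i) + 2 * r" by simp
      have "chi p' q' = exp (pi * \<i> * of_int (\<Sum>k<g. vec_index p' k * vec_index q' k))" by (simp add: chi_def)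
      also have "\<dots> = exp (pi * \<i> * of_int (\<Sum>i<g. vec_index n i * A i i)) * exp (2 * pi * \<i> * of_int r)"
        unfolding r by (simp only: of_int_add of_int_mult of_int_numeral distrib_left exp_add) (simp add: mult_ac)
      finally have 2: "chi p' q' = exp (pi * \<i> * of_int (\<Sum>i<g. vec_index n i * A i i))" by (simp only: exp_2pi_int mult_1_right)
      show ?thesis
        by (intro bexI[of _ p'] bexI[of _ q'] conjI 2) (use 1 in \<open>auto simp: p'_def q'_def int_vecs_def\<close>)
    qed
    then show ?thesis unfolding A_def by blast
  qed
  have z0: "zr (0\<^sub>v g) i = 0" if "i < g" for i using that by simp
  define e1 where "e1 j = tpoint g \<tau> (zr (u j)) (zr (0\<^sub>v g))" for j
  define e2 where "e2 j = tpoint g \<tau> (zr (0\<^sub>v g)) (zr (u j))" for j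
  have e1i: "e1 j i = (if i = j then 1 else 0)" if "i < g" for i j
    using that zu z0 by (simp add: e1_def tpoint_def lin_map_def)
  have e2i: "e2 j i = \<tau> $$ (i, j)" if "i < g" "j < g" for i j
    using that by (simp add: e2_def tpoint_def lin_map_def u_def if_distrib cong: if_cong)
  have y1: "yform g \<tau> (e1 j) w = 0" for j w
    unfolding e1_def yform_tpoint[OF t] by (auto intro: sum.neutral)
  have ex1: "\<exists>p'\<in>int_vecs g. \<exists>q'\<in>int_vecs g. \<forall>i<g. lin_map g L (e1 j) i = tpoint g \<tau>' (zr p') (zr q') i" for j
    unfolding e1_def by (rule lattice_image[OF u zero_int_vecs])
  obtain x1 w1 where g1: "\<forall>n\<in>int_vecs g. \<exists>p'\<in>int_vecs g. \<exists>q'\<in>int_vecs g.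
      (\<forall>i<g. lin_map g L (\<lambda>i. \<Sum>j<g. zc n j * e1 j i) i = tpoint g \<tau>' (zr p') (zr q') i) \<and>
      chi p' q' = exp (pi * \<i> * of_int (\<Sum>i<g. vec_index n i * (\<Sum>k<g. vec_index (x1 i) k * vec_index (w1 i) k)))"
    using gen[of e1, OF ex1] y1 by (auto simp only: simp_thms)
  have y2: "yform g \<tau> (e2 j) (e2 k) = yform g \<tau> (e2 k) (e2 j)" for j k
  proof -
    have "yform g \<tau> (e2 j) (e2 k) = bform g \<tau> (zc (u j)) (zc (u k))" for j k
      unfolding e2_def yform_tpoint[OF t] by (simp add: tpoint_def lin_map_def bform_def sum_distrib_left mult_ac)
    then show ?thesis using bform_sym[OF siegelD(1,2)[OF t]] by metis
  qed
  have ex2: "\<exists>p'\<in>int_vecs g. \<exists>q'\<in>int_vecs g. \<forall>i<g. lin_map g L (e2 j) i = tpoint g \<tau>' (zr p') (zr q') i" for j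
    unfolding e2_def by (rule lattice_image[OF zero_int_vecs u])
  obtain x2 w2 where g2: "\<forall>n\<in>int_vecs g. \<exists>p'\<in>int_vecs g. \<exists>q'\<in>int_vecs g.
      (\<forall>i<g. lin_map g L (\<lambda>i. \<Sum>j<g. zc n j * e2 j i) i = tpoint g \<tau>' (zr p') (zr q') i) \<and>
      chi p' q' = exp (pi * \<i> * of_int (\<Sum>i<g. vec_index n i * (\<Sum>k<g. vec_index (x2 i) k * vec_index (w2 i) k)))"
    using gen[of e2, OF ex2] y2 by (auto simp only: simp_thms)
  \<comment> \<open>Halves of the linear forms just found. The vector p pairs with c to -p.yc and
    \<tau> q pairs with c to q.xc, hence the signs.\<close>
  define yc where "yc i = - real_of_int (\<Sum>k<g. vec_index (x1 i) k * vec_index (w1 i) k) / 2" for i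
  define xc where "xc i = real_of_int (\<Sum>k<g. vec_index (x2 i) k * vec_index (w2 i) k) / 2" for i
  define c where "c = tpoint g \<tau> xc yc"
  show ?thesis
  proof (intro exI[of _ c] allI impI)
    fix p q assume p: "p \<in> int_vecs g" and q: "q \<in> int_vecs g" and "p = 0\<^sub>v g \<or> q = 0\<^sub>v g"
    then consider (1) "q = 0\<^sub>v g" | (2) "p = 0\<^sub>v g" by blast
    then show "\<exists>p'\<in>int_vecs g. \<exists>q'\<in>int_vecs g. (\<forall>i<g. lin_map g L (tpoint g \<tau> (zr p) (zr q)) i = tpoint g \<tau>' (zr p') (zr q') i) \<and>
       chi p' q' * exp (- 2 * pi * \<i> * (yform g \<tau> (tpoint g \<tau> (zr p) (zr q)) c - yform g \<tau> c (tpoint g \<tau> (zr p) (zr q)))) = 1"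
    proof cases
      case 1
      obtain p' q' where pq: "p' \<in> int_vecs g" "q' \<in> int_vecs g"
        and l: "\<And>i. i < g \<Longrightarrow> lin_map g L (\<lambda>i. \<Sum>j<g. zc p j * e1 j i) i = tpoint g \<tau>' (zr p') (zr q') i"
        and ch: "chi p' q' = exp (pi * \<i> * of_int (\<Sum>i<g. vec_index p i * (\<Sum>k<g. vec_index (x1 i) k * vec_index (w1 i) k)))"
        using bspec[OF g1 p] by blast
      have eq: "tpoint g \<tau> (zr p) (zr q) i = (\<Sum>j<g. zc p j * e1 j i)" if "i < g" for i
        using that 1 by (simp add: e1i tpoint_def lin_map_def if_distrib cong: if_cong)
      have "yform g \<tau> (tpoint g \<tau> (zr p) (zr q)) c = 0"
        unfolding yform_tpoint[OF t] by (auto simp: 1 intro: sum.neutral)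
      moreover have "yform g \<tau> c (tpoint g \<tau> (zr p) (zr q)) = - of_int (\<Sum>i<g. vec_index p i * (\<Sum>k<g. vec_index (x1 i) k * vec_index (w1 i) k)) / 2"
        unfolding c_def yform_tpoint[OF t] using 1
        by (simp add: tpoint_def lin_map_def yc_def sum_divide_distrib[symmetric] sum_negf mult.commute)
      ultimately have "chi p' q' * exp (- 2 * pi * \<i> * (yform g \<tau> (tpoint g \<tau> (zr p) (zr q)) c - yform g \<tau> c (tpoint g \<tau> (zr p) (zr q)))) = 1"
        unfolding ch by (simp add: exp_add[symmetric] algebra_simps)
      moreover have "lin_map g L (tpoint g \<tau> (zr p) (zr q)) = lin_map g L (\<lambda>i. \<Sum>j<g. zc p j * e1 j i)"
        by (rule lin_map_cong) (rule eq)
      ultimately show ?thesis using pq l by auto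
    next
      case 2
      obtain p' q' where pq: "p' \<in> int_vecs g" "q' \<in> int_vecs g"
        and l: "\<And>i. i < g \<Longrightarrow> lin_map g L (\<lambda>i. \<Sum>j<g. zc q j * e2 j i) i = tpoint g \<tau>' (zr p') (zr q') i"
        and ch: "chi p' q' = exp (pi * \<i> * of_int (\<Sum>i<g. vec_index q i * (\<Sum>k<g. vec_index (x2 i) k * vec_index (w2 i) k)))"
        using bspec[OF g2 q] by blast
      have eq: "tpoint g \<tau> (zr p) (zr q) i = (\<Sum>j<g. zc q j * e2 j i)" if "i < g" for i
        using that 2 by (simp add: e2i tpoint_def lin_map_def mult.commute)
      have "yform g \<tau> (tpoint g \<tau> (zr p) (zr q)) c = (\<Sum>i<g. zc q i * cpx xc i) + bform g \<tau> (zc q) (cpx yc)"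
        unfolding yform_tpoint[OF t] c_def by (simp add: tpoint_def lin_map_def bform_def distrib_left sum.distrib sum_distrib_left mult_ac)
      moreover have "yform g \<tau> c (tpoint g \<tau> (zr p) (zr q)) = bform g \<tau> (cpx yc) (zc q)"
        unfolding c_def yform_tpoint[OF t] using 2 by (simp add: tpoint_def lin_map_def bform_def sum_distrib_left mult_ac)
      moreover have "(\<Sum>i<g. zc q i * cpx xc i) = of_int (\<Sum>i<g. vec_index q i * (\<Sum>k<g. vec_index (x2 i) k * vec_index (w2 i) k)) / 2"
        by (simp add: xc_def sum_divide_distrib[symmetric])
      ultimately have "chi p' q' * exp (- 2 * pi * \<i> * (yform g \<tau> (tpoint g \<tau> (zr p) (zr q)) c - yform g \<tau> c (tpoint g \<tau> (zr p) (zr q)))) = 1"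
        unfolding ch using bform_sym[OF siegelD(1,2)[OF t], of "cpx yc" "zc q"] by (simp add: exp_add[symmetric] algebra_simps)
      moreover have "lin_map g L (tpoint g \<tau> (zr p) (zr q)) = lin_map g L (\<lambda>i. \<Sum>j<g. zc q j * e2 j i)"
        by (rule lin_map_cong) (rule eq)
      ultimately show ?thesis using pq l by auto
    qed
  qed
qed

end

context torus_iso
begin

text \<open>The pulled back theta function, translated by the half period and corrected by an
  exponential of a quadratic polynomial, has the quasi-periods of theta for \<tau>, so
  \<open>theta_uniqueness\<close> makes it a multiple of theta. Quasi-periodicity is tested there on
  Z^g and \<tau> Z^g, which is where the signs have been arranged.\<close>

lemma ex_theta_transformation:
  "\<exists>c c0. \<forall>z. exp (pi * \<i> * (qform (\<lambda>i. z i + c i) (\<lambda>i. z i + c i) + 2 * yform g \<tau> c z + yform g \<tau> c c)) *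
     theta_fun g \<tau>' (lin_map g L (\<lambda>i. z i + c i)) = c0 * theta_fun g \<tau> z"
proof -
  from ex_half_period obtain c where c: "\<And>p q. p \<in> int_vecs g \<Longrightarrow> q \<in> int_vecs g \<Longrightarrow> p = 0\<^sub>v g \<or> q = 0\<^sub>v g \<Longrightarrow>
     \<exists>p'\<in>int_vecs g. \<exists>q'\<in>int_vecs g. (\<forall>i<g. lin_map g L (tpoint g \<tau> (zr p) (zr q)) i = tpoint g \<tau>' (zr p') (zr q') i) \<and>
       chi p' q' * exp (- 2 * pi * \<i> * (yform g \<tau> (tpoint g \<tau> (zr p) (zr q)) c - yform g \<tau> c (tpoint g \<tau> (zr p) (zr q)))) = 1"
    by (elim exE) blast
  \<comment> \<open>The \<open>qform\<close> part cancels the change of \<open>yform\<close> in the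
    automorphy factor. The terms with \<open>yform g \<tau> c\<close> account for the translation by
    \<open>c\<close>, up to the pairing with \<open>c\<close> that cancels the sign.\<close>
  define P where "P z = qform (\<lambda>i. z i + c i) (\<lambda>i. z i + c i) + 2 * yform g \<tau> c z + yform g \<tau> c c" for z
  define f where "f z = exp (pi * \<i> * P z) * theta_fun g \<tau>' (lin_map g L (\<lambda>i. z i + c i))" for z
  obtain C0 k0 where b: "gauss_bounded g C0 k0 (section_coeff g \<tau> (\<lambda>_. 0))" and k0: "k0 > 0"
    using section_coeff_gauss_bounded[OF t] by blast
  obtain C1 k1 where b': "gauss_bounded g C1 k1 (section_coeff g \<tau>' (\<lambda>_. 0))" and k1: "k1 > 0"
    using section_coeff_gauss_bounded[OF t'] by blast
  have trans: "f (\<lambda>i. z i + tpoint g \<tau> (zr p) (zr q) i) =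
      exp (- pi * \<i> * (yform g \<tau> (tpoint g \<tau> (zr p) (zr q)) (tpoint g \<tau> (zr p) (zr q)) + 2 * yform g \<tau> (tpoint g \<tau> (zr p) (zr q)) z)) * f z"
    if p: "p \<in> int_vecs g" and q: "q \<in> int_vecs g" and pq: "p = 0\<^sub>v g \<or> q = 0\<^sub>v g" for z p q
  proof -
    define l where "l = tpoint g \<tau> (zr p) (zr q)"
    obtain p' q' where pq': "p' \<in> int_vecs g" "q' \<in> int_vecs g"
      and Ll: "\<And>i. i < g \<Longrightarrow> lin_map g L l i = tpoint g \<tau>' (zr p') (zr q') i"
      and ch: "chi p' q' * exp (- 2 * pi * \<i> * (yform g \<tau> l c - yform g \<tau> c l)) = 1"
      using c[OF p q pq] unfolding l_def by blast
    define w where "w = lin_map g L (\<lambda>i. z i + c i)"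
    have th: "theta_fun g \<tau>' (lin_map g L (\<lambda>i. (z i + l i) + c i)) =
        chi p' q' * exp (- pi * \<i> * (yform g \<tau>' (lin_map g L l) (lin_map g L l) + 2 * yform g \<tau>' (lin_map g L l) w)) * theta_fun g \<tau>' w"
    proof -
      have "lin_map g L (\<lambda>i. (z i + l i) + c i) = (\<lambda>i. w i + lin_map g L l i)"
        unfolding w_def lin_map_add[symmetric] by (rule arg_cong[where f = "lin_map g L"]) auto
      then have "theta_fun g \<tau>' (lin_map g L (\<lambda>i. (z i + l i) + c i)) = theta_fun g \<tau>' (\<lambda>i. w i + tpoint g \<tau>' (zr p') (zr q') i)"
        by (simp add: Ll cong: fourier_series_cong)
      moreover have "yform g \<tau>' (tpoint g \<tau>' (zr p') (zr q')) (tpoint g \<tau>' (zr p') (zr q')) = yform g \<tau>' (lin_map g L l) (lin_map g L l)"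
        "yform g \<tau>' (tpoint g \<tau>' (zr p') (zr q')) w = yform g \<tau>' (lin_map g L l) w"
        by (auto intro: yform_cong simp: Ll)
      ultimately show ?thesis unfolding theta_fun_translate[OF t' pq'] chi_def by simp
    qed
    have exponent: "P (\<lambda>i. z i + l i) - (yform g \<tau>' (lin_map g L l) (lin_map g L l) + 2 * yform g \<tau>' (lin_map g L l) w) =
        P z - (yform g \<tau> l l + 2 * yform g \<tau> l z) - 2 * (yform g \<tau> l c - yform g \<tau> c l)"
    proof -
      have "(\<lambda>i. z i + l i + c i) = (\<lambda>i. (z i + c i) + l i)" by (simp add: fun_eq_iff)
      then have "P (\<lambda>i. z i + l i) = P z + 2 * qform l (\<lambda>i. z i + c i) + qform l l + 2 * yform g \<tau> c l"
        unfolding P_def using qform_sym[of "\<lambda>i. z i + c i" l]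
        by (simp only: qform_add_left[of "\<lambda>i. z i + c i" l] qform_add_right[of _ "\<lambda>i. z i + c i" l] yform_add_right) simp
      then show ?thesis
        unfolding qform_def w_def by (simp add: yform_add_right algebra_simps)
    qed
    have "f (\<lambda>i. z i + l i) = chi p' q' * exp (pi * \<i> * (P (\<lambda>i. z i + l i) - (yform g \<tau>' (lin_map g L l) (lin_map g L l) + 2 * yform g \<tau>' (lin_map g L l) w))) * theta_fun g \<tau>' w"
      unfolding f_def th by (simp add: exp_diff exp_minus right_diff_distrib divide_inverse)
    also have "\<dots> = (chi p' q' * exp (- 2 * pi * \<i> * (yform g \<tau> l c - yform g \<tau> c l))) *
       (exp (- pi * \<i> * (yform g \<tau> l l + 2 * yform g \<tau> l z)) * (exp (pi * \<i> * P z) * theta_fun g \<tau>' w))"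
      unfolding exponent by (simp add: exp_diff exp_minus right_diff_distrib divide_inverse mult_ac)
    also have "\<dots> = exp (- pi * \<i> * (yform g \<tau> l l + 2 * yform g \<tau> l z)) * f z"
      unfolding ch by (simp add: f_def w_def)
    finally show ?thesis by (simp add: l_def)
  qed
  have fcong: "f z = f z'" if "\<And>i. i < g \<Longrightarrow> z i = z' i" for z z'
  proof -
    have "lin_map g L (\<lambda>i. z i + c i) = lin_map g L (\<lambda>i. z' i + c i)"
      using that by (intro lin_map_cong) auto
    moreover have "qform (\<lambda>i. z i + c i) (\<lambda>i. z i + c i) = qform (\<lambda>i. z' i + c i) (\<lambda>i. z' i + c i)"
      unfolding qform_expand[of "\<lambda>i. z i + c i"] qform_expand[of "\<lambda>i. z' i + c i"] using that by simp
    moreover have "yform g \<tau> c z = yform g \<tau> c z'" using that by (intro yform_cong) auto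
    ultimately show ?thesis by (simp add: f_def P_def)
  qed
  have P_expand: "P z = (\<Sum>j<g. \<Sum>i<g. (z j + c j) * ((z i + c i) * qform (unit_fun j) (unit_fun i))) +
      2 * (\<Sum>i<g. complex_of_real (ycoord g \<tau> c i) * z i) + yform g \<tau> c c" for z
    unfolding P_def qform_expand[of "\<lambda>i. z i + c i"] by (simp add: yform_def[of g \<tau> c z])
  have "\<exists>c0. \<forall>z. f z = c0 * theta_fun g \<tau> z"
  proof (rule theta_uniqueness[OF b k0, where T = "\<lambda>i j. \<tau> $$ (i, j)"])
    show "section_coeff g \<tau> (\<lambda>_. 0) n \<noteq> 0" for n by (simp add: section_coeff_def)
    show "(\<lambda>\<zeta>. f (\<lambda>i. p i + \<zeta> * d i)) holomorphic_on UNIV" for p d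
    proof -
      have "lin_map g L (\<lambda>i. p i + \<zeta> * d i + c i) = (\<lambda>i. lin_map g L (\<lambda>i. p i + c i) i + \<zeta> * lin_map g L d i)" for \<zeta>
        by (simp add: lin_map_def fun_eq_iff distrib_left sum.distrib sum_distrib_left algebra_simps)
      then have "f (\<lambda>i. p i + \<zeta> * d i) = exp (pi * \<i> * P (\<lambda>i. p i + \<zeta> * d i)) * theta_fun g \<tau>' (\<lambda>i. lin_map g L (\<lambda>i. p i + c i) i + \<zeta> * lin_map g L d i)" for \<zeta>
        by (simp add: f_def)
      moreover have "(\<lambda>\<zeta>. exp (pi * \<i> * P (\<lambda>i. p i + \<zeta> * d i)) * theta_fun g \<tau>' (\<lambda>i. lin_map g L (\<lambda>i. p i + c i) i + \<zeta> * lin_map g L d i)) holomorphic_on UNIV"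
        unfolding P_expand
        by (intro holomorphic_intros fourier_series_line_holomorphic[OF b' k1, of "lin_map g L (\<lambda>i. p i + c i)" "lin_map g L d"])
      ultimately show ?thesis by simp
    qed
    show "(\<lambda>k. f (X k)) \<longlonglongrightarrow> f x" if X: "\<And>i. i < g \<Longrightarrow> (\<lambda>k. X k i) \<longlonglongrightarrow> x i" for X x
    proof -
      have lim: "(\<lambda>k. lin_map g L (\<lambda>i. X k i + c i) i) \<longlonglongrightarrow> lin_map g L (\<lambda>i. x i + c i) i" for i
        unfolding lin_map_def using X by (auto intro!: tendsto_intros)
      have "\<exists>K. \<forall>k. \<bar>Im (lin_map g L (\<lambda>i. X k i + c i) i)\<bar> \<le> K" for i
      proof -
        have "Bseq (\<lambda>k. lin_map g L (\<lambda>i. X k i + c i) i)"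
          using lim[of i] by (intro convergent_imp_Bseq convergentI)
        then obtain K where "\<forall>k. norm (lin_map g L (\<lambda>i. X k i + c i) i) \<le> K" by (auto elim: BseqE)
        then show ?thesis using order_trans[OF abs_Im_le_cmod] by blast
      qed
      then obtain K where K: "\<And>i k. \<bar>Im (lin_map g L (\<lambda>i. X k i + c i) i)\<bar> \<le> K i" by metis
      have KS: "\<bar>Im (lin_map g L (\<lambda>i. X k i + c i) i)\<bar> \<le> (\<Sum>i<g. K i)" if "i < g" for i k
      proof -
        have "0 \<le> K j" for j using order_trans[OF abs_ge_zero K] .
        then have "K i \<le> (\<Sum>i<g. K i)" using that by (intro member_le_sum) auto
        then show ?thesis using K order_trans by blast
      qed
      have "(\<lambda>k. theta_fun g \<tau>' (lin_map g L (\<lambda>i. X k i + c i))) \<longlonglongrightarrow> theta_fun g \<tau>' (lin_map g L (\<lambda>i. x i + c i))"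
        by (rule fourier_series_tendsto[OF b' k1 KS]) (auto intro: lim)
      moreover have "(\<lambda>k. P (X k)) \<longlonglongrightarrow> P x"
        unfolding P_expand using X by (auto intro!: tendsto_intros)
      ultimately show ?thesis unfolding f_def by (intro tendsto_intros)
    qed
    show "\<exists>B. \<forall>z. (\<forall>i<g. cmod (z i) \<le> K) \<longrightarrow> cmod (f z) \<le> B" for K
    proof -
      define KP where "KP = (\<Sum>j<g. \<Sum>i<g. (K + norm (c j)) * ((K + norm (c i)) * norm (qform (unit_fun j) (unit_fun i)))) +
        2 * (\<Sum>i<g. \<bar>ycoord g \<tau> c i\<bar> * K) + norm (yform g \<tau> c c)"
      define KL where "KL = (\<Sum>i<g. \<Sum>j<g. norm (L $$ (i, j)) * (K + norm (c j)))"
      have "cmod (f z) \<le> exp (pi * KP) * (C1 * exp (real g * ((2 * pi * KL)\<^sup>2 / (2 * k1))) * gauss_mass g (k1 / 2))"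
        if z: "\<forall>i<g. cmod (z i) \<le> K" for z
      proof -
        have zc: "norm (z i + c i) \<le> K + norm (c i)" if "i < g" for i
          using z that by (intro order_trans[OF norm_triangle_ineq]) auto
        have K0: "i < g \<Longrightarrow> 0 \<le> K + norm (c i)" for i using order_trans[OF norm_ge_zero zc] .
        have "norm (P z) \<le> KP"
          unfolding P_expand KP_def
          using z zc K0
          by (intro order_trans[OF norm_triangle_ineq] add_mono order_trans[OF norm_sum] sum_mono order_refl)
            (auto simp: norm_mult intro!: mult_mono sum_mono order_trans[OF norm_sum])
        then have "pi * (- Im (P z)) \<le> pi * KP"
          using abs_Im_le_cmod[of "P z"] by (intro mult_left_mono) auto
        then have 1: "norm (exp (pi * \<i> * P z)) \<le> exp (pi * KP)" by simp
        have 2: "norm (theta_fun g \<tau>' (lin_map g L (\<lambda>i. z i + c i))) \<le> C1 * exp (real g * ((2 * pi * KL)\<^sup>2 / (2 * k1))) * gauss_mass g (k1 / 2)"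
        proof (rule norm_fourier_series_le[OF b' k1])
          fix i assume i: "i < g"
          have "\<bar>Im (lin_map g L (\<lambda>i. z i + c i) i)\<bar> \<le> norm (lin_map g L (\<lambda>i. z i + c i) i)" by (rule abs_Im_le_cmod)
          also have "\<dots> \<le> (\<Sum>j<g. norm (L $$ (i, j)) * (K + norm (c j)))"
            unfolding lin_map_def by (rule order_trans[OF norm_sum]) (auto simp: norm_mult intro!: sum_mono mult_left_mono zc)
          also have "\<dots> \<le> KL"
            unfolding KL_def using K0 i
            by (intro member_le_sum[where f = "\<lambda>i. \<Sum>j<g. norm (L $$ (i, j)) * (K + norm (c j))"]) (auto intro!: sum_nonneg mult_nonneg_nonneg)
          finally show "\<bar>Im (lin_map g L (\<lambda>i. z i + c i) i)\<bar> \<le> KL" .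
        qed
        show ?thesis unfolding f_def norm_mult using 1 2 by (intro mult_mono) auto
      qed
      then show ?thesis by blast
    qed
    show "(\<lambda>x. f (\<lambda>i. cpx x i + w i)) \<in> borel_measurable (unit_cube g)" for w
      unfolding f_def P_expand lin_map_def
      by (intro borel_measurable_times borel_measurable_exp[THEN measurable_compose[rotated]] borel_measurable_add borel_measurable_sum
          borel_measurable_const fourier_series_measurable) auto
    show "f (z(i := z i + 1)) = f z" if i: "i < g" for z i
    proof -
      define u where "u = Matrix.vec g (\<lambda>j. if j = i then 1 else 0 :: int)"
      have u: "u \<in> int_vecs g" by (simp add: u_def int_vecs_def)
      have "f (z(i := z i + 1)) = f (\<lambda>j. z j + tpoint g \<tau> (zr u) (zr (0\<^sub>v g)) j)"
        by (rule fcong) (auto simp: tpoint_def lin_map_def u_def)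
      also have "\<dots> = f z"
        unfolding trans[OF u zero_int_vecs disjI2[OF refl]] yform_tpoint[OF t] by simp
      finally show ?thesis .
    qed
    show "f (\<lambda>i. z i + (\<Sum>j<g. \<tau> $$ (i, j) * zc n j)) = f z / (section_coeff g \<tau> (\<lambda>_. 0) n * fourier_char g n z)"
      if n: "n \<in> int_vecs g" for z n
    proof -
      have tp: "tpoint g \<tau> (zr (0\<^sub>v g)) (zr n) i = (\<Sum>j<g. \<tau> $$ (i, j) * zc n j)" if "i < g" for i
        using that by (simp add: tpoint_def lin_map_def)
      have "f (\<lambda>i. z i + (\<Sum>j<g. \<tau> $$ (i, j) * zc n j)) = f (\<lambda>i. z i + tpoint g \<tau> (zr (0\<^sub>v g)) (zr n) i)"
        by (rule fcong) (simp add: tp)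
      also have "\<dots> = exp (- pi * \<i> * (bform g \<tau> (zc n) (zc n) + 2 * (\<Sum>i<g. zc n i * z i))) * f z"
        unfolding trans[OF zero_int_vecs n disjI1[OF refl]] yform_tpoint[OF t]
        by (simp add: tp bform_def sum_distrib_left mult_ac)
      finally show ?thesis
        by (simp add: section_coeff_def fourier_char_def divide_inverse exp_minus[symmetric] algebra_simps flip: exp_add)
    qed
  qed
  then show ?thesis unfolding f_def P_def by blast
qed

end

text \<open>The squared norm of theta in free complex coordinates: at z = x + \<tau> y the exponent
  \<open>yform g \<tau> z z\<close> differs from the form of \<tau> at y by a real number, which
  leaves the modulus unchanged.\<close>

definition norm_theta_fun :: "nat \<Rightarrow> complex mat \<Rightarrow> (nat \<Rightarrow> complex) \<Rightarrow> real" where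
  "norm_theta_fun g \<tau> z = sqrt (Determinant.det (map_mat Im \<tau>)) * (norm (exp (pi * \<i> * yform g \<tau> z z) * theta_fun g \<tau> z))\<^sup>2"

lemma norm_theta_fun_tpoint:
  assumes t: "\<tau> \<in> siegel g"
  shows "norm_theta_sq g \<tau> (torus_point g \<tau> x y) = norm_theta_fun g \<tau> (tpoint g \<tau> x y)"
proof -
  have p: "torus_point g \<tau> x y \<in> carrier_vec g" using siegelD(1)[OF t] by auto
  have "yform g \<tau> (tpoint g \<tau> x y) (tpoint g \<tau> x y) = of_real (\<Sum>i<g. y i * x i) + bform g \<tau> (cpx y) (cpx y)"
    unfolding yform_tpoint[OF t] by (simp add: tpoint_def lin_map_def bform_def distrib_left sum.distrib sum_distrib_left mult_ac)
  then have "norm (exp (pi * \<i> * yform g \<tau> (tpoint g \<tau> x y) (tpoint g \<tau> x y))) = norm (exp (pi * \<i> * bform g \<tau> (cpx y) (cpx y)))"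
    by (simp del: of_real_sum)
  moreover have "riemann_theta g \<tau> (torus_point g \<tau> x y) = theta_fun g \<tau> (tpoint g \<tau> x y)"
    unfolding riemann_theta_eq[OF t p]
    by (rule fourier_series_cong) (subst index_torus_point[OF siegelD(1)[OF t]], auto simp: tpoint_def lin_map_def)
  ultimately show ?thesis
    unfolding norm_theta_sq_torus_point[OF t] theta_section_eq_riemann_theta[OF t] norm_theta_fun_def norm_mult by simp
qed

context torus_iso
begin

text \<open>The exponent left over in the transformation formula is the polarization at (z, c), a
  real number, so it disappears in the modulus. The constant \<kappa> is identified later from total
  integrals.\<close>

lemma ex_norm_theta_transformation:
  "\<exists>c \<kappa>. \<forall>z. norm_theta_fun g \<tau>' (lin_map g L (\<lambda>i. z i + c i)) = \<kappa> * norm_theta_fun g \<tau> z"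
proof -
  obtain c c0 where tr: "\<And>z. exp (pi * \<i> * (qform (\<lambda>i. z i + c i) (\<lambda>i. z i + c i) + 2 * yform g \<tau> c z + yform g \<tau> c c)) *
     theta_fun g \<tau>' (lin_map g L (\<lambda>i. z i + c i)) = c0 * theta_fun g \<tau> z"
    using ex_theta_transformation by blast
  have E: "Im (yform g \<tau> z c - yform g \<tau> c z) = 0" for z
    unfolding std_form_eq_yform[OF t, symmetric] by simp
  define \<kappa> where "\<kappa> = sqrt (Determinant.det (map_mat Im \<tau>')) / sqrt (Determinant.det (map_mat Im \<tau>)) * (norm c0)\<^sup>2"
  have d: "sqrt (Determinant.det (map_mat Im \<tau>)) > 0"
    using pos_def_mat_det_pos[OF siegelD(3)[OF t]] by simp
  have "norm_theta_fun g \<tau>' (lin_map g L (\<lambda>i. z i + c i)) = \<kappa> * norm_theta_fun g \<tau> z" for z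
  proof -
    define w where "w = lin_map g L (\<lambda>i. z i + c i)"
    have "yform g \<tau>' w w = (qform (\<lambda>i. z i + c i) (\<lambda>i. z i + c i) + 2 * yform g \<tau> c z + yform g \<tau> c c) + yform g \<tau> z z + (yform g \<tau> z c - yform g \<tau> c z)"
      unfolding w_def qform_def by (simp add: yform_add_left yform_add_right)
    then have "exp (pi * \<i> * yform g \<tau>' w w) = exp (pi * \<i> * (qform (\<lambda>i. z i + c i) (\<lambda>i. z i + c i) + 2 * yform g \<tau> c z + yform g \<tau> c c)) *
       exp (pi * \<i> * yform g \<tau> z z) * exp (pi * \<i> * (yform g \<tau> z c - yform g \<tau> c z))"
      by (simp only: distrib_left[of "pi * \<i>"] exp_add)
    then have "exp (pi * \<i> * yform g \<tau>' w w) * theta_fun g \<tau>' w =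
       exp (pi * \<i> * yform g \<tau> z z) * exp (pi * \<i> * (yform g \<tau> z c - yform g \<tau> c z)) * (c0 * theta_fun g \<tau> z)"
      unfolding tr[symmetric] w_def[symmetric] by (simp only: mult_ac)
    moreover have "norm (exp (pi * \<i> * (yform g \<tau> z c - yform g \<tau> c z))) = 1"
      using E[of z] by (simp add: algebra_simps)
    ultimately have "norm (exp (pi * \<i> * yform g \<tau>' w w) * theta_fun g \<tau>' w) = norm c0 * norm (exp (pi * \<i> * yform g \<tau> z z) * theta_fun g \<tau> z)"
      by (simp add: norm_mult)
    then show ?thesis
      unfolding norm_theta_fun_def w_def[symmetric] \<kappa>_def using d by (simp add: power_mult_distrib)
  qed
  then show ?thesis by blast
qed

end

lemma norm_theta_fun_measurable [measurable]:
  assumes [measurable]: "\<And>i. i < g \<Longrightarrow> (\<lambda>w. z w i) \<in> borel_measurable M"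
  shows "(\<lambda>w. norm_theta_fun g \<tau> (z w)) \<in> borel_measurable M"
proof -
  have "(\<lambda>w. Im (z w i)) \<in> borel_measurable M" if "i < g" for i
    using assms[OF that] by simp
  then have "(\<lambda>w. yform g \<tau> (z w) (z w)) \<in> borel_measurable M"
    unfolding yform_def ycoord_def
    by (intro borel_measurable_sum borel_measurable_times measurable_compose[OF _ borel_measurable_of_real] borel_measurable_const assms) auto
  moreover have "(\<lambda>w. theta_fun g \<tau> (z w)) \<in> borel_measurable M" by measurable
  ultimately show ?thesis
    unfolding norm_theta_fun_def
    by (intro borel_measurable_times borel_measurable_const borel_measurable_power measurable_compose[OF _ borel_measurable_norm]
        borel_measurable_exp[THEN measurable_compose[rotated]])
qed

lemma norm_theta_fun_cong:
  "(\<And>i. i < g \<Longrightarrow> z i = w i) \<Longrightarrow> norm_theta_fun g \<tau> z = norm_theta_fun g \<tau> w"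
  unfolding norm_theta_fun_def using yform_cong[of g z w z w \<tau>] fourier_series_cong[of g z w] by simp

lemma norm_theta_fun_periodic:
  assumes t: "\<tau> \<in> siegel g" and p: "p \<in> int_vecs g" and q: "q \<in> int_vecs g"
  shows "norm_theta_fun g \<tau> (\<lambda>i. z i + tpoint g \<tau> (zr p) (zr q) i) = norm_theta_fun g \<tau> z"
proof -
  define l where "l = tpoint g \<tau> (zr p) (zr q)"
  have E: "Im (yform g \<tau> z l - yform g \<tau> l z) = 0"
    unfolding std_form_eq_yform[OF t, symmetric] by simp
  have "exp (pi * \<i> * yform g \<tau> (\<lambda>i. z i + l i) (\<lambda>i. z i + l i)) * exp (- pi * \<i> * (yform g \<tau> l l + 2 * yform g \<tau> l z)) =
      exp (pi * \<i> * yform g \<tau> z z) * exp (pi * \<i> * (yform g \<tau> z l - yform g \<tau> l z))"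
    by (simp add: yform_add_left yform_add_right algebra_simps flip: exp_add)
  then have "norm (exp (pi * \<i> * yform g \<tau> (\<lambda>i. z i + l i) (\<lambda>i. z i + l i))) * norm (exp (- pi * \<i> * (yform g \<tau> l l + 2 * yform g \<tau> l z))) =
      norm (exp (pi * \<i> * yform g \<tau> z z)) * norm (exp (pi * \<i> * (yform g \<tau> z l - yform g \<tau> l z)))"
    by (simp only: norm_mult[symmetric])
  moreover have "norm (exp (pi * \<i> * (yform g \<tau> z l - yform g \<tau> l z))) = 1"
    using E by (simp add: algebra_simps)
  moreover have "norm (exp (pi * \<i> * (\<Sum>i<g. zc p i * zc q i))) = 1"
  proof -
    have "(\<Sum>i<g. zc p i * zc q i) = of_real (\<Sum>i<g. zr p i * zr q i)" by simp
    then have "Im (\<Sum>i<g. zc p i * zc q i) = 0" by (simp only: Im_complex_of_real)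
    then show ?thesis by simp
  qed
  moreover have "norm (theta_fun g \<tau> (\<lambda>i. z i + l i)) = norm (exp (pi * \<i> * (\<Sum>i<g. zc p i * zc q i))) *
      norm (exp (- pi * \<i> * (yform g \<tau> l l + 2 * yform g \<tau> l z))) * norm (theta_fun g \<tau> z)"
    unfolding l_def theta_fun_translate[OF t p q] norm_mult ..
  ultimately show ?thesis
    unfolding norm_theta_fun_def l_def[symmetric] norm_mult
    by (simp only: mult_1_left mult_1_right mult.assoc[symmetric])
qed

lemma tpoint_component_measurable [measurable]:
  assumes [measurable]: "\<And>i. i < g \<Longrightarrow> (\<lambda>w. x w i) \<in> borel_measurable M" "\<And>i. i < g \<Longrightarrow> (\<lambda>w. y w i) \<in> borel_measurable M" and "i < g"
  shows "(\<lambda>w. tpoint g \<tau> (x w) (y w) i) \<in> borel_measurable M"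
  unfolding tpoint_def lin_map_def using \<open>i < g\<close>
  by (intro borel_measurable_add borel_measurable_sum borel_measurable_times borel_measurable_const measurable_compose[OF _ borel_measurable_of_real] assms(1,2)) auto

section \<open>Transport of the Haar measure\<close>

text \<open>In the coordinates x and y a complex translation is a pair of real translations, and
  periodicity under the lattice is periodicity in every coordinate.\<close>

lemma nn_integral_torus_shift:
  fixes F :: "(nat \<Rightarrow> complex) \<Rightarrow> ennreal"
  assumes t: "\<tau> \<in> siegel g"
    and meas: "\<And>u. (\<lambda>p. F (\<lambda>i. tpoint g \<tau> (fst p) (snd p) i + u i)) \<in> borel_measurable (unit_cube g \<Otimes>\<^sub>M unit_cube g)"
    and cong: "\<And>z w. (\<And>i. i < g \<Longrightarrow> z i = w i) \<Longrightarrow> F z = F w"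
    and per: "\<And>z p q. p \<in> int_vecs g \<Longrightarrow> q \<in> int_vecs g \<Longrightarrow> F (\<lambda>i. z i + tpoint g \<tau> (zr p) (zr q) i) = F z"
  shows "(\<integral>\<^sup>+p. F (\<lambda>i. tpoint g \<tau> (fst p) (snd p) i + u i) \<partial>(unit_cube g \<Otimes>\<^sub>M unit_cube g)) =
    (\<integral>\<^sup>+p. F (tpoint g \<tau> (fst p) (snd p)) \<partial>(unit_cube g \<Otimes>\<^sub>M unit_cube g))"
proof -
  let ?M = "unit_cube g \<Otimes>\<^sub>M unit_cube g"
  define a b where "a = xcoord g \<tau> u" and "b = ycoord g \<tau> u"
  define H where "H x y = F (tpoint g \<tau> x y)" for x y
  have Hcong: "H x y = H x' y'" if "\<And>i. i < g \<Longrightarrow> x i = x' i" "\<And>i. i < g \<Longrightarrow> y i = y' i" for x y x' y'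
    unfolding H_def using that by (intro cong) (simp add: tpoint_def lin_map_def)
  have Hshift: "H (\<lambda>i. x i + c i) (\<lambda>i. y i + d i) = F (\<lambda>i. tpoint g \<tau> x y i + tpoint g \<tau> c d i)" for x y c d
    by (simp add: H_def tpoint_add)
  have Hm: "(\<lambda>p. H (\<lambda>i. fst p i + c i) (\<lambda>i. snd p i + d i)) \<in> borel_measurable ?M" for c d
    unfolding Hshift by (rule meas)
  have u: "F (\<lambda>i. tpoint g \<tau> x y i + u i) = H (\<lambda>i. x i + a i) (\<lambda>i. y i + b i)" for x y
    unfolding Hshift a_def b_def by (rule cong) (simp add: tpoint_coords[OF t])
  define e where "e i = Matrix.vec g (\<lambda>j. if j = i then 1 else 0 :: int)" for i
  have e: "e i \<in> int_vecs g" for i by (simp add: e_def int_vecs_def)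
  have perx: "H (x(i := x i + 1)) y = H x y" if "i < g" for x y i
  proof -
    have "H (x(i := x i + 1)) y = H (\<lambda>j. x j + zr (e i) j) (\<lambda>j. y j + zr (0\<^sub>v g) j)"
      by (rule Hcong) (auto simp: e_def)
    then show ?thesis unfolding Hshift by (simp add: per[OF e zero_int_vecs] H_def)
  qed
  have pery: "H x (y(i := y i + 1)) = H x y" if "i < g" for x y i
  proof -
    have "H x (y(i := y i + 1)) = H (\<lambda>j. x j + zr (0\<^sub>v g) j) (\<lambda>j. y j + zr (e i) j)"
      by (rule Hcong) (auto simp: e_def)
    then show ?thesis unfolding Hshift by (simp add: per[OF zero_int_vecs e] H_def)
  qed
  have Hm': "(\<lambda>(x, y). H (\<lambda>i. x i + c i) (\<lambda>i. y i + d i)) \<in> borel_measurable ?M" for c d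
    using Hm[of c d] by (simp add: case_prod_unfold)
  have Hx: "(\<lambda>x. H x (\<lambda>i. y i + d i)) \<in> borel_measurable (unit_cube g)" if "y \<in> space (unit_cube g)" for y d
    using measurable_Pair1[OF Hm'[of "\<lambda>_. 0" d] that] by simp
  have Hy: "(\<lambda>y. H x y) \<in> borel_measurable (unit_cube g)" if "x \<in> space (unit_cube g)" for x
    using measurable_Pair2[OF Hm'[of "\<lambda>_. 0" "\<lambda>_. 0"] that] by simp
  have "(\<integral>\<^sup>+p. F (\<lambda>i. tpoint g \<tau> (fst p) (snd p) i + u i) \<partial>?M) = (\<integral>\<^sup>+y. (\<integral>\<^sup>+x. H (\<lambda>i. x i + a i) (\<lambda>i. y i + b i) \<partial>unit_cube g) \<partial>unit_cube g)"
    unfolding u by (subst cube2.nn_integral_snd[symmetric]) (use Hm[of a b] in auto)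
  also have "\<dots> = (\<integral>\<^sup>+y. (\<integral>\<^sup>+x. H x (\<lambda>i. y i + b i) \<partial>unit_cube g) \<partial>unit_cube g)"
  proof (rule nn_integral_cong)
    fix y assume y: "y \<in> space (unit_cube g)"
    have "(\<integral>\<^sup>+x. H (\<lambda>i. x i + a i) (\<lambda>i. y i + b i) \<partial>unit_cube g) = (\<integral>\<^sup>+x. H (\<lambda>i\<in>{..<g}. x i + a i) (\<lambda>i. y i + b i) \<partial>unit_cube g)"
      by (intro nn_integral_cong Hcong) auto
    also have "\<dots> = (\<integral>\<^sup>+x. H x (\<lambda>i. y i + b i) \<partial>unit_cube g)"
      unfolding unit_cube_def
      by (rule nn_integral_PiM_U01_shift)
        (use Hx[OF y, of b] perx in \<open>auto simp: measurable_cong_sets[OF sets_unit_cube refl] simp del: fun_upd_apply\<close>)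
    finally show "(\<integral>\<^sup>+x. H (\<lambda>i. x i + a i) (\<lambda>i. y i + b i) \<partial>unit_cube g) = (\<integral>\<^sup>+x. H x (\<lambda>i. y i + b i) \<partial>unit_cube g)" .
  qed
  also have "\<dots> = (\<integral>\<^sup>+x. (\<integral>\<^sup>+y. H x (\<lambda>i. y i + b i) \<partial>unit_cube g) \<partial>unit_cube g)"
    by (rule cube2.Fubini') (use Hm'[of "\<lambda>_. 0" b] in simp)
  also have "\<dots> = (\<integral>\<^sup>+x. (\<integral>\<^sup>+y. H x y \<partial>unit_cube g) \<partial>unit_cube g)"
  proof (rule nn_integral_cong)
    fix x assume x: "x \<in> space (unit_cube g)"
    have "(\<integral>\<^sup>+y. H x (\<lambda>i. y i + b i) \<partial>unit_cube g) = (\<integral>\<^sup>+y. H x (\<lambda>i\<in>{..<g}. y i + b i) \<partial>unit_cube g)"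
      by (intro nn_integral_cong Hcong) auto
    also have "\<dots> = (\<integral>\<^sup>+y. H x y \<partial>unit_cube g)"
      unfolding unit_cube_def
      by (rule nn_integral_PiM_U01_shift)
        (use Hy[OF x] pery in \<open>auto simp: measurable_cong_sets[OF sets_unit_cube refl] simp del: fun_upd_apply\<close>)
    finally show "(\<integral>\<^sup>+y. H x (\<lambda>i. y i + b i) \<partial>unit_cube g) = (\<integral>\<^sup>+y. H x y \<partial>unit_cube g)" .
  qed
  also have "\<dots> = (\<integral>\<^sup>+p. F (tpoint g \<tau> (fst p) (snd p)) \<partial>?M)"
    using cube.nn_integral_fst[of "\<lambda>p. H (fst p) (snd p)" "unit_cube g"] Hm[of "\<lambda>_. 0" "\<lambda>_. 0"]
    unfolding H_def[symmetric] by simp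
  finally show ?thesis .
qed

context torus_iso
begin

text \<open>The argument is the one for uniqueness of Haar measure rather than a change of
  variables. The function is averaged over translations of the target torus: integrating over the
  translation first gives one side, integrating over the source torus first gives the other.\<close>

lemma nn_integral_transport:
  fixes h :: "real \<Rightarrow> ennreal"
  assumes h: "h \<in> borel_measurable borel"
  shows "(\<integral>\<^sup>+p. h (norm_theta_fun g \<tau>' (tpoint g \<tau>' (fst p) (snd p))) \<partial>(unit_cube g \<Otimes>\<^sub>M unit_cube g)) =
    (\<integral>\<^sup>+p. h (norm_theta_fun g \<tau>' (lin_map g L (\<lambda>i. tpoint g \<tau> (fst p) (snd p) i + c i))) \<partial>(unit_cube g \<Otimes>\<^sub>M unit_cube g))"
    (is "?J = ?I")
proof -
  let ?M = "unit_cube g \<Otimes>\<^sub>M unit_cube g"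
  define G where "G z = h (norm_theta_fun g \<tau>' z)" for z
  have Gcong: "G z = G w" if "\<And>i. i < g \<Longrightarrow> z i = w i" for z w
    using norm_theta_fun_cong[OF that] by (simp add: G_def)
  have Gper: "G (\<lambda>i. z i + tpoint g \<tau>' (zr p) (zr q) i) = G z" if "p \<in> int_vecs g" "q \<in> int_vecs g" for z p q
    unfolding G_def norm_theta_fun_periodic[OF t' that] ..
  have fst_m: "(\<lambda>p. fst p i) \<in> borel_measurable ?M" and snd_m: "(\<lambda>p. snd p i) \<in> borel_measurable ?M" if "i < g" for i
    using that by (auto intro: measurable_compose[OF measurable_fst component_measurable_unit_cube] measurable_compose[OF measurable_snd component_measurable_unit_cube])
  have tp: "(\<lambda>p. tpoint g \<sigma> (fst p) (snd p) i) \<in> borel_measurable ?M" if "i < g" for \<sigma> i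
    using that by (intro tpoint_component_measurable fst_m snd_m)
  have lin: "(\<lambda>p. lin_map g L (\<lambda>i. tpoint g \<tau> (fst p) (snd p) i + v i) i) \<in> borel_measurable ?M" for v i
    unfolding lin_map_def by (intro borel_measurable_sum borel_measurable_times borel_measurable_add borel_measurable_const tp) auto
  obtain B where B: "B \<in> carrier_mat g g" "L * B = 1\<^sub>m g"
  proof -
    have "invertible_mat L" using iso by (simp add: ppav_iso_def)
    then obtain B where "inverts_mat L B" "inverts_mat B L" by (auto simp: invertible_mat_def)
    then have LB: "L * B = 1\<^sub>m g" "B * L = 1\<^sub>m (dim_row B)" using L_carrier by (auto simp: inverts_mat_def)
    from arg_cong[OF LB(1), of dim_col] arg_cong[OF LB(2), of dim_col] have "B \<in> carrier_mat g g"
      using L_carrier by auto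
    then show ?thesis using LB(1) that by blast
  qed
  have LB: "lin_map g L (lin_map g B z) i = z i" if "i < g" for z i
  proof -
    have "lin_map g L (lin_map g B z) i = (\<Sum>j<g. \<Sum>k<g. L $$ (i, j) * (B $$ (j, k) * z k))"
      by (simp add: lin_map_def sum_distrib_left)
    also have "\<dots> = (\<Sum>k<g. \<Sum>j<g. L $$ (i, j) * (B $$ (j, k) * z k))" by (rule sum.swap)
    also have "\<dots> = (\<Sum>k<g. (L * B) $$ (i, k) * z k)"
      using that by (intro sum.cong refl) (simp add: mat_mult_entry[OF L_carrier B(1), symmetric] sum_distrib_right mult.assoc)
    also have "\<dots> = (\<Sum>k<g. if k = i then z k else 0)"
      unfolding B(2) using that by (intro sum.cong) auto
    finally show ?thesis using that by simp
  qed
  define A where "A w = lin_map g L (\<lambda>i. tpoint g \<tau> (fst w) (snd w) i + c i)" for w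
  have inner1: "(\<integral>\<^sup>+w. G (\<lambda>i. A w i + tpoint g \<tau>' (fst v) (snd v) i) \<partial>?M) = (\<integral>\<^sup>+w. G (A w) \<partial>?M)" for v
  proof -
    \<comment> \<open>The inverse of \<open>L\<close> pulls a translation of the target back to one
      of the source.\<close>
    define u where "u = lin_map g B (tpoint g \<tau>' (fst v) (snd v))"
    define F where "F z = G (lin_map g L (\<lambda>i. z i + c i))" for z
    have "G (\<lambda>i. A w i + tpoint g \<tau>' (fst v) (snd v) i) = F (\<lambda>i. tpoint g \<tau> (fst w) (snd w) i + u i)" for w
    proof -
      have "lin_map g L (\<lambda>i. (tpoint g \<tau> (fst w) (snd w) i + u i) + c i) = (\<lambda>i. A w i + lin_map g L u i)"
        unfolding A_def lin_map_add[symmetric] by (rule arg_cong[where f = "lin_map g L"]) auto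
      then show ?thesis unfolding F_def u_def by (simp only:) (rule Gcong, simp add: LB)
    qed
    moreover have "(\<integral>\<^sup>+w. F (\<lambda>i. tpoint g \<tau> (fst w) (snd w) i + u i) \<partial>?M) = (\<integral>\<^sup>+w. F (tpoint g \<tau> (fst w) (snd w)) \<partial>?M)"
    proof (rule nn_integral_torus_shift[OF t])
      show "(\<lambda>p. F (\<lambda>i. tpoint g \<tau> (fst p) (snd p) i + u i)) \<in> borel_measurable ?M" for u
      proof -
        have "(\<lambda>i. z i + u i + c i) = (\<lambda>i. z i + (u i + c i))" for z by (simp add: fun_eq_iff)
        then show ?thesis unfolding F_def G_def
          by (simp only:) (intro measurable_compose[OF _ h] norm_theta_fun_measurable lin)
      qed
      show "F z = F w" if "\<And>i. i < g \<Longrightarrow> z i = w i" for z w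
      proof -
        have "lin_map g L (\<lambda>i. z i + c i) = lin_map g L (\<lambda>i. w i + c i)" using that by (intro lin_map_cong) auto
        then show ?thesis by (simp add: F_def)
      qed
      show "F (\<lambda>i. z i + tpoint g \<tau> (zr p) (zr q) i) = F z" if pq: "p \<in> int_vecs g" "q \<in> int_vecs g" for z p q
      proof -
        obtain p' q' where pq': "p' \<in> int_vecs g" "q' \<in> int_vecs g"
          and l: "\<And>i. i < g \<Longrightarrow> lin_map g L (tpoint g \<tau> (zr p) (zr q)) i = tpoint g \<tau>' (zr p') (zr q') i"
          using lattice_image[OF pq] by blast
        have "lin_map g L (\<lambda>i. (z i + tpoint g \<tau> (zr p) (zr q) i) + c i) = (\<lambda>i. lin_map g L (\<lambda>i. z i + c i) i + lin_map g L (tpoint g \<tau> (zr p) (zr q)) i)"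
          unfolding lin_map_add[symmetric] by (rule arg_cong[where f = "lin_map g L"]) auto
        then have "F (\<lambda>i. z i + tpoint g \<tau> (zr p) (zr q) i) = G (\<lambda>i. lin_map g L (\<lambda>i. z i + c i) i + tpoint g \<tau>' (zr p') (zr q') i)"
          unfolding F_def by (simp only:) (rule Gcong, simp add: l)
        also have "\<dots> = F z" unfolding Gper[OF pq'] F_def ..
        finally show ?thesis .
      qed
    qed
    ultimately show ?thesis by (simp add: F_def A_def)
  qed
  have inner2: "(\<integral>\<^sup>+v. G (\<lambda>i. A w i + tpoint g \<tau>' (fst v) (snd v) i) \<partial>?M) = (\<integral>\<^sup>+v. G (tpoint g \<tau>' (fst v) (snd v)) \<partial>?M)" for w
  proof -
    have "G (\<lambda>i. A w i + tpoint g \<tau>' (fst v) (snd v) i) = G (\<lambda>i. tpoint g \<tau>' (fst v) (snd v) i + A w i)" for v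
      by (simp only: add.commute)
    moreover have "(\<integral>\<^sup>+v. G (\<lambda>i. tpoint g \<tau>' (fst v) (snd v) i + A w i) \<partial>?M) = (\<integral>\<^sup>+v. G (tpoint g \<tau>' (fst v) (snd v)) \<partial>?M)"
    proof (rule nn_integral_torus_shift[OF t' _ Gcong Gper])
      show "(\<lambda>p. G (\<lambda>i. tpoint g \<tau>' (fst p) (snd p) i + u i)) \<in> borel_measurable ?M" for u
        unfolding G_def by (intro measurable_compose[OF _ h] norm_theta_fun_measurable borel_measurable_add borel_measurable_const tp)
    qed
    ultimately show ?thesis by simp
  qed
  have "?I = (\<integral>\<^sup>+v. (\<integral>\<^sup>+w. G (\<lambda>i. A w i + tpoint g \<tau>' (fst v) (snd v) i) \<partial>?M) \<partial>?M)"
    unfolding inner1 using cube2.emeasure_space_1 by (simp add: G_def A_def)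
  also have "\<dots> = (\<integral>\<^sup>+w. (\<integral>\<^sup>+v. G (\<lambda>i. A w i + tpoint g \<tau>' (fst v) (snd v) i) \<partial>?M) \<partial>?M)"
  proof (rule pair_sigma_finite.Fubini')
    show "pair_sigma_finite ?M ?M" ..
    show "(\<lambda>(w, v). G (\<lambda>i. A w i + tpoint g \<tau>' (fst v) (snd v) i)) \<in> borel_measurable (?M \<Otimes>\<^sub>M ?M)"
      unfolding case_prod_unfold G_def A_def
      by (intro measurable_compose[OF _ h] norm_theta_fun_measurable borel_measurable_add
          measurable_compose[OF measurable_fst lin] measurable_compose[OF measurable_snd tp])
  qed
  also have "\<dots> = ?J"
    unfolding inner2 using cube2.emeasure_space_1 by (simp add: G_def)
  finally show ?thesis by simp
qed

text \<open>The squared norms have the same mean on both tori, so \<kappa> = 1; transport then shows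
  that they have the same distribution, hence the same mean logarithm.\<close>

lemma theta_invariant_iso: "theta_invariant g \<tau>' = theta_invariant g \<tau>"
proof -
  let ?M = "unit_cube g \<Otimes>\<^sub>M unit_cube g"
  obtain c \<kappa> where tr: "\<And>z. norm_theta_fun g \<tau>' (lin_map g L (\<lambda>i. z i + c i)) = \<kappa> * norm_theta_fun g \<tau> z"
    using ex_norm_theta_transformation by blast
  define N where "N \<sigma> p = norm_theta_fun g \<sigma> (tpoint g \<sigma> (fst p) (snd p))" for \<sigma> p
  have fst_m: "(\<lambda>p. fst p i) \<in> borel_measurable ?M" and snd_m: "(\<lambda>p. snd p i) \<in> borel_measurable ?M" if "i < g" for i
    using that by (auto intro: measurable_compose[OF measurable_fst component_measurable_unit_cube] measurable_compose[OF measurable_snd component_measurable_unit_cube])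
  have Nm: "N \<sigma> \<in> borel_measurable ?M" for \<sigma>
    unfolding N_def by (intro norm_theta_fun_measurable tpoint_component_measurable fst_m snd_m)
  have transport: "(\<integral>\<^sup>+p. h (N \<tau>' p) \<partial>?M) = (\<integral>\<^sup>+p. h (\<kappa> * N \<tau> p) \<partial>?M)" if "h \<in> borel_measurable borel" for h
    unfolding N_def using nn_integral_transport[OF that, of c] by (simp add: tr)
  have N0: "N \<sigma> p \<ge> 0" if "\<sigma> \<in> siegel g" for \<sigma> p
    using pos_def_mat_det_pos[OF siegelD(3)[OF that]] by (simp add: N_def norm_theta_fun_def)
  have total: "(\<integral>p. N \<sigma> p \<partial>?M) = 1 / sqrt (2 ^ g)" if "\<sigma> \<in> siegel g" for \<sigma>
    using torus_integral_norm_theta_sq[OF that] unfolding torus_integral_eq N_def norm_theta_fun_tpoint[OF that] .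
  have "\<kappa> = 1"
  proof -
    have "1 / sqrt (2 ^ g) = enn2real (\<integral>\<^sup>+p. ennreal (N \<tau>' p) \<partial>?M)"
      unfolding total[OF t', symmetric] by (rule integral_eq_nn_integral) (use Nm N0[OF t'] in auto)
    also have "\<dots> = enn2real (\<integral>\<^sup>+p. ennreal (\<kappa> * N \<tau> p) \<partial>?M)"
      using transport[of ennreal] by simp
    also have "\<dots> = enn2real (ennreal \<kappa> * (\<integral>\<^sup>+p. ennreal (N \<tau> p) \<partial>?M))"
      using Nm[of \<tau>] N0[OF t] by (simp add: ennreal_mult'' nn_integral_cmult)
    \<comment> \<open>The sign of \<kappa> is not known at this point, and \<open>ennreal\<close>
      truncates negative values.\<close>
    also have "\<dots> = max 0 \<kappa> * enn2real (\<integral>\<^sup>+p. ennreal (N \<tau> p) \<partial>?M)"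
      by (simp add: enn2real_mult enn2real_ennreal max_def ennreal_neg)
    also have "enn2real (\<integral>\<^sup>+p. ennreal (N \<tau> p) \<partial>?M) = 1 / sqrt (2 ^ g)"
      unfolding total[OF t, symmetric] by (rule integral_eq_nn_integral[symmetric]) (use Nm N0[OF t] in auto)
    finally have "max 0 \<kappa> = 1" by simp
    then show ?thesis by (auto simp: max_def split: if_splits)
  qed
  have lnm: "(\<lambda>p. ln (N \<sigma> p)) \<in> borel_measurable ?M" for \<sigma>
    using Nm by (rule borel_measurable_ln)
  have lb: "(\<lambda>r::real. ln r) \<in> borel_measurable borel" by measurable
  have abs: "(\<integral>\<^sup>+p. ennreal (norm (ln (N \<tau>' p))) \<partial>?M) = (\<integral>\<^sup>+p. ennreal (norm (ln (N \<tau> p))) \<partial>?M)"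
    using transport[of "\<lambda>r. ennreal (norm (ln r))"] lb \<open>\<kappa> = 1\<close> by simp
  have pos: "(\<integral>\<^sup>+p. ennreal (ln (N \<tau>' p)) \<partial>?M) = (\<integral>\<^sup>+p. ennreal (ln (N \<tau> p)) \<partial>?M)"
    using transport[of "\<lambda>r. ennreal (ln r)"] lb \<open>\<kappa> = 1\<close> by simp
  have neg: "(\<integral>\<^sup>+p. ennreal (- ln (N \<tau>' p)) \<partial>?M) = (\<integral>\<^sup>+p. ennreal (- ln (N \<tau> p)) \<partial>?M)"
    using transport[of "\<lambda>r. ennreal (- ln r)"] lb \<open>\<kappa> = 1\<close> by simp
  have "(\<integral>p. ln (N \<tau>' p) \<partial>?M) = (\<integral>p. ln (N \<tau> p) \<partial>?M)"
  \<comment> \<open>If one logarithm were not integrable, neither would be the other, and both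
    integrals would have the default value 0.\<close>
  proof (cases "integrable ?M (\<lambda>p. ln (N \<tau> p))")
    case True
    then have "integrable ?M (\<lambda>p. ln (N \<tau>' p))"
      unfolding integrable_iff_bounded abs using lnm by simp
    with True show ?thesis by (simp add: real_lebesgue_integral_def pos neg)
  next
    case False
    then have "\<not> integrable ?M (\<lambda>p. ln (N \<tau>' p))"
      unfolding integrable_iff_bounded abs using lnm by simp
    with False show ?thesis by (simp add: not_integrable_integral_eq)
  qed
  then show ?thesis
    unfolding theta_invariant_eq[OF t] theta_invariant_eq[OF t'] norm_theta_fun_tpoint[OF t] norm_theta_fun_tpoint[OF t'] N_def by simp
qed

end

subsection \<open>Degeneration\<close>

lemma bform_abs_le:
  fixes A :: "real mat"
  assumes "\<And>i j. i < g \<Longrightarrow> j < g \<Longrightarrow> \<bar>A $$ (i, j)\<bar> \<le> K" and "\<And>i. i < g \<Longrightarrow> \<bar>x i\<bar> \<le> D" and "\<And>i. i < g \<Longrightarrow> \<bar>y i\<bar> \<le> E"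
  shows "\<bar>bform g A x y\<bar> \<le> real g * (real g * (D * K * E))"
proof -
  have "\<bar>bform g A x y\<bar> \<le> (\<Sum>i<g. \<Sum>j<g. \<bar>x i * A $$ (i, j) * y j\<bar>)"
    unfolding bform_def by (intro order_trans[OF sum_abs] sum_mono) simp
  also have "\<dots> \<le> (\<Sum>i<g. \<Sum>j<g. D * K * E)"
  proof (intro sum_mono)
    fix i j assume "i \<in> {..<g}" "j \<in> {..<g}"
    then have ij: "i < g" "j < g" by auto
    have "0 \<le> D" "0 \<le> K" using order_trans[OF abs_ge_zero assms(2)[OF ij(1)]] order_trans[OF abs_ge_zero assms(1)[OF ij]] by auto
    then show "\<bar>x i * A $$ (i, j) * y j\<bar> \<le> D * K * E"
      unfolding abs_mult using assms ij by (intro mult_mono) auto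
  qed
  finally show ?thesis by simp
qed

lemma bform_perturb:
  fixes A A' :: "real mat"
  assumes "\<And>i j. i < g \<Longrightarrow> j < g \<Longrightarrow> \<bar>A $$ (i, j) - A' $$ (i, j)\<bar> \<le> \<eta>"
  shows "bform g A' x x - \<eta> * real g * (\<Sum>i<g. (x i)\<^sup>2) \<le> bform g A x x"
proof -
  have "x i * A' $$ (i, j) * x j - \<eta> * (((x i)\<^sup>2 + (x j)\<^sup>2) / 2) \<le> x i * A $$ (i, j) * x j" if "i < g" "j < g" for i j
  proof -
    have "\<bar>x i * (A $$ (i, j) - A' $$ (i, j)) * x j\<bar> = \<bar>A $$ (i, j) - A' $$ (i, j)\<bar> * \<bar>x i * x j\<bar>" by (simp add: abs_mult)
    also have "\<dots> \<le> \<eta> * \<bar>x i * x j\<bar>" using assms[OF that] by (intro mult_right_mono) auto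
    also have "\<dots> \<le> \<eta> * (((x i)\<^sup>2 + (x j)\<^sup>2) / 2)"
      using order_trans[OF abs_ge_zero assms[OF that]] sum_squares_bound[of "\<bar>x i\<bar>" "\<bar>x j\<bar>"]
      by (intro mult_left_mono) (auto simp: abs_mult)
    finally have "- (\<eta> * (((x i)\<^sup>2 + (x j)\<^sup>2) / 2)) \<le> x i * (A $$ (i, j) - A' $$ (i, j)) * x j" by linarith
    then show ?thesis by (simp add: algebra_simps)
  qed
  then have "(\<Sum>i<g. \<Sum>j<g. x i * A' $$ (i, j) * x j - \<eta> * (((x i)\<^sup>2 + (x j)\<^sup>2) / 2)) \<le> bform g A x x"
    unfolding bform_def by (intro sum_mono) auto
  also have "(\<Sum>i<g. \<Sum>j<g. x i * A' $$ (i, j) * x j - \<eta> * (((x i)\<^sup>2 + (x j)\<^sup>2) / 2)) = bform g A' x x - \<eta> * real g * (\<Sum>i<g. (x i)\<^sup>2)"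
    by (simp add: bform_def sum_subtractf sum.distrib sum_distrib_left[symmetric] sum_divide_distrib[symmetric] algebra_simps)
  finally show ?thesis .
qed

text \<open>Parallels to the axis of a coordinate with nonzero coefficient meet the hyperplane in
  single points.\<close>

lemma AE_unit_cube_hyperplane:
  assumes i: "i < g" and a: "a i \<noteq> 0"
  shows "AE y in unit_cube g. (\<Sum>j<g. a j * y j) \<noteq> (c :: real)"
proof -
  let ?H = "{y \<in> space (unit_cube g). (\<Sum>j<g. a j * y j) = c}"
  have lm: "(\<lambda>y. \<Sum>j<g. a j * y j) \<in> borel_measurable (unit_cube g)"
    by (intro borel_measurable_sum borel_measurable_times borel_measurable_const component_measurable_unit_cube) auto
  then have Hm: "?H \<in> sets (unit_cube g)" by measurable
  have ins: "{..<g} = insert i ({..<g} - {i})" using i by auto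
  let ?P = "PiM ({..<g} - {i}) (\<lambda>_. U01)"
  have "emeasure (unit_cube g) ?H = (\<integral>\<^sup>+y. indicator ?H y \<partial>unit_cube g)" using Hm by simp
  also have "\<dots> = (\<integral>\<^sup>+y. (\<integral>\<^sup>+t. indicator ?H (y(i := t)) \<partial>U01) \<partial>?P)"
  proof -
    have "(indicator ?H :: _ \<Rightarrow> ennreal) \<in> borel_measurable (PiM (insert i ({..<g} - {i})) (\<lambda>_. U01))"
      using Hm unfolding ins[symmetric] unit_cube_def by (rule borel_measurable_indicator)
    from cube_factors.product_nn_integral_insert[OF _ _ this]
    show ?thesis unfolding ins[symmetric] unit_cube_def[symmetric] by simp
  qed
  also have "\<dots> \<le> (\<integral>\<^sup>+y. 0 \<partial>?P)"
  proof (rule nn_integral_mono)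
    fix y
    define t0 where "t0 = (c - (\<Sum>j\<in>{..<g} - {i}. a j * y j)) / a i"
    have "(\<Sum>j<g. a j * (y(i := t)) j) = a i * t + (\<Sum>j\<in>{..<g} - {i}. a j * y j)" for t
      using i by (subst sum.remove[of _ i]) auto
    then have "indicator ?H (y(i := t)) \<le> (indicator {t0} t :: ennreal)" for t
      using a by (auto simp: indicator_def t0_def field_simps)
    then have "(\<integral>\<^sup>+t. indicator ?H (y(i := t)) \<partial>U01) \<le> (\<integral>\<^sup>+t. indicator {t0} t \<partial>U01)"
      by (intro nn_integral_mono) auto
    also have "\<dots> = emeasure U01 {t0}" by simp
    also have "\<dots> = 0"
    proof -
      have "emeasure lborel ({0..1} \<inter> {t0}) \<le> emeasure lborel {t0}" by (intro emeasure_mono) auto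
      then show ?thesis by (subst emeasure_uniform_measure) auto
    qed
    finally show "(\<integral>\<^sup>+t. indicator ?H (y(i := t)) \<partial>U01) \<le> 0" .
  qed
  finally have "?H \<in> null_sets (unit_cube g)" using Hm by auto
  then show ?thesis by (rule AE_I') auto
qed

section \<open>Closest lattice points and the tropical moment\<close>

lemma finite_bounded_int_vecs: "finite {n \<in> int_vecs g. \<forall>i<g. \<bar>vec_index n i\<bar> \<le> N}"
proof -
  have "{n \<in> int_vecs g. \<forall>i<g. \<bar>vec_index n i\<bar> \<le> N} \<subseteq> (\<lambda>f. Matrix.vec g f) ` (PiE {..<g} (\<lambda>_. {-N..N}))"
  proof
    fix n assume n: "n \<in> {n \<in> int_vecs g. \<forall>i<g. \<bar>vec_index n i\<bar> \<le> N}"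
    then have "n = Matrix.vec g (\<lambda>i\<in>{..<g}. vec_index n i)"
      by (intro eq_vecI) (auto simp: int_vecs_def)
    moreover have "(\<lambda>i\<in>{..<g}. vec_index n i) \<in> PiE {..<g} (\<lambda>_. {-N..N})" using n by (auto simp: abs_le_iff)
    ultimately show "n \<in> (\<lambda>f. Matrix.vec g f) ` (PiE {..<g} (\<lambda>_. {-N..N}))" by blast
  qed
  then show ?thesis by (rule finite_subset) (intro finite_imageI finite_PiE; simp)
qed

text \<open>By coercivity only finitely many lattice vectors do as well as 0. The bound
  \<open>D\<close> on the representative is independent of \<open>y\<close> because the form at
  \<open>y\<close> itself is bounded on the cube.\<close>

lemma ex_lattice_minimiser:
  assumes B: "pos_def_mat h B"
  shows "\<exists>D. \<forall>y. (\<forall>i<h. y i \<in> {0..1}) \<longrightarrow> (\<exists>k\<in>int_vecs h.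
     (\<forall>n\<in>int_vecs h. bform h B (\<lambda>i. y i + zr k i) (\<lambda>i. y i + zr k i) \<le> bform h B (\<lambda>i. y i + zr n i) (\<lambda>i. y i + zr n i)) \<and>
     (\<forall>i<h. \<bar>y i + zr k i\<bar> \<le> D))"
proof -
  obtain c where c: "c > 0" "\<And>x. c * (\<Sum>i<h. (x i)\<^sup>2) \<le> bform h B x x"
    using pos_def_mat_coercive[OF B] by blast
  define A where "A = (\<Sum>i<h. \<Sum>j<h. \<bar>B $$ (i, j)\<bar>)"
  define D0 where "D0 = real h * (real h * (1 * A * 1))"
  \<comment> \<open>From t^2 <= D0/c and |t| <= 1 + t^2.\<close>
  define D where "D = D0 / c + 1"
  have A: "\<bar>B $$ (i, j)\<bar> \<le> A" if "i < h" "j < h" for i j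
  proof -
    have "\<bar>B $$ (i, j)\<bar> \<le> (\<Sum>j<h. \<bar>B $$ (i, j)\<bar>)" using that by (intro member_le_sum) auto
    also have "\<dots> \<le> A" unfolding A_def using that by (intro member_le_sum[where f = "\<lambda>i. \<Sum>j<h. \<bar>B $$ (i, j)\<bar>"]) (auto intro: sum_nonneg)
    finally show ?thesis .
  qed
  show ?thesis
  proof (intro exI[of _ D] allI impI)
    fix y :: "nat \<Rightarrow> real" assume y: "\<forall>i<h. y i \<in> {0..1}"
    define q where "q n = bform h B (\<lambda>i. y i + zr n i) (\<lambda>i. y i + zr n i)" for n
    have q0: "q (0\<^sub>v h) \<le> D0"
    proof -
      have "q (0\<^sub>v h) = bform h B y y" unfolding q_def by (rule bform_cong) auto
      moreover have "\<bar>bform h B y y\<bar> \<le> D0" unfolding D0_def using A y by (intro bform_abs_le) auto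
      ultimately show ?thesis by simp
    qed
    have bound: "\<bar>y i + zr n i\<bar> \<le> D" if n: "q n \<le> D0" and i: "i < h" for n i
    proof -
      have "(y i + zr n i)\<^sup>2 \<le> (\<Sum>i<h. (y i + zr n i)\<^sup>2)" using i by (intro member_le_sum) auto
      also have "\<dots> \<le> D0 / c" using c(2)[of "\<lambda>i. y i + zr n i"] n c(1) by (simp add: q_def pos_le_divide_eq mult.commute)
      finally have le: "(y i + zr n i)\<^sup>2 \<le> D0 / c" .
      have "\<bar>y i + zr n i\<bar> \<le> 1 + (y i + zr n i)\<^sup>2"
      proof -
        have "2 * \<bar>y i + zr n i\<bar> \<le> (y i + zr n i)\<^sup>2 + 1"
          using zero_le_power2[of "\<bar>y i + zr n i\<bar> - 1"] by (simp add: power2_diff)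
        then show ?thesis using zero_le_power2[of "y i + zr n i"] abs_ge_zero[of "y i + zr n i"] by argo
      qed
      then show ?thesis using le by (simp add: D_def)
    qed
    define S where "S = {n \<in> int_vecs h. q n \<le> q (0\<^sub>v h)}"
    have "S \<subseteq> {n \<in> int_vecs h. \<forall>i<h. \<bar>vec_index n i\<bar> \<le> \<lceil>D + 1\<rceil>}"
    proof
      fix n assume n: "n \<in> S"
      have "\<bar>vec_index n i\<bar> \<le> \<lceil>D + 1\<rceil>" if "i < h" for i
      proof -
        have "\<bar>y i + zr n i\<bar> \<le> D" using bound[of n i] n q0 that by (auto simp: S_def)
        then have "real_of_int \<bar>vec_index n i\<bar> \<le> D + 1" using y that by (auto simp: abs_le_iff)
        then show ?thesis by linarith
      qed
      then show "n \<in> {n \<in> int_vecs h. \<forall>i<h. \<bar>vec_index n i\<bar> \<le> \<lceil>D + 1\<rceil>}" using n by (simp add: S_def)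
    qed
    then have fS: "finite S" by (rule finite_subset) (rule finite_bounded_int_vecs)
    have S0: "0\<^sub>v h \<in> S" by (simp add: S_def)
    obtain k where k: "k \<in> S" "\<And>n. n \<in> S \<Longrightarrow> q k \<le> q n"
      using ex_min_if_finite[of "q ` S"] fS S0 by (metis (no_types, lifting) arg_min_if_finite(1) arg_min_least empty_iff)
    have min: "q k \<le> q n" if "n \<in> int_vecs h" for n
      using k(2)[of n] k(1) that by (cases "q n \<le> q (0\<^sub>v h)") (auto simp: S_def)
    show "\<exists>k\<in>int_vecs h. (\<forall>n\<in>int_vecs h. bform h B (\<lambda>i. y i + zr k i) (\<lambda>i. y i + zr k i) \<le> bform h B (\<lambda>i. y i + zr n i) (\<lambda>i. y i + zr n i)) \<and>
     (\<forall>i<h. \<bar>y i + zr k i\<bar> \<le> D)"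
    proof (intro bexI[of _ k] conjI ballI allI impI)
      show "\<bar>y i + zr k i\<bar> \<le> D" if "i < h" for i
        using bound[of k i] k(1) q0 that by (auto simp: S_def)
      show "k \<in> int_vecs h" using k(1) by (simp add: S_def)
    qed (use min in \<open>simp add: q_def\<close>)
  qed
qed

lemma sum_lessThan_add: "(\<Sum>i<a + b. f i) = (\<Sum>i<a. f i) + (\<Sum>j<(b::nat). f (a + j) :: real)"
  by (induction b) (auto simp: add.assoc)

text \<open>Two lattice vectors tie only on a hyperplane, and there are countably many pairs. At a
  tie for the minimum a frequency outside the first block would survive in the limit. The form acts
  on the last \<open>h\<close> of the \<open>g\<close> coordinates.\<close>

lemma AE_unique_minimiser:
  assumes B: "pos_def_mat h B" and g: "g1 + h = g"
  shows "AE y in unit_cube g. \<forall>k\<in>int_vecs h. \<forall>n\<in>int_vecs h. k \<noteq> n \<longrightarrow>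
     bform h B (\<lambda>i. y (g1 + i) + zr k i) (\<lambda>i. y (g1 + i) + zr k i) \<noteq> bform h B (\<lambda>i. y (g1 + i) + zr n i) (\<lambda>i. y (g1 + i) + zr n i)"
proof (subst AE_ball_countable, simp, intro ballI, subst AE_ball_countable, simp, intro ballI)
  fix k n assume k: "k \<in> int_vecs h" and n: "n \<in> int_vecs h"
  show "AE y in unit_cube g. k \<noteq> n \<longrightarrow>
     bform h B (\<lambda>i. y (g1 + i) + zr k i) (\<lambda>i. y (g1 + i) + zr k i) \<noteq> bform h B (\<lambda>i. y (g1 + i) + zr n i) (\<lambda>i. y (g1 + i) + zr n i)"
  proof (cases "k = n")
    case False
    define d where "d i = zr k i - zr n i" for i
    define b where "b j = (\<Sum>i<h. d i * B $$ (i, j))" for j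
    define a where "a i = (if i < g1 then 0 else 2 * b (i - g1))" for i
    have "\<exists>i<h. d i \<noteq> 0" using False int_vecs_eqI[OF k n] by (auto simp: d_def)
    then have "bform h B d d > 0" by (rule pos_def_mat_bform[OF B])
    moreover have bd: "bform h B d x = (\<Sum>j<h. b j * x j)" for x
      unfolding bform_def b_def sum_distrib_right by (subst sum.swap) simp
    ultimately have "\<exists>j<h. b j \<noteq> 0" by (metis (no_types, lifting) less_irrefl mult_zero_left sum.neutral lessThan_iff)
    then obtain j where j: "j < h" "b j \<noteq> 0" by blast
    have "AE y in unit_cube g. (\<Sum>i<g. a i * y i) \<noteq> bform h B (zr n) (zr n) - bform h B (zr k) (zr k)"
      by (rule AE_unit_cube_hyperplane[of "g1 + j"]) (use j g in \<open>auto simp: a_def\<close>)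
    then show ?thesis
    proof eventually_elim
      case (elim y)
      have "(\<Sum>i<g. a i * y i) = (\<Sum>i<g1. a i * y i) + (\<Sum>j<h. a (g1 + j) * y (g1 + j))"
        unfolding g[symmetric] by (rule sum_lessThan_add)
      also have "\<dots> = 2 * bform h B d (\<lambda>i. y (g1 + i))"
        by (simp add: a_def bd sum_distrib_left mult.assoc)
      finally have e: "2 * bform h B d (\<lambda>i. y (g1 + i)) \<noteq> bform h B (zr n) (zr n) - bform h B (zr k) (zr k)" using elim by simp
      have sym: "bform h B x z = bform h B z x" for x z
        using B by (intro bform_sym) (auto simp: pos_def_mat_def)
      have ex: "bform h B (\<lambda>i. y (g1 + i) + zr m i) (\<lambda>i. y (g1 + i) + zr m i) =
          bform h B (\<lambda>i. y (g1 + i)) (\<lambda>i. y (g1 + i)) + 2 * bform h B (zr m) (\<lambda>i. y (g1 + i)) + bform h B (zr m) (zr m)" for m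
        using sym[of "zr m" "\<lambda>i. y (g1 + i)"] by (simp add: bform_add_left bform_add_right)
      have "bform h B d (\<lambda>i. y (g1 + i)) = bform h B (zr k) (\<lambda>i. y (g1 + i)) - bform h B (zr n) (\<lambda>i. y (g1 + i))"
        by (simp add: d_def bform_def left_diff_distrib sum_subtractf)
      then show ?case using e unfolding ex by auto
    qed
  qed simp
qed

text \<open>The minimum of the form over x + Z^h. The factors 2 and 1/2 are kept to match
  \<open>tropical_theta\<close> term by term.\<close>

definition lattice_min :: "nat \<Rightarrow> real mat \<Rightarrow> (nat \<Rightarrow> real) \<Rightarrow> real" where
  "lattice_min h B x = 2 * (INF n\<in>int_vecs h. 1/2 * bform h B (\<lambda>i. x i + zr n i) (\<lambda>i. x i + zr n i))"

lemma pos_def_mat_bform_nonneg: "pos_def_mat g A \<Longrightarrow> 0 \<le> bform g A x x"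
  using pos_def_mat_bform[of g A x] bform_cong[of g x "\<lambda>_. 0" x "\<lambda>_. 0" A]
  by (cases "\<exists>i<g. x i \<noteq> 0") (auto simp: bform_def)

lemma lattice_min_eq:
  assumes "k \<in> int_vecs h"
    and "\<And>n. n \<in> int_vecs h \<Longrightarrow> bform h B (\<lambda>i. x i + zr k i) (\<lambda>i. x i + zr k i) \<le> bform h B (\<lambda>i. x i + zr n i) (\<lambda>i. x i + zr n i)"
  shows "lattice_min h B x = bform h B (\<lambda>i. x i + zr k i) (\<lambda>i. x i + zr k i)"
proof -
  have "(INF n\<in>int_vecs h. 1/2 * bform h B (\<lambda>i. x i + zr n i) (\<lambda>i. x i + zr n i)) = 1/2 * bform h B (\<lambda>i. x i + zr k i) (\<lambda>i. x i + zr k i)"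
    by (rule cInf_eq_minimum) (use assms in auto)
  then show ?thesis by (simp add: lattice_min_def)
qed

lemma lattice_min_measurable:
  assumes B: "pos_def_mat h B" and x: "\<And>i. i < h \<Longrightarrow> (\<lambda>w. x w i) \<in> borel_measurable M"
  shows "(\<lambda>w. lattice_min h B (x w)) \<in> borel_measurable M"
  unfolding lattice_min_def
proof (rule borel_measurable_times[OF borel_measurable_const borel_measurable_cINF])
  show "(\<lambda>w. 1/2 * bform h B (\<lambda>i. x w i + zr n i) (\<lambda>i. x w i + zr n i)) \<in> borel_measurable M" for n
    by (intro borel_measurable_times borel_measurable_const bform_measurable borel_measurable_add x)
  show "bdd_below ((\<lambda>n. 1/2 * bform h B (\<lambda>i. x w i + zr n i) (\<lambda>i. x w i + zr n i)) ` int_vecs h)" for w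
    using pos_def_mat_bform_nonneg[OF B] by (intro bdd_belowI2[of _ 0]) auto
qed simp

text \<open>In the lattice basis the inner product of B u with itself is the form of B at u. The
  integral over \<open>h\<close> coordinates is a marginal of the one over \<open>g\<close>
  coordinates.\<close>

lemma tropical_moment_eq:
  assumes B: "pos_def_mat h B" and g: "g1 + h = g"
  shows "tropical_moment B = (\<integral>y. lattice_min h B (\<lambda>i. y (g1 + i)) \<partial>unit_cube g)"
proof -
  have Bc: "B \<in> carrier_mat h h" using B by (simp add: pos_def_mat_def)
  note inv = mat_inv_pos_def[OF B]
  have "2 * tropical_theta B (B *\<^sub>v Matrix.vec h x) = lattice_min h B x" for x
  proof -
    have "1/2 * lattice_inner B (B *\<^sub>v Matrix.vec h x + B *\<^sub>v map_vec of_int n) (B *\<^sub>v Matrix.vec h x + B *\<^sub>v map_vec of_int n) =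
        1/2 * bform h B (\<lambda>i. x i + zr n i) (\<lambda>i. x i + zr n i)" if n: "n \<in> int_vecs h" for n
    proof -
      define v where "v = Matrix.vec h x + map_vec real_of_int n"
      have v: "v \<in> carrier_vec h" using n by (auto simp: v_def int_vecs_def)
      have "B *\<^sub>v Matrix.vec h x + B *\<^sub>v map_vec of_int n = B *\<^sub>v v"
        unfolding v_def using Bc n by (subst mult_add_distrib_mat_vec[of _ h h]) (auto simp: int_vecs_def)
      moreover have "lattice_inner B (B *\<^sub>v v) (B *\<^sub>v v) = scalar_prod (B *\<^sub>v v) v"
        unfolding lattice_inner_def using inv Bc v by (simp add: assoc_mult_mat_vec[symmetric])
      moreover have "\<dots> = scalar_prod v (B *\<^sub>v v)" using Bc v by (intro comm_scalar_prod[of _ h]) auto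
      moreover have "\<dots> = bform h B (\<lambda>i. x i + zr n i) (\<lambda>i. x i + zr n i)"
        unfolding scalar_prod_mult_mat_vec[OF Bc v v] using n by (intro bform_cong) (auto simp: v_def int_vecs_def)
      ultimately show ?thesis by simp
    qed
    then have "(INF n\<in>int_vecs h. 1/2 * lattice_inner B (B *\<^sub>v Matrix.vec h x + B *\<^sub>v map_vec of_int n) (B *\<^sub>v Matrix.vec h x + B *\<^sub>v map_vec of_int n)) =
        (INF n\<in>int_vecs h. 1/2 * bform h B (\<lambda>i. x i + zr n i) (\<lambda>i. x i + zr n i))"
      by (intro INF_cong refl)
    moreover have "real_lattice B = (\<lambda>n. B *\<^sub>v map_vec of_int n) ` int_vecs h"
      unfolding real_lattice_def using Bc by auto
    ultimately show ?thesis
      unfolding tropical_theta_def lattice_min_def by (simp only: image_image)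
  qed
  then have "tropical_moment B = (\<integral>x. lattice_min h B x \<partial>unit_cube h)"
    unfolding tropical_moment_def using Bc by (simp flip: integral_mult_right_zero)
  also have "unit_cube h = distr (unit_cube g) (unit_cube h) (\<lambda>y. \<lambda>i\<in>{..<h}. y (g1 + i))"
    unfolding unit_cube_def
    by (rule distr_PiM_reindex[of "{..<g}" "\<lambda>_. U01" "\<lambda>i. g1 + i" "{..<h}", symmetric]) (use g prob_space_U01 in auto)
  also have "(\<integral>x. lattice_min h B x \<partial>distr (unit_cube g) (unit_cube h) (\<lambda>y. \<lambda>i\<in>{..<h}. y (g1 + i))) =
      (\<integral>y. lattice_min h B (\<lambda>i\<in>{..<h}. y (g1 + i)) \<partial>unit_cube g)"
  proof (rule integral_distr)
    show "(\<lambda>y. \<lambda>i\<in>{..<h}. y (g1 + i)) \<in> unit_cube g \<rightarrow>\<^sub>M unit_cube h"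
      unfolding unit_cube_def by (rule measurable_restrict) (use g in \<open>auto intro: measurable_component_singleton\<close>)
    show "lattice_min h B \<in> borel_measurable (unit_cube h)"
      by (rule lattice_min_measurable[OF B]) (rule component_measurable_unit_cube)
  qed
  also have "\<dots> = (\<integral>y. lattice_min h B (\<lambda>i. y (g1 + i)) \<partial>unit_cube g)"
    unfolding lattice_min_def
    by (intro Bochner_Integration.integral_cong refl arg_cong[where f = "\<lambda>x. 2 * x"] INF_cong arg_cong[where f = "\<lambda>x. 1/2 * x"] bform_cong) auto
  finally show ?thesis .
qed

lemma degeneration_data_integrable:
  assumes c: "c > 0" and d: "degeneration_data g C c R \<beta> \<rho> \<tau> m"
  shows "integrable (unit_cube g \<Otimes>\<^sub>M unit_cube g) (renormalized_log g (\<tau> j) (m j))"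
proof -
  have t: "\<tau> j \<in> siegel g" and m: "m j \<in> borel_measurable (unit_cube g)" using d by (auto simp: degeneration_data_def)
  obtain K where K: "\<forall>\<tau> m. \<tau> \<in> siegel g \<longrightarrow> m \<in> borel_measurable (unit_cube g) \<longrightarrow>
     (AE y in unit_cube g. \<exists>k\<in>int_vecs g. gauss_bounded g C c (normalized_coeff g \<tau> (\<lambda>i. y i + zr k i)) \<and>
        \<bar>bform g (map_mat Im \<tau>) (\<lambda>i. y i + zr k i) (\<lambda>i. y i + zr k i) - m y\<bar> \<le> R) \<longrightarrow>
     (\<integral>\<^sup>+p. ennreal ((renormalized_log g \<tau> m p)\<^sup>2) \<partial>(unit_cube g \<Otimes>\<^sub>M unit_cube g)) \<le> ennreal K"
    using renormalized_log_L2[OF c, of g C R] by (elim exE conjE) (rule that)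
  have "(\<integral>\<^sup>+p. ennreal ((renormalized_log g (\<tau> j) (m j) p)\<^sup>2) \<partial>(unit_cube g \<Otimes>\<^sub>M unit_cube g)) \<le> ennreal K"
  proof (rule K[rule_format, OF t m])
    show "AE y in unit_cube g. \<exists>k\<in>int_vecs g. gauss_bounded g C c (normalized_coeff g (\<tau> j) (\<lambda>i. y i + zr k i)) \<and>
        \<bar>bform g (map_mat Im (\<tau> j)) (\<lambda>i. y i + zr k i) (\<lambda>i. y i + zr k i) - m j y\<bar> \<le> R"
      using d unfolding degeneration_data_def by (auto elim!: eventually_mono)
  qed
  then show ?thesis by (rule cube2.integrable_of_nn_integral_square(1)[OF renormalized_log_measurable[OF t m]])
qed

lemma theta_invariant_renormalized:
  assumes t: "\<tau> \<in> siegel g" and U: "integrable (unit_cube g \<Otimes>\<^sub>M unit_cube g) (renormalized_log g \<tau> m)"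
    and m: "integrable (unit_cube g) m"
  shows "theta_invariant g \<tau> = - (real g / 2) * ln 2 - (\<integral>p. renormalized_log g \<tau> m p \<partial>(unit_cube g \<Otimes>\<^sub>M unit_cube g))
     - ln (Determinant.det (map_mat Im \<tau>)) / 2 + 2 * pi * (\<integral>y. m y \<partial>unit_cube g)"
proof -
  let ?M = "unit_cube g \<Otimes>\<^sub>M unit_cube g"
  have im: "integrable ?M (\<lambda>p. m (snd p))" and em: "(\<integral>p. m (snd p) \<partial>?M) = (\<integral>y. m y \<partial>unit_cube g)"
  proof -
    have d: "distr ?M (unit_cube g) snd = unit_cube g"
    proof -
      have "distr ?M (unit_cube g) snd = distr (distr ?M ?M (\<lambda>(x, y). (y, x))) (unit_cube g) snd"
        using cube2.distr_pair_swap[of g] by simp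
      also have "\<dots> = distr ?M (unit_cube g) fst"
        by (subst distr_distr) (auto simp: comp_def case_prod_unfold)
      also have "\<dots> = unit_cube g" by (rule cube.distr_pair_fst)
      finally show ?thesis .
    qed
    show "integrable ?M (\<lambda>p. m (snd p))"
      using m integrable_distr[OF measurable_snd[of "unit_cube g" "unit_cube g"], of m] d by simp
    show "(\<integral>p. m (snd p) \<partial>?M) = (\<integral>y. m y \<partial>unit_cube g)"
      using integral_distr[OF measurable_snd[of "unit_cube g" "unit_cube g"] borel_measurable_integrable[OF m]] d by simp
  qed
  have "(\<integral>p. ln (norm_theta_sq g \<tau> (torus_point g \<tau> (fst p) (snd p))) \<partial>?M) =
     (\<integral>p. (renormalized_log g \<tau> m p + ln (Determinant.det (map_mat Im \<tau>)) / 2) - 2 * pi * m (snd p) \<partial>?M)"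
    by (simp add: renormalized_log_def)
  also have "\<dots> = (\<integral>p. renormalized_log g \<tau> m p \<partial>?M) + ln (Determinant.det (map_mat Im \<tau>)) / 2 - 2 * pi * (\<integral>y. m y \<partial>unit_cube g)"
    using U im by (simp add: em cube2.prob_space)
  finally show ?thesis unfolding theta_invariant_eq[OF t] by simp
qed

section \<open>Choice of the period matrix, and continuity on the Siegel space\<close>

lemma invertible_mat_ex_inverse:
  assumes "L \<in> carrier_mat g g" "invertible_mat L"
  shows "\<exists>B\<in>carrier_mat g g. L * B = 1\<^sub>m g \<and> B * L = 1\<^sub>m g"
proof -
  obtain B where "inverts_mat L B" "inverts_mat B L" using assms(2) by (auto simp: invertible_mat_def)
  then have LB: "L * B = 1\<^sub>m g" "B * L = 1\<^sub>m (dim_row B)" using assms(1) by (auto simp: inverts_mat_def)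
  from arg_cong[OF LB(1), of dim_col] arg_cong[OF LB(2), of dim_col] have B: "B \<in> carrier_mat g g"
    using assms(1) by auto
  then show ?thesis using LB by auto
qed

lemma std_lattice_carrier: "\<tau> \<in> carrier_mat g g \<Longrightarrow> std_lattice g \<tau> \<subseteq> carrier_vec g"
  by (auto simp: std_lattice_def int_vecs_def)

text \<open>The witness is the inverse of \<open>L'\<close> times \<open>L\<close>.\<close>

lemma ppav_iso_left_quotient:
  assumes s: "S \<subseteq> carrier_vec g" and s': "S' \<subseteq> carrier_vec g"
    and L: "ppav_iso g L S E \<Lambda> F" and L': "ppav_iso g L' S' E' \<Lambda> F"
  shows "\<exists>K. ppav_iso g K S E S' E'"
proof -
  have Lc: "L \<in> carrier_mat g g" "invertible_mat L" and L'c: "L' \<in> carrier_mat g g" "invertible_mat L'"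
    using L L' by (auto simp: ppav_iso_def)
  obtain A where A: "A \<in> carrier_mat g g" "L * A = 1\<^sub>m g" "A * L = 1\<^sub>m g" using invertible_mat_ex_inverse[OF Lc] by blast
  obtain B where B: "B \<in> carrier_mat g g" "L' * B = 1\<^sub>m g" "B * L' = 1\<^sub>m g" using invertible_mat_ex_inverse[OF L'c] by blast
  have K: "(B * L) \<in> carrier_mat g g" using B Lc by auto
  have Kv: "(B * L) *\<^sub>v x = B *\<^sub>v (L *\<^sub>v x)" if "x \<in> carrier_vec g" for x
    using B Lc that by (intro assoc_mult_mat_vec) auto
  have L'K: "L' *\<^sub>v ((B * L) *\<^sub>v x) = L *\<^sub>v x" if "x \<in> carrier_vec g" for x
  proof -
    have "L' *\<^sub>v (B *\<^sub>v (L *\<^sub>v x)) = (L' * B) *\<^sub>v (L *\<^sub>v x)"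
      using B L'c Lc that by (intro assoc_mult_mat_vec[symmetric]) auto
    then show ?thesis unfolding Kv[OF that] B(2) using Lc that by auto
  qed
  have BL': "B *\<^sub>v (L' *\<^sub>v x) = x" if "x \<in> carrier_vec g" for x
    using B L'c that by (simp add: assoc_mult_mat_vec[symmetric, of B g g L' g x])
  have inv: "invertible_mat (B * L)"
  proof -
    have cancel: "(P * Q) * (P' * Q') = 1\<^sub>m g" if "P \<in> carrier_mat g g" "Q \<in> carrier_mat g g" "P' \<in> carrier_mat g g"
        "Q' \<in> carrier_mat g g" "Q * P' = 1\<^sub>m g" "P * Q' = 1\<^sub>m g" for P Q P' Q' :: "complex mat"
    proof -
      have "(P * Q) * (P' * Q') = P * (Q * (P' * Q'))" using that by (intro assoc_mult_mat) auto
      also have "Q * (P' * Q') = (Q * P') * Q'" using that by (intro assoc_mult_mat[symmetric]) auto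
      finally show ?thesis using that by simp
    qed
    have 1: "(B * L) * (A * L') = 1\<^sub>m g" and 2: "(A * L') * (B * L) = 1\<^sub>m g"
      using A B Lc L'c by (auto intro!: cancel)
    show ?thesis unfolding invertible_mat_def inverts_mat_def
      using 1 2 A B Lc L'c by (intro conjI exI[of _ "A * L'"]) auto
  qed
  have "(\<lambda>x. (B * L) *\<^sub>v x) ` S = (\<lambda>y. B *\<^sub>v y) ` ((\<lambda>x. L *\<^sub>v x) ` S)"
    unfolding image_image using s by (intro image_cong refl Kv) auto
  also have "\<dots> = (\<lambda>y. B *\<^sub>v y) ` ((\<lambda>x. L' *\<^sub>v x) ` S')"
    using L L' by (simp add: ppav_iso_def)
  also have "\<dots> = id ` S'" unfolding image_image using s' BL' by (intro image_cong) auto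
  finally have img: "(\<lambda>x. (B * L) *\<^sub>v x) ` S = S'" by simp
  have "E' ((B * L) *\<^sub>v x) ((B * L) *\<^sub>v y) = E x y" if "x \<in> carrier_vec g" "y \<in> carrier_vec g" for x y
  proof -
    have "F (L' *\<^sub>v ((B * L) *\<^sub>v x)) (L' *\<^sub>v ((B * L) *\<^sub>v y)) = E' ((B * L) *\<^sub>v x) ((B * L) *\<^sub>v y)"
      using L' K that by (auto simp: ppav_iso_def)
    moreover have "F (L *\<^sub>v x) (L *\<^sub>v y) = E x y" using L that by (auto simp: ppav_iso_def)
    ultimately show ?thesis using L'K that by simp
  qed
  then show ?thesis using K inv img by (auto simp: ppav_iso_def)
qed

lemma ppav_invariant_eq:
  assumes "period_matrix g \<Lambda> E \<tau>"
  shows "ppav_invariant g \<Lambda> E = theta_invariant g \<tau>"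
proof -
  define \<sigma> where "\<sigma> = (SOME \<tau>. period_matrix g \<Lambda> E \<tau>)"
  have \<sigma>: "period_matrix g \<Lambda> E \<sigma>" unfolding \<sigma>_def using assms by (rule someI)
  obtain L where L: "\<sigma> \<in> siegel g" "ppav_iso g L (std_lattice g \<sigma>) (std_form \<sigma>) \<Lambda> E" using \<sigma> by (auto simp: period_matrix_def)
  obtain L' where L': "\<tau> \<in> siegel g" "ppav_iso g L' (std_lattice g \<tau>) (std_form \<tau>) \<Lambda> E" using assms by (auto simp: period_matrix_def)
  obtain K where "ppav_iso g K (std_lattice g \<sigma>) (std_form \<sigma>) (std_lattice g \<tau>) (std_form \<tau>)"
    using ppav_iso_left_quotient[OF std_lattice_carrier[OF siegelD(1)[OF L(1)]] std_lattice_carrier[OF siegelD(1)[OF L'(1)]] L(2) L'(2)] by blast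
  then have "torus_iso g K \<sigma> \<tau>" using L L' by unfold_locales auto
  from torus_iso.theta_invariant_iso[OF this] show ?thesis by (simp add: ppav_invariant_def \<sigma>_def)
qed

lemma det_tendsto:
  fixes A :: "nat \<Rightarrow> real mat"
  assumes A: "\<And>j. A j \<in> carrier_mat n n" "A' \<in> carrier_mat n n"
    and lim: "\<And>i k. i < n \<Longrightarrow> k < n \<Longrightarrow> (\<lambda>j. A j $$ (i, k)) \<longlonglongrightarrow> A' $$ (i, k)"
  shows "(\<lambda>j. Determinant.det (A j)) \<longlonglongrightarrow> Determinant.det A'"
proof -
  have "(\<lambda>j. \<Sum>p | p permutes {0..<n}. signof p * (\<Prod>i = 0..<n. A j $$ (i, p i))) \<longlonglongrightarrow>
      (\<Sum>p | p permutes {0..<n}. signof p * (\<Prod>i = 0..<n. A' $$ (i, p i)))"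
  proof (intro tendsto_sum tendsto_mult tendsto_const tendsto_prod lim)
    show "p i < n" if "p \<in> {p. p permutes {0..<n}}" "i \<in> {0..<n}" for p i
      using permutes_in_image[of p "{0..<n}" i] that by auto
  qed auto
  then show ?thesis using A by (simp add: Determinant.det_def' [of _ n])
qed

lemma mat_entries_bounded: "\<exists>K\<ge>0. \<forall>i<g. \<forall>j<g. \<bar>A $$ (i, j)\<bar> \<le> K" for A :: "real mat"
proof (intro exI[of _ "\<Sum>i<g. \<Sum>j<g. \<bar>A $$ (i, j)\<bar>"] conjI allI impI)
  fix i j assume "i < g" "j < g"
  then have "\<bar>A $$ (i, j)\<bar> \<le> (\<Sum>j<g. \<bar>A $$ (i, j)\<bar>)" by (intro member_le_sum) auto
  also have "\<dots> \<le> (\<Sum>i<g. \<Sum>j<g. \<bar>A $$ (i, j)\<bar>)"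
    using \<open>i < g\<close> by (intro member_le_sum[where f = "\<lambda>i. \<Sum>j<g. \<bar>A $$ (i, j)\<bar>"]) (auto intro: sum_nonneg)
  finally show "\<bar>A $$ (i, j)\<bar> \<le> (\<Sum>i<g. \<Sum>j<g. \<bar>A $$ (i, j)\<bar>)" .
qed (auto intro!: sum_nonneg)

lemma eventually_entries_close:
  fixes A :: "'a \<Rightarrow> real mat"
  assumes "\<And>i k. i < n \<Longrightarrow> k < n \<Longrightarrow> ((\<lambda>j. A j $$ (i, k)) \<longlongrightarrow> A' $$ (i, k)) F" and \<eta>: "\<eta> > 0"
  shows "eventually (\<lambda>j. \<forall>i<n. \<forall>k<n. \<bar>A j $$ (i, k) - A' $$ (i, k)\<bar> \<le> \<eta>) F"
proof -
  have "eventually (\<lambda>j. \<forall>i\<in>{..<n}. \<forall>k\<in>{..<n}. \<bar>A j $$ (i, k) - A' $$ (i, k)\<bar> \<le> \<eta>) F"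
  proof (intro eventually_ball_finite ballI finite_lessThan)
    fix i k assume "i \<in> {..<n}" "k \<in> {..<n}"
    then have "eventually (\<lambda>j. dist (A j $$ (i, k)) (A' $$ (i, k)) < \<eta>) F"
      using assms by (intro tendstoD) auto
    then show "eventually (\<lambda>j. \<bar>A j $$ (i, k) - A' $$ (i, k)\<bar> \<le> \<eta>) F"
      by eventually_elim (simp add: dist_real_def)
  qed
  then show ?thesis by eventually_elim auto
qed

lemma bform_tendsto:
  fixes A :: "nat \<Rightarrow> 'a::real_normed_field mat"
  assumes "\<And>i k. i < g \<Longrightarrow> k < g \<Longrightarrow> (\<lambda>j. A j $$ (i, k)) \<longlonglongrightarrow> A' $$ (i, k)"
  shows "(\<lambda>j. bform g (A j) x y) \<longlonglongrightarrow> bform g A' x y"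
  unfolding bform_def by (intro tendsto_sum tendsto_mult tendsto_const assms) auto

text \<open>Convergence inside the Siegel space is treated as a degeneration without diverging part:
  the growth \<open>m\<close> and the lattice vector are 0, and the constant sequence \<tau>' has
  the same limit data.\<close>

lemma theta_invariant_tendsto:
  assumes t: "\<And>j. \<tau> j \<in> siegel g" and t': "\<tau>' \<in> siegel g"
    and lim: "\<And>i k. i < g \<Longrightarrow> k < g \<Longrightarrow> (\<lambda>j. \<tau> j $$ (i, k)) \<longlonglongrightarrow> \<tau>' $$ (i, k)"
  shows "(\<lambda>j. theta_invariant g (\<tau> j)) \<longlonglongrightarrow> theta_invariant g \<tau>'"
proof -
  define Y where "Y j = map_mat Im (\<tau> j)" for j
  define Y' where "Y' = map_mat Im \<tau>'"
  have Yc: "Y j \<in> carrier_mat g g" "Y' \<in> carrier_mat g g" for j using siegelD(4) t t' by (auto simp: Y_def Y'_def)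
  have limY: "(\<lambda>j. Y j $$ (i, k)) \<longlonglongrightarrow> Y' $$ (i, k)" if "i < g" "k < g" for i k
  proof -
    have "(\<lambda>j. Im (\<tau> j $$ (i, k))) \<longlonglongrightarrow> Im (\<tau>' $$ (i, k))" by (intro tendsto_intros lim that)
    then show ?thesis using that siegelD(1)[OF t] siegelD(1)[OF t'] by (simp add: Y_def Y'_def carrier_matD[of _ g g])
  qed
  obtain c where c: "c > 0" "\<And>x. c * (\<Sum>i<g. (x i)\<^sup>2) \<le> bform g Y' x x"
    using pos_def_mat_coercive[OF siegelD(3)[OF t']] unfolding Y'_def by blast
  \<comment> \<open>A perturbation of all entries by \<eta> costs at most half of the coercivity
    constant.\<close>
  define \<eta> where "\<eta> = c / (2 * (real g + 1))"
  have \<eta>: "\<eta> > 0" "\<eta> * real g \<le> c / 2" using c by (auto simp: \<eta>_def field_simps)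
  obtain N where N: "\<And>j i k. j \<ge> N \<Longrightarrow> i < g \<Longrightarrow> k < g \<Longrightarrow> \<bar>Y j $$ (i, k) - Y' $$ (i, k)\<bar> \<le> \<eta>"
  proof -
    have "eventually (\<lambda>j. \<forall>i<g. \<forall>k<g. \<bar>Y j $$ (i, k) - Y' $$ (i, k)\<bar> \<le> \<eta>) sequentially"
      by (rule eventually_entries_close[OF limY \<eta>(1)])
    then show ?thesis unfolding eventually_sequentially by (elim exE) (rule that, auto)
  qed
  obtain K where K: "K \<ge> 0" "\<And>i j. i < g \<Longrightarrow> j < g \<Longrightarrow> \<bar>Y' $$ (i, j)\<bar> \<le> K"
    using mat_entries_bounded[of g Y'] by (elim exE conjE) (rule that, auto)
  define A where "A = K + \<eta>"
  define C where "C = exp (real g * ((2 * pi * (real g * (A * 1)))\<^sup>2 / (2 * (pi * (c / 2)))))"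
  define c' where "c' = pi * (c / 2) / 2"
  define R where "R = real g * (real g * (1 * A * 1))"
  \<comment> \<open>The zero shift is kept because entries of \<open>0\<^sub>v g\<close> beyond
    \<open>g\<close> are unspecified, so the two functions need not be equal there.\<close>
  define v where "v y i = y i + zr (0\<^sub>v g) i" for y :: "nat \<Rightarrow> real" and i
  have data: "degeneration_data g C c' R (\<lambda>y. normalized_coeff g \<tau>' (v y)) (\<lambda>y. bform g Y' (v y) (v y)) \<sigma> (\<lambda>_ _. 0)"
    if s: "\<And>j. \<sigma> j \<in> siegel g" and close: "\<And>j i k. i < g \<Longrightarrow> k < g \<Longrightarrow> \<bar>map_mat Im (\<sigma> j) $$ (i, k) - Y' $$ (i, k)\<bar> \<le> \<eta>"
      and ls: "\<And>i k. i < g \<Longrightarrow> k < g \<Longrightarrow> (\<lambda>j. \<sigma> j $$ (i, k)) \<longlonglongrightarrow> \<tau>' $$ (i, k)" for \<sigma>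
    unfolding degeneration_data_def
  proof (intro conjI allI s borel_measurable_const)
    have coer: "c / 2 * (\<Sum>i<g. (x i)\<^sup>2) \<le> bform g (map_mat Im (\<sigma> j)) x x" for x j
    proof -
      have "\<eta> * real g * (\<Sum>i<g. (x i)\<^sup>2) \<le> c / 2 * (\<Sum>i<g. (x i)\<^sup>2)"
        using \<eta> by (intro mult_right_mono sum_nonneg) auto
      moreover have "bform g Y' x x - \<eta> * real g * (\<Sum>i<g. (x i)\<^sup>2) \<le> bform g (map_mat Im (\<sigma> j)) x x"
        by (rule bform_perturb) (rule close)
      ultimately show ?thesis using c(2)[of x] by (simp add: field_simps)
    qed
    have entry: "\<bar>map_mat Im (\<sigma> j) $$ (i, k)\<bar> \<le> A" if "i < g" "k < g" for i k j
      using close[OF that, of j] K(2)[OF that] by (simp add: A_def)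
    show "AE y in unit_cube g. \<exists>k\<in>int_vecs g.
        (\<forall>j. gauss_bounded g C c' (normalized_coeff g (\<sigma> j) (\<lambda>i. y i + zr k i)) \<and>
          \<bar>bform g (map_mat Im (\<sigma> j)) (\<lambda>i. y i + zr k i) (\<lambda>i. y i + zr k i) - 0\<bar> \<le> R) \<and>
        (\<forall>n\<in>int_vecs g. (\<lambda>j. normalized_coeff g (\<sigma> j) (\<lambda>i. y i + zr k i) n) \<longlonglongrightarrow> normalized_coeff g \<tau>' (v y) n) \<and>
        (\<lambda>j. bform g (map_mat Im (\<sigma> j)) (\<lambda>i. y i + zr k i) (\<lambda>i. y i + zr k i) - 0) \<longlonglongrightarrow> bform g Y' (v y) (v y)"
      using AE_unit_cube
    proof eventually_elim
      fix y :: "nat \<Rightarrow> real" assume y: "\<forall>i<g. y i \<in> {0..1}"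
      have v1: "\<bar>v y i\<bar> \<le> 1" if "i < g" for i using y that by (auto simp: v_def)
      have v: "(\<lambda>i. y i + zr (0\<^sub>v g) i) = v y" by (simp add: v_def fun_eq_iff)
      show "\<exists>k\<in>int_vecs g.
        (\<forall>j. gauss_bounded g C c' (normalized_coeff g (\<sigma> j) (\<lambda>i. y i + zr k i)) \<and>
          \<bar>bform g (map_mat Im (\<sigma> j)) (\<lambda>i. y i + zr k i) (\<lambda>i. y i + zr k i) - 0\<bar> \<le> R) \<and>
        (\<forall>n\<in>int_vecs g. (\<lambda>j. normalized_coeff g (\<sigma> j) (\<lambda>i. y i + zr k i) n) \<longlonglongrightarrow> normalized_coeff g \<tau>' (v y) n) \<and>
        (\<lambda>j. bform g (map_mat Im (\<sigma> j)) (\<lambda>i. y i + zr k i) (\<lambda>i. y i + zr k i) - 0) \<longlonglongrightarrow> bform g Y' (v y) (v y)"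
      proof (intro bexI[of _ "0\<^sub>v g"] conjI allI ballI zero_int_vecs, unfold v diff_zero)
        show "gauss_bounded g C c' (normalized_coeff g (\<sigma> j) (v y))" for j
          unfolding C_def c'_def
          by (rule normalized_coeff_gauss_bounded[where Z = "map_mat Im (\<sigma> j)"]) (use s c coer entry v1 in auto)
        show "\<bar>bform g (map_mat Im (\<sigma> j)) (v y) (v y)\<bar> \<le> R" for j
          unfolding R_def by (rule bform_abs_le) (use entry v1 in auto)
        show "(\<lambda>j. normalized_coeff g (\<sigma> j) (v y) n) \<longlonglongrightarrow> normalized_coeff g \<tau>' (v y) n" for n
          unfolding normalized_coeff_def by (intro tendsto_intros bform_tendsto ls)
        show "(\<lambda>j. bform g (map_mat Im (\<sigma> j)) (v y) (v y)) \<longlonglongrightarrow> bform g Y' (v y) (v y)"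
        proof (rule bform_tendsto)
          fix i k assume ik: "i < g" "k < g"
          have "(\<lambda>j. Im (\<sigma> j $$ (i, k))) \<longlonglongrightarrow> Im (\<tau>' $$ (i, k))" by (intro tendsto_intros ls ik)
          then show "(\<lambda>j. map_mat Im (\<sigma> j) $$ (i, k)) \<longlonglongrightarrow> Y' $$ (i, k)"
            using ik siegelD(1)[OF s] siegelD(1)[OF t'] by (simp add: Y'_def carrier_matD[of _ g g])
        qed
      qed
    qed
  qed
  have c'0: "c' > 0" using c by (simp add: c'_def)
  have d1: "degeneration_data g C c' R (\<lambda>y. normalized_coeff g \<tau>' (v y)) (\<lambda>y. bform g Y' (v y) (v y)) (\<lambda>j. \<tau> (j + N)) (\<lambda>_ _. 0)"
    using N by (intro data t LIMSEQ_ignore_initial_segment lim) (auto simp: Y_def)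
  have d2: "degeneration_data g C c' R (\<lambda>y. normalized_coeff g \<tau>' (v y)) (\<lambda>y. bform g Y' (v y) (v y)) (\<lambda>j. \<tau>') (\<lambda>_ _. 0)"
    using \<eta> by (intro data t') (auto simp: Y'_def)
  let ?M = "unit_cube g \<Otimes>\<^sub>M unit_cube g"
  have U: "(\<lambda>j. \<integral>p. renormalized_log g (\<tau> (j + N)) (\<lambda>_. 0) p \<partial>?M) \<longlonglongrightarrow> (\<integral>p. renormalized_log g \<tau>' (\<lambda>_. 0) p \<partial>?M)"
  proof -
    obtain l where l: "(\<lambda>j. \<integral>p. renormalized_log g (\<tau> (j + N)) (\<lambda>_. 0) p \<partial>?M) \<longlonglongrightarrow> l"
      and l': "(\<lambda>j::nat. \<integral>p. renormalized_log g \<tau>' (\<lambda>_. 0) p \<partial>?M) \<longlonglongrightarrow> l"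
      using degeneration_data_same_limit[OF c'0 d1 d2] by (elim exE conjE) (rule that)
    from l' have "(\<integral>p. renormalized_log g \<tau>' (\<lambda>_. 0) p \<partial>?M) = l" by (rule LIMSEQ_unique[OF tendsto_const])
    with l show ?thesis by (simp only:)
  qed
  have dlim: "(\<lambda>j. Determinant.det (Y (j + N))) \<longlonglongrightarrow> Determinant.det Y'"
    by (intro LIMSEQ_ignore_initial_segment det_tendsto[OF Yc] limY)
  have dpos: "Determinant.det Y' > 0" using pos_def_mat_det_pos[OF siegelD(3)[OF t']] by (simp add: Y'_def)
  have "(\<lambda>j. theta_invariant g (\<tau> (j + N))) \<longlonglongrightarrow> theta_invariant g \<tau>'"
    unfolding theta_invariant_renormalized[OF t degeneration_data_integrable[OF c'0 d1], simplified]
      theta_invariant_renormalized[OF t' degeneration_data_integrable[OF c'0 d2], simplified]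
    using dpos U dlim unfolding Y_def Y'_def by (intro tendsto_intros) auto
  then show ?thesis by (rule LIMSEQ_offset)
qed

section \<open>Block degenerations\<close>

text \<open>Terms that involve the second block are split by the inequality of arithmetic and
  geometric means into a small multiple of the first block, which its coercivity absorbs, and a
  large multiple of the second, which \<open>L0\<close> copies of B pay for. The constant is uniform
  over all \<open>A\<close> with the given bounds.\<close>

lemma block_coercive:
  assumes c1: "c1 > 0" and cB: "cB > 0" and K: "K \<ge> 0" and g: "g1 + h = g"
    and B: "\<And>z. cB * (\<Sum>i<h. (z i)\<^sup>2) \<le> bform h B z z"
  shows "\<exists>L0\<ge>0. \<forall>A :: real mat. (\<forall>i<g. \<forall>j<g. \<bar>A $$ (i, j)\<bar> \<le> K) \<longrightarrow> (\<forall>x. c1 * (\<Sum>i<g1. (x i)\<^sup>2) \<le> bform g1 A x x) \<longrightarrow>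
     (\<forall>x. c1 / 2 * (\<Sum>i<g. (x i)\<^sup>2) \<le> bform g A x x + L0 * bform h B (\<lambda>i. x (g1 + i)) (\<lambda>i. x (g1 + i)))"
proof -
  define \<epsilon> where "\<epsilon> = c1 / (4 * (real g + 1))"
  have \<epsilon>: "\<epsilon> > 0" "2 * real g * \<epsilon> \<le> c1 / 2" using c1 by (auto simp: \<epsilon>_def field_simps)
  define K' where "K' = K\<^sup>2 / (4 * \<epsilon>) + K"
  have K': "K' \<ge> 0" "K\<^sup>2 / (4 * \<epsilon>) \<le> K'" "K \<le> K'" using K \<epsilon> by (auto simp: K'_def)
  define L0 where "L0 = (2 * real g * K' + c1 / 2) / cB"
  have "c1 / 2 * (\<Sum>i<g. (x i)\<^sup>2) \<le> bform g A x x + L0 * bform h B (\<lambda>i. x (g1 + i)) (\<lambda>i. x (g1 + i))"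
    if AK: "\<forall>i<g. \<forall>j<g. \<bar>A $$ (i, j)\<bar> \<le> K" and A1: "\<forall>x. c1 * (\<Sum>i<g1. (x i)\<^sup>2) \<le> bform g1 A x x" for A :: "real mat" and x
  proof -
    \<comment> \<open>Each entry outside the first block is charged to its two coordinates; over all
      entries every weight is counted 2 g times.\<close>
    define e where "e i = (if i < g1 then \<epsilon> else K') * (x i)\<^sup>2" for i
    have e0: "e i \<ge> 0" for i using \<epsilon> K' by (simp add: e_def)
    define a b where "a = (\<Sum>i<g1. (x i)\<^sup>2)" and "b = (\<Sum>i<h. (x (g1 + i))\<^sup>2)"
    have ab: "a \<ge> 0" "b \<ge> 0" by (auto simp: a_def b_def sum_nonneg)
    have amgm: "K * \<bar>p\<bar> * \<bar>q\<bar> \<le> \<epsilon> * p\<^sup>2 + K' * q\<^sup>2" for p q :: real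
    proof -
      have "0 \<le> (2 * \<epsilon> * \<bar>p\<bar> - K * \<bar>q\<bar>)\<^sup>2" by simp
      then have "4 * \<epsilon> * (K * \<bar>p\<bar> * \<bar>q\<bar>) \<le> 4 * \<epsilon>\<^sup>2 * p\<^sup>2 + K\<^sup>2 * q\<^sup>2"
        by (simp add: power2_diff power_mult_distrib mult_ac)
      then have "K * \<bar>p\<bar> * \<bar>q\<bar> \<le> \<epsilon> * p\<^sup>2 + K\<^sup>2 / (4 * \<epsilon>) * q\<^sup>2"
        using \<epsilon> by (simp add: field_simps power2_eq_square)
      also have "\<dots> \<le> \<epsilon> * p\<^sup>2 + K' * q\<^sup>2" using K' by (intro add_left_mono mult_right_mono) auto
      finally show ?thesis .
    qed
    have entrywise: "(if i < g1 \<and> j < g1 then x i * A $$ (i, j) * x j else 0) - (e i + e j) \<le> x i * A $$ (i, j) * x j" if ij: "i < g" "j < g" for i j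
    proof (cases "i < g1 \<and> j < g1")
      case True
      then show ?thesis using e0[of i] e0[of j] by simp
    next
      case False
      have "\<bar>x i * A $$ (i, j) * x j\<bar> \<le> K * \<bar>x i\<bar> * \<bar>x j\<bar>"
        using AK ij mult_right_mono[of "\<bar>A $$ (i, j)\<bar>" K "\<bar>x i\<bar> * \<bar>x j\<bar>"] by (simp add: abs_mult mult_ac)
      also have "\<dots> \<le> e i + e j"
      proof -
        consider "i < g1" "\<not> j < g1" | "\<not> i < g1" "j < g1" | "\<not> i < g1" "\<not> j < g1" using False by blast
        then show ?thesis
        proof cases
          case 1
          then show ?thesis using amgm[of "x i" "x j"] by (simp add: e_def)
        next
          case 2
          then show ?thesis using amgm[of "x j" "x i"] by (simp add: e_def mult_ac)
        next
          case 3
          have "\<bar>x i\<bar> * \<bar>x j\<bar> \<le> (x i)\<^sup>2 + (x j)\<^sup>2"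
            using sum_squares_bound[of "\<bar>x i\<bar>" "\<bar>x j\<bar>"] mult_nonneg_nonneg[OF abs_ge_zero[of "x i"] abs_ge_zero[of "x j"]]
            by (simp only: mult.assoc power2_abs)
          then have "K * (\<bar>x i\<bar> * \<bar>x j\<bar>) \<le> K' * ((x i)\<^sup>2 + (x j)\<^sup>2)" using K K' by (intro mult_mono) auto
          then show ?thesis using 3 by (simp add: e_def algebra_simps)
        qed
      qed
      finally show ?thesis using False by (auto simp: abs_le_iff)
    qed
    have se: "(\<Sum>i<g. e i) = \<epsilon> * a + K' * b"
      unfolding g[symmetric] sum_lessThan_add a_def b_def by (simp add: e_def sum_distrib_left)
    have "bform g1 A x x = (\<Sum>i<g. \<Sum>j<g. if i < g1 \<and> j < g1 then x i * A $$ (i, j) * x j else 0)"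
      unfolding g[symmetric] sum_lessThan_add by (simp add: bform_def)
    then have "bform g1 A x x - 2 * real g * (\<Sum>i<g. e i) = (\<Sum>i<g. \<Sum>j<g. (if i < g1 \<and> j < g1 then x i * A $$ (i, j) * x j else 0) - (e i + e j))"
      by (simp add: sum_subtractf sum.distrib sum_distrib_left[symmetric])
    also have "\<dots> \<le> bform g A x x" unfolding bform_def by (intro sum_mono) (use entrywise in auto)
    finally have 1: "bform g1 A x x - 2 * real g * (\<epsilon> * a + K' * b) \<le> bform g A x x" unfolding se .
    have 2: "c1 * a \<le> bform g1 A x x" using A1 by (simp add: a_def)
    have 3: "2 * real g * \<epsilon> * a \<le> c1 / 2 * a" using \<epsilon>(2) ab by (intro mult_right_mono) auto
    have L0cB: "L0 * cB = 2 * real g * K' + c1 / 2" using cB by (simp add: L0_def)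
    have "L0 * (cB * b) \<le> L0 * bform h B (\<lambda>i. x (g1 + i)) (\<lambda>i. x (g1 + i))"
      unfolding b_def using B[of "\<lambda>i. x (g1 + i)"] cB K' c1 by (intro mult_left_mono) (auto simp: L0_def)
    then have 4: "(2 * real g * K' + c1 / 2) * b \<le> L0 * bform h B (\<lambda>i. x (g1 + i)) (\<lambda>i. x (g1 + i))"
      unfolding L0cB[symmetric] by (simp add: mult.assoc)
    have "(\<Sum>i<g. (x i)\<^sup>2) = a + b" unfolding g[symmetric] sum_lessThan_add a_def b_def ..
    then show ?thesis using 1 2 3 4 by (simp add: algebra_simps)
  qed
  moreover have "L0 \<ge> 0" using cB K' c1 by (simp add: L0_def)
  ultimately show ?thesis by blast
qed

lemma det_scale_rows:
  fixes A :: "'a::comm_ring_1 mat"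
  assumes A: "A \<in> carrier_mat n n"
  shows "Determinant.det (Matrix.mat n n (\<lambda>(i, j). r i * A $$ (i, j))) = (\<Prod>i = 0..<n. r i) * Determinant.det A"
proof -
  have "(\<Prod>i = 0..<n. Matrix.mat n n (\<lambda>(i, j). r i * A $$ (i, j)) $$ (i, p i)) = (\<Prod>i = 0..<n. r i) * (\<Prod>i = 0..<n. A $$ (i, p i))"
    if "p permutes {0..<n}" for p
    unfolding prod.distrib[symmetric]
  proof (rule prod.cong[OF refl])
    fix i assume "i \<in> {0..<n}"
    then show "Matrix.mat n n (\<lambda>(i, j). r i * A $$ (i, j)) $$ (i, p i) = r i * A $$ (i, p i)"
      using permutes_in_image[OF that, of i] by simp
  qed
  then show ?thesis
    using A by (simp add: Determinant.det_def'[of _ n] sum_distrib_left mult_ac)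
qed

text \<open>The matrix \<open>Q0\<close> is the limit of the period matrices after the diverging
  multiple of B has been removed from the lower right block. Positivity is available only for the
  imaginary part of its first block; on the second block B has to supply it.\<close>

locale block_degeneration =
  fixes g g1 h :: nat and B :: "real mat" and Q0 :: "complex mat"
  assumes g: "g1 + h = g" and B: "pos_def_mat h B"
    and Q0: "Q0 \<in> carrier_mat g g" and Q0_pos: "pos_def_mat g1 (Matrix.mat g1 g1 (\<lambda>(i, j). Im (Q0 $$ (i, j))))"
begin

definition lower_block :: "real mat" where
  "lower_block = Matrix.mat g g (\<lambda>(i, j). if i < g1 \<or> j < g1 then 0 else B $$ (i - g1, j - g1))"

abbreviation tail :: "(nat \<Rightarrow> 'a) \<Rightarrow> nat \<Rightarrow> 'a" where
  "tail x \<equiv> \<lambda>i. x (g1 + i)"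

text \<open>The family is reduced to sequences of matrices: \<sigma> stands for log t / (2 pi i),
  whose imaginary part tends to infinity at the puncture.\<close>

definition degenerates :: "(nat \<Rightarrow> complex mat) \<Rightarrow> (nat \<Rightarrow> complex) \<Rightarrow> bool" where
  "degenerates \<tau> \<sigma> \<longleftrightarrow> (\<forall>j. \<tau> j \<in> siegel g) \<and> filterlim (\<lambda>j. Im (\<sigma> j)) at_top sequentially \<and>
     (\<forall>i<g. \<forall>k<g. (\<lambda>j. \<tau> j $$ (i, k) - \<sigma> j * complex_of_real (lower_block $$ (i, k))) \<longlonglongrightarrow> Q0 $$ (i, k))"

lemma bform_lower_block: "bform g lower_block x y = bform h B (tail x) (tail y)"
proof -
  have "bform g lower_block x y = (\<Sum>i<g1 + h. \<Sum>j<g1 + h. x i * (if i < g1 \<or> j < g1 then 0 else B $$ (i - g1, j - g1)) * y j)"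
    unfolding bform_def g by (intro sum.cong refl) (auto simp: lower_block_def)
  also have "\<dots> = bform h B (tail x) (tail y)"
    unfolding sum_lessThan_add by (simp add: bform_def)
  finally show ?thesis .
qed

lemma bform_add_lower_block:
  assumes "\<And>i j. i < g \<Longrightarrow> j < g \<Longrightarrow> A $$ (i, j) = A' $$ (i, j) + c * lower_block $$ (i, j)"
  shows "bform g A x y = bform g A' x y + c * bform h B (tail x) (tail y)"
proof -
  have "bform g A x y = (\<Sum>i<g. \<Sum>j<g. x i * A' $$ (i, j) * y j + c * (x i * lower_block $$ (i, j) * y j))"
    unfolding bform_def by (intro sum.cong refl) (auto simp: assms algebra_simps)
  then show ?thesis
    unfolding bform_lower_block[symmetric] by (simp add: bform_def sum.distrib sum_distrib_left)
qed

definition is_minimiser :: "real \<Rightarrow> (nat \<Rightarrow> real) \<Rightarrow> int Matrix.vec \<Rightarrow> bool" where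
  "is_minimiser D x k \<longleftrightarrow> k \<in> int_vecs h \<and> (\<forall>i<h. \<bar>x i + zr k i\<bar> \<le> D) \<and>
    (\<forall>n\<in>int_vecs h. bform h B (\<lambda>i. x i + zr k i) (\<lambda>i. x i + zr k i) \<le> bform h B (\<lambda>i. x i + zr n i) (\<lambda>i. x i + zr n i))"

definition lift :: "int Matrix.vec \<Rightarrow> int Matrix.vec" where
  "lift k = Matrix.vec g (\<lambda>i. if i < g1 then 0 else vec_index k (i - g1))"

text \<open>The representative of \<open>y\<close> whose tail is shortest for B. The choice is made
  pointwise, with no claim of measurability.\<close>

definition shifted :: "real \<Rightarrow> (nat \<Rightarrow> real) \<Rightarrow> nat \<Rightarrow> real" where
  "shifted D y i = y i + zr (lift (SOME k. is_minimiser D (tail y) k)) i"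

text \<open>Frequencies with nonzero tail decay wherever the closest lattice point is unique; the
  others do not meet the diverging block and see only \<open>Q0\<close>.\<close>

definition limit_coeff :: "real \<Rightarrow> (nat \<Rightarrow> real) \<Rightarrow> int Matrix.vec \<Rightarrow> complex" where
  "limit_coeff D y n = (if \<forall>i<h. vec_index n (g1 + i) = 0 then normalized_coeff g Q0 (shifted D y) n else 0)"

lemma lift_int_vecs: "lift k \<in> int_vecs g"
  by (simp add: lift_def int_vecs_def)

lemma tail_lift: "i < h \<Longrightarrow> vec_index (lift k) (g1 + i) = vec_index k i"
  using g by (simp add: lift_def)

lemma ex_is_minimiser: "\<exists>D\<ge>1. \<forall>x. (\<forall>i<h. x i \<in> {0..1}) \<longrightarrow> (\<exists>k. is_minimiser D x k)"
proof -
  obtain D where D: "\<forall>y. (\<forall>i<h. y i \<in> {0..1}) \<longrightarrow> (\<exists>k\<in>int_vecs h.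
     (\<forall>n\<in>int_vecs h. bform h B (\<lambda>i. y i + zr k i) (\<lambda>i. y i + zr k i) \<le> bform h B (\<lambda>i. y i + zr n i) (\<lambda>i. y i + zr n i)) \<and>
     (\<forall>i<h. \<bar>y i + zr k i\<bar> \<le> D))" using ex_lattice_minimiser[OF B] by (elim exE) (rule that)
  show ?thesis
  proof (intro exI[of _ "max D 1"] conjI allI impI)
    fix x :: "nat \<Rightarrow> real" assume "\<forall>i<h. x i \<in> {0..1}"
    from D[rule_format, of x] this obtain k where "k\<in>int_vecs h"
     "\<forall>n\<in>int_vecs h. bform h B (\<lambda>i. x i + zr k i) (\<lambda>i. x i + zr k i) \<le> bform h B (\<lambda>i. x i + zr n i) (\<lambda>i. x i + zr n i)"
     "\<forall>i<h. \<bar>x i + zr k i\<bar> \<le> D" by blast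
    then show "\<exists>k. is_minimiser (max D 1) x k" unfolding is_minimiser_def by (intro exI[of _ k]) (auto simp: le_max_iff_disj)
  qed simp
qed

text \<open>The expression is the increment of B when the minimal vector \<open>v\<close> is moved
  by n. It is the factor of Im \<sigma> in the exponent of the normalised coefficients, so its sign
  decides between decay and survival.\<close>

lemma is_minimiser_increment:
  assumes k: "is_minimiser D x k" and n: "n \<in> int_vecs h"
  defines "v \<equiv> \<lambda>i. x i + zr k i"
  shows "0 \<le> bform h B (zr n) (zr n) + 2 * bform h B (zr n) v"
    "n \<noteq> 0\<^sub>v h \<Longrightarrow> (\<And>k n. k \<in> int_vecs h \<Longrightarrow> n \<in> int_vecs h \<Longrightarrow> k \<noteq> n \<Longrightarrow>
       bform h B (\<lambda>i. x i + zr k i) (\<lambda>i. x i + zr k i) \<noteq> bform h B (\<lambda>i. x i + zr n i) (\<lambda>i. x i + zr n i)) \<Longrightarrow>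
      0 < bform h B (zr n) (zr n) + 2 * bform h B (zr n) v"
proof -
  have kc: "k \<in> int_vecs h" using k by (simp add: is_minimiser_def)
  have kn: "k + n \<in> int_vecs h" using kc n by (simp add: int_vecs_def)
  have sym: "bform h B v (zr n) = bform h B (zr n) v" using B by (intro bform_sym) (auto simp: pos_def_mat_def)
  have "bform h B (\<lambda>i. x i + zr (k + n) i) (\<lambda>i. x i + zr (k + n) i) = bform h B (\<lambda>i. v i + zr n i) (\<lambda>i. v i + zr n i)"
    using kc n by (intro bform_cong) (auto simp: v_def int_vecs_def)
  also have "\<dots> = bform h B v v + (bform h B (zr n) (zr n) + 2 * bform h B (zr n) v)"
    using sym by (simp add: bform_add_left bform_add_right)
  finally have e: "bform h B (\<lambda>i. x i + zr (k + n) i) (\<lambda>i. x i + zr (k + n) i) = bform h B v v + (bform h B (zr n) (zr n) + 2 * bform h B (zr n) v)" .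
  have le: "bform h B v v \<le> bform h B (\<lambda>i. x i + zr (k + n) i) (\<lambda>i. x i + zr (k + n) i)"
    using k kn unfolding is_minimiser_def v_def by blast
  then show 1: "0 \<le> bform h B (zr n) (zr n) + 2 * bform h B (zr n) v" unfolding e by simp
  assume n0: "n \<noteq> 0\<^sub>v h" and uniq: "\<And>k n. k \<in> int_vecs h \<Longrightarrow> n \<in> int_vecs h \<Longrightarrow> k \<noteq> n \<Longrightarrow>
       bform h B (\<lambda>i. x i + zr k i) (\<lambda>i. x i + zr k i) \<noteq> bform h B (\<lambda>i. x i + zr n i) (\<lambda>i. x i + zr n i)"
  have "k \<noteq> k + n"
  proof
    assume a: "k = k + n"
    have "n = 0\<^sub>v h"
    proof (rule eq_vecI)
      fix i assume "i < dim_vec (0\<^sub>v h :: int Matrix.vec)"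
      then show "vec_index n i = vec_index (0\<^sub>v h) i" using arg_cong[OF a, of "\<lambda>v. vec_index v i"] kc n by (simp add: int_vecs_def)
    qed (use n in \<open>simp add: int_vecs_def\<close>)
    then show False using n0 by simp
  qed
  from uniq[OF kc kn this] have "bform h B v v \<noteq> bform h B (\<lambda>i. x i + zr (k + n) i) (\<lambda>i. x i + zr (k + n) i)" by (simp add: v_def)
  then show "0 < bform h B (zr n) (zr n) + 2 * bform h B (zr n) v" using 1 unfolding e by simp
qed

text \<open>For the vector \<open>lift k\<close> the diverging part of the exponent is Im \<sigma>
  times a nonnegative increment \<delta> n. Keeping only \<open>L0\<close> copies of it gives a
  fixed Gaussian bound; letting it grow kills the frequencies with \<delta> n > 0; and the diverging
  part of the quadratic form is exactly the lattice minimum that is subtracted. The constants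
  precede the sequence, so that all sequences share them.\<close>

lemma degeneration_data_ex:
  "\<exists>\<eta> L0 C c R D. \<eta> > 0 \<and> c > 0 \<and> (\<forall>\<tau> \<sigma>. degenerates \<tau> \<sigma> \<longrightarrow> (\<forall>j. L0 \<le> Im (\<sigma> j)) \<longrightarrow>
     (\<forall>j. \<forall>i<g. \<forall>k<g. \<bar>Im (\<tau> j $$ (i, k)) - Im (\<sigma> j) * lower_block $$ (i, k) - Im (Q0 $$ (i, k))\<bar> \<le> \<eta>) \<longrightarrow>
     degeneration_data g C c R (limit_coeff D) (\<lambda>y. bform g (map_mat Im Q0) (shifted D y) (shifted D y)) \<tau>
       (\<lambda>j y. Im (\<sigma> j) * lattice_min h B (tail y)))"
proof -
  define R0 where "R0 = map_mat Im Q0"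
  have R0e: "R0 $$ (i, k) = Im (Q0 $$ (i, k))" if "i < g" "k < g" for i k using that Q0 by (simp add: R0_def)
  obtain c0 where c0: "c0 > 0" "\<And>x. c0 * (\<Sum>i<g1. (x i)\<^sup>2) \<le> bform g1 (Matrix.mat g1 g1 (\<lambda>(i, j). Im (Q0 $$ (i, j)))) x x"
    using pos_def_mat_coercive[OF Q0_pos] by (elim exE conjE) (rule that, auto)
  have c0': "c0 * (\<Sum>i<g1. (x i)\<^sup>2) \<le> bform g1 R0 x x" for x
    using c0(2)[of x] g by (simp add: bform_def R0e)
  obtain cB where cB: "cB > 0" "\<And>x. cB * (\<Sum>i<h. (x i)\<^sup>2) \<le> bform h B x x"
    using pos_def_mat_coercive[OF B] by (elim exE conjE) (rule that, auto)
  \<comment> \<open>At most half of the coercivity of the first block is given up to the deviation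
    from the limit.\<close>
  define \<eta> where "\<eta> = c0 / (2 * (real g + 1))"
  have \<eta>: "\<eta> > 0" "\<eta> * real g \<le> c0 / 2" using c0 by (auto simp: \<eta>_def field_simps)
  have \<eta>1: "\<eta> * real g1 \<le> c0 / 2"
  proof (rule order_trans[OF _ \<eta>(2)])
    show "\<eta> * real g1 \<le> \<eta> * real g" using \<eta>(1) g by (intro mult_left_mono) auto
  qed
  obtain K0 where K0: "K0 \<ge> 0" "\<And>i j. i < g \<Longrightarrow> j < g \<Longrightarrow> \<bar>R0 $$ (i, j)\<bar> \<le> K0"
    using mat_entries_bounded[of g R0] by (elim exE conjE) (rule that, auto)
  obtain KB where KB: "KB \<ge> 0" "\<And>i j. i < g \<Longrightarrow> j < g \<Longrightarrow> \<bar>lower_block $$ (i, j)\<bar> \<le> KB"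
    using mat_entries_bounded[of g lower_block] by (elim exE conjE) (rule that, auto)
  define K where "K = K0 + \<eta>"
  define c1 where "c1 = c0 / 2"
  have K: "K \<ge> 0" using K0 \<eta> by (simp add: K_def)
  have c1: "c1 > 0" using c0 by (simp add: c1_def)
  obtain L0 where L0: "L0 \<ge> 0" and coer: "\<And>A x. \<forall>i<g. \<forall>j<g. \<bar>A $$ (i, j)\<bar> \<le> K \<Longrightarrow> \<forall>x. c1 * (\<Sum>i<g1. (x i)\<^sup>2) \<le> bform g1 A x x \<Longrightarrow>
     c1 / 2 * (\<Sum>i<g. (x i)\<^sup>2) \<le> bform g A x x + L0 * bform h B (tail x) (tail x)"
    using block_coercive[OF c1 cB(1) K g cB(2)] by (elim exE conjE) (rule that, auto)
  obtain D where D: "D \<ge> 1" "\<And>x. \<forall>i<h. x i \<in> {0..1} \<Longrightarrow> \<exists>k. is_minimiser D x k"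
    using ex_is_minimiser by (elim exE conjE) (rule that, auto)
  define A where "A = K + L0 * KB"
  define C where "C = exp (real g * ((2 * pi * (real g * (A * D)))\<^sup>2 / (2 * (pi * (c1 / 2)))))"
  define c where "c = pi * (c1 / 2) / 2"
  define R where "R = real g * (real g * (D * K * D))"
  have main: "degeneration_data g C c R (limit_coeff D) (\<lambda>y. bform g R0 (shifted D y) (shifted D y)) \<tau> (\<lambda>j y. Im (\<sigma> j) * lattice_min h B (tail y))"
    if dg: "degenerates \<tau> \<sigma>" and \<sigma>L: "\<forall>j. L0 \<le> Im (\<sigma> j)"
      and close: "\<forall>j. \<forall>i<g. \<forall>k<g. \<bar>Im (\<tau> j $$ (i, k)) - Im (\<sigma> j) * lower_block $$ (i, k) - Im (Q0 $$ (i, k))\<bar> \<le> \<eta>" for \<tau> \<sigma>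
    unfolding degeneration_data_def
  proof (intro conjI allI)
    show t: "\<tau> j \<in> siegel g" for j using dg by (simp add: degenerates_def)
    show "(\<lambda>y. Im (\<sigma> j) * lattice_min h B (tail y)) \<in> borel_measurable (unit_cube g)" for j
      using g by (intro borel_measurable_times borel_measurable_const lattice_min_measurable[OF B] component_measurable_unit_cube) auto
    \<comment> \<open>\<open>Qm\<close> and \<open>Rm\<close> are the period matrix and its
      imaginary part without the diverging block; \<open>Z\<close> puts back only the multiple
      \<open>L0\<close> of it that \<open>block_coercive\<close> asks for.\<close>
    define Qm where "Qm j = Matrix.mat g g (\<lambda>(i, k). \<tau> j $$ (i, k) - \<sigma> j * complex_of_real (lower_block $$ (i, k)))" for j
    define Rm where "Rm j = Matrix.mat g g (\<lambda>(i, k). Im (\<tau> j $$ (i, k)) - Im (\<sigma> j) * lower_block $$ (i, k))" for j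
    define Z where "Z j = Matrix.mat g g (\<lambda>(i, k). Rm j $$ (i, k) + L0 * lower_block $$ (i, k))" for j
    have Qlim: "(\<lambda>j. Qm j $$ (i, k)) \<longlonglongrightarrow> Q0 $$ (i, k)" if "i < g" "k < g" for i k
      using dg that by (simp add: degenerates_def Qm_def)
    have Rm_Qm: "Rm j $$ (i, k) = Im (Qm j $$ (i, k))" if "i < g" "k < g" for i k j
      using that by (simp add: Rm_def Qm_def)
    have Rlim: "(\<lambda>j. Rm j $$ (i, k)) \<longlonglongrightarrow> R0 $$ (i, k)" if "i < g" "k < g" for i k
      unfolding Rm_Qm[OF that] R0e[OF that] by (intro tendsto_Im Qlim that)
    have Rclose: "\<bar>Rm j $$ (i, k) - R0 $$ (i, k)\<bar> \<le> \<eta>" if "i < g" "k < g" for i k j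
      using close that by (simp add: Rm_def R0e)
    have RK: "\<bar>Rm j $$ (i, k)\<bar> \<le> K" if "i < g" "k < g" for i k j
      using Rclose[OF that, of j] K0(2)[OF that] by (simp add: K_def)
    have Rcoer: "c1 * (\<Sum>i<g1. (x i)\<^sup>2) \<le> bform g1 (Rm j) x x" for j x
    proof -
      have "bform g1 R0 x x - \<eta> * real g1 * (\<Sum>i<g1. (x i)\<^sup>2) \<le> bform g1 (Rm j) x x"
        using g by (intro bform_perturb Rclose) auto
      moreover have "\<eta> * real g1 * (\<Sum>i<g1. (x i)\<^sup>2) \<le> c0 / 2 * (\<Sum>i<g1. (x i)\<^sup>2)"
        using \<eta>1 by (intro mult_right_mono sum_nonneg) auto
      ultimately show ?thesis using c0'[of x] by (simp add: c1_def field_simps)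
    qed
    have bZ: "bform g (Z j) x y = bform g (Rm j) x y + L0 * bform h B (tail x) (tail y)" for j x y
      by (rule bform_add_lower_block) (simp add: Z_def)
    have bY: "bform g (map_mat Im (\<tau> j)) x y = bform g (Rm j) x y + Im (\<sigma> j) * bform h B (tail x) (tail y)" for j x y
      by (rule bform_add_lower_block) (use siegelD(1)[OF t, of j] in \<open>simp add: Rm_def carrier_matD[of _ g g]\<close>)
    have Zcoer: "c1 / 2 * (\<Sum>i<g. (x i)\<^sup>2) \<le> bform g (Z j) x x" for j x
      unfolding bZ by (rule coer) (use RK Rcoer in auto)
    have ZA: "\<bar>Z j $$ (i, k)\<bar> \<le> A" if "i < g" "k < g" for i k j
    proof -
      have "\<bar>L0 * lower_block $$ (i, k)\<bar> \<le> L0 * KB" unfolding abs_mult using L0 KB(2)[OF that] by (simp add: mult_left_mono)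
      then show ?thesis using RK[OF that, of j] that by (simp add: Z_def A_def)
    qed
    show "AE y in unit_cube g. \<exists>k\<in>int_vecs g.
        (\<forall>j. gauss_bounded g C c (normalized_coeff g (\<tau> j) (\<lambda>i. y i + zr k i)) \<and>
          \<bar>bform g (map_mat Im (\<tau> j)) (\<lambda>i. y i + zr k i) (\<lambda>i. y i + zr k i) - Im (\<sigma> j) * lattice_min h B (tail y)\<bar> \<le> R) \<and>
        (\<forall>n\<in>int_vecs g. (\<lambda>j. normalized_coeff g (\<tau> j) (\<lambda>i. y i + zr k i) n) \<longlonglongrightarrow> limit_coeff D y n) \<and>
        (\<lambda>j. bform g (map_mat Im (\<tau> j)) (\<lambda>i. y i + zr k i) (\<lambda>i. y i + zr k i) - Im (\<sigma> j) * lattice_min h B (tail y)) \<longlonglongrightarrow> bform g R0 (shifted D y) (shifted D y)"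
      using AE_unit_cube AE_unique_minimiser[OF B g]
    proof eventually_elim
      fix y :: "nat \<Rightarrow> real"
      assume y: "\<forall>i<g. y i \<in> {0..1}" and uniq: "\<forall>k\<in>int_vecs h. \<forall>n\<in>int_vecs h. k \<noteq> n \<longrightarrow>
         bform h B (\<lambda>i. y (g1 + i) + zr k i) (\<lambda>i. y (g1 + i) + zr k i) \<noteq> bform h B (\<lambda>i. y (g1 + i) + zr n i) (\<lambda>i. y (g1 + i) + zr n i)"
      define k where "k = (SOME k. is_minimiser D (tail y) k)"
      have "\<exists>k. is_minimiser D (tail y) k" using y g by (intro D) auto
      then have k: "is_minimiser D (tail y) k" unfolding k_def by (rule someI_ex)
      have v: "(\<lambda>i. y i + zr (lift k) i) = shifted D y" by (simp add: shifted_def k_def fun_eq_iff)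
      define v where "v = shifted D y"
      have tv: "v (g1 + i) = y (g1 + i) + zr k i" if "i < h" for i
        using tail_lift[OF that, of k] by (simp add: v_def shifted_def k_def)
      have vD: "\<bar>v i\<bar> \<le> D" if i: "i < g" for i
      proof (cases "i < g1")
        case True
        then have "v i = y i" using i by (simp add: v_def shifted_def lift_def)
        then show ?thesis using y i D(1) by (auto simp: abs_le_iff)
      next
        case False
        then have "i = g1 + (i - g1)" "i - g1 < h" using i g by auto
        then show ?thesis using tv[of "i - g1"] k by (auto simp: is_minimiser_def)
      qed
      have min: "bform h B (tail v) (tail v) = lattice_min h B (tail y)"
      proof -
        have "lattice_min h B (tail y) = bform h B (\<lambda>i. y (g1 + i) + zr k i) (\<lambda>i. y (g1 + i) + zr k i)"
          using k by (intro lattice_min_eq) (auto simp: is_minimiser_def)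
        also have "\<dots> = bform h B (tail v) (tail v)" by (rule bform_cong) (auto simp: tv)
        finally show ?thesis ..
      qed
      have btv: "bform h B x (tail v) = bform h B x (\<lambda>i. y (g1 + i) + zr k i)" for x
        by (rule bform_cong) (auto simp: tv)
      define tl where "tl n = Matrix.vec h (\<lambda>i. vec_index n (g1 + i))" for n :: "int Matrix.vec"
      have tl: "tl n \<in> int_vecs h" for n by (simp add: tl_def int_vecs_def)
      define \<delta> where "\<delta> n = bform h B (tail (zr n)) (tail (zr n)) + 2 * bform h B (tail (zr n)) (tail v)" for n
      have \<delta>_eq: "\<delta> n = bform h B (zr (tl n)) (zr (tl n)) + 2 * bform h B (zr (tl n)) (\<lambda>i. y (g1 + i) + zr k i)" for n
        unfolding \<delta>_def btv by (intro arg_cong2[where f = "(+)"] arg_cong2[where f = "(*)"] refl bform_cong) (auto simp: tl_def)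
      have \<delta>0: "0 \<le> \<delta> n" for n unfolding \<delta>_eq by (rule is_minimiser_increment(1)[OF k tl])
      have \<delta>1: "0 < \<delta> n" if "\<exists>i<h. vec_index n (g1 + i) \<noteq> 0" for n unfolding \<delta>_eq
      proof (rule is_minimiser_increment(2)[OF k tl])
        show "tl n \<noteq> 0\<^sub>v h" using that by (auto simp: tl_def vec_eq_iff)
      qed (use uniq in auto)
      have inc: "bform g (map_mat Im (\<tau> j)) (zr n) (zr n) + 2 * bform g (map_mat Im (\<tau> j)) (zr n) v =
          bform g (Rm j) (zr n) (zr n) + 2 * bform g (Rm j) (zr n) v + Im (\<sigma> j) * \<delta> n" for j n
        unfolding bY \<delta>_def by (simp add: algebra_simps)
      have bR: "bform g (map_mat Im (\<tau> j)) v v - Im (\<sigma> j) * lattice_min h B (tail y) = bform g (Rm j) v v" for j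
        unfolding bY min by simp
      show "\<exists>k\<in>int_vecs g.
        (\<forall>j. gauss_bounded g C c (normalized_coeff g (\<tau> j) (\<lambda>i. y i + zr k i)) \<and>
          \<bar>bform g (map_mat Im (\<tau> j)) (\<lambda>i. y i + zr k i) (\<lambda>i. y i + zr k i) - Im (\<sigma> j) * lattice_min h B (tail y)\<bar> \<le> R) \<and>
        (\<forall>n\<in>int_vecs g. (\<lambda>j. normalized_coeff g (\<tau> j) (\<lambda>i. y i + zr k i) n) \<longlonglongrightarrow> limit_coeff D y n) \<and>
        (\<lambda>j. bform g (map_mat Im (\<tau> j)) (\<lambda>i. y i + zr k i) (\<lambda>i. y i + zr k i) - Im (\<sigma> j) * lattice_min h B (tail y)) \<longlonglongrightarrow> bform g R0 (shifted D y) (shifted D y)"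
      proof (intro bexI[of _ "lift k"] conjI allI ballI lift_int_vecs, unfold v, fold v_def, unfold bR)
        fix j
        show "gauss_bounded g C c (normalized_coeff g (\<tau> j) v)"
          unfolding C_def c_def
        proof (rule normalized_coeff_gauss_bounded[where Z = "Z j"])
          fix n
          have "bform g (Z j) (zr n) (zr n) + 2 * bform g (Z j) (zr n) v = bform g (Rm j) (zr n) (zr n) + 2 * bform g (Rm j) (zr n) v + L0 * \<delta> n"
            unfolding bZ \<delta>_def by (simp add: algebra_simps)
          moreover have "L0 * \<delta> n \<le> Im (\<sigma> j) * \<delta> n" using \<sigma>L \<delta>0 by (intro mult_right_mono) auto
          ultimately show "bform g (Z j) (zr n) (zr n) + 2 * bform g (Z j) (zr n) v \<le>
             bform g (map_mat Im (\<tau> j)) (zr n) (zr n) + 2 * bform g (map_mat Im (\<tau> j)) (zr n) v" unfolding inc by simp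
        qed (use t c1 Zcoer ZA vD in auto)
        show "\<bar>bform g (Rm j) v v\<bar> \<le> R" unfolding R_def by (rule bform_abs_le) (use RK vD in auto)
      next
        show "(\<lambda>j. bform g (Rm j) v v) \<longlonglongrightarrow> bform g R0 v v" by (rule bform_tendsto[OF Rlim])
      next
        fix n assume n: "n \<in> int_vecs g"
        show "(\<lambda>j. normalized_coeff g (\<tau> j) v n) \<longlonglongrightarrow> limit_coeff D y n"
        proof (cases "\<forall>i<h. vec_index n (g1 + i) = 0")
          case True
          \<comment> \<open>Rows of the second block are killed by the entries of n, and rows of the
            first block do not meet the diverging part, so \<sigma> drops out.\<close>
          have "zc n i * (\<tau> j $$ (i, l)) = zc n i * Qm j $$ (i, l)" if "i < g" "l < g" for i l j
          proof (cases "i < g1")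
            case True then show ?thesis using that by (simp add: Qm_def lower_block_def)
          next
            case False
            then have "i = g1 + (i - g1)" "i - g1 < h" using that g by auto
            then have "vec_index n i = 0" using True by metis
            then show ?thesis by simp
          qed
          then have "bform g (\<tau> j) (zc n) x = bform g (Qm j) (zc n) x" for j x
            unfolding bform_def by (intro sum.cong refl) auto
          then have "normalized_coeff g (\<tau> j) v n = normalized_coeff g (Qm j) v n" for j by (simp add: normalized_coeff_def)
          moreover have "(\<lambda>j. normalized_coeff g (Qm j) v n) \<longlonglongrightarrow> normalized_coeff g Q0 v n"
            unfolding normalized_coeff_def by (intro tendsto_intros bform_tendsto Qlim)
          ultimately show ?thesis using True by (simp add: limit_coeff_def v_def)
        next
          case False
          then have d: "0 < \<delta> n" by (intro \<delta>1) auto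
          have f: "filterlim (\<lambda>j. Im (\<sigma> j)) at_top sequentially" using dg by (simp add: degenerates_def)
          have "filterlim (\<lambda>j. bform g (Rm j) (zr n) (zr n) + 2 * bform g (Rm j) (zr n) v + Im (\<sigma> j) * \<delta> n) at_top sequentially"
            by (rule filterlim_tendsto_add_at_top[where c = "bform g R0 (zr n) (zr n) + 2 * bform g R0 (zr n) v"])
              (intro tendsto_intros bform_tendsto Rlim, assumption, assumption, use f d in \<open>auto intro!: filterlim_at_top_mult_tendsto_pos\<close>)
          then have "filterlim (\<lambda>j. - pi * (bform g (Rm j) (zr n) (zr n) + 2 * bform g (Rm j) (zr n) v + Im (\<sigma> j) * \<delta> n)) at_bot sequentially"
            by (intro filterlim_tendsto_neg_mult_at_bot[OF tendsto_const]) auto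
          then have "(\<lambda>j. exp (- pi * (bform g (Rm j) (zr n) (zr n) + 2 * bform g (Rm j) (zr n) v + Im (\<sigma> j) * \<delta> n))) \<longlonglongrightarrow> 0"
            by (rule filterlim_compose[OF exp_at_bot])
          then have "(\<lambda>j. norm (normalized_coeff g (\<tau> j) v n)) \<longlonglongrightarrow> 0"
            unfolding norm_normalized_coeff[OF siegelD(1)[OF t]] inc .
          then have "(\<lambda>j. normalized_coeff g (\<tau> j) v n) \<longlonglongrightarrow> 0" by (rule tendsto_norm_zero_cancel)
          moreover have "limit_coeff D y n = 0" using False unfolding limit_coeff_def by (rule if_not_P)
          ultimately show ?thesis by simp
        qed
      qed
    qed
  qed
  have "c > 0" using c1 by (simp add: c_def)
  show ?thesis
    by (rule exI[of _ \<eta>], rule exI[of _ L0], rule exI[of _ C], rule exI[of _ c], rule exI[of _ R], rule exI[of _ D],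
        intro conjI allI impI) (fact \<eta>(1), fact \<open>c > 0\<close>, (rule main[unfolded R0_def]; assumption))
qed

lemma lattice_min_integrable: "integrable (unit_cube g) (\<lambda>y. lattice_min h B (tail y))"
proof -
  obtain D where D: "D \<ge> 1" "\<And>x. \<forall>i<h. x i \<in> {0..1} \<Longrightarrow> \<exists>k. is_minimiser D x k"
    using ex_is_minimiser by (elim exE conjE) (rule that, auto)
  obtain K where K: "K \<ge> 0" "\<And>i j. i < h \<Longrightarrow> j < h \<Longrightarrow> \<bar>B $$ (i, j)\<bar> \<le> K"
    using mat_entries_bounded[of h B] by (elim exE conjE) (rule that, auto)
  show ?thesis
  proof (rule cube.integrable_const_bound)
    show "AE y in unit_cube g. norm (lattice_min h B (tail y)) \<le> real h * (real h * (D * K * D))"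
      using AE_unit_cube
    proof eventually_elim
      fix y :: "nat \<Rightarrow> real" assume y: "\<forall>i<g. y i \<in> {0..1}"
      have "\<exists>k. is_minimiser D (tail y) k" using y g by (intro D) auto
      then obtain k where k: "is_minimiser D (tail y) k" ..
      have "lattice_min h B (tail y) = bform h B (\<lambda>i. y (g1 + i) + zr k i) (\<lambda>i. y (g1 + i) + zr k i)"
        using k by (intro lattice_min_eq) (auto simp: is_minimiser_def)
      moreover have "\<bar>bform h B (\<lambda>i. y (g1 + i) + zr k i) (\<lambda>i. y (g1 + i) + zr k i)\<bar> \<le> real h * (real h * (D * K * D))"
        using k by (intro bform_abs_le K) (auto simp: is_minimiser_def)
      ultimately show "norm (lattice_min h B (tail y)) \<le> real h * (real h * (D * K * D))" by simp
    qed
    show "(\<lambda>y. lattice_min h B (tail y)) \<in> borel_measurable (unit_cube g)"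
      using g by (intro lattice_min_measurable[OF B] component_measurable_unit_cube) auto
  qed
qed

text \<open>Dividing the last \<open>h\<close> rows by Im \<sigma> takes the factor (Im \<sigma>)^h
  out of the determinant. The scaled matrices converge to a block triangular matrix whose diagonal
  blocks, the imaginary part of the first block of \<open>Q0\<close> and B, have positive
  determinants.\<close>

lemma ln_det_tendsto:
  "\<exists>l. \<forall>\<tau> \<sigma>. degenerates \<tau> \<sigma> \<longrightarrow>
    (\<lambda>j. ln (Determinant.det (map_mat Im (\<tau> j))) - real h * ln (Im (\<sigma> j))) \<longlonglongrightarrow> l"
proof -
  define M where "M = Matrix.mat g g (\<lambda>(i, k). if i < g1 then Im (Q0 $$ (i, k)) else lower_block $$ (i, k))"
  show ?thesis
  proof (intro exI[of _ "ln (Determinant.det M)"] allI impI)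
    fix \<tau> \<sigma> assume dg: "degenerates \<tau> \<sigma>"
    define r where "r j i = (if i < g1 then 1 else 1 / Im (\<sigma> j))" for j and i :: nat
    define Y where "Y j = map_mat Im (\<tau> j)" for j
    have t: "\<tau> j \<in> siegel g" for j using dg by (simp add: degenerates_def)
    have f: "filterlim (\<lambda>j. Im (\<sigma> j)) at_top sequentially" using dg by (simp add: degenerates_def)
    have Yc: "Y j \<in> carrier_mat g g" for j using siegelD(4)[OF t] by (simp add: Y_def)
    have inv: "(\<lambda>j. 1 / Im (\<sigma> j)) \<longlonglongrightarrow> 0" using f by (intro tendsto_divide_0[OF tendsto_const] filterlim_at_top_imp_at_infinity)
    have pos: "eventually (\<lambda>j. Im (\<sigma> j) > 0) sequentially" using f by (simp add: filterlim_at_top_dense)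
    have Yl: "(\<lambda>j. Y j $$ (i, k) - Im (\<sigma> j) * lower_block $$ (i, k)) \<longlonglongrightarrow> Im (Q0 $$ (i, k))" if "i < g" "k < g" for i k
    proof -
      have "(\<lambda>j. Im (\<tau> j $$ (i, k) - \<sigma> j * complex_of_real (lower_block $$ (i, k)))) \<longlonglongrightarrow> Im (Q0 $$ (i, k))"
        using dg that by (intro tendsto_Im) (simp add: degenerates_def)
      then show ?thesis using that siegelD(1)[OF t] by (simp add: Y_def carrier_matD[of _ g g])
    qed
    have lim: "(\<lambda>j. Determinant.det (Matrix.mat g g (\<lambda>(i, k). r j i * Y j $$ (i, k)))) \<longlonglongrightarrow> Determinant.det M"
    proof (rule det_tendsto)
      fix i k assume ik: "i < g" "k < g"
      show "(\<lambda>j. Matrix.mat g g (\<lambda>(i, k). r j i * Y j $$ (i, k)) $$ (i, k)) \<longlonglongrightarrow> M $$ (i, k)"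
      proof (cases "i < g1")
        case True
        then show ?thesis using Yl[OF ik] ik by (simp add: r_def M_def lower_block_def)
      next
        case False
        have "(\<lambda>j. 1 / Im (\<sigma> j) * (Y j $$ (i, k) - Im (\<sigma> j) * lower_block $$ (i, k)) + lower_block $$ (i, k)) \<longlonglongrightarrow> 0 * Im (Q0 $$ (i, k)) + lower_block $$ (i, k)"
          by (intro tendsto_intros inv Yl ik)
        then have "(\<lambda>j. 1 / Im (\<sigma> j) * Y j $$ (i, k)) \<longlonglongrightarrow> 0 * Im (Q0 $$ (i, k)) + lower_block $$ (i, k)"
          by (rule Lim_transform_eventually) (use pos in \<open>auto elim!: eventually_mono simp: field_simps\<close>)
        then show ?thesis using ik False by (simp add: r_def M_def)
      qed
    qed (auto simp: M_def)
    have detM: "Determinant.det M > 0"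
    proof -
      have Bc: "B \<in> carrier_mat h h" using B by (simp add: pos_def_mat_def)
      have "M = four_block_mat (Matrix.mat g1 g1 (\<lambda>(i, j). Im (Q0 $$ (i, j)))) (Matrix.mat g1 h (\<lambda>(i, j). Im (Q0 $$ (i, g1 + j)))) (0\<^sub>m h g1) B"
        using Bc g by (intro eq_matI) (auto simp: M_def lower_block_def)
      then have "Determinant.det M = Determinant.det (Matrix.mat g1 g1 (\<lambda>(i, j). Im (Q0 $$ (i, j)))) * Determinant.det B"
        by (simp only:) (rule det_four_block_mat_lower_left_zero[OF _ _ refl Bc]; simp)
      then show ?thesis using pos_def_mat_det_pos[OF Q0_pos] pos_def_mat_det_pos[OF B] by simp
    qed
    have prod_r: "(\<Prod>i = 0..<g. r j i) = (1 / Im (\<sigma> j)) ^ h" for j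
    proof -
      have "(\<Prod>i = 0..<g1 + n. r j i) = (1 / Im (\<sigma> j)) ^ n" for n
        by (induction n) (auto simp: r_def)
      from this[of h] show ?thesis unfolding g .
    qed
    have key: "ln (Determinant.det (Matrix.mat g g (\<lambda>(i, k). r j i * Y j $$ (i, k)))) =
         ln (Determinant.det (map_mat Im (\<tau> j))) - real h * ln (Im (\<sigma> j))" if p: "Im (\<sigma> j) > 0" for j
    proof -
      have dY: "Determinant.det (Y j) > 0" using pos_def_mat_det_pos[OF siegelD(3)[OF t]] by (simp add: Y_def)
      have "ln ((1 / Im (\<sigma> j)) ^ h * Determinant.det (Y j)) = ln ((1 / Im (\<sigma> j)) ^ h) + ln (Determinant.det (Y j))"
        using p dY by (intro ln_mult_pos) auto
      also have "ln ((1 / Im (\<sigma> j)) ^ h) = real h * ln (1 / Im (\<sigma> j))" using p by (simp add: ln_realpow)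
      also have "ln (1 / Im (\<sigma> j)) = - ln (Im (\<sigma> j))" using p by (simp add: ln_div)
      finally show ?thesis
        by (simp only: det_scale_rows[OF Yc, where r = "r j"] prod_r) (simp add: Y_def)
    qed
    have "(\<lambda>j. ln (Determinant.det (Matrix.mat g g (\<lambda>(i, k). r j i * Y j $$ (i, k))))) \<longlonglongrightarrow> ln (Determinant.det M)"
      using detM by (intro tendsto_ln lim) auto
    then show "(\<lambda>j. ln (Determinant.det (map_mat Im (\<tau> j))) - real h * ln (Im (\<sigma> j))) \<longlonglongrightarrow> ln (Determinant.det M)"
      by (rule Lim_transform_eventually) (rule eventually_mono[OF pos key])
  qed
qed

end

context block_degeneration
begin

lemma degenerates_shift: "degenerates \<tau> \<sigma> \<Longrightarrow> degenerates (\<lambda>j. \<tau> (j + N)) (\<lambda>j. \<sigma> (j + N))"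
  unfolding degenerates_def
  by (intro conjI allI impI LIMSEQ_ignore_initial_segment[where f = "\<lambda>j. \<tau> j $$ (i, k) - \<sigma> j * complex_of_real (lower_block $$ (i, k))" for i k]
      filterlim_compose[OF _ filterlim_add_const_nat_at_top, of "\<lambda>j. Im (\<sigma> j)"]) auto

text \<open>The subtracted growth integrates to Im \<sigma> times the tropical moment, and half of
  the log determinant contributes (h/2) log Im \<sigma>. Since all degenerating sequences share
  their limit data, each is compared with one reference sequence, and the limit is the same for
  all.\<close>

lemma theta_invariant_degeneration:
  "\<exists>l. \<forall>\<tau> \<sigma>. degenerates \<tau> \<sigma> \<longrightarrow>
    (\<lambda>j. theta_invariant g (\<tau> j) - 2 * pi * Im (\<sigma> j) * tropical_moment B + real h / 2 * ln (Im (\<sigma> j))) \<longlonglongrightarrow> l"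
proof -
  obtain \<eta> L0 C c R D where \<eta>: "\<eta> > 0" and c: "c > 0" and main: "\<forall>\<tau> \<sigma>. degenerates \<tau> \<sigma> \<longrightarrow> (\<forall>j. L0 \<le> Im (\<sigma> j)) \<longrightarrow>
     (\<forall>j. \<forall>i<g. \<forall>k<g. \<bar>Im (\<tau> j $$ (i, k)) - Im (\<sigma> j) * lower_block $$ (i, k) - Im (Q0 $$ (i, k))\<bar> \<le> \<eta>) \<longrightarrow>
     degeneration_data g C c R (limit_coeff D) (\<lambda>y. bform g (map_mat Im Q0) (shifted D y) (shifted D y)) \<tau>
       (\<lambda>j y. Im (\<sigma> j) * lattice_min h B (tail y))"
    using degeneration_data_ex by (elim exE conjE) (rule that)
  obtain d where d: "\<And>\<tau> \<sigma>. degenerates \<tau> \<sigma> \<Longrightarrow>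
    (\<lambda>j. ln (Determinant.det (map_mat Im (\<tau> j))) - real h * ln (Im (\<sigma> j))) \<longlonglongrightarrow> d"
    using ln_det_tendsto by (elim exE) (rule that, auto)
  let ?M = "unit_cube g \<Otimes>\<^sub>M unit_cube g"
  let ?m = "\<lambda>s y. Im s * lattice_min h B (tail y)"
  let ?dd = "degeneration_data g C c R (limit_coeff D) (\<lambda>y. bform g (map_mat Im Q0) (shifted D y) (shifted D y))"
  \<comment> \<open>The closeness conditions hold from some index on; dropping the first N terms
    makes them hold throughout.\<close>
  have ex: "\<exists>N. ?dd (\<lambda>j. \<tau> (j + N)) (\<lambda>j. ?m (\<sigma> (j + N)))" if dg: "degenerates \<tau> \<sigma>" for \<tau> \<sigma>
  proof -
    define A where "A j = Matrix.mat g g (\<lambda>(i, k). Im (\<tau> j $$ (i, k)) - Im (\<sigma> j) * lower_block $$ (i, k))" for j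
    have "(\<lambda>j. A j $$ (i, k)) \<longlonglongrightarrow> map_mat Im Q0 $$ (i, k)" if ik: "i < g" "k < g" for i k
    proof -
      have "(\<lambda>j. Im (\<tau> j $$ (i, k) - \<sigma> j * complex_of_real (lower_block $$ (i, k)))) \<longlonglongrightarrow> Im (Q0 $$ (i, k))"
        using dg ik by (intro tendsto_Im) (simp add: degenerates_def)
      then show ?thesis using ik Q0 by (simp add: A_def)
    qed
    then have 1: "eventually (\<lambda>j. \<forall>i<g. \<forall>k<g. \<bar>A j $$ (i, k) - map_mat Im Q0 $$ (i, k)\<bar> \<le> \<eta>) sequentially"
      by (rule eventually_entries_close[OF _ \<eta>])
    have 2: "eventually (\<lambda>j. L0 \<le> Im (\<sigma> j)) sequentially"
      using dg by (simp add: degenerates_def filterlim_at_top)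
    obtain N where N: "\<forall>j\<ge>N. (\<forall>i<g. \<forall>k<g. \<bar>A j $$ (i, k) - map_mat Im Q0 $$ (i, k)\<bar> \<le> \<eta>) \<and> L0 \<le> Im (\<sigma> j)"
      using eventually_conj[OF 1 2] unfolding eventually_sequentially by (elim exE) (rule that)
    have "?dd (\<lambda>j. \<tau> (j + N)) (\<lambda>j. ?m (\<sigma> (j + N)))"
    proof (rule main[rule_format, OF degenerates_shift[OF dg]])
      show "L0 \<le> Im (\<sigma> (j + N))" for j using N by simp
      show "\<bar>Im (\<tau> (j + N) $$ (i, k)) - Im (\<sigma> (j + N)) * lower_block $$ (i, k) - Im (Q0 $$ (i, k))\<bar> \<le> \<eta>"
        if ik: "i < g" "k < g" for i k j
        using N[rule_format, THEN conjunct1, rule_format, OF le_add2 ik, of j] ik Q0 by (simp add: A_def)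
    qed
    then show ?thesis by (rule exI)
  qed
  have lim: "(\<lambda>j. theta_invariant g (\<tau> j) - 2 * pi * Im (\<sigma> j) * tropical_moment B + real h / 2 * ln (Im (\<sigma> j)))
      \<longlonglongrightarrow> - (real g / 2) * ln 2 - u - d / 2"
    if dg: "degenerates \<tau> \<sigma>" and dd: "?dd (\<lambda>j. \<tau> (j + N)) (\<lambda>j. ?m (\<sigma> (j + N)))"
      and u: "(\<lambda>j. \<integral>p. renormalized_log g (\<tau> (j + N)) (?m (\<sigma> (j + N))) p \<partial>?M) \<longlonglongrightarrow> u" for \<tau> \<sigma> N u
  proof (rule LIMSEQ_offset[where k = N])
    have t: "\<tau> j \<in> siegel g" for j using dg by (simp add: degenerates_def)
    have eq: "theta_invariant g (\<tau> (j + N)) - 2 * pi * Im (\<sigma> (j + N)) * tropical_moment B + real h / 2 * ln (Im (\<sigma> (j + N))) =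
      - (real g / 2) * ln 2 - (\<integral>p. renormalized_log g (\<tau> (j + N)) (?m (\<sigma> (j + N))) p \<partial>?M)
       - (ln (Determinant.det (map_mat Im (\<tau> (j + N)))) - real h * ln (Im (\<sigma> (j + N)))) / 2" for j
    proof -
      have I: "(\<integral>y. ?m (\<sigma> (j + N)) y \<partial>unit_cube g) = Im (\<sigma> (j + N)) * tropical_moment B"
        unfolding tropical_moment_eq[OF B g] by simp
      show ?thesis
        unfolding theta_invariant_renormalized[OF t degeneration_data_integrable[OF c dd] integrable_mult_right[OF lattice_min_integrable], of j] I
        by (simp add: field_simps)
    qed
    show "(\<lambda>j. theta_invariant g (\<tau> (j + N)) - 2 * pi * Im (\<sigma> (j + N)) * tropical_moment B + real h / 2 * ln (Im (\<sigma> (j + N))))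
      \<longlonglongrightarrow> - (real g / 2) * ln 2 - u - d / 2"
      unfolding eq by (intro tendsto_intros u d degenerates_shift[OF dg]) auto
  qed
  show ?thesis
  \<comment> \<open>Without any degenerating sequence there is no reference, but then the claim is
    empty.\<close>
  proof (cases "\<exists>\<tau> \<sigma>. degenerates \<tau> \<sigma>")
    case True
    then obtain \<tau>0 \<sigma>0 where dg0: "degenerates \<tau>0 \<sigma>0" by blast
    obtain N0 where dd0: "?dd (\<lambda>j. \<tau>0 (j + N0)) (\<lambda>j. ?m (\<sigma>0 (j + N0)))" using ex[OF dg0] by (elim exE) (rule that)
    obtain u where u: "(\<lambda>j. \<integral>p. renormalized_log g (\<tau>0 (j + N0)) (?m (\<sigma>0 (j + N0))) p \<partial>?M) \<longlonglongrightarrow> u"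
      using degeneration_data_same_limit[OF c dd0 dd0] by (elim exE conjE) (rule that)
    show ?thesis
    proof (intro exI allI impI)
      fix \<tau> \<sigma> assume dg: "degenerates \<tau> \<sigma>"
      obtain N where dd: "?dd (\<lambda>j. \<tau> (j + N)) (\<lambda>j. ?m (\<sigma> (j + N)))" using ex[OF dg] by (elim exE) (rule that)
      obtain u' where u': "(\<lambda>j. \<integral>p. renormalized_log g (\<tau>0 (j + N0)) (?m (\<sigma>0 (j + N0))) p \<partial>?M) \<longlonglongrightarrow> u'"
        "(\<lambda>j. \<integral>p. renormalized_log g (\<tau> (j + N)) (?m (\<sigma> (j + N))) p \<partial>?M) \<longlonglongrightarrow> u'"
        using degeneration_data_same_limit[OF c dd0 dd] by (elim exE conjE) (rule that)
      have "u' = u" by (rule LIMSEQ_unique[OF u'(1) u])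
      then show "(\<lambda>j. theta_invariant g (\<tau> j) - 2 * pi * Im (\<sigma> j) * tropical_moment B + real h / 2 * ln (Im (\<sigma> j)))
        \<longlonglongrightarrow> - (real g / 2) * ln 2 - u - d / 2"
        using lim[OF dg dd u'(2)] by simp
    qed
  qed auto
qed

end

section \<open>Families over the punctured disc\<close>

lemma fibre_invariant_exp:
  assumes "period_map g f T" "s \<in> left_half_plane"
  shows "fibre_invariant g f (exp s) = theta_invariant g (T s)"
proof -
  have "period_matrix g (fibre_lattice f (exp s)) (fibre_form f (exp s)) (T s)"
    using assms by (auto simp: period_map_def period_matrix_def)
  from ppav_invariant_eq[OF this] show ?thesis by (simp add: fibre_invariant_def)
qed

lemma Ln_left_half_plane:
  assumes "t \<in> punctured_disc"
  shows "Ln t \<in> left_half_plane" "t \<noteq> 0" "cmod t > 0" "cmod t < 1"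
  using assms by (auto simp: punctured_disc_def left_half_plane_def Re_Ln)

lemma fibre_invariant_continuous:
  assumes pm: "period_map g f T"
  shows "continuous_on punctured_disc (fibre_invariant g f)"
  unfolding continuous_on_sequentially
proof (intro allI impI ballI)
  fix X :: "nat \<Rightarrow> complex" and t
  assume "t \<in> punctured_disc" and "(\<forall>n. X n \<in> punctured_disc) \<and> X \<longlonglongrightarrow> t"
  then have t: "t \<in> punctured_disc" and X: "\<And>n. X n \<in> punctured_disc" and lim: "X \<longlonglongrightarrow> t" by auto
  \<comment> \<open>A branch of the logarithm that is continuous near \<open>t\<close>, whereas
    \<open>Ln\<close> itself jumps across the negative axis.\<close>
  define u where "u n = Ln t + Ln (X n / t)" for n
  have eu: "exp (u n) = X n" for n
    using Ln_left_half_plane(2)[OF t] Ln_left_half_plane(2)[OF X] by (simp add: u_def exp_add)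
  have uL: "u n \<in> left_half_plane" for n
  proof -
    have "exp (Re (u n)) < 1" using Ln_left_half_plane(4)[OF X[of n]] norm_exp_eq_Re[of "u n"] by (simp add: eu)
    then show ?thesis by (simp add: left_half_plane_def)
  qed
  have "(\<lambda>n. X n / t) \<longlonglongrightarrow> t / t" using Ln_left_half_plane(2)[OF t] by (intro tendsto_divide lim) auto
  then have "(\<lambda>n. X n / t) \<longlonglongrightarrow> 1" using Ln_left_half_plane(2)[OF t] by simp
  then have "(\<lambda>n. Ln (X n / t)) \<longlonglongrightarrow> Ln 1" by (intro tendsto_Ln) auto
  from tendsto_add[OF tendsto_const[of "Ln t"] this] have ul: "u \<longlonglongrightarrow> Ln t" by (simp add: u_def[abs_def])
  have siegel: "T s \<in> siegel g" if "s \<in> left_half_plane" for s using pm that by (simp add: period_map_def)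
  have "(\<lambda>n. theta_invariant g (T (u n))) \<longlonglongrightarrow> theta_invariant g (T (Ln t))"
  proof (rule theta_invariant_tendsto)
    show "T (u n) \<in> siegel g" for n by (rule siegel[OF uL])
    show "T (Ln t) \<in> siegel g" by (rule siegel[OF Ln_left_half_plane(1)[OF t]])
    fix i k assume "i < g" "k < g"
    then have "(\<lambda>s. T s $$ (i, k)) holomorphic_on left_half_plane"
      using pm by (auto simp: period_map_def mat_holomorphic_on_def)
    then have "continuous_on left_half_plane (\<lambda>s. T s $$ (i, k))" by (rule holomorphic_on_imp_continuous_on)
    then show "(\<lambda>n. T (u n) $$ (i, k)) \<longlonglongrightarrow> T (Ln t) $$ (i, k)"
      by (rule continuous_on_tendsto_compose[OF _ ul Ln_left_half_plane(1)[OF t]]) (simp add: uL)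
  qed
  then show "((fibre_invariant g f) \<circ> X) \<longlonglongrightarrow> fibre_invariant g f t"
    using fibre_invariant_exp[OF pm uL] fibre_invariant_exp[OF pm Ln_left_half_plane(1)[OF t]] Ln_left_half_plane(2)[OF t]
    by (simp add: comp_def eu)
qed

text \<open>Along every sequence tending to the puncture the period matrices degenerate with
  \<sigma> = Ln t / (2 pi i) and one fixed \<open>Q0\<close>, so the common limit for all such
  sequences is a limit of the function.\<close>

lemma fibre_invariant_limit:
  assumes "associated_torus g f B"
  shows "\<exists>l. ((\<lambda>t. fibre_invariant g f t + tropical_moment B * ln (cmod t) + real (torus_dim B) / 2 * ln (- ln (cmod t))) \<longlongrightarrow> l)
    (at 0 within ball 0 1)"
proof -
  obtain T m g1 h S1 S2 S3 where pm: "period_map g f T" and m: "m \<ge> (1::nat)" and gh: "g1 + h = g"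
    and S1: "\<forall>t\<in>ball 0 1. S1 t \<in> siegel g1" "mat_holomorphic_on g1 g1 S1 (ball 0 1)"
    and S3: "mat_holomorphic_on g1 h S3 (ball 0 1)" and S2: "mat_holomorphic_on h h S2 (ball 0 1)"
    and B: "pos_def_mat h B"
    and T: "\<forall>s\<in>left_half_plane. T (of_nat m * s) =
             four_block_mat (S1 (exp s)) (S3 (exp s))
               (transpose_mat (S3 (exp s)))
               ((of_nat m * s / (2 * pi * \<i>)) \<cdot>\<^sub>m map_mat complex_of_real B + S2 (exp s))"
    using assms unfolding associated_torus_def by (elim exE conjE) (rule that)
  have Bc: "B \<in> carrier_mat h h" using B by (simp add: pos_def_mat_def)
  have hB: "torus_dim B = h" using Bc by (simp add: torus_dim_def)
  define Q where "Q w = four_block_mat (S1 w) (S3 w) (transpose_mat (S3 w)) (S2 w)" for w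
  have c: "S1 w \<in> carrier_mat g1 g1" "S3 w \<in> carrier_mat g1 h" "S2 w \<in> carrier_mat h h" if "w \<in> ball 0 1" for w
    using S1(2) S2 S3 that by (auto simp: mat_holomorphic_on_def)
  have Qe: "Q w $$ (i, k) = (if i < g1 then if k < g1 then S1 w $$ (i, k) else S3 w $$ (i, k - g1)
      else if k < g1 then S3 w $$ (k, i - g1) else S2 w $$ (i - g1, k - g1))" if "w \<in> ball 0 1" "i < g" "k < g" for w i k
    using c[OF that(1)] that gh by (auto simp: Q_def)
  interpret block_degeneration g g1 h B "Q 0"
  proof
    show "Q 0 \<in> carrier_mat g g" using c[of 0] gh by (auto simp: Q_def)
    have "Matrix.mat g1 g1 (\<lambda>(i, j). Im (Q 0 $$ (i, j))) = map_mat Im (S1 0)"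
      using c(1)[of 0] gh by (intro eq_matI) (auto simp: Qe)
    then show "pos_def_mat g1 (Matrix.mat g1 g1 (\<lambda>(i, j). Im (Q 0 $$ (i, j))))"
      using S1(1) by (simp add: siegel_def)
  qed (fact gh B)+
  obtain l where l: "\<And>\<tau> \<sigma>. degenerates \<tau> \<sigma> \<Longrightarrow>
    (\<lambda>j. theta_invariant g (\<tau> j) - 2 * pi * Im (\<sigma> j) * tropical_moment B + real h / 2 * ln (Im (\<sigma> j))) \<longlonglongrightarrow> l"
    using theta_invariant_degeneration by (elim exE) (rule that, auto)
  \<comment> \<open>As Im \<sigma> = -log|t| / (2 pi), passing from log Im \<sigma> to log(-log|t|)
    adds (h/2) log(2 pi).\<close>
  have "((\<lambda>t. fibre_invariant g f t + tropical_moment B * ln (cmod t) + real h / 2 * ln (- ln (cmod t))) \<longlongrightarrow> l + real h / 2 * ln (2 * pi))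
    (at 0 within ball 0 1)"
    unfolding tendsto_at_iff_sequentially
  proof (intro allI impI)
    fix X :: "nat \<Rightarrow> complex"
    assume "\<forall>i. X i \<in> ball 0 1 - {0}" and lim: "X \<longlonglongrightarrow> 0"
    then have X: "X i \<in> punctured_disc" for i by (simp add: punctured_disc_def)
    \<comment> \<open>Its exponential is an m-th root of \<open>X i\<close> and tends to 0 as well,
      so the single-valued blocks converge along it.\<close>
    define s where "s i = Ln (X i) / of_nat m" for i
    have ms: "of_nat m * s i = Ln (X i)" for i using m by (simp add: s_def)
    have Re_s: "Re (s i) = ln (cmod (X i)) / real m" for i
      using Ln_left_half_plane(2)[OF X] by (simp add: s_def Re_divide_of_nat)
    have sL: "s i \<in> left_half_plane" for i
      using Ln_left_half_plane(1)[OF X, of i] m by (simp add: left_half_plane_def s_def Re_divide_of_nat divide_neg_pos)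
    define \<sigma> where "\<sigma> i = of_nat m * s i / (2 * pi * \<i>)" for i
    have Im_\<sigma>: "Im (\<sigma> i) = - ln (cmod (X i)) / (2 * pi)" for i
      using Ln_left_half_plane(2)[OF X[of i]] by (simp add: \<sigma>_def ms Im_divide Re_Ln power2_eq_square)
    have lnX: "filterlim (\<lambda>i. ln (cmod (X i))) at_bot sequentially"
    proof (rule filterlim_compose[OF ln_at_0])
      show "filterlim (\<lambda>i. cmod (X i)) (at_right 0) sequentially"
        unfolding filterlim_at using tendsto_norm[OF lim] Ln_left_half_plane(3)[OF X] by auto
    qed
    have es: "(\<lambda>i. exp (s i)) \<longlonglongrightarrow> 0"
    proof (rule tendsto_norm_zero_cancel)
      have "filterlim (\<lambda>i. Re (s i)) at_bot sequentially"
        unfolding Re_s divide_inverse mult.commute[of "ln _"]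
        using m by (intro filterlim_tendsto_pos_mult_at_bot[OF tendsto_const _ lnX]) auto
      then show "(\<lambda>i. cmod (exp (s i))) \<longlonglongrightarrow> 0"
        unfolding norm_exp_eq_Re by (rule filterlim_compose[OF exp_at_bot])
    qed
    have eb: "exp (s i) \<in> ball 0 1" for i using sL[of i] by (simp add: left_half_plane_def)
    have cont: "(\<lambda>i. M (exp (s i)) $$ (a, b)) \<longlonglongrightarrow> M 0 $$ (a, b)"
      if "mat_holomorphic_on p q M (ball 0 1)" "a < p" "b < q" for M p q a b
    proof -
      have "continuous_on (ball 0 1) (\<lambda>t. M t $$ (a, b))"
        using that by (intro holomorphic_on_imp_continuous_on) (simp add: mat_holomorphic_on_def)
      from continuous_on_tendsto_compose[OF this es] show ?thesis using eb by simp
    qed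
    have Qlim: "(\<lambda>i. Q (exp (s i)) $$ (a, b)) \<longlonglongrightarrow> Q 0 $$ (a, b)" if ab: "a < g" "b < g" for a b
      using ab gh by (simp add: Qe[OF eb] Qe) (auto intro!: cont[OF S1(2)] cont[OF S2] cont[OF S3])
    have "degenerates (\<lambda>i. T (of_nat m * s i)) \<sigma>"
      unfolding degenerates_def
    proof (intro conjI allI impI)
      show "T (of_nat m * s i) \<in> siegel g" for i
        using pm Ln_left_half_plane(1)[OF X] by (simp add: ms period_map_def)
      have "filterlim (\<lambda>i. 1 / (2 * pi) * - ln (cmod (X i))) at_top sequentially"
        by (rule filterlim_tendsto_pos_mult_at_top[OF tendsto_const _ lnX[unfolded filterlim_uminus_at_bot]]) simp
      then show "filterlim (\<lambda>j. Im (\<sigma> j)) at_top sequentially" by (simp add: Im_\<sigma>)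
      fix a b assume ab: "a < g" "b < g"
      have "T (of_nat m * s i) $$ (a, b) - \<sigma> i * complex_of_real (lower_block $$ (a, b)) = Q (exp (s i)) $$ (a, b)" for i
        unfolding T[rule_format, OF sL] Qe[OF eb ab] using c[OF eb[of i]] Bc ab gh
        by (auto simp: lower_block_def \<sigma>_def)
      then show "(\<lambda>i. T (of_nat m * s i) $$ (a, b) - \<sigma> i * complex_of_real (lower_block $$ (a, b))) \<longlonglongrightarrow> Q 0 $$ (a, b)"
        using Qlim[OF ab] by simp
    qed
    from tendsto_add[OF l[OF this] tendsto_const[of "real h / 2 * ln (2 * pi)"]]
    show "((\<lambda>t. fibre_invariant g f t + tropical_moment B * ln (cmod t) + real h / 2 * ln (- ln (cmod t))) \<circ> X) \<longlonglongrightarrow> l + real h / 2 * ln (2 * pi)"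
    proof (rule Lim_transform_eventually[OF _ always_eventually[OF allI]])
      fix i
      have n: "- ln (cmod (X i)) > 0" using Ln_left_half_plane(3,4)[OF X[of i]] by simp
      have "ln (Im (\<sigma> i)) = ln (- ln (cmod (X i))) - ln (2 * pi)" unfolding Im_\<sigma> using n by (intro ln_divide_pos) auto
      then have "real h / 2 * ln (Im (\<sigma> i)) = real h / 2 * ln (- ln (cmod (X i))) - real h / 2 * ln (2 * pi)"
        by (simp only: right_diff_distrib)
      moreover have "fibre_invariant g f (X i) = theta_invariant g (T (of_nat m * s i))"
        using fibre_invariant_exp[OF pm Ln_left_half_plane(1)[OF X]] Ln_left_half_plane(2)[OF X] by (simp add: ms)
      moreover have "2 * pi * Im (\<sigma> i) * tropical_moment B = - (tropical_moment B * ln (cmod (X i)))" by (simp add: Im_\<sigma>)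
      ultimately show "theta_invariant g (T (of_nat m * s i)) - 2 * pi * Im (\<sigma> i) * tropical_moment B + real h / 2 * ln (Im (\<sigma> i)) + real h / 2 * ln (2 * pi) =
        ((\<lambda>t. fibre_invariant g f t + tropical_moment B * ln (cmod t) + real h / 2 * ln (- ln (cmod t))) \<circ> X) i"
        unfolding comp_def by linarith
    qed
  qed
  then show ?thesis unfolding hB by (rule exI)
qed

theorem theorem1p1:
  fixes g :: nat and f :: av_family and B :: "real mat"
  assumes "g \<ge> 1"
    and "ppav_family g f"
    and "associated_torus g f B"
  shows "same_asymptotics
           (\<lambda>t. fibre_invariant g f t)
           (\<lambda>t. - tropical_moment B * ln (cmod t)
                - real (torus_dim B) / 2 * ln (- ln (cmod t)))"
proof -
  define F where "F t = fibre_invariant g f t + tropical_moment B * ln (cmod t) + real (torus_dim B) / 2 * ln (- ln (cmod t))" for t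
  have "\<exists>l. (F \<longlongrightarrow> l) (at 0 within ball 0 1)" unfolding F_def by (rule fibre_invariant_limit[OF assms(3)])
  then obtain l where l: "(F \<longlongrightarrow> l) (at 0 within ball 0 1)" ..
  obtain T where pm: "period_map g f T" using assms(3) unfolding associated_torus_def by (elim exE conjE) (rule that)
  have op: "open punctured_disc" by (simp add: punctured_disc_def open_delete)
  have nz: "t \<noteq> 0" "cmod t \<noteq> 1" if "t \<in> punctured_disc" for t
    using Ln_left_half_plane(2-4)[OF that] by auto
  have "continuous_on punctured_disc F"
    unfolding F_def by (intro continuous_intros fibre_invariant_continuous[OF pm]) (simp_all add: nz)
  then have "continuous_on punctured_disc (\<lambda>t. if t = 0 then l else F t)"
    by (rule continuous_on_eq) (auto simp: punctured_disc_def)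
  then have 1: "isCont (\<lambda>t. if t = 0 then l else F t) t" if "t \<in> punctured_disc" for t
    using that continuous_on_eq_continuous_at[OF op] by blast
  have "((\<lambda>t. if t = 0 then l else F t) \<longlongrightarrow> l) (at 0)"
  proof (rule Lim_transform_eventually)
    show "(F \<longlongrightarrow> l) (at 0)" using l at_within_open[of 0 "ball 0 1 :: complex set"] by simp
    show "\<forall>\<^sub>F t in at 0. F t = (if t = 0 then l else F t)" by (auto simp: eventually_at_filter)
  qed
  then have 2: "isCont (\<lambda>t. if t = 0 then l else F t) 0" by (simp add: isCont_def)
  have "continuous_on (ball 0 1) (\<lambda>t. if t = 0 then l else F t)"
  proof (rule continuous_at_imp_continuous_on, rule ballI)
    fix t :: complex assume "t \<in> ball 0 1"
    then show "isCont (\<lambda>t. if t = 0 then l else F t) t"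
      by (cases "t = 0") (use 1[of t] 2 in \<open>auto simp: punctured_disc_def\<close>)
  qed
  then show ?thesis
    unfolding same_asymptotics_def by (intro exI[of _ "\<lambda>t. if t = 0 then l else F t"]) (simp add: F_def punctured_disc_def)
qed

end
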